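(* Assume the weak Mertens hypothesis, i.e. $\int_1^X \big(M(x)/x\big)^2\,dx \ll \log X$ as $X\to\infty$, and the linear independence hypothesis, i.e. the positive ordinates $\gamma$ of the zeros of the Riemann zeta function are linearly independent over $\mathbb{Q}$. Let $C=\sum_{\gamma>0}|a(\gamma)|$. Then $\sqrt b\,F(b)$ is dense in $[-C,C]$ (that is, every point of $[-C,C]$ is in the closure of the set of values $\{\sqrt b\,F(b): b\ge\pi\}$), and, in particular, $$\liminf_{b\to\infty}\sqrt b\,F(b)=-C\qquad\text{and}\qquad \limsup_{b\to\infty}\sqrt b\,F(b)=C.$$
   Context: $\mu$ is the Möbius function, $M(x)=\sum_{n\le x}\mu(n)$, and for $b>0$, $$F(b)=\sum_{n=1}^\infty \frac{\mu(n)}{n}e^{-(b/n)^2}.$$ $\zeta$ is the Riemann zeta function and $\Gamma$ the Gamma function. The weak Mertens hypothesis implies the Riemann hypothesis and that all nontrivial zeros of $\zeta$ are simple; so under this hypothesis the nontrivial zeros are $\rho=\tfrac12+i\gamma$ with $\gamma$ real and $\zeta'(\rho)\neq 0$. Sums over $\gamma>0$ run over the positive ordinates of the nontrivial zeros, and $$a(\gamma)=\frac{\Gamma\left(\tfrac14-i\tfrac{\gamma}{2}\right)}{\zeta'\left(\tfrac12+i\gamma\right)}.$$ *)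

theory Defs
  imports
    "HOL-Complex_Analysis.Complex_Analysis"
    "HOL-Computational_Algebra.Squarefree"
    "HOL-Library.Landau_Symbols"
begin

definition moebius :: "nat \<Rightarrow> int" where
  "moebius n = (if squarefree n then (-1) ^ card (prime_factors n) else 0)"

definition mertens :: "real \<Rightarrow> real" where
  "mertens x = (\<Sum>n\<in>{1..nat \<lfloor>x\<rfloor>}. of_int (moebius n))"

text \<open>
  The series is only conditionally convergent, hence \<^const>\<open>suminf\<close> rather than \<^const>\<open>infsum\<close>;
  the summation index is shifted by one.
\<close>
definition moebius_exp_series :: "real \<Rightarrow> real" where
  "moebius_exp_series b =
     (\<Sum>n. of_int (moebius (Suc n)) / of_nat (Suc n) * exp (- (b / of_nat (Suc n))\<^sup>2))"

text \<open>
  The Riemann zeta function as the analytic continuation of its Dirichlet series to the complex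
  plane without the point \<open>1\<close>. The value at the pole \<open>1\<close> is irrelevant; it is fixed to be
  \<open>0\<close> for uniqueness. Lemma \<open>zeta_characterization\<close> below shows that such a function exists and
  is unique.
\<close>
definition is_zeta :: "(complex \<Rightarrow> complex) \<Rightarrow> bool" where
  "is_zeta f \<longleftrightarrow> f holomorphic_on (- {1}) \<and>
     (\<forall>s. Re s > 1 \<longrightarrow> f s = (\<Sum>n. of_nat (Suc n) powr (- s))) \<and> f 1 = 0"

definition zeta :: "complex \<Rightarrow> complex" where
  "zeta = (THE f. is_zeta f)"

definition nontrivial_zeta_zeros :: "complex set" where
  "nontrivial_zeta_zeros = {\<rho>. zeta \<rho> = 0 \<and> 0 < Re \<rho> \<and> Re \<rho> < 1}"

definition positive_ordinates :: "real set" where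
  "positive_ordinates = {\<gamma>. \<gamma> > 0 \<and> (\<exists>\<rho>\<in>nontrivial_zeta_zeros. Im \<rho> = \<gamma>)}"

definition weak_Mertens_hypothesis :: bool where
  "weak_Mertens_hypothesis \<longleftrightarrow>
     (\<lambda>X. integral {1..X} (\<lambda>x. (mertens x / x)\<^sup>2)) \<in> O[at_top](\<lambda>X. ln X)"

definition linear_independence_hypothesis :: bool where
  "linear_independence_hypothesis \<longleftrightarrow>
     module.independent (\<lambda>(q::rat) (x::real). of_rat q * x) positive_ordinates"

definition zero_coeff :: "real \<Rightarrow> complex" where
  "zero_coeff \<gamma> = Gamma (1/4 - \<i> * of_real \<gamma> / 2) / deriv zeta (1/2 + \<i> * of_real \<gamma>)"

text \<open>
  An unordered sum. By the weak Mertens hypothesis each ordinate belongs to exactly one zero,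
  which is simple, so summing over the set of ordinates involves no multiplicities.
\<close>
definition zero_coeff_sum :: real where
  "zero_coeff_sum = (\<Sum>\<^sub>\<infinity>\<gamma>\<in>positive_ordinates. norm (zero_coeff \<gamma>))"

lemma is_zeta_unique:
  assumes "is_zeta f" "is_zeta g"
  shows "f = g"
proof
  fix z
  show "f z = g z"
  proof (cases "z = 1")
    case False
    have op: "open {s. Re s > 1}" by (simp add: open_halfspace_Re_gt)
    have con: "connected (- {1::complex})"
      by (rule connected_punctured_universe) simp
    have ne: "{s. Re s > 1} \<noteq> {}" by (auto intro: exI[of _ 2])
    show ?thesis
      by (rule analytic_continuation_open[of "{s. Re s > 1}" "- {1}" f g])
         (use assms False op con ne in \<open>auto simp: is_zeta_def open_Compl\<close>)
  qed (use assms in \<open>auto simp: is_zeta_def\<close>)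
qed

definition zeta_series :: "complex \<Rightarrow> complex" where
  "zeta_series s = (\<Sum>n. of_nat (Suc n) powr (- s))"

lemma norm_nat_powr: "norm (of_nat (Suc n) powr (s::complex)) = real (Suc n) powr Re s"
  by (subst norm_powr_real_powr) auto

lemma summable_zeta_series:
  assumes "Re s > 1"
  shows "summable (\<lambda>n. of_nat (Suc n) powr (- s) :: complex)"
proof (rule summable_norm_cancel)
  have "summable (\<lambda>n. real n powr (- Re s))"
    using assms by (subst summable_real_powr_iff) auto
  hence "summable (\<lambda>n. real (Suc n) powr (- Re s))" by (subst summable_Suc_iff)
  thus "summable (\<lambda>n. norm (of_nat (Suc n) powr (- s) :: complex))"
    by (simp only: norm_nat_powr uminus_complex.sel)
qed

text \<open>
  The continuation is obtained half-plane by half-plane: summing over \<open>n \<ge> 1\<close> the Taylor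
  expansion of \<open>(n+1) powr (1-s)\<close> at \<open>n\<close> expresses \<open>(s-1) * zeta s\<close> through the values
  \<open>(s+j-1) * zeta (s+j)\<close> with \<open>j \<ge> 1\<close>.
\<close>
definition ffc :: "nat \<Rightarrow> complex \<Rightarrow> complex" where
  "ffc i s = (\<Prod>j<i. 1 - s - of_nat j)"

definition taylor_rem :: "nat \<Rightarrow> nat \<Rightarrow> complex \<Rightarrow> complex" where
  "taylor_rem K n s = of_nat (Suc (Suc n)) powr (1 - s) -
     (\<Sum>i\<le>K. ffc i s / fact i * of_nat (Suc n) powr (1 - s - of_nat i))"

lemma taylor_rem_bound:
  assumes "Re s + real K \<ge> 0"
  shows "norm (taylor_rem K n s) \<le> norm (ffc (Suc K) s) * real (Suc n) powr (- Re s - real K)"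
proof -
  define w where "w = (of_nat (Suc n) :: complex)"
  define S where "S = {z::complex. z \<in> \<real> \<and> Re z \<ge> real (Suc n)}"
  define f where "f = (\<lambda>i z. ffc i s * z powr (1 - s - of_nat i))"
  define B where "B = norm (ffc (Suc K) s) * real (Suc n) powr (- Re s - real K)"
  have "convex S"
  proof -
    have "S = {z. Re z \<ge> real (Suc n)} \<inter> \<real>" by (auto simp: S_def)
    thus ?thesis by (simp only: convex_Int convex_halfspace_Re_ge convex_Reals)
  qed
  moreover have "(f i has_field_derivative f (Suc i) x) (at x within S)" if "x \<in> S" for i x
  proof -
    have "x \<notin> \<real>\<^sub>\<le>\<^sub>0" using that by (auto simp: S_def complex_nonpos_Reals_iff)
    thus ?thesis unfolding f_def ffc_def
      by (auto intro!: derivative_eq_intros DERIV_subset[OF has_field_derivative_powr] simp: algebra_simps)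
  qed
  moreover have "norm (f (Suc K) x) \<le> B" if "x \<in> S" for x
  proof -
    from that have x: "x \<in> \<real>" "Re x \<ge> real (Suc n)" by (auto simp: S_def)
    have "norm (x powr (1 - s - of_nat (Suc K))) = Re x powr (- Re s - real K)"
      using x by (subst norm_powr_real_powr) auto
    also have "\<dots> \<le> real (Suc n) powr (- Re s - real K)"
      using x assms by (intro powr_mono2') auto
    finally show ?thesis unfolding f_def B_def norm_mult by (intro mult_left_mono) auto
  qed
  moreover have "w \<in> S" "w + 1 \<in> S" by (auto simp: w_def S_def)
  ultimately have "norm (f 0 (w + 1) - (\<Sum>i\<le>K. f i w * ((w + 1) - w) ^ i / fact i))
      \<le> B * norm ((w + 1) - w) ^ Suc K / fact K"
    by (intro complex_Taylor[where S = S]) auto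
  also have "\<dots> = B / fact K" by simp
  also have "\<dots> \<le> B / 1"
    unfolding B_def by (intro divide_left_mono) auto
  also have "f 0 (w + 1) - (\<Sum>i\<le>K. f i w * ((w + 1) - w) ^ i / fact i) = taylor_rem K n s"
    by (simp add: f_def taylor_rem_def ffc_def w_def add_ac)
  finally show ?thesis by (simp add: B_def)
qed

lemma holomorphic_ffc [holomorphic_intros]: "ffc i holomorphic_on A"
  unfolding ffc_def by (intro holomorphic_intros)

lemma holomorphic_taylor_rem: "taylor_rem K n holomorphic_on A"
  unfolding taylor_rem_def by (intro holomorphic_intros) auto

lemma taylor_rem_sum_holomorphic:
  "(\<lambda>s. \<Sum>n. taylor_rem (Suc N) n s) holomorphic_on {s. Re s > - real N}"
proof (rule holomorphic_uniform_sequence)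
  show "open {s. Re s > - real N}" by (simp add: open_halfspace_Re_gt)
  show "(\<lambda>s. \<Sum>n<m. taylor_rem (Suc N) n s) holomorphic_on {s. Re s > - real N}" for m
    by (intro holomorphic_intros holomorphic_taylor_rem)
next
  fix s0 assume "s0 \<in> {s. Re s > - real N}"
  define d where "d = (Re s0 + real N) / 2"
  have d: "d > 0" using \<open>s0 \<in> _\<close> by (simp add: d_def)
  have re: "Re s \<ge> d - real N" if "s \<in> cball s0 d" for s
  proof -
    have "Re s0 - Re s \<le> norm (s0 - s)" using complex_Re_le_cmod[of "s0 - s"] by simp
    thus ?thesis using that by (simp add: dist_norm d_def field_simps)
  qed
  have "compact (ffc (Suc (Suc N)) ` cball s0 d)"
    by (intro compact_continuous_image holomorphic_on_imp_continuous_on holomorphic_ffc) auto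
  then obtain C where C: "\<And>s. s \<in> cball s0 d \<Longrightarrow> norm (ffc (Suc (Suc N)) s) \<le> C"
    by (meson compact_imp_bounded bounded_iff imageI)
  have C0: "C \<ge> 0" using C[of s0] d by (meson centre_in_cball less_imp_le norm_ge_zero order_trans)
  have "uniform_limit (cball s0 d) (\<lambda>m s. \<Sum>n<m. taylor_rem (Suc N) n s)
          (\<lambda>s. \<Sum>n. taylor_rem (Suc N) n s) sequentially"
  proof (rule Weierstrass_m_test)
    fix n s assume s: "s \<in> cball s0 d"
    have "norm (taylor_rem (Suc N) n s) \<le>
            norm (ffc (Suc (Suc N)) s) * real (Suc n) powr (- Re s - real (Suc N))"
      using re[OF s] d by (intro taylor_rem_bound) auto
    also have "\<dots> \<le> C * real (Suc n) powr (- (1 + d))"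
      using re[OF s] C[OF s] C0 by (intro mult_mono powr_mono) auto
    finally show "norm (taylor_rem (Suc N) n s) \<le> C * real (Suc n) powr (- (1 + d))" .
  next
    have "summable (\<lambda>n. real n powr (- (1 + d)))"
      using d by (subst summable_real_powr_iff) auto
    hence "summable (\<lambda>n. real (Suc n) powr (- (1 + d)))" by (subst summable_Suc_iff)
    thus "summable (\<lambda>n. C * real (Suc n) powr (- (1 + d)))" by (intro summable_mult)
  qed
  moreover have "cball s0 d \<subseteq> {s. Re s > - real N}" using re d by fastforce
  ultimately show "\<exists>d>0. cball s0 d \<subseteq> {s. Re s > - real N} \<and>
      uniform_limit (cball s0 d) (\<lambda>m s. \<Sum>n<m. taylor_rem (Suc N) n s)
        (\<lambda>s. \<Sum>n. taylor_rem (Suc N) n s) sequentially" using d by blast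
qed

lemma taylor_rem_suminf:
  assumes "Re s > 1"
  shows "(\<Sum>n. taylor_rem (Suc N) n s) =
    -1 + (\<Sum>j\<le>N. ffc j s / fact (Suc j) * ((s + of_nat j - 1) * zeta_series (s + of_nat j)))"
proof -
  have lim: "(\<lambda>n. of_nat (Suc n) powr (1 - s) :: complex) \<longlonglongrightarrow> 0"
  proof (rule tendsto_norm_zero_cancel)
    have "(\<lambda>n. real (Suc n) powr (1 - Re s)) \<longlonglongrightarrow> 0"
      using assms by (intro tendsto_neg_powr filterlim_compose[OF filterlim_real_sequentially filterlim_Suc]) auto
    thus "(\<lambda>n. norm (of_nat (Suc n) powr (1 - s) :: complex)) \<longlonglongrightarrow> 0"
      by (simp only: norm_nat_powr minus_complex.sel one_complex.sel)
  qed
  have tel: "(\<lambda>n. of_nat (Suc (Suc n)) powr (1 - s) - of_nat (Suc n) powr (1 - s)) sums (0 - 1 :: complex)"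
    using telescope_sums[OF lim] by simp
  have ser: "(\<lambda>n. \<Sum>j\<le>N. ffc j s / fact (Suc j) * ((s + of_nat j - 1) * of_nat (Suc n) powr (- (s + of_nat j))))
      sums (\<Sum>j\<le>N. ffc j s / fact (Suc j) * ((s + of_nat j - 1) * zeta_series (s + of_nat j)))"
    unfolding zeta_series_def using assms
    by (intro sums_sum sums_mult summable_sums summable_zeta_series) auto
  have "taylor_rem (Suc N) n s = (of_nat (Suc (Suc n)) powr (1 - s) - of_nat (Suc n) powr (1 - s)) +
      (\<Sum>j\<le>N. ffc j s / fact (Suc j) * ((s + of_nat j - 1) * of_nat (Suc n) powr (- (s + of_nat j))))" for n
  proof -
    have "(\<Sum>i\<le>Suc N. ffc i s / fact i * of_nat (Suc n) powr (1 - s - of_nat i)) =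
        of_nat (Suc n) powr (1 - s) +
        (\<Sum>j\<le>N. ffc (Suc j) s / fact (Suc j) * of_nat (Suc n) powr (1 - s - of_nat (Suc j)))"
      by (subst sum.atMost_Suc_shift) (simp add: ffc_def)
    also have "(\<Sum>j\<le>N. ffc (Suc j) s / fact (Suc j) * of_nat (Suc n) powr (1 - s - of_nat (Suc j))) =
       (\<Sum>j\<le>N. - (ffc j s / fact (Suc j) * ((s + of_nat j - 1) * of_nat (Suc n) powr (- (s + of_nat j)))))"
    proof (rule sum.cong)
      fix j
      have 1: "ffc (Suc j) s = - (ffc j s * (s + of_nat j - 1))"
        by (simp add: ffc_def algebra_simps)
      have 2: "1 - s - of_nat (Suc j) = - (s + of_nat j)" by simp
      show "ffc (Suc j) s / fact (Suc j) * of_nat (Suc n) powr (1 - s - of_nat (Suc j)) =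
         - (ffc j s / fact (Suc j) * ((s + of_nat j - 1) * of_nat (Suc n) powr (- (s + of_nat j))))"
        unfolding 1 2 by (simp only: mult_minus_left minus_divide_left[symmetric]
            times_divide_eq_left times_divide_eq_right mult.assoc)
    qed auto
    finally have *: "(\<Sum>i\<le>Suc N. ffc i s / fact i * of_nat (Suc n) powr (1 - s - of_nat i)) =
        of_nat (Suc n) powr (1 - s) + - (\<Sum>j\<le>N. ffc j s / fact (Suc j) *
          ((s + of_nat j - 1) * of_nat (Suc n) powr (- (s + of_nat j))))" unfolding sum_negf .
    have "t - S = (t - p) + q" if "S = p + - q" for t S p q :: complex using that by simp
    from this[OF *] show ?thesis unfolding taylor_rem_def .
  qed
  hence "(\<lambda>n. taylor_rem (Suc N) n s) sums ((0 - 1) +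
     (\<Sum>j\<le>N. ffc j s / fact (Suc j) * ((s + of_nat j - 1) * zeta_series (s + of_nat j))))"
    using sums_add[OF tel ser] by presburger
  thus ?thesis by (simp add: sums_iff)
qed

lemma zeta_half_plane:
  "\<exists>g. (N > 0 \<longrightarrow> g holomorphic_on {s. Re s > 1 - real N}) \<and>
       (\<forall>s. Re s > 1 \<longrightarrow> g s = (s - 1) * zeta_series s)"
proof (induction N)
  case 0
  show ?case by (intro exI[of _ "\<lambda>s. (s - 1) * zeta_series s"]) auto
next
  case (Suc N)
  then obtain g where g: "N > 0 \<Longrightarrow> g holomorphic_on {s. Re s > 1 - real N}"
    "\<And>s. Re s > 1 \<Longrightarrow> g s = (s - 1) * zeta_series s" by blast
  define h where "h = (\<lambda>s. 1 + (\<Sum>n. taylor_rem (Suc N) n s) -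
     (\<Sum>j\<in>{1..N}. ffc j s / fact (Suc j) * g (s + of_nat j)))"
  have "h holomorphic_on {s. Re s > - real N}"
  proof -
    have "(\<lambda>s. g (s + of_nat j)) holomorphic_on {s. Re s > - real N}" if "j \<in> {1..N}" for j
    proof -
      have "g \<circ> (\<lambda>s. s + of_nat j) holomorphic_on {s. Re s > - real N}"
        by (rule holomorphic_on_compose_gen[OF _ g(1)]) (use that in \<open>auto intro!: holomorphic_intros\<close>)
      thus ?thesis by (simp add: o_def)
    qed
    thus ?thesis unfolding h_def
      by (intro holomorphic_intros taylor_rem_sum_holomorphic) auto
  qed
  moreover have "h s = (s - 1) * zeta_series s" if s: "Re s > 1" for s
  proof -
    have "(\<Sum>n. taylor_rem (Suc N) n s) = -1 + (\<Sum>j\<le>N. ffc j s / fact (Suc j) * g (s + of_nat j))"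
      unfolding taylor_rem_suminf[OF s] using s g(2) by simp
    also have "{..N} = insert 0 {1..N}" by auto
    finally have "h s = g s" unfolding h_def by (simp add: ffc_def)
    thus ?thesis using g(2) s by simp
  qed
  ultimately show ?case by (intro exI[of _ h]) auto
qed

lemma is_zeta_exists: "\<exists>f. is_zeta f"
proof -
  obtain g where g: "\<And>N. N > 0 \<Longrightarrow> g N holomorphic_on {s. Re s > 1 - real N}"
    "\<And>N s. Re s > 1 \<Longrightarrow> g N s = (s - 1) * zeta_series s"
    using zeta_half_plane by metis
  have agree: "g M s = g N s" if "0 < M" "M \<le> N" "Re s > 1 - real M" for M N s
    by (rule analytic_continuation_open[of "{s. Re s > 1}" "{s. Re s > 1 - real M}"])
       (use that g(2) in \<open>auto simp: open_halfspace_Re_gt convex_connected convex_halfspace_Re_gt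
          intro!: exI[of _ "2::complex"] holomorphic_on_subset[OF g(1)]\<close>)
  define G where "G = (\<lambda>s. g (Suc (nat \<lceil>1 - Re s\<rceil>)) s)"
  have G: "G s = g N s" if "N > 0" "Re s > 1 - real N" for s N
  proof -
    define M where "M = Suc (nat \<lceil>1 - Re s\<rceil>)"
    have "Re s > 1 - real M" unfolding M_def by linarith
    moreover have "M > 0" by (simp add: M_def)
    ultimately have "g M s = g N s"
      using agree[of M N s] agree[of N M s] that by (metis nat_le_linear)
    thus ?thesis unfolding G_def M_def .
  qed
  have "G field_differentiable (at s)" for s
  proof -
    define N where "N = Suc (nat \<lceil>1 - Re s\<rceil>)"
    have N: "N > 0" "Re s > 1 - real N" unfolding N_def by (simp, linarith)
    have "G holomorphic_on {s. Re s > 1 - real N}"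
      using g(1)[OF N(1)] by (rule holomorphic_transform) (use G N in auto)
    thus ?thesis using N(2)
      by (auto intro!: holomorphic_on_imp_differentiable_at open_halfspace_Re_gt)
  qed
  hence "G holomorphic_on UNIV" by (auto simp: holomorphic_on_def)
  hence hol: "(\<lambda>s. G s / (s - 1)) holomorphic_on - {1}"
    by (intro holomorphic_intros) (auto intro: holomorphic_on_subset)
  define f where "f = (\<lambda>s. if s = 1 then 0 else G s / (s - 1))"
  have "f holomorphic_on - {1}"
    using hol by (rule holomorphic_transform) (auto simp: f_def)
  moreover have "f s = zeta_series s" if "Re s > 1" for s
    using that g(2)[of s 1] G[of 1 s] by (auto simp: f_def)
  moreover have "f 1 = 0" by (simp add: f_def)
  ultimately show ?thesis unfolding is_zeta_def zeta_series_def by blast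
qed

lemma zeta_characterization: "is_zeta f \<longleftrightarrow> f = zeta"
  using is_zeta_exists is_zeta_unique theI[of is_zeta] unfolding zeta_def by metis

end

theory Submission
  imports Defs
begin

text \<open>
  By Mellin inversion \<open>F (exp t)\<close> is the integral of
  \<open>Gamma ((1 - v) / 2) / (2 * zeta v) * exp ((v - 1) * t) / (2 * pi)\<close> over the line \<open>Re v = 2\<close>.
  Under the weak Mertens hypothesis the series \<open>(\<Sum>n. mertens n * (n powr - s - (n + 1) powr - s))\<close>
  represents \<open>1 / zeta s\<close> for \<open>Re s > 1/2\<close> and is at most a multiple of \<open>1 + 1 / (Re s - 1/2)\<close> times
  \<open>norm s\<close>. Hence all nontrivial zeros are simple and on the critical line, the derivative of zeta at
  a zero is not too small, and the exponential decay of Gamma makes the residues \<open>a(\<gamma>)\<close> summable even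
  with an exponential weight. Subtracting from the integrand the absolutely convergent sum of the
  terms \<open>a(\<gamma>) / 2 * exp ((v - \<rho>)\<^sup>2) / (v - \<rho>)\<close> leaves a function that is holomorphic and exponentially
  decreasing up to the line \<open>Re v = 3/8\<close>, where by the functional equation it is still under control.
  Moving the contour there gives
  \<open>exp (t / 2) * F (exp t) = (\<Sum>\<gamma> > 0. norm a(\<gamma>) * cos (\<gamma> * t + Arg a(\<gamma>))) + O(exp (- t / 8))\<close>. No
  bound for \<open>1 / zeta\<close> on horizontal segments between zeros is needed. By Kronecker's theorem the phases
  \<open>\<gamma> * t\<close> of finitely many terms can be made arbitrary modulo \<open>2 * pi\<close>, for arbitrarily large \<open>t\<close>.
\<close>

section \<open>Contour shifts and parametric integrals\<close>

text \<open>A bare fraction a/(v - rho) decays only like 1/|v| on vertical lines, so its integral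
  there would not converge absolutely. The Gaussian factor equals 1 at rho, hence keeps the residue,
  and makes every pole term shiftable on its own. The obstacle is then the remainder next to the
  critical line: \<open>mellin_F\<close> and the pole sum are both bounded there only with a factor
  1/|Re v - 1/2|. As the remainder is holomorphic, the maximum principle on discs centred on the
  line removes this loss. On \<open>Re v = 2\<close> the argument (1 - v)/2 lies left of the pole of
  Gamma at 0, so the Mellin integral gives exp(-x) - 1; the terms - 1 add up to the sum of mu(n)/n,
  which has to be shown to vanish. In return the Moebius series converges absolutely on that line.
  The rates of decay are deliberately wasteful: Gamma contributes exp(-|Im v|/8), linear factors
  lower this to 1/16, and 1/64 leaves room to recentre the Gaussians.\<close>

lemma integrable_one_over_one_plus_square: "integrable lborel (\<lambda>y::real. 1 / (1 + y\<^sup>2))"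
proof -
  have "set_integrable lborel (einterval (-\<infinity>) \<infinity>) (\<lambda>x::real. inverse (1 + x\<^sup>2))"
  proof (rule interval_integral_FTC_nonneg(1)[where F = arctan and A = "-pi/2" and B = "pi/2"])
    show "DERIV arctan x :> inverse (1 + x\<^sup>2)" for x by (rule DERIV_arctan)
    have "1 + x\<^sup>2 > 0" for x :: real by (simp add: add_pos_nonneg)
    then have "1 + x\<^sup>2 \<noteq> 0" for x :: real by (metis less_irrefl)
    then show "isCont (\<lambda>x. inverse (1 + x\<^sup>2)) x" for x :: real
      by (intro continuous_intros)
    show "((arctan \<circ> real_of_ereal) \<longlongrightarrow> - pi / 2) (at_right (- \<infinity>))"
      "((arctan \<circ> real_of_ereal) \<longlongrightarrow> pi / 2) (at_left \<infinity>)"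
      by (simp_all add: ereal_tendsto_simps1 tendsto_arctan_at_bot[simplified] tendsto_arctan_at_top)
  qed auto
  then show ?thesis by (simp add: set_integrable_def divide_inverse einterval_eq)
qed

lemma integrable_decay:
  fixes f :: "real \<Rightarrow> complex"
  assumes "continuous_on UNIV f" "\<And>y. norm (f y) \<le> C / (1 + y\<^sup>2)"
  shows "integrable lborel f"
proof (rule Bochner_Integration.integrable_bound)
  show "integrable lborel (\<lambda>y::real. C * (1 / (1 + y\<^sup>2)))"
    by (intro integrable_mult_right integrable_one_over_one_plus_square)
  show "f \<in> borel_measurable lborel"
    using assms(1) by (simp add: borel_measurable_continuous_onI)
  show "AE y in lborel. norm (f y) \<le> norm (C * (1 / (1 + y\<^sup>2)))"
  proof (rule AE_I2)
    fix y show "norm (f y) \<le> norm (C * (1 / (1 + y\<^sup>2)))"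
      using order.trans[OF assms(2)[of y] abs_ge_self] by simp
  qed
qed

text \<open>Passes from the sides of a finite rectangle, which contour integrals give as gauge
  integrals over intervals, to Lebesgue integrals over the whole line.\<close>

lemma integral_symmetric_tendsto:
  fixes f :: "real \<Rightarrow> complex"
  assumes "integrable lborel f" "continuous_on UNIV f"
  shows "(\<lambda>n. integral {- real n..real n} f) \<longlonglongrightarrow> (\<integral>y. f y \<partial>lborel)"
proof -
  have eq: "integral {- real n..real n} f = (\<integral>y. indicator {- real n..real n} y *\<^sub>R f y \<partial>lborel)" for n
  proof -
    have "set_integrable lborel {- real n..real n} f"
      unfolding set_integrable_def using assms(2)
      by (intro borel_integrable_compact) (auto intro: continuous_on_subset)
    from set_borel_integral_eq_integral(2)[OF this] show ?thesis
      by (simp add: set_lebesgue_integral_def)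
  qed
  show ?thesis unfolding eq
  proof (rule integral_dominated_convergence)
    show "integrable lborel (\<lambda>y. norm (f y))" using assms(1) by simp
    show "f \<in> borel_measurable lborel" "\<And>n. (\<lambda>y. indicator {- real n..real n} y *\<^sub>R f y) \<in> borel_measurable lborel"
      using assms by auto
    show "AE y in lborel. (\<lambda>n. indicator {- real n..real n} y *\<^sub>R f y) \<longlonglongrightarrow> f y"
    proof (rule AE_I2)
      fix y :: real
      obtain N where N: "\<bar>y\<bar> \<le> real N" using real_arch_simple by blast
      show "(\<lambda>n. indicator {- real n..real n} y *\<^sub>R f y) \<longlonglongrightarrow> f y"
        by (rule tendsto_eventually, rule eventually_mono[OF eventually_ge_at_top[of N]])
           (use N in \<open>auto simp: indicator_def\<close>)
    qed
    show "AE y in lborel. norm (indicator {- real n..real n} y *\<^sub>R f y) \<le> norm (f y)" for n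
      by (auto simp: indicator_def)
  qed
qed

text \<open>Cauchy's formula on a rectangle whose horizontal sides move to infinity.\<close>
lemma vertical_line_shift_pole:
  fixes A :: "complex \<Rightarrow> complex"
  assumes A: "A holomorphic_on {z. a' < Re z \<and> Re z < b'}" and ab: "a' < a" "b < b'"
    and p: "a < Re p" "Re p < b"
    and bound: "\<And>z. a \<le> Re z \<Longrightarrow> Re z \<le> b \<Longrightarrow> norm (A z) \<le> C / (1 + (Im z)\<^sup>2)"
  shows "integrable lborel (\<lambda>y. A (Complex b y) / (Complex b y - p))"
    and "integrable lborel (\<lambda>y. A (Complex a y) / (Complex a y - p))"
    and "(\<integral>y. A (Complex b y) / (Complex b y - p) \<partial>lborel) -
         (\<integral>y. A (Complex a y) / (Complex a y - p) \<partial>lborel) = 2 * pi * A p"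
proof -
  define S where "S = {z. a' < Re z \<and> Re z < b'}"
  define q where "q = (\<lambda>w. A w / (w - p))"
  have S: "open S" "convex S"
  proof -
    have "S = {z. a' < Re z} \<inter> {z. Re z < b'}" by (auto simp: S_def)
    then show "open S" "convex S"
      by (auto intro!: open_Int convex_Int open_halfspace_Re_gt open_halfspace_Re_lt
          convex_halfspace_Re_gt convex_halfspace_Re_lt)
  qed
  have contA: "continuous_on S A" using A S_def holomorphic_on_imp_continuous_on by blast
  have C0: "C \<ge> 0"
  proof -
    have "norm (A (Complex a 0)) \<le> C / (1 + 0)" using bound[of "Complex a 0"] p by auto
    then show ?thesis using norm_ge_zero[of "A (Complex a 0)"] by (simp, linarith)
  qed
  have line: "integrable lborel (\<lambda>y. q (Complex c y)) \<and> continuous_on UNIV (\<lambda>y. q (Complex c y))"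
    if c: "a \<le> c" "c \<le> b" "c \<noteq> Re p" for c
  proof
    have "continuous_on UNIV (\<lambda>y. A (Complex c y))"
      by (rule continuous_on_compose2[OF contA]) (use c ab in \<open>auto simp: S_def Complex_eq intro!: continuous_intros\<close>)
    then show cont: "continuous_on UNIV (\<lambda>y. q (Complex c y))"
      unfolding q_def by (intro continuous_intros) (use c in \<open>auto simp: Complex_eq complex_eq_iff intro!: continuous_intros\<close>)
    show "integrable lborel (\<lambda>y. q (Complex c y))"
    proof (rule integrable_decay[OF cont])
      fix y
      have "norm (A (Complex c y)) \<le> C / (1 + y\<^sup>2)" using bound[of "Complex c y"] c by simp
      moreover have "\<bar>c - Re p\<bar> \<le> norm (Complex c y - p)"
        using abs_Re_le_cmod[of "Complex c y - p"] by simp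
      ultimately have "norm (q (Complex c y)) \<le> (C / (1 + y\<^sup>2)) / \<bar>c - Re p\<bar>"
        unfolding q_def norm_divide using c C0 by (intro frac_le divide_nonneg_nonneg add_nonneg_nonneg) auto
      then show "norm (q (Complex c y)) \<le> (C / \<bar>c - Re p\<bar>) / (1 + y\<^sup>2)" by (simp add: field_simps)
    qed
  qed
  show "integrable lborel (\<lambda>y. A (Complex b y) / (Complex b y - p))"
    "integrable lborel (\<lambda>y. A (Complex a y) / (Complex a y - p))"
    using line[of a] line[of b] p by (auto simp: q_def)
  \<comment> \<open>Estimate of one horizontal side at height n: there |z - p| is at least n - |Im
    p|, and the side has length \<open>b - a\<close>.\<close>
  define err where "err = (\<lambda>n::nat. C / (1 + (real n)\<^sup>2) / (real n - \<bar>Im p\<bar>) * (b - a))"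
  define J where "J = (\<lambda>n::nat. \<i> * integral {- real n..real n} (\<lambda>y. q (Complex b y))
     - \<i> * integral {- real n..real n} (\<lambda>y. q (Complex a y)))"
  have main: "norm (J n - 2 * pi * \<i> * A p) \<le> 2 * err n" if n: "real n > \<bar>Im p\<bar>" for n
  proof -
    define a1 a2 a3 a4 where "a1 = Complex a (- real n)" and "a2 = Complex b (- real n)"
      and "a3 = Complex b (real n)" and "a4 = Complex a (real n)"
    note as = a1_def a2_def a3_def a4_def
    have n0: "real n > 0" using n by linarith
    have pin: "p \<in> box a1 a3" using p n by (auto simp: in_box_complex_iff as)
    have sub: "path_image (rectpath a1 a3) \<subseteq> S - {p}"
    proof -
      have "path_image (rectpath a1 a3) = cbox a1 a3 - box a1 a3"
        using p n0 by (intro path_image_rectpath_cbox_minus_box) (auto simp: as)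
      moreover have "cbox a1 a3 \<subseteq> S"
      proof
        fix z assume "z \<in> cbox a1 a3"
        then have "a \<le> Re z" "Re z \<le> b" by (simp_all add: in_cbox_complex_iff as)
        then show "z \<in> S" using ab by (simp add: S_def)
      qed
      ultimately show ?thesis using pin by blast
    qed
    have pS: "p \<in> S" using p ab by (auto simp: S_def)
    have hc: "(q has_contour_integral (2 * pi * \<i> * winding_number (rectpath a1 a3) p * A p)) (rectpath a1 a3)"
      unfolding q_def
      by (rule Cauchy_integral_formula_convex_simple[OF S(2)])
         (use A[folded S_def] interior_open[OF S(1)] sub pS in simp_all)
    have hc': "(q has_contour_integral (2 * pi * \<i> * A p))
        (linepath a1 a2 +++ linepath a2 a3 +++ linepath a3 a4 +++ linepath a4 a1)"
      using hc winding_number_rectpath[OF pin] by (simp add: rectpath_def as Let_def)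
    then have I1: "q contour_integrable_on (linepath a1 a2 +++ linepath a2 a3 +++ linepath a3 a4 +++ linepath a4 a1)"
      by (auto simp: contour_integrable_on_def)
    have I2: "q contour_integrable_on (linepath a2 a3 +++ linepath a3 a4 +++ linepath a4 a1)"
      using contour_integrable_joinD2[OF I1] by simp
    have I3: "q contour_integrable_on (linepath a3 a4 +++ linepath a4 a1)"
      using contour_integrable_joinD2[OF I2] by simp
    have ci: "q contour_integrable_on linepath a1 a2" "q contour_integrable_on linepath a2 a3"
      "q contour_integrable_on linepath a3 a4" "q contour_integrable_on linepath a4 a1"
      using contour_integrable_joinD1[OF I1] contour_integrable_joinD1[OF I2]
        contour_integrable_joinD1[OF I3] contour_integrable_joinD2[OF I3] by simp_all
    have sum: "2 * pi * \<i> * A p = contour_integral (linepath a1 a2) q + contour_integral (linepath a2 a3) q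
        + contour_integral (linepath a3 a4) q + contour_integral (linepath a4 a1) q"
      using contour_integral_unique[OF hc'] ci by (simp add: add.assoc)
    have v1: "contour_integral (linepath a2 a3) q = \<i> * integral {- real n..real n} (\<lambda>y. q (Complex b y))"
      by (rule contour_integral_linepath_same_Re) (use n0 in \<open>auto simp: as\<close>)
    have "contour_integral (linepath a1 a4) q = \<i> * integral {- real n..real n} (\<lambda>y. q (Complex a y))"
      by (rule contour_integral_linepath_same_Re) (use n0 in \<open>auto simp: as\<close>)
    moreover have "contour_integral (linepath a4 a1) q = - contour_integral (linepath a1 a4) q"
      by (metis contour_integral_reversepath reversepath_linepath valid_path_linepath)
    ultimately have v2: "contour_integral (linepath a4 a1) q = - (\<i> * integral {- real n..real n} (\<lambda>y. q (Complex a y)))"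
      by simp
    have qb: "norm (q z) \<le> C / (1 + (real n)\<^sup>2) / (real n - \<bar>Im p\<bar>)"
      if z: "a \<le> Re z" "Re z \<le> b" "\<bar>Im z\<bar> = real n" for z
    proof -
      have "(Im z)\<^sup>2 = (real n)\<^sup>2" using z(3) by (metis power2_abs)
      then have "norm (A z) \<le> C / (1 + (real n)\<^sup>2)" using bound[of z] z by simp
      moreover have "real n - \<bar>Im p\<bar> \<le> norm (z - p)"
        using abs_Im_le_cmod[of "z - p"] z by simp
      ultimately show ?thesis unfolding q_def norm_divide using n C0 by (intro frac_le divide_nonneg_nonneg add_nonneg_nonneg) auto
    qed
    have seg: "a \<le> Re z \<and> Re z \<le> b \<and> \<bar>Im z\<bar> = real n"
      if "z \<in> closed_segment a1 a2 \<or> z \<in> closed_segment a3 a4" for z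
      using that p n0 unfolding as
      by (auto simp: closed_segment_same_Im closed_segment_eq_real_ivl split: if_splits)
    have Bnn: "0 \<le> C / (1 + (real n)\<^sup>2) / (real n - \<bar>Im p\<bar>)" using C0 n by (intro divide_nonneg_nonneg) auto
    have "norm (contour_integral (linepath a1 a2) q) \<le> C / (1 + (real n)\<^sup>2) / (real n - \<bar>Im p\<bar>) * norm (a2 - a1)"
      by (rule contour_integral_bound_linepath[OF ci(1) Bnn]) (use seg qb in blast)
    moreover have "norm (contour_integral (linepath a3 a4) q) \<le> C / (1 + (real n)\<^sup>2) / (real n - \<bar>Im p\<bar>) * norm (a4 - a3)"
      by (rule contour_integral_bound_linepath[OF ci(3) Bnn]) (use seg qb in blast)
    moreover have "norm (a2 - a1) = b - a" "norm (a4 - a3) = b - a"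
      using p by (auto simp: as cmod_def)
    moreover have "J n - 2 * pi * \<i> * A p = - contour_integral (linepath a1 a2) q - contour_integral (linepath a3 a4) q"
      unfolding sum v1 v2 J_def by simp
    then have "norm (J n - 2 * pi * \<i> * A p) \<le> norm (contour_integral (linepath a1 a2) q) + norm (contour_integral (linepath a3 a4) q)"
      using norm_triangle_ineq4[of "- contour_integral (linepath a1 a2) q" "contour_integral (linepath a3 a4) q"] by simp
    ultimately show ?thesis unfolding err_def by simp
  qed
  have err0: "(\<lambda>n. 2 * err n) \<longlonglongrightarrow> 0" unfolding err_def by real_asymp
  have "(\<lambda>n. J n - 2 * pi * \<i> * A p) \<longlonglongrightarrow> 0"
  proof (rule Lim_null_comparison[OF _ err0])
    show "\<forall>\<^sub>F n in sequentially. norm (J n - 2 * pi * \<i> * A p) \<le> 2 * err n"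
    proof -
      obtain N where "\<bar>Im p\<bar> < real N" using reals_Archimedean2 by blast
      then have "norm (J n - 2 * pi * \<i> * A p) \<le> 2 * err n" if "n \<ge> N" for n
        using that by (intro main) linarith
      then show ?thesis using eventually_sequentially by blast
    qed
  qed
  then have "J \<longlonglongrightarrow> 2 * pi * \<i> * A p" using LIM_zero_iff by blast
  moreover have "J \<longlonglongrightarrow> \<i> * (\<integral>y. q (Complex b y) \<partial>lborel) - \<i> * (\<integral>y. q (Complex a y) \<partial>lborel)"
    unfolding J_def using line[of a] line[of b] p
    by (intro tendsto_intros integral_symmetric_tendsto) auto
  ultimately have "\<i> * (\<integral>y. q (Complex b y) \<partial>lborel) - \<i> * (\<integral>y. q (Complex a y) \<partial>lborel) = 2 * pi * \<i> * A p"
    using LIMSEQ_unique by blast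
  then have "\<i> * ((\<integral>y. q (Complex b y) \<partial>lborel) - (\<integral>y. q (Complex a y) \<partial>lborel)) = \<i> * (2 * pi * A p)"
    by (simp add: algebra_simps)
  then show "(\<integral>y. A (Complex b y) / (Complex b y - p) \<partial>lborel) -
         (\<integral>y. A (Complex a y) / (Complex a y - p) \<partial>lborel) = 2 * pi * A p"
    by (simp add: q_def)
qed

text \<open>Domination of \<open>f\<close> itself suffices: Cauchy's inequality on discs of radius
  \<open>r\<close> bounds the derivative by \<open>g / r\<close>, so all difference quotients have
  this integrable majorant and dominated convergence applies.\<close>

lemma holomorphic_on_lebesgue_integral:
  fixes f :: "'a \<Rightarrow> complex \<Rightarrow> complex"
  assumes S: "open S" and hol: "\<And>x. x \<in> space M \<Longrightarrow> f x holomorphic_on S"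
    and meas: "\<And>z. z \<in> S \<Longrightarrow> (\<lambda>x. f x z) \<in> borel_measurable M"
    and dom: "\<And>z0. z0 \<in> S \<Longrightarrow> \<exists>r>0. \<exists>g. integrable M g \<and>
                (\<forall>x\<in>space M. \<forall>z\<in>S. dist z0 z \<le> r \<longrightarrow> norm (f x z) \<le> g x)"
    and z0: "z0 \<in> S"
  shows "((\<lambda>z. \<integral>x. f x z \<partial>M) has_field_derivative (\<integral>x. deriv (f x) z0 \<partial>M)) (at z0)"
proof -
  obtain r1 g where r1: "r1 > 0" "integrable M g" and
    g1: "\<And>x z. x \<in> space M \<Longrightarrow> z \<in> S \<Longrightarrow> dist z0 z \<le> r1 \<Longrightarrow> norm (f x z) \<le> g x"
    using dom[OF z0] by blast
  obtain r2 where r2: "r2 > 0" "cball z0 r2 \<subseteq> S" using S z0 open_contains_cball by blast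
  \<comment> \<open>Halved so that a disc of radius \<open>r\<close> about any point of
    \<open>cball z0 r\<close> stays where the majorant is valid.\<close>
  define r where "r = min r1 r2 / 2"
  have r: "r > 0" using r1 r2 by (simp add: r_def)
  have g: "norm (f x z) \<le> g x" "z \<in> S" if "x \<in> space M" "z \<in> cball z0 (2 * r)" for x z
    using g1[of x z] that r2 by (auto simp: r_def subset_iff)
  have cb: "cball z0 (2 * r) \<subseteq> S" using r2 by (auto simp: r_def)
  have int: "integrable M (\<lambda>x. f x z)" if "z \<in> cball z0 (2 * r)" for z
  proof (rule Bochner_Integration.integrable_bound[OF r1(2)])
    show "(\<lambda>x. f x z) \<in> borel_measurable M" using meas cb that by blast
    show "AE x in M. norm (f x z) \<le> norm (g x)" using g(1)[OF _ that]
      by (intro AE_I2) (smt (verit) real_norm_def)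
  qed
  have lip: "norm (f x z - f x z0) \<le> g x / r * norm (z - z0)" if x: "x \<in> space M" and z: "z \<in> cball z0 r" for x z
  proof (rule field_differentiable_bound[where S = "cball z0 r" and f = "f x" and f' = "deriv (f x)"])
    fix w assume w: "w \<in> cball z0 r"
    have wb: "cball w r \<subseteq> cball z0 (2 * r)"
    proof
      fix u assume "u \<in> cball w r"
      then show "u \<in> cball z0 (2 * r)" using w dist_triangle[of z0 u w] by simp
    qed
    have "w \<in> cball w r" using r by simp
    then have "w \<in> S" using cb wb by blast
    then show "(f x has_field_derivative deriv (f x) w) (at w within cball z0 r)"
      using hol[OF x] S by (meson has_field_derivative_at_within holomorphic_derivI)
    have "norm ((deriv ^^ 1) (f x) w) \<le> fact 1 * g x / r ^ 1"
    proof (rule Cauchy_inequality)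
      show "f x holomorphic_on ball w r"
        using hol[OF x] wb cb by (meson ball_subset_cball holomorphic_on_subset order_trans)
      show "continuous_on (cball w r) (f x)"
        using hol[OF x] wb cb by (meson holomorphic_on_imp_continuous_on holomorphic_on_subset order_trans)
      fix u assume "norm (w - u) = r"
      then have "u \<in> cball w r" by (simp add: dist_norm)
      then show "norm (f x u) \<le> g x" using wb g(1)[OF x] by blast
    qed (use r in auto)
    then show "norm (deriv (f x) w) \<le> g x / r" by simp
  qed (use z r in auto)
  show ?thesis unfolding has_field_derivative_iff tendsto_at_iff_sequentially comp_def
  proof (intro allI impI)
    fix X assume "\<forall>i. X i \<in> UNIV - {z0}" and Xlim: "X \<longlonglongrightarrow> z0"
    then have Xne: "X i \<noteq> z0" for i by auto
    obtain N where N: "\<And>n. n \<ge> N \<Longrightarrow> dist (X n) z0 < r"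
      using Xlim r unfolding lim_sequentially by blast
    define Y where "Y = (\<lambda>n. X (n + N))"
    have Y: "Y n \<in> cball z0 r" "Y n \<noteq> z0" for n
      using N[of "n + N"] Xne by (auto simp: Y_def dist_commute less_imp_le)
    have Y2: "Y n \<in> cball z0 (2 * r)" for n using Y[of n] r by auto
    have Ylim: "Y \<longlonglongrightarrow> z0" unfolding Y_def using Xlim by (rule LIMSEQ_ignore_initial_segment)
    have "(\<lambda>n. \<integral>x. (f x (Y n) - f x z0) / (Y n - z0) \<partial>M) \<longlonglongrightarrow> (\<integral>x. deriv (f x) z0 \<partial>M)"
    proof (rule integral_dominated_convergence)
      show "integrable M (\<lambda>x. g x / r)" using r1 by simp
      show m: "(\<lambda>x. (f x (Y n) - f x z0) / (Y n - z0)) \<in> borel_measurable M" for n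
      proof -
        have "Y n \<in> S" using cb Y2 by blast
        then show ?thesis using meas[of "Y n"] meas[OF z0] by simp
      qed
      have lim: "(\<lambda>n. (f x (Y n) - f x z0) / (Y n - z0)) \<longlonglongrightarrow> deriv (f x) z0" if x: "x \<in> space M" for x
      proof -
        have "(f x has_field_derivative deriv (f x) z0) (at z0)"
          using hol[OF x] S z0 by (meson holomorphic_derivI)
        then show ?thesis unfolding has_field_derivative_iff tendsto_at_iff_sequentially comp_def
          using Y(2) Ylim by auto
      qed
      then show "AE x in M. (\<lambda>n. (f x (Y n) - f x z0) / (Y n - z0)) \<longlonglongrightarrow> deriv (f x) z0"
        by (rule AE_I2)
      \<comment> \<open>Measurability of the derivative is inherited from the difference quotients,
        whose pointwise limit it is.\<close>
      show "(\<lambda>x. deriv (f x) z0) \<in> borel_measurable M"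
        by (rule borel_measurable_LIMSEQ_metric[where f = "\<lambda>n x. (f x (Y n) - f x z0) / (Y n - z0)"])
           (use m lim in auto)
      show "AE x in M. norm ((f x (Y n) - f x z0) / (Y n - z0)) \<le> g x / r" for n
        using lip[OF _ Y(1)[of n]] Y(2)[of n] by (intro AE_I2) (simp add: norm_divide field_simps)
    qed
    also have "(\<lambda>n. \<integral>x. (f x (Y n) - f x z0) / (Y n - z0) \<partial>M) =
      (\<lambda>n. ((\<integral>x. f x (Y n) \<partial>M) - (\<integral>x. f x z0 \<partial>M)) / (Y n - z0))"
      using int[OF Y2] int[of z0] r by (auto simp: Bochner_Integration.integral_diff)
    finally show "(\<lambda>n. ((\<integral>x. f x (X n) \<partial>M) - (\<integral>x. f x z0 \<partial>M)) / (X n - z0)) \<longlonglongrightarrow> (\<integral>x. deriv (f x) z0 \<partial>M)"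
      unfolding Y_def by (rule LIMSEQ_offset)
  qed
qed

text \<open>The Weierstrass test taken along the filter of finite subsets, so that sums over the set
  of zeros need no enumeration.\<close>

lemma holomorphic_on_infsum:
  fixes f :: "'a \<Rightarrow> complex \<Rightarrow> complex"
  assumes S: "open S" and hol: "\<And>x. x \<in> X \<Longrightarrow> f x holomorphic_on S"
    and dom: "\<And>z0. z0 \<in> S \<Longrightarrow> \<exists>r>0. \<exists>g. g summable_on X \<and>
                (\<forall>x\<in>X. \<forall>z\<in>S. dist z0 z \<le> r \<longrightarrow> norm (f x z) \<le> g x)"
  shows "(\<lambda>z. \<Sum>\<^sub>\<infinity>x\<in>X. f x z) holomorphic_on S"
proof -
  have "(\<lambda>z. \<Sum>\<^sub>\<infinity>x\<in>X. f x z) field_differentiable (at z0)" if z0: "z0 \<in> S" for z0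
  proof -
    obtain r1 g where r1: "r1 > 0" "g summable_on X" and
      g1: "\<And>x z. x \<in> X \<Longrightarrow> z \<in> S \<Longrightarrow> dist z0 z \<le> r1 \<Longrightarrow> norm (f x z) \<le> g x"
      using dom[OF z0] by blast
    obtain r2 where r2: "r2 > 0" "cball z0 r2 \<subseteq> S" using S z0 open_contains_cball by blast
    define r where "r = min r1 r2"
    have r: "r > 0" "cball z0 r \<subseteq> S" using r1 r2 by (auto simp: r_def)
    have "uniform_limit (cball z0 r) (\<lambda>X z. \<Sum>x\<in>X. f x z) (\<lambda>z. \<Sum>\<^sub>\<infinity>x\<in>X. f x z) (finite_subsets_at_top X)"
      by (rule Weierstrass_m_test_general[OF _ r1(2)]) (use g1 r in \<open>auto simp: r_def\<close>)
    then have "(\<lambda>z. \<Sum>\<^sub>\<infinity>x\<in>X. f x z) holomorphic_on ball z0 r"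
    proof (rule holomorphic_uniform_limit[rotated])
      show "\<forall>\<^sub>F Y in finite_subsets_at_top X. continuous_on (cball z0 r) (\<lambda>z. \<Sum>x\<in>Y. f x z) \<and>
           (\<lambda>z. \<Sum>x\<in>Y. f x z) holomorphic_on ball z0 r"
      proof (rule eventually_finite_subsets_at_top_weakI)
        fix Y assume Y: "finite Y" "Y \<subseteq> X"
        then have "(\<lambda>z. \<Sum>x\<in>Y. f x z) holomorphic_on S" using hol by (intro holomorphic_intros) auto
        then show "continuous_on (cball z0 r) (\<lambda>z. \<Sum>x\<in>Y. f x z) \<and> (\<lambda>z. \<Sum>x\<in>Y. f x z) holomorphic_on ball z0 r"
          using r(2) by (meson ball_subset_cball holomorphic_on_imp_continuous_on holomorphic_on_subset continuous_on_subset order_trans)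
      qed
    qed (auto simp: finite_subsets_at_top_neq_bot)
    then show ?thesis using r(1) by (meson centre_in_ball holomorphic_on_imp_differentiable_at open_ball)
  qed
  then show ?thesis using S by (simp add: field_differentiable_at_within holomorphic_on_def)
qed

lemma exp_decay_cubic:
  fixes c :: real
  assumes "c > 0"
  obtains K where "K > 0" "\<And>y. (1 + \<bar>y\<bar>) ^ 3 * exp (- c * \<bar>y\<bar>) \<le> K"
proof -
  \<comment> \<open>With this \<open>m\<close>, m(1 + |y|) is at most 1 + c|y|/3, hence at most
    exp(c|y|/3); the cube gives the claim.\<close>
  define m where "m = min 1 (c / 3)"
  have m: "m > 0" "m \<le> 1" "m \<le> c / 3" using assms by (auto simp: m_def)
  have "(1 + \<bar>y\<bar>) ^ 3 * exp (- c * \<bar>y\<bar>) \<le> 1 / m ^ 3" for y :: real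
  proof -
    have "m * (1 + \<bar>y\<bar>) \<le> 1 + c * \<bar>y\<bar> / 3"
      using m mult_right_mono[OF m(3), of "\<bar>y\<bar>"] by (simp add: algebra_simps)
    also have "\<dots> \<le> exp (c * \<bar>y\<bar> / 3)" by (rule exp_ge_add_one_self)
    finally have "(m * (1 + \<bar>y\<bar>)) ^ 3 \<le> exp (c * \<bar>y\<bar> / 3) ^ 3"
      using m by (intro power_mono) auto
    also have "\<dots> = exp (c * \<bar>y\<bar>)" by (simp flip: exp_of_nat_mult)
    finally have "m ^ 3 * (1 + \<bar>y\<bar>) ^ 3 \<le> exp (c * \<bar>y\<bar>)" by (simp only: power_mult_distrib)
    then have "(1 + \<bar>y\<bar>) ^ 3 \<le> exp (c * \<bar>y\<bar>) / m ^ 3" using m by (simp add: pos_le_divide_eq mult.commute)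
    then have "(1 + \<bar>y\<bar>) ^ 3 * exp (- c * \<bar>y\<bar>) \<le> exp (c * \<bar>y\<bar>) / m ^ 3 * exp (- c * \<bar>y\<bar>)"
      by (intro mult_right_mono) auto
    then show ?thesis by (simp add: exp_minus)
  qed
  then show ?thesis using m by (intro that[of "1 / m ^ 3"]) auto
qed

lemma one_plus_square_le: "1 + y\<^sup>2 \<le> (1 + \<bar>y\<bar>)\<^sup>2" for y :: real
  by (simp add: power2_eq_square algebra_simps)

lemma exp_decay_quadratic:
  fixes c :: real
  assumes "c > 0"
  obtains K where "K > 0" "\<And>y. (1 + \<bar>y\<bar>) * exp (- c * \<bar>y\<bar>) \<le> K / (1 + y\<^sup>2)"
    "\<And>y. exp (- c * \<bar>y\<bar>) \<le> K / (1 + y\<^sup>2)"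
proof -
  obtain K where K: "K > 0" "\<And>y. (1 + \<bar>y\<bar>) ^ 3 * exp (- c * \<bar>y\<bar>) \<le> K"
    using exp_decay_cubic[OF assms] by blast
  have 1: "(1 + \<bar>y\<bar>) * exp (- c * \<bar>y\<bar>) \<le> K / (1 + y\<^sup>2)" for y :: real
  proof -
    have "(1 + y\<^sup>2) * ((1 + \<bar>y\<bar>) * exp (- c * \<bar>y\<bar>)) \<le> (1 + \<bar>y\<bar>)\<^sup>2 * ((1 + \<bar>y\<bar>) * exp (- c * \<bar>y\<bar>))"
      by (intro mult_right_mono one_plus_square_le) auto
    also have "\<dots> \<le> K" using K(2)[of y] by (simp add: power2_eq_square power3_eq_cube mult_ac)
    finally show ?thesis by (simp add: field_simps add_pos_nonneg)
  qed
  have "exp (- c * \<bar>y\<bar>) \<le> (1 + \<bar>y\<bar>) * exp (- c * \<bar>y\<bar>)" for y :: real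
    using mult_right_mono[of 1 "1 + \<bar>y\<bar>" "exp (- c * \<bar>y\<bar>)"] by simp
  then show ?thesis using that[of K] K(1) 1 order_trans by blast
qed

text \<open>\<open>vertical_line_shift_pole\<close> is applied to \<open>(z - p) * f z\<close> with
  a point \<open>p\<close> between the lines: the numerator vanishes at \<open>p\<close>, so no
  residue remains. The exponential decay pays for the additional linear factor.\<close>

lemma vertical_line_shift:
  fixes f :: "complex \<Rightarrow> complex"
  assumes f: "f holomorphic_on {z. a' < Re z \<and> Re z < b'}" and ab: "a' < a" "a < b" "b < b'"
    and c: "c > 0"
    and bound: "\<And>z. a \<le> Re z \<Longrightarrow> Re z \<le> b \<Longrightarrow> norm (f z) \<le> C * exp (- c * \<bar>Im z\<bar>)"
  shows "integrable lborel (\<lambda>y. f (Complex b y))" "integrable lborel (\<lambda>y. f (Complex a y))"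
    and "(\<integral>y. f (Complex b y) \<partial>lborel) = (\<integral>y. f (Complex a y) \<partial>lborel)"
proof -
  obtain K where K: "K > 0" "\<And>y. (1 + \<bar>y\<bar>) * exp (- c * \<bar>y\<bar>) \<le> K / (1 + y\<^sup>2)"
    and "\<And>y. exp (- c * \<bar>y\<bar>) \<le> K / (1 + y\<^sup>2)"
    by (rule exp_decay_quadratic[OF c]) (rule that)
  define p where "p = complex_of_real ((a + b) / 2)"
  define A where "A = (\<lambda>z. (z - p) * f z)"
  have p: "a < Re p" "Re p < b" "Im p = 0" using ab by (auto simp: p_def)
  have C0: "C \<ge> 0"
  proof -
    have "norm (f (Complex a 0)) \<le> C" using bound[of "Complex a 0"] ab by auto
    then show ?thesis using norm_ge_zero[of "f (Complex a 0)"] by linarith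
  qed
  have hA: "A holomorphic_on {z. a' < Re z \<and> Re z < b'}"
    unfolding A_def using f by (intro holomorphic_intros)
  have bA: "norm (A z) \<le> ((b - a + 1) * C * K) / (1 + (Im z)\<^sup>2)" if z: "a \<le> Re z" "Re z \<le> b" for z
  proof -
    have "norm (z - p) \<le> \<bar>Re (z - p)\<bar> + \<bar>Im (z - p)\<bar>" by (rule cmod_le)
    also have "\<dots> \<le> (b - a) + \<bar>Im z\<bar>" using p z by auto
    also have "\<dots> \<le> (b - a + 1) * (1 + \<bar>Im z\<bar>)" using ab mult_nonneg_nonneg[of "b - a" "\<bar>Im z\<bar>"] by (simp add: algebra_simps)
    finally have "norm (A z) \<le> ((b - a + 1) * (1 + \<bar>Im z\<bar>)) * (C * exp (- c * \<bar>Im z\<bar>))"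
      unfolding A_def norm_mult using bound[OF z] ab by (intro mult_mono) auto
    also have "\<dots> = ((b - a + 1) * C) * ((1 + \<bar>Im z\<bar>) * exp (- c * \<bar>Im z\<bar>))" by simp
    also have "\<dots> \<le> ((b - a + 1) * C) * (K / (1 + (Im z)\<^sup>2))"
      using ab C0 by (intro mult_left_mono K) auto
    finally show ?thesis by simp
  qed
  have q: "A (Complex s y) / (Complex s y - p) = f (Complex s y)" if "s \<noteq> Re p" for s y
    using that by (auto simp: A_def complex_eq_iff)
  note * = vertical_line_shift_pole[OF hA ab(1,3) p(1,2) bA]
  show "integrable lborel (\<lambda>y. f (Complex b y))" "integrable lborel (\<lambda>y. f (Complex a y))"
    "(\<integral>y. f (Complex b y) \<partial>lborel) = (\<integral>y. f (Complex a y) \<partial>lborel)"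
    using * p by (simp_all add: q) (simp add: A_def)
qed

section \<open>The Gamma function on vertical lines\<close>

text \<open>|Gamma(x + iy)| / Gamma(x) increases with x, because in Euler's product each factor (x +
  k) / |x + k + iy| does. Thus decay known on one vertical line spreads to the lines on its
  left.\<close>

lemma Gamma_norm_ratio_mono:
  assumes "0 < x" "x \<le> x'"
  shows "norm (Gamma (Complex x y)) * Gamma x' \<le> norm (Gamma (Complex x' y)) * Gamma x"
proof (rule LIMSEQ_le)
  show "(\<lambda>n. norm (Gamma_series (Complex x y) n) * Gamma_series x' n)
      \<longlonglongrightarrow> norm (Gamma (Complex x y)) * Gamma x'"
    "(\<lambda>n. norm (Gamma_series (Complex x' y) n) * Gamma_series x n)
      \<longlonglongrightarrow> norm (Gamma (Complex x' y)) * Gamma x"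
    by (intro tendsto_intros)+
  have "norm (Gamma_series (Complex x y) n) * Gamma_series x' n \<le>
        norm (Gamma_series (Complex x' y) n) * Gamma_series x n" for n
  proof -
    have poch: "norm (pochhammer (Complex u y) (n + 1)) = (\<Prod>k=0..<n+1. norm (Complex (u + real k) y))" for u
      unfolding pochhammer_prod prod_norm[symmetric] by (intro prod.cong) (auto simp: complex_eq_iff intro!: arg_cong[of _ _ norm])
    have pos: "0 < norm (pochhammer (Complex u y) (n + 1))" "0 < pochhammer u (n + 1)" if "u > 0" for u
    proof -
      show "0 < norm (pochhammer (Complex u y) (n + 1))"
        unfolding poch using that by (intro prod_pos) (auto simp: complex_eq_iff)
      show "0 < pochhammer u (n + 1)" using that by (rule pochhammer_pos)
    qed
    have "norm (pochhammer (Complex x' y) (n + 1)) * pochhammer x (n + 1) \<le>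
          norm (pochhammer (Complex x y) (n + 1)) * pochhammer x' (n + 1)"
      unfolding poch unfolding pochhammer_prod prod.distrib[symmetric]
    proof (intro prod_mono conjI)
      fix k assume "k \<in> {0..<n+1}"
      define s where "s = x + real k"
      define s' where "s' = x' + real k"
      have s: "0 < s" "s \<le> s'" using assms by (auto simp: s_def s'_def)
      have "(norm (Complex s' y) * s)\<^sup>2 \<le> (norm (Complex s y) * s')\<^sup>2"
        using s by (simp add: power_mult_distrib cmod_power2 algebra_simps) (intro mult_right_mono power_mono, auto)
      then have "norm (Complex s' y) * s \<le> norm (Complex s y) * s'"
        by (rule power2_le_imp_le) (use s in auto)
      then show "norm (Complex (x' + real k) y) * (x + real k) \<le> norm (Complex (x + real k) y) * (x' + real k)"
        by (simp add: s_def s'_def)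
    qed (use assms in auto)
    then have "fact n * exp (x * ln (real n)) * (fact n * exp (x' * ln (real n))) /
        (norm (pochhammer (Complex x y) (n + 1)) * pochhammer x' (n + 1)) \<le>
        fact n * exp (x * ln (real n)) * (fact n * exp (x' * ln (real n))) /
        (norm (pochhammer (Complex x' y) (n + 1)) * pochhammer x (n + 1))"
      using assms pos[of x] pos[of x'] by (intro divide_left_mono mult_pos_pos mult_nonneg_nonneg) auto
    moreover have "norm (fact n :: complex) = fact n" by (metis norm_fact)
    ultimately show ?thesis
      unfolding Gamma_series_def norm_divide norm_mult norm_exp_eq_Re by (simp add: mult_ac)
  qed
  then show "\<exists>N. \<forall>n\<ge>N. norm (Gamma_series (Complex x y) n) * Gamma_series x' n \<le>
        norm (Gamma_series (Complex x' y) n) * Gamma_series x n" by blast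
qed

text \<open>Follows from exp(u/2) (exp(u/2) - exp(-u/2)) = exp(u) - 1 and sinh(u/2) >= u/2. The
  factor \<open>u\<close> is kept to cancel the numerator of pi y / sinh(pi y).\<close>

lemma sinh_ge_exp_half:
  fixes u :: real
  assumes "u \<ge> 0"
  shows "u * exp (u / 2) \<le> 2 * sinh u"
proof -
  have 1: "exp u = exp (u/2) * exp (u/2)" "exp (u/2) * exp (- u / 2) = 1" by (simp_all flip: exp_add)
  have "2 * (u/2) \<le> 2 * sinh (u / 2)"
  proof -
    have "sinh (u/2) \<ge> u/2"
    proof -
      have "(\<lambda>x::real. sinh x - x) 0 \<le> (\<lambda>x. sinh x - x) (u/2)"
      proof (rule DERIV_nonneg_imp_nondecreasing[where f = "\<lambda>x::real. sinh x - x"])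
        show "\<exists>y. ((\<lambda>x. sinh x - x) has_real_derivative y) (at x) \<and> 0 \<le> y" for x :: real
          by (rule exI[of _ "cosh x - 1"]) (auto intro!: derivative_eq_intros simp: cosh_real_ge_1)
      qed (use assms in auto)
      then show ?thesis by simp
    qed
    then show ?thesis by simp
  qed
  then have "u \<le> exp (u/2) - exp (- u/2)" by (simp add: sinh_field_def)
  then have "exp (u/2) * u \<le> exp (u/2) * (exp (u/2) - exp (- u/2))" by (intro mult_left_mono) auto
  also have "\<dots> = exp u - 1" using 1 by (simp add: algebra_simps)
  also have "\<dots> \<le> 2 * sinh u" using assms by (simp add: sinh_field_def)
  finally show ?thesis by (simp add: mult_ac)
qed

text \<open>The reflection formula gives |Gamma(1 + iy)|^2 = pi y / sinh(pi y). The true rate pi/2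
  is lowered to 1/2 in exchange for a bound without polynomial factor.\<close>

lemma Gamma_one_plus_imaginary_bound: "norm (Gamma (Complex 1 y)) \<le> 2 * exp (- \<bar>y\<bar> / 2)"
proof (cases "y = 0")
  case True
  then show ?thesis by (simp flip: one_complex.code)
next
  case False
  define z where "z = \<i> * of_real y"
  have z: "z \<noteq> 0" "z \<notin> \<int>\<^sub>\<le>\<^sub>0" "Complex 1 y = z + 1" "cnj (Complex 1 y) = 1 - z" "norm z = \<bar>y\<bar>"
    using False by (auto simp: z_def complex_eq_iff norm_mult elim!: nonpos_Ints_cases)
  define u where "u = pi * \<bar>y\<bar>"
  have u: "u > 0" using False by (simp add: u_def)
  have "(norm (Gamma (Complex 1 y)))\<^sup>2 = norm (Gamma (Complex 1 y) * cnj (Gamma (Complex 1 y)))"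
    by (simp add: norm_mult power2_eq_square)
  also have "\<dots> = norm (z * (Gamma z * Gamma (1 - z)))"
    unfolding cnj_Gamma z(3,4) using z(4) unfolding z(3) by (simp add: Gamma_plus1 z mult_ac)
  also have "\<dots> = norm (z * (of_real pi / sin (of_real pi * z)))" by (simp only: Gamma_reflection_complex)
  also have "\<dots> = u / norm (sin (of_real pi * z))" by (simp add: norm_mult norm_divide z u_def)
  also have "sin (of_real pi * z) = \<i> * of_real (sinh (pi * y))"
  proof -
    have "sinh (complex_of_real (pi * y)) = of_real (sinh (pi * y))"
      by (simp add: sinh_field_def flip: exp_of_real)
    moreover have "\<i> * sinh (complex_of_real (pi * y)) = sin (\<i> * of_real (pi * y))"
      unfolding sinh_conv_sin by simp
    ultimately show ?thesis by (simp add: z_def mult_ac)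
  qed
  also have "norm \<dots> = sinh u"
    using sinh_real_abs[of "pi * y"] by (simp add: u_def norm_mult abs_mult)
  also have "u / sinh u \<le> 2 * exp (- (u / 2))"
  proof -
    have "u * exp (u / 2) * exp (- (u / 2)) \<le> 2 * sinh u * exp (- (u / 2))"
      using sinh_ge_exp_half[of u] u by (intro mult_right_mono) auto
    then have "u \<le> 2 * sinh u * exp (- (u / 2))" by (simp add: mult.assoc flip: exp_add)
    then show ?thesis using u by (simp add: pos_divide_le_eq mult_ac)
  qed
  also have "\<dots> \<le> 4 * exp (- \<bar>y\<bar>)"
  proof -
    have "\<bar>y\<bar> * 2 \<le> \<bar>y\<bar> * pi" by (intro mult_left_mono) (use pi_ge_two in auto)
    then have "exp (- (u / 2)) \<le> exp (- \<bar>y\<bar>)" by (simp add: u_def mult_ac)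
    then show ?thesis using exp_ge_zero[of "- \<bar>y\<bar>"] by linarith
  qed
  also have "\<dots> = (2 * exp (- \<bar>y\<bar> / 2))\<^sup>2" by (simp add: power_mult_distrib flip: exp_of_nat_mult exp_double)
  finally show ?thesis by (rule power2_le_imp_le) auto
qed

text \<open>The line \<open>Re z = 2\<close> is reached by monotonicity of the ratio and treated by
  Gamma(2 + iy) = (1 + iy) Gamma(1 + iy); halving the rate from 1/2 to 1/4 absorbs the linear
  factor.\<close>

lemma Gamma_norm_bound:
  assumes "0 < Re z" "Re z \<le> 2"
  shows "norm (Gamma z) \<le> 8 * Gamma (Re z) * exp (- \<bar>Im z\<bar> / 4)"
proof -
  define x y where "x = Re z" and "y = Im z"
  have z: "z = Complex x y" by (simp add: x_def y_def)
  have x: "0 < x" "x \<le> 2" using assms by (auto simp: x_def)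
  have "Gamma (2::real) = 1" using Gamma_fact[of 1, where ?'a = real] by simp
  then have "norm (Gamma (Complex x y)) \<le> norm (Gamma (Complex 2 y)) * Gamma x"
    using Gamma_norm_ratio_mono[OF x] by simp
  also have "Complex 2 y = Complex 1 y + 1" by (simp add: complex_eq_iff)
  also have "Gamma \<dots> = Complex 1 y * Gamma (Complex 1 y)"
    by (rule Gamma_plus1) (auto simp: complex_eq_iff elim!: nonpos_Ints_cases)
  also have "norm \<dots> * Gamma x \<le> ((1 + \<bar>y\<bar>) * (2 * exp (- \<bar>y\<bar> / 2))) * Gamma x"
  proof (intro mult_right_mono)
    show "norm (Complex 1 y * Gamma (Complex 1 y)) \<le> (1 + \<bar>y\<bar>) * (2 * exp (- \<bar>y\<bar> / 2))"
      unfolding norm_mult using cmod_le[of "Complex 1 y"]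
      by (intro mult_mono Gamma_one_plus_imaginary_bound) auto
  qed (use x Gamma_real_pos[of x] in auto)
  also have "\<dots> \<le> (8 * exp (- \<bar>y\<bar> / 4)) * Gamma x"
  proof (intro mult_right_mono)
    have "1 + \<bar>y\<bar> \<le> 4 * (1 + \<bar>y\<bar> / 4)" by simp
    also have "\<dots> \<le> 4 * exp (\<bar>y\<bar> / 4)" by (intro mult_left_mono exp_ge_add_one_self) auto
    finally have "(1 + \<bar>y\<bar>) * (2 * exp (- \<bar>y\<bar> / 2)) \<le> (4 * exp (\<bar>y\<bar> / 4)) * (2 * exp (- \<bar>y\<bar> / 2))"
      by (intro mult_right_mono) auto
    also have "\<dots> = 8 * exp (- \<bar>y\<bar> / 4)" by (simp flip: exp_add)
    finally show "(1 + \<bar>y\<bar>) * (2 * exp (- \<bar>y\<bar> / 2)) \<le> 8 * exp (- \<bar>y\<bar> / 4)" .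
  qed (use x Gamma_real_pos[of x] in auto)
  finally show ?thesis by (simp add: z mult_ac)
qed

lemma Gamma_strip_bound:
  assumes "0 < a"
  obtains K where "K > 0" "\<And>z. a \<le> Re z \<Longrightarrow> Re z \<le> 2 \<Longrightarrow> norm (Gamma z) \<le> K * exp (- \<bar>Im z\<bar> / 4)"
proof -
  have "continuous_on {a..2} (Gamma :: real \<Rightarrow> real)"
    using assms by (intro continuous_on_Gamma) (auto elim!: nonpos_Ints_cases)
  then have "bounded (Gamma ` {a..2::real})"
    by (intro compact_imp_bounded compact_continuous_image) auto
  then obtain B where "\<forall>x\<in>Gamma ` {a..2}. norm (x::real) \<le> B" unfolding bounded_iff by blast
  then have B: "\<And>x. x \<in> {a..2} \<Longrightarrow> \<bar>Gamma (x::real)\<bar> \<le> B" by simp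
  have "norm (Gamma z) \<le> (8 * \<bar>B\<bar> + 1) * exp (- \<bar>Im z\<bar> / 4)" if "a \<le> Re z" "Re z \<le> 2" for z
  proof -
    have "norm (Gamma z) \<le> 8 * Gamma (Re z) * exp (- \<bar>Im z\<bar> / 4)"
      using that assms by (intro Gamma_norm_bound) auto
    also have "\<dots> \<le> (8 * \<bar>B\<bar> + 1) * exp (- \<bar>Im z\<bar> / 4)"
      using B[of "Re z"] that by (intro mult_right_mono) auto
    finally show ?thesis .
  qed
  then show ?thesis by (intro that[of "8 * \<bar>B\<bar> + 1"]) auto
qed

lemma Gamma_holomorphic_right: "Gamma holomorphic_on {z. 0 < Re z \<and> Re z < b}"
  by (rule holomorphic_Gamma) (auto elim!: nonpos_Ints_cases)

lemma Gamma_not_nonpos_Ints: "Re z > 0 \<Longrightarrow> z \<notin> \<int>\<^sub>\<le>\<^sub>0"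
  by (auto elim!: nonpos_Ints_cases)

lemma norm_exp_minus_mult_of_real: "norm (exp (- z * of_real t)) = exp (- (Re z * t))"
  by (simp add: norm_exp_eq_Re)

text \<open>Writing \<open>x = exp t\<close>, this is the Mellin inversion of \<open>exp (- x)\<close> on the line \<open>Re = 1/2\<close>
  and of \<open>exp (- x) - 1\<close> on the line \<open>Re = -1/2\<close>. The integral \<open>J\<close> over the first line satisfies
  \<open>J' = - exp t * J\<close> because of \<open>z * Gamma z = Gamma (z + 1)\<close>.\<close>
lemma Gamma_Mellin_inversion:
  fixes t :: real
  shows "integrable lborel (\<lambda>y. Gamma (Complex (-1/2) y) * exp (- Complex (-1/2) y * of_real t))"
    and "(\<integral>y. Gamma (Complex (-1/2) y) * exp (- Complex (-1/2) y * of_real t) \<partial>lborel) =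
         2 * pi * of_real (exp (- exp t) - 1)"
proof -
  obtain K where K: "K > 0" "\<And>z. 1/2 \<le> Re z \<Longrightarrow> Re z \<le> 2 \<Longrightarrow> norm (Gamma z) \<le> K * exp (- \<bar>Im z\<bar> / 4)"
    using Gamma_strip_bound[of "1/2"] by auto
  \<comment> \<open>\<open>J\<close> lies to the right and \<open>L\<close> to the left of the pole
    of Gamma at 0; they differ by its residue. The variable is complex because the differential
    equation of \<open>J\<close> is obtained from holomorphy.\<close>
  define J where "J = (\<lambda>t::complex. \<integral>y. Gamma (Complex (1/2) y) * exp (- Complex (1/2) y * t) \<partial>lborel)"
  define L where "L = (\<lambda>t::complex. \<integral>y. Gamma (Complex (-1/2) y) * exp (- Complex (-1/2) y * t) \<partial>lborel)"
  have Gcont: "continuous_on UNIV (\<lambda>y. Gamma (Complex s y))" if "s > 0" for s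
    by (rule continuous_on_compose2[OF holomorphic_on_imp_continuous_on[OF Gamma_holomorphic_right[of "s + 1"]]])
       (use that in \<open>auto simp: Complex_eq intro!: continuous_intros\<close>)

  have J': "(J has_field_derivative (- exp (of_real t) * J (of_real t))) (at (of_real t))" for t :: real
  proof -
    \<comment> \<open>Complex t costs exp(|y| |Im t|); with |Im t| < 1/8 half of the rate 1/4 of
      Gamma survives.\<close>
    define S where "S = {z::complex. \<bar>Im z\<bar> < 1/8} \<inter> ball (of_real t) 1"
    have S: "open S" "of_real t \<in> S"
    proof -
      have eq: "{z::complex. \<bar>Im z\<bar> < 1/8} = {z. Im z < 1/8} \<inter> {z. Im z > -1/8}" by auto
      show "open S" unfolding S_def eq
        by (intro open_Int open_halfspace_Im_lt open_halfspace_Im_gt open_ball)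
    qed (simp add: S_def)
    obtain K2 where "K2 > 0" "\<And>y::real. (1 + \<bar>y\<bar>) * exp (- (1/8) * \<bar>y\<bar>) \<le> K2 / (1 + y\<^sup>2)"
      and K2: "\<And>y::real. exp (- (1/8) * \<bar>y\<bar>) \<le> K2 / (1 + y\<^sup>2)"
      by (rule exp_decay_quadratic[of "1/8"]) auto
    have "(J has_field_derivative (\<integral>y. deriv (\<lambda>z. Gamma (Complex (1/2) y) * exp (- Complex (1/2) y * z)) (of_real t) \<partial>lborel)) (at (of_real t))"
      unfolding J_def
    proof (rule holomorphic_on_lebesgue_integral[OF S(1) _ _ _ S(2)])
      show "(\<lambda>y. Gamma (Complex (1/2) y) * exp (- Complex (1/2) y * z)) \<in> borel_measurable lborel" for z
        by (simp, intro borel_measurable_continuous_onI continuous_intros Gcont)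
           (auto simp: Complex_eq intro!: continuous_intros)
      fix z0 assume "z0 \<in> S"
      show "\<exists>r>0. \<exists>g. integrable lborel g \<and> (\<forall>y\<in>space lborel. \<forall>z\<in>S. dist z0 z \<le> r \<longrightarrow>
          norm (Gamma (Complex (1/2) y) * exp (- Complex (1/2) y * z)) \<le> g y)"
      proof (rule exI[of _ 1], intro conjI, simp, rule exI[of _ "\<lambda>y. (K * exp (\<bar>t\<bar> + 1) * K2) * (1 / (1 + y\<^sup>2))"], intro conjI ballI impI)
        show "integrable lborel (\<lambda>y::real. (K * exp (\<bar>t\<bar> + 1) * K2) * (1 / (1 + y\<^sup>2)))"
          by (intro integrable_mult_right integrable_one_over_one_plus_square)
        fix y z assume z: "z \<in> S"
        have "\<bar>Re z - t\<bar> < 1" using z abs_Re_le_cmod[of "z - of_real t"] by (auto simp: S_def dist_norm norm_minus_commute)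
        moreover have "\<bar>y * Im z\<bar> \<le> \<bar>y\<bar> * (1/8)"
          using z unfolding S_def abs_mult by (intro mult_left_mono) auto
        ultimately have "Re (- Complex (1/2) y * z) \<le> \<bar>t\<bar> + 1 + \<bar>y\<bar> / 8" by (simp add: abs_le_iff)
        then have "norm (exp (- Complex (1/2) y * z)) \<le> exp (\<bar>t\<bar> + 1) * exp (\<bar>y\<bar> / 8)"
          by (simp only: norm_exp_eq_Re exp_add[symmetric] exp_le_cancel_iff)
        then have "norm (Gamma (Complex (1/2) y) * exp (- Complex (1/2) y * z)) \<le>
            (K * exp (- \<bar>y\<bar> / 4)) * (exp (\<bar>t\<bar> + 1) * exp (\<bar>y\<bar> / 8))"
          unfolding norm_mult using K(1) K(2)[of "Complex (1/2) y"] by (intro mult_mono) auto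
        also have "\<dots> = K * exp (\<bar>t\<bar> + 1) * (exp (- \<bar>y\<bar> / 4) * exp (\<bar>y\<bar> / 8))" by simp
        also have "exp (- \<bar>y\<bar> / 4) * exp (\<bar>y\<bar> / 8) = exp (- (1/8) * \<bar>y\<bar>)" by (simp flip: exp_add)
        also have "K * exp (\<bar>t\<bar> + 1) * exp (- (1/8) * \<bar>y\<bar>) \<le> K * exp (\<bar>t\<bar> + 1) * (K2 / (1 + y\<^sup>2))"
          using K by (intro mult_left_mono K2) auto
        finally show "norm (Gamma (Complex (1/2) y) * exp (- Complex (1/2) y * z)) \<le> (K * exp (\<bar>t\<bar> + 1) * K2) * (1 / (1 + y\<^sup>2))"
          by simp
      qed
    qed (auto intro!: holomorphic_intros)
    also have "(\<lambda>y. deriv (\<lambda>z. Gamma (Complex (1/2) y) * exp (- Complex (1/2) y * z)) (of_real t)) =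
       (\<lambda>y. - exp (of_real t) * (Gamma (Complex (3/2) y) * exp (- Complex (3/2) y * of_real t)))"
    proof
      fix y
      define w where "w = Complex (1/2) y"
      have w: "Complex (3/2) y = w + 1" by (simp add: w_def complex_eq_iff)
      have w': "w \<notin> \<int>\<^sub>\<le>\<^sub>0" by (rule Gamma_not_nonpos_Ints) (simp add: w_def)
      have e: "exp (of_real t) * exp (- (w + 1) * of_real t) = exp (- w * of_real t)"
        by (simp add: algebra_simps flip: exp_add)
      have "deriv (\<lambda>z. Gamma w * exp (- w * z)) (of_real t) = - w * Gamma w * exp (- w * of_real t)"
        by (rule DERIV_imp_deriv) (auto intro!: derivative_eq_intros)
      also have "\<dots> = - (w * Gamma w) * (exp (of_real t) * exp (- (w + 1) * of_real t))"
        unfolding e by simp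
      also have "\<dots> = - exp (of_real t) * (Gamma (w + 1) * exp (- (w + 1) * of_real t))"
        unfolding Gamma_plus1[OF w'] by (simp only: mult_ac minus_mult_left[symmetric] minus_mult_right[symmetric])
      finally show "deriv (\<lambda>z. Gamma (Complex (1/2) y) * exp (- Complex (1/2) y * z)) (of_real t) =
         - exp (of_real t) * (Gamma (Complex (3/2) y) * exp (- Complex (3/2) y * of_real t))"
        unfolding w w_def .
    qed
    also have "(\<integral>y. - exp (complex_of_real t) * (Gamma (Complex (3/2) y) * exp (- Complex (3/2) y * of_real t)) \<partial>lborel) =
       - exp (of_real t) * (\<integral>y. Gamma (Complex (3/2) y) * exp (- Complex (3/2) y * of_real t) \<partial>lborel)"
      by (rule integral_mult_right_zero)
    also have "(\<integral>y. Gamma (Complex (3/2) y) * exp (- Complex (3/2) y * of_real t) \<partial>lborel) = J (of_real t)"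
      unfolding J_def
    proof (rule vertical_line_shift(3)[where a' = 0 and b' = 2 and c = "1/4" and C = "K * exp (2 * \<bar>t\<bar>)"])
      show "(\<lambda>a. Gamma a * exp (- a * complex_of_real t)) holomorphic_on {z. 0 < Re z \<and> Re z < 2}"
        by (intro holomorphic_intros Gamma_holomorphic_right)
      fix z assume z: "1/2 \<le> Re z" "Re z \<le> 3/2"
      have "- (Re z * t) \<le> \<bar>Re z * t\<bar>" by simp
      also have "\<dots> \<le> 2 * \<bar>t\<bar>" unfolding abs_mult using z by (intro mult_right_mono) auto
      finally have "norm (exp (- z * of_real t)) \<le> exp (2 * \<bar>t\<bar>)"
        unfolding norm_exp_minus_mult_of_real by simp
      then have "norm (Gamma z * exp (- z * of_real t)) \<le> (K * exp (- \<bar>Im z\<bar> / 4)) * exp (2 * \<bar>t\<bar>)"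
        unfolding norm_mult using z K(1) by (intro mult_mono K) auto
      then show "norm (Gamma z * exp (- z * of_real t)) \<le> K * exp (2 * \<bar>t\<bar>) * exp (- (1/4) * \<bar>Im z\<bar>)"
        by (simp add: mult_ac)
    qed auto
    finally show ?thesis .
  qed

  have shift: "integrable lborel (\<lambda>y. Gamma (Complex (-1/2) y) * exp (- Complex (-1/2) y * of_real t))"
    "J (of_real t) - L (of_real t) = 2 * pi" for t :: real
  proof -
    obtain K2 where "K2 > 0" "\<And>y::real. (1 + \<bar>y\<bar>) * exp (- (1/4) * \<bar>y\<bar>) \<le> K2 / (1 + y\<^sup>2)"
      and K2: "\<And>y::real. exp (- (1/4) * \<bar>y\<bar>) \<le> K2 / (1 + y\<^sup>2)"
      by (rule exp_decay_quadratic[of "1/4"]) auto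
    \<comment> \<open>\<open>A z / z\<close> equals \<open>Gamma z * exp (- z * of_real t)\<close>,
      and \<open>A 0 = 1\<close> is the residue.\<close>
    define A where "A = (\<lambda>z::complex. Gamma (z + 1) * exp (- z * of_real t))"
    have hol: "A holomorphic_on {z. -1 < Re z \<and> Re z < 1}"
      unfolding A_def
      by (intro holomorphic_intros holomorphic_on_compose_gen[OF _ Gamma_holomorphic_right[of 2], unfolded o_def]) auto
    have bnd: "norm (A z) \<le> (K * exp (2 * \<bar>t\<bar>) * K2) / (1 + (Im z)\<^sup>2)" if z: "-1/2 \<le> Re z" "Re z \<le> 1/2" for z
    proof -
      have "- (Re z * t) \<le> \<bar>Re z * t\<bar>" by simp
      also have "\<dots> \<le> 2 * \<bar>t\<bar>" unfolding abs_mult using z by (intro mult_right_mono) auto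
      finally have "norm (exp (- z * of_real t)) \<le> exp (2 * \<bar>t\<bar>)"
        unfolding norm_exp_minus_mult_of_real by simp
      then have "norm (A z) \<le> (K * exp (- \<bar>Im z\<bar> / 4)) * exp (2 * \<bar>t\<bar>)"
        unfolding norm_mult A_def using z K(1) K(2)[of "z + 1"] by (intro mult_mono) auto
      also have "\<dots> = K * exp (2 * \<bar>t\<bar>) * exp (- (1/4) * \<bar>Im z\<bar>)" by simp
      also have "\<dots> \<le> K * exp (2 * \<bar>t\<bar>) * (K2 / (1 + (Im z)\<^sup>2))"
        using K by (intro mult_left_mono K2) auto
      finally show ?thesis by simp
    qed
    have eq: "A (Complex s y) / (Complex s y - 0) = Gamma (Complex s y) * exp (- Complex s y * of_real t)"
      if "s \<noteq> 0" "s > -1" for s y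
    proof -
      have "Complex s y \<notin> \<int>\<^sub>\<le>\<^sub>0"
      proof
        assume "Complex s y \<in> \<int>\<^sub>\<le>\<^sub>0"
        then obtain n :: int where n: "Complex s y = of_int n" "n \<le> 0" by (auto elim!: nonpos_Ints_cases)
        then have "s = of_int n" by (simp add: complex_eq_iff)
        then show False using n that by auto
      qed
      then show ?thesis using that by (simp add: A_def Gamma_plus1 complex_eq_iff)
    qed
    note * = vertical_line_shift_pole[where A = A and a' = "-1" and b' = 1 and a = "-1/2" and b = "1/2"
        and p = 0, OF hol _ _ _ _ bnd]
    have e1: "A (Complex (-1/2) y) / (Complex (-1/2) y - 0) = Gamma (Complex (-1/2) y) * exp (- Complex (-1/2) y * of_real t)" for y
      by (rule eq) auto
    have e2: "A (Complex (1/2) y) / (Complex (1/2) y - 0) = Gamma (Complex (1/2) y) * exp (- Complex (1/2) y * of_real t)" for y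
      by (rule eq) auto
    have "integrable lborel (\<lambda>y. A (Complex (-1/2) y) / (Complex (-1/2) y - 0))"
      by (rule *(2)) auto
    then show "integrable lborel (\<lambda>y. Gamma (Complex (-1/2) y) * exp (- Complex (-1/2) y * of_real t))"
      unfolding e1 .
    have "(\<integral>y. A (Complex (1/2) y) / (Complex (1/2) y - 0) \<partial>lborel) -
      (\<integral>y. A (Complex (-1/2) y) / (Complex (-1/2) y - 0) \<partial>lborel) = 2 * pi * A 0"
      by (rule *(3)) auto
    then show "J (of_real t) - L (of_real t) = 2 * pi"
      unfolding e1 e2 J_def L_def by (simp add: A_def)
  qed
  then show "integrable lborel (\<lambda>y. Gamma (Complex (-1/2) y) * exp (- Complex (-1/2) y * of_real t))" by blast

  define k where "k = J 0 * exp 1"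
  have J: "J (of_real t) = k * of_real (exp (- exp t))" for t :: real
  proof -
    define H where "H = (\<lambda>t::real. J (of_real t) * exp (exp (of_real t)))"
    have "(H has_vector_derivative 0) (at t within UNIV)" for t
    proof -
      have "((\<lambda>z. J z * exp (exp z)) has_field_derivative 0) (at (of_real t))"
        by (rule derivative_eq_intros J' refl)+ (simp add: algebra_simps)
      then have "((\<lambda>t::real. J (of_real t) * exp (exp (of_real t))) has_vector_derivative 0) (at t within UNIV)"
        by (rule has_vector_derivative_real_field)
      then show ?thesis by (simp add: H_def)
    qed
    then obtain c where "\<And>t. H t = c"
      using has_vector_derivative_zero_constant[of UNIV H] by auto
    then have "H t = H 0" by simp
    then have "J (of_real t) * exp (exp (of_real t)) = k" by (simp add: H_def k_def)
    then have "J (of_real t) = k * exp (- exp (of_real t))" by (simp add: exp_minus field_simps)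
    moreover have "exp (- exp (complex_of_real t)) = of_real (exp (- exp t))"
      by (simp add: exp_of_real flip: of_real_minus)
    ultimately show ?thesis by simp
  qed
  define B where "B = (\<integral>y. norm (Gamma (Complex (-1/2) y)) \<partial>lborel)"
  have Lb: "norm (L (of_real t)) \<le> exp (t / 2) * B" for t :: real
  proof -
    have "norm (L (of_real t)) \<le> (\<integral>y. norm (Gamma (Complex (-1/2) y) * exp (- Complex (-1/2) y * of_real t)) \<partial>lborel)"
      unfolding L_def by (rule integral_norm_bound)
    also have "\<dots> = (\<integral>y. exp (t / 2) * norm (Gamma (Complex (-1/2) y)) \<partial>lborel)"
      unfolding norm_mult norm_exp_minus_mult_of_real by (simp add: mult_ac)
    also have "\<dots> = exp (t / 2) * B" unfolding B_def by (rule integral_mult_right_zero)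
    finally show ?thesis .
  qed
  \<comment> \<open>The differential equation leaves the constant \<open>k\<close> free. It is read
    off as t tends to minus infinity, where \<open>L\<close> vanishes while \<open>J - L\<close>
    stays \<open>2 * pi\<close>.\<close>
  have "((\<lambda>t::real. exp (t / 2) * B) \<longlongrightarrow> 0) at_bot" by real_asymp
  then have L0: "((\<lambda>t::real. L (of_real t)) \<longlongrightarrow> 0) at_bot"
    by (rule Lim_null_comparison[rotated]) (use Lb in auto)
  have "((\<lambda>t::real. exp (- exp t)) \<longlongrightarrow> 1) at_bot" by real_asymp
  then have "((\<lambda>t::real. k * of_real (exp (- exp t)) - L (of_real t)) \<longlongrightarrow> k * of_real 1 - 0) at_bot"
    by (intro tendsto_intros L0)
  moreover have "(\<lambda>t::real. k * of_real (exp (- exp t)) - L (of_real t)) = (\<lambda>t. 2 * pi)"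
    using shift(2) J by auto
  ultimately have "((\<lambda>t::real. complex_of_real (2 * pi)) \<longlongrightarrow> k) at_bot" by simp
  then have k: "k = 2 * pi"
    using tendsto_unique[OF trivial_limit_at_bot_linorder _ tendsto_const] by metis
  have "L (of_real t) = J (of_real t) - 2 * pi"
    unfolding shift(2)[of t, symmetric] by simp
  then have "(\<integral>y. Gamma (Complex (-1/2) y) * exp (- Complex (-1/2) y * of_real t) \<partial>lborel) = J (of_real t) - 2 * pi"
    unfolding L_def .
  then show "(\<integral>y. Gamma (Complex (-1/2) y) * exp (- Complex (-1/2) y * of_real t) \<partial>lborel) =
         2 * pi * of_real (exp (- exp t) - 1)"
    unfolding J k by (simp add: algebra_simps)
qed

section \<open>The functional equation of the zeta function\<close>

text \<open>The derivative of the reflection formula in its \<open>rGamma\<close> form, multiplied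
  out so that no quotient occurs. With the limit formula for Digamma it yields the cotangent
  series.\<close>

lemma digamma_reflection:
  fixes z :: complex
  assumes "z \<notin> \<int>"
  shows "sin (of_real pi * z) * (Digamma (1 - z) - Digamma z) = of_real pi * cos (of_real pi * z)"
proof -
  have z: "z \<notin> \<int>\<^sub>\<le>\<^sub>0" "1 - z \<notin> \<int>\<^sub>\<le>\<^sub>0"
  proof -
    show "z \<notin> \<int>\<^sub>\<le>\<^sub>0" using assms nonpos_Ints_Int by blast
    show "1 - z \<notin> \<int>\<^sub>\<le>\<^sub>0"
    proof
      assume "1 - z \<in> \<int>\<^sub>\<le>\<^sub>0"
      then have "1 - (1 - z) \<in> \<int>" using nonpos_Ints_Int by (intro Ints_diff) auto
      then show False using assms by simp
    qed
  qed
  have 1: "((\<lambda>w. rGamma w * rGamma (1 - w)) has_field_derivative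
      (rGamma z * rGamma (1 - z) * (Digamma (1 - z) - Digamma z))) (at z)"
    using z by (auto intro!: derivative_eq_intros has_field_derivative_rGamma_no_nonpos_int
        DERIV_chain2[OF has_field_derivative_rGamma_no_nonpos_int] simp: algebra_simps)
  have 2: "((\<lambda>w. sin (of_real pi * w) / of_real pi) has_field_derivative cos (of_real pi * z)) (at z)"
    by (auto intro!: derivative_eq_intros)
  have "rGamma z * rGamma (1 - z) * (Digamma (1 - z) - Digamma z) = cos (of_real pi * z)"
    using DERIV_unique[OF 1] 2 by (simp add: rGamma_reflection_complex)
  then show ?thesis by (simp add: rGamma_reflection_complex field_simps)
qed

text \<open>The function 1/(exp x - 1) without its pole and its constant term at 0. It is O(x) there
  and tends to 1/2 at infinity, so its Mellin integral converges for exponents strictly between -1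
  and 0.\<close>

definition bose :: "real \<Rightarrow> real" where
  "bose x = 1 / (exp x - 1) - 1 / x + 1 / 2"

text \<open>The partial fraction expansion of the hyperbolic cotangent.\<close>
lemma bose_sums:
  assumes x: "x > 0"
  shows "(\<lambda>n. 2 * x / (x\<^sup>2 + (2 * pi * real (Suc n))\<^sup>2)) sums bose x"
proof -
  \<comment> \<open>At z = iy with x = 2 pi y the trigonometric functions of pi z become hyperbolic
    functions of x/2.\<close>
  define y where "y = x / (2 * pi)"
  define z where "z = \<i> * complex_of_real y"
  define \<Delta> where "\<Delta> = Digamma (1 - z) - Digamma z"
  have y: "y > 0" using x by (simp add: y_def)
  have zI: "z \<notin> \<int>" using y by (auto simp: z_def complex_eq_iff elim!: Ints_cases)
  have zne: "z + of_nat n \<noteq> 0" "z - of_nat n \<noteq> 0" "1 - z + of_nat n \<noteq> 0" for n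
    using y by (auto simp: z_def complex_eq_iff)
  have "\<i> * of_real (sinh (x/2)) * \<Delta> = pi * of_real (cosh (x/2))"
  proof -
    have t: "of_real pi * z = \<i> * of_real (x / 2)" by (simp add: z_def y_def)
    have "sin (\<i> * of_real (x / 2)) = \<i> * complex_of_real (sinh (x / 2))"
    proof -
      have "\<i> * sinh (complex_of_real (x / 2)) = sin (\<i> * of_real (x / 2))"
        unfolding sinh_conv_sin by simp
      moreover have "sinh (complex_of_real (x / 2)) = of_real (sinh (x / 2))"
        by (simp add: sinh_field_def flip: exp_of_real)
      ultimately show ?thesis by simp
    qed
    moreover have "cos (\<i> * of_real (x / 2)) = complex_of_real (cosh (x / 2))"
    proof -
      have "cosh (complex_of_real (x / 2)) = of_real (cosh (x / 2))"
        by (simp add: cosh_field_def flip: exp_of_real)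
      then show ?thesis unfolding cosh_conv_cos .
    qed
    ultimately show ?thesis
      using digamma_reflection[OF zI] unfolding t \<Delta>_def by simp
  qed
  moreover have sh: "sinh (x/2) > 0" using x by simp
  ultimately have \<Delta>: "\<i> * \<Delta> = of_real (pi * cosh (x/2) / sinh (x/2))"
    by (simp add: field_simps)
  have "(\<lambda>m. (of_real (ln (real m)) - (\<Sum>n<m. inverse (1 - z + of_nat n))) -
      (of_real (ln (real m)) - (\<Sum>n<m. inverse (z + of_nat n)))) \<longlonglongrightarrow> \<Delta>"
    unfolding \<Delta>_def using zne(1)[of 0] zne(3)[of 0] by (intro tendsto_diff Digamma_LIMSEQ) auto
  then have "(\<lambda>m. (\<Sum>n<m. inverse (z + of_nat n)) - (\<Sum>n<m. inverse (1 - z + of_nat n))) \<longlonglongrightarrow> \<Delta>"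
    by (simp add: algebra_simps)
  \<comment> \<open>The logarithms in the two Digamma limits have cancelled. Shifting one index
    pairs z + n with z - n; the unpaired last term tends to 0.\<close>
  also have "(\<lambda>m. (\<Sum>n<m. inverse (z + of_nat n)) - (\<Sum>n<m. inverse (1 - z + of_nat n))) =
     (\<lambda>m. inverse z + (\<Sum>n<m. inverse (z + of_nat (Suc n)) + inverse (z - of_nat (Suc n))) - inverse (z + of_nat m))"
  proof
    fix m
    show "(\<Sum>n<m. inverse (z + of_nat n)) - (\<Sum>n<m. inverse (1 - z + of_nat n)) =
      inverse z + (\<Sum>n<m. inverse (z + of_nat (Suc n)) + inverse (z - of_nat (Suc n))) - inverse (z + of_nat m)"
    proof (induction m)
      case (Suc m)
      have "inverse (z - of_nat (Suc m)) = - inverse (1 - z + of_nat m)"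
        by (subst inverse_minus_eq[symmetric]) (simp add: algebra_simps)
      then show ?case using Suc by (simp add: algebra_simps)
    qed simp
  qed
  finally have lim: "(\<lambda>m. inverse z + (\<Sum>n<m. inverse (z + of_nat (Suc n)) + inverse (z - of_nat (Suc n))) - inverse (z + of_nat m)) \<longlonglongrightarrow> \<Delta>" .
  have lim0: "(\<lambda>m. inverse (z + of_nat m)) \<longlonglongrightarrow> 0"
    by (intro tendsto_inverse_0[THEN filterlim_compose] tendsto_add_filterlim_at_infinity[OF tendsto_const] tendsto_of_nat)
  have "(\<lambda>m. \<i> * ((inverse z + (\<Sum>n<m. inverse (z + of_nat (Suc n)) + inverse (z - of_nat (Suc n))) - inverse (z + of_nat m))
     - inverse z + inverse (z + of_nat m))) \<longlonglongrightarrow> \<i> * (\<Delta> - inverse z + 0)"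
    by (intro tendsto_intros lim lim0)
  also have "(\<lambda>m. \<i> * ((inverse z + (\<Sum>n<m. inverse (z + of_nat (Suc n)) + inverse (z - of_nat (Suc n))) - inverse (z + of_nat m))
     - inverse z + inverse (z + of_nat m))) = (\<lambda>m. of_real (\<Sum>n<m. 2 * y / (y\<^sup>2 + (real (Suc n))\<^sup>2)))"
  proof
    fix m
    have "\<i> * (inverse (z + of_nat (Suc n)) + inverse (z - of_nat (Suc n))) =
        of_real (2 * y / (y\<^sup>2 + (real (Suc n))\<^sup>2))" for n
    proof -
      define k where "k = complex_of_real (real (Suc n))"
      have k: "of_nat (Suc n) = k" by (simp add: k_def)
      have "z + k \<noteq> 0" "z - k \<noteq> 0" using zne[of "Suc n"] k by auto
      then have "inverse (z + k) + inverse (z - k) = 2 * z / ((z + k) * (z - k))"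
        by (simp add: field_simps)
      also have "(z + k) * (z - k) = - (of_real (y\<^sup>2 + (real (Suc n))\<^sup>2))"
        by (simp add: k_def z_def algebra_simps power2_eq_square)
      finally have "\<i> * (inverse (z + k) + inverse (z - k)) = \<i> * (2 * (\<i> * of_real y) / - complex_of_real (y\<^sup>2 + (real (Suc n))\<^sup>2))"
        by (simp only: z_def)
      moreover have "\<i> * (2 * (\<i> * Y) / - D) = 2 * Y / D" for Y D :: complex
      proof -
        have "\<i> * (2 * (\<i> * Y)) = - (2 * Y)" by (simp add: algebra_simps)
        then have "(\<i> * (2 * (\<i> * Y))) / - D = - (2 * Y) / - D" by (simp only:)
        then have "(\<i> * (2 * (\<i> * Y))) / - D = 2 * Y / D" by (simp del: mult_eq_0_iff)
        then show ?thesis by (simp only: times_divide_eq_right)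
      qed
      ultimately show ?thesis unfolding k by (simp only: of_real_divide of_real_mult of_real_numeral)
    qed
    then show "\<i> * ((inverse z + (\<Sum>n<m. inverse (z + of_nat (Suc n)) + inverse (z - of_nat (Suc n))) - inverse (z + of_nat m))
     - inverse z + inverse (z + of_nat m)) = of_real (\<Sum>n<m. 2 * y / (y\<^sup>2 + (real (Suc n))\<^sup>2))"
      by (simp add: sum_distrib_left del: of_nat_Suc)
  qed
  also have "\<i> * (\<Delta> - inverse z + 0) = of_real (pi * cosh (x/2) / sinh (x/2) - 1 / y)"
  proof -
    have iz: "\<i> * inverse z = of_real (1 / y)" by (simp add: z_def divide_inverse)
    have "\<i> * (\<Delta> - inverse z + 0) = \<i> * \<Delta> - \<i> * inverse z" by (simp only: add_0_right right_diff_distrib)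
    then show ?thesis unfolding \<Delta> iz by (simp only: of_real_diff)
  qed
  finally have "(\<lambda>n. 2 * y / (y\<^sup>2 + (real (Suc n))\<^sup>2)) sums (pi * cosh (x/2) / sinh (x/2) - 1 / y)"
    unfolding sums_def tendsto_of_real_iff .
  then have "(\<lambda>n. (1 / (2 * pi)) * (2 * y / (y\<^sup>2 + (real (Suc n))\<^sup>2))) sums
      ((1 / (2 * pi)) * (pi * cosh (x/2) / sinh (x/2) - 1 / y))"
    by (rule sums_mult)
  also have "(\<lambda>n. (1 / (2 * pi)) * (2 * y / (y\<^sup>2 + (real (Suc n))\<^sup>2))) =
      (\<lambda>n. 2 * x / (x\<^sup>2 + (2 * pi * real (Suc n))\<^sup>2))"
  proof
    fix n
    define k where "k = real (Suc n)"
    have "x = 2 * pi * y" by (simp add: y_def)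
    then have "2 * x / (x\<^sup>2 + (2 * pi * k)\<^sup>2) = (2 * pi) * (2 * y) / ((2 * pi) * (2 * pi) * (y\<^sup>2 + k\<^sup>2))"
      by (simp add: power2_eq_square algebra_simps)
    also have "\<dots> = (1 / (2 * pi)) * (2 * y / (y\<^sup>2 + k\<^sup>2))" by simp
    finally show "(1 / (2 * pi)) * (2 * y / (y\<^sup>2 + (real (Suc n))\<^sup>2)) = 2 * x / (x\<^sup>2 + (2 * pi * real (Suc n))\<^sup>2)"
      by (simp add: k_def)
  qed
  also have "(1 / (2 * pi)) * (pi * cosh (x/2) / sinh (x/2) - 1 / y) = bose x"
  proof -
    define E where "E = exp (x / 2)"
    have E: "exp x = E * E" "exp (- (x/2)) = 1 / E" "E > 1"
      using x by (simp_all add: E_def exp_minus field_simps flip: exp_add)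
    have EE: "E * E > 1" using E(3) by (simp add: less_1_mult)
    have "cosh (x/2) / sinh (x/2) = (E + 1 / E) / (E - 1 / E)"
    proof -
      have "cosh (x/2) = (E + 1 / E) / 2" "sinh (x/2) = (E - 1 / E) / 2"
        by (simp_all add: cosh_field_def sinh_field_def E(2) E_def[symmetric])
      moreover have "(a / 2) / (b / 2) = a / b" for a b :: real by simp
      ultimately show ?thesis by (simp only:)
    qed
    also have "\<dots> = ((E + 1 / E) * E) / ((E - 1 / E) * E)" using E by simp
    also have "\<dots> = (E * E + 1) / (E * E - 1)" using E by (simp add: algebra_simps)
    also have "\<dots> = 1 + 2 / (E * E - 1)" using EE by (simp add: field_simps)
    finally have c: "cosh (x/2) / sinh (x/2) = 1 + 2 / (exp x - 1)" using E by simp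
    have "(1 / (2 * pi)) * (pi * cosh (x/2) / sinh (x/2) - 1 / y) = (cosh (x/2) / sinh (x/2)) / 2 - 1 / x"
      using x by (simp add: y_def algebra_simps)
    also have "\<dots> = bose x" unfolding c bose_def by simp
    finally show ?thesis .
  qed
  finally show ?thesis .
qed

text \<open>Every term of the series is nonnegative; dropping \<open>x\<^sup>2\<close> from the
  denominators and summing the inverse squares gives x/12 as an upper bound.\<close>

lemma bose_bounds:
  assumes x: "x > 0"
  shows "0 \<le> bose x" "bose x \<le> x"
proof -
  show "0 \<le> bose x" using x by (intro sums_le[OF _ sums_zero bose_sums[OF x]]) auto
  have s: "(\<lambda>n. (x / (2 * pi\<^sup>2)) * (1 / (real n + 1)\<^sup>2)) sums ((x / (2 * pi\<^sup>2)) * (pi\<^sup>2 / 6))"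
    using sums_mult[OF inverse_squares_sums, of "x / (2 * pi\<^sup>2)"] by (simp add: add.commute)
  have "bose x \<le> (x / (2 * pi\<^sup>2)) * (pi\<^sup>2 / 6)"
  proof (rule sums_le[OF _ bose_sums[OF x] s])
    fix n
    have "2 * x / (x\<^sup>2 + (2 * pi * real (Suc n))\<^sup>2) \<le> 2 * x / (2 * pi * real (Suc n))\<^sup>2"
      using x by (intro divide_left_mono mult_pos_pos add_nonneg_pos) auto
    also have "\<dots> = (x / (2 * pi\<^sup>2)) * (1 / (real n + 1)\<^sup>2)"
      by (simp add: power2_eq_square add_ac)
    finally show "2 * x / (x\<^sup>2 + (2 * pi * real (Suc n))\<^sup>2) \<le> (x / (2 * pi\<^sup>2)) * (1 / (real n + 1)\<^sup>2)" .
  qed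
  also have "\<dots> \<le> x" using x by simp
  finally show "bose x \<le> x" .
qed

section \<open>Mellin integrals of the Bose function\<close>

lemma has_integral_subst_nonneg:
  fixes f g :: "real \<Rightarrow> real"
  assumes "S \<in> sets lebesgue" "\<And>x. x \<in> S \<Longrightarrow> (g has_field_derivative g' x) (at x within S)" "inj_on g S"
    and nn: "\<And>y. y \<in> g ` S \<Longrightarrow> 0 \<le> f y" and I: "(f has_integral I) (g ` S)"
  shows "((\<lambda>x. \<bar>g' x\<bar> * f (g x)) has_integral I) S"
proof -
  have "f absolutely_integrable_on g ` S"
    using nn I by (intro nonnegative_absolutely_integrable_1) auto
  then have "(\<lambda>x. \<bar>g' x\<bar> * f (g x)) absolutely_integrable_on S \<and> integral S (\<lambda>x. \<bar>g' x\<bar> * f (g x)) = I"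
    using has_absolute_integral_change_of_variables_1'[OF assms(1-3), of f I] I by (simp add: integral_unique)
  then show ?thesis
    using has_integral_iff set_lebesgue_integral_eq_integral(1) by blast
qed

lemma Gamma_integral_scaled:
  fixes s c :: real
  assumes "s > 0" "c > 0"
  shows "((\<lambda>x. x powr (s - 1) * exp (- (c * x))) has_integral (Gamma s * c powr (- s))) {0<..}"
proof -
  have img: "(\<lambda>x. c * x) ` {0<..} = {0<..}"
  proof (intro equalityI subsetI)
    fix y :: real assume "y \<in> {0<..}"
    then show "y \<in> (\<lambda>x. c * x) ` {0<..}" using assms by (intro image_eqI[of _ _ "y / c"]) auto
  qed (use assms in auto)
  have 0: "((\<lambda>t. t powr (s - 1) / exp t) has_integral Gamma s) {0<..}"
  proof -
    \<comment> \<open>The endpoint does no harm because \<open>0 powr a = 0\<close>.\<close>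
    have eq: "(\<lambda>x. if x \<in> {0<..} then x powr (s - 1) / exp x else 0) =
              (\<lambda>x. if x \<in> {0..} then x powr (s - 1) / exp x else 0)" by auto
    show ?thesis using Gamma_integral_real[OF assms(1)]
      by (subst has_integral_restrict_UNIV[symmetric], subst eq, subst has_integral_restrict_UNIV)
  qed
  have "((\<lambda>x. \<bar>c\<bar> * ((c * x) powr (s - 1) / exp (c * x))) has_integral Gamma s) {0<..}"
  proof (rule has_integral_subst_nonneg[where g = "\<lambda>x. c * x" and g' = "\<lambda>_. c"
        and f = "\<lambda>t. t powr (s - 1) / exp t" and S = "{0<..}"])
    show "((\<lambda>t. t powr (s - 1) / exp t) has_integral Gamma s) ((\<lambda>x. c * x) ` {0<..})"
      unfolding img by (rule 0)
  qed (use assms in \<open>auto intro!: derivative_eq_intros inj_onI\<close>)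
  then have "((\<lambda>x. c powr (- s) * (\<bar>c\<bar> * ((c * x) powr (s - 1) / exp (c * x)))) has_integral (c powr (- s) * Gamma s)) {0<..}"
    by (rule has_integral_mult_right)
  then show ?thesis
  proof (rule has_integral_eq_rhs[OF has_integral_eq, rotated])
    fix x :: real assume x: "x \<in> {0<..}"
    have "c powr (- s) * c * c powr (s - 1) = c powr (- s + 1 + (s - 1))"
      using assms by (simp only: powr_add powr_one)
    then have "c powr (- s) * c * c powr (s - 1) = 1" using assms by simp
    then show "c powr (- s) * (\<bar>c\<bar> * ((c * x) powr (s - 1) / exp (c * x))) = x powr (s - 1) * exp (- (c * x))"
      using assms x by (simp add: powr_mult exp_minus divide_inverse mult.assoc[symmetric])
  qed (simp add: mult.commute)
qed

lemma nn_integral_Gamma_scaled: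
  fixes s c :: real
  assumes "s > 0" "c > 0"
  shows "(\<integral>\<^sup>+x. ennreal (indicator {0<..} x * (x powr (s - 1) * exp (- (c * x)))) \<partial>lborel) = ennreal (Gamma s * c powr (- s))"
  using nn_integral_has_integral_lebesgue[OF _ Gamma_integral_scaled[OF assms]] by simp

lemma nn_integral_Gauss_moment:
  fixes s u :: real
  assumes "s > -1" "u > 0"
  shows "(\<integral>\<^sup>+x. ennreal (indicator {0<..} x * (2 * x powr s * exp (- (u * x\<^sup>2)))) \<partial>lborel) =
         ennreal (Gamma ((s + 1) / 2) * u powr (- ((s + 1) / 2)))"
proof -
  define a where "a = (s + 1) / 2"
  have a: "a > 0" "2 * a - 1 = s" using assms by (auto simp: a_def field_simps)
  have img: "(\<lambda>x. x\<^sup>2) ` {0<..} = ({0<..} :: real set)"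
  proof (intro equalityI subsetI)
    fix y :: real assume "y \<in> {0<..}"
    then show "y \<in> (\<lambda>x. x\<^sup>2) ` {0<..}" by (intro image_eqI[of _ _ "sqrt y"]) auto
  qed auto
  have "((\<lambda>x. \<bar>2 * x\<bar> * (x\<^sup>2 powr (a - 1) * exp (- (u * x\<^sup>2)))) has_integral Gamma a * u powr (- a)) {0<..}"
  proof (rule has_integral_subst_nonneg[where g = "\<lambda>x. x\<^sup>2" and g' = "\<lambda>x. 2 * x"
        and f = "\<lambda>x. x powr (a - 1) * exp (- (u * x))" and S = "{0<..}"])
    show "((\<lambda>x. x powr (a - 1) * exp (- (u * x))) has_integral Gamma a * u powr (- a)) ((\<lambda>x. x\<^sup>2) ` {0<..})"
      unfolding img by (rule Gamma_integral_scaled[OF a(1) assms(2)])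
  qed (auto intro!: derivative_eq_intros inj_onI simp: power2_eq_iff)
  then have "((\<lambda>x. 2 * x powr s * exp (- (u * x\<^sup>2))) has_integral Gamma a * u powr (- a)) {0<..}"
  proof (rule has_integral_eq[rotated])
    fix x :: real assume x: "x \<in> {0<..}"
    have "x\<^sup>2 = x powr 2" using x by (simp add: powr_numeral)
    then have "x\<^sup>2 powr (a - 1) = x powr (2 * (a - 1))" by (simp only: powr_powr)
    moreover have "x * x powr (2 * (a - 1)) = x powr s"
      using x powr_add[of x 1 "2 * (a - 1)"] a by (simp add: algebra_simps)
    ultimately show "\<bar>2 * x\<bar> * (x\<^sup>2 powr (a - 1) * exp (- (u * x\<^sup>2))) = 2 * x powr s * exp (- (u * x\<^sup>2))"
      using x by (simp add: mult.assoc[symmetric])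
  qed
  from nn_integral_has_integral_lebesgue[OF _ this] show ?thesis by (simp add: a_def)
qed

text \<open>Writing 1/(x^2 + c^2) as the integral of exp(-(x^2 + c^2) u) over u > 0 and exchanging
  the order leaves a Gaussian moment in x and a Gamma integral in u. Everything is nonnegative, so
  Tonelli suffices, and the two Gamma factors appear already in the shape of the functional
  equation.\<close>

lemma nn_integral_bose_term:
  fixes s c :: real
  assumes s: "-1 < s" "s < 0" and c: "c > 0"
  shows "(\<integral>\<^sup>+x. ennreal (indicator {0<..} x * (2 * x / (x\<^sup>2 + c\<^sup>2) * x powr (s - 1))) \<partial>lborel) =
         ennreal (Gamma ((1 + s) / 2) * Gamma ((1 - s) / 2) * c powr (s - 1))"
proof -
  have "(\<integral>\<^sup>+x. ennreal (indicator {0<..} x * (2 * x / (x\<^sup>2 + c\<^sup>2) * x powr (s - 1))) \<partial>lborel) =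
    (\<integral>\<^sup>+x. \<integral>\<^sup>+u. ennreal (indicator {0<..} x * (2 * x powr s)) *
        ennreal (indicator {0<..} u * (u powr (1 - 1) * exp (- ((x\<^sup>2 + c\<^sup>2) * u)))) \<partial>lborel \<partial>lborel)"
  proof (rule nn_integral_cong)
    fix x :: real
    have p: "x\<^sup>2 + c\<^sup>2 > 0" using c by (simp add: add_nonneg_pos)
    have "(\<integral>\<^sup>+u. ennreal (indicator {0<..} x * (2 * x powr s)) *
        ennreal (indicator {0<..} u * (u powr (1 - 1) * exp (- ((x\<^sup>2 + c\<^sup>2) * u)))) \<partial>lborel) =
       ennreal (indicator {0<..} x * (2 * x powr s)) * ennreal (Gamma 1 * (x\<^sup>2 + c\<^sup>2) powr (- 1))"
      by (subst nn_integral_cmult) (use nn_integral_Gamma_scaled[OF zero_less_one p] in \<open>auto\<close>)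
    also have "\<dots> = ennreal (indicator {0<..} x * (2 * x powr s) * (Gamma 1 * (x\<^sup>2 + c\<^sup>2) powr (- 1)))"
      by (subst ennreal_mult[symmetric]) (auto simp: indicator_def)
    also have "indicator {0<..} x * (2 * x powr s) * (Gamma 1 * (x\<^sup>2 + c\<^sup>2) powr (- 1)) =
       indicator {0<..} x * (2 * x / (x\<^sup>2 + c\<^sup>2) * x powr (s - 1))"
    proof (cases "x > 0")
      case True
      have "x powr s = x * x powr (s - 1)" using True powr_add[of x 1 "s - 1"] by simp
      then show ?thesis using True p by (simp add: powr_minus divide_inverse)
    qed auto
    finally show "ennreal (indicator {0<..} x * (2 * x / (x\<^sup>2 + c\<^sup>2) * x powr (s - 1))) =
      (\<integral>\<^sup>+u. ennreal (indicator {0<..} x * (2 * x powr s)) *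
        ennreal (indicator {0<..} u * (u powr (1 - 1) * exp (- ((x\<^sup>2 + c\<^sup>2) * u)))) \<partial>lborel)" ..
  qed
  also have "\<dots> = (\<integral>\<^sup>+u. \<integral>\<^sup>+x. ennreal (indicator {0<..} x * (2 * x powr s)) *
        ennreal (indicator {0<..} u * (u powr (1 - 1) * exp (- ((x\<^sup>2 + c\<^sup>2) * u)))) \<partial>lborel \<partial>lborel)"
    by (rule lborel_pair.Fubini') measurable
  also have "\<dots> = (\<integral>\<^sup>+u. ennreal (Gamma ((s + 1) / 2)) *
      ennreal (indicator {0<..} u * (u powr ((1 - s) / 2 - 1) * exp (- (c\<^sup>2 * u)))) \<partial>lborel)"
  proof (rule nn_integral_cong)
    fix u :: real
    show "(\<integral>\<^sup>+x. ennreal (indicator {0<..} x * (2 * x powr s)) *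
        ennreal (indicator {0<..} u * (u powr (1 - 1) * exp (- ((x\<^sup>2 + c\<^sup>2) * u)))) \<partial>lborel) =
      ennreal (Gamma ((s + 1) / 2)) * ennreal (indicator {0<..} u * (u powr ((1 - s) / 2 - 1) * exp (- (c\<^sup>2 * u))))"
    proof (cases "u > 0")
      case u: True
      have "(\<integral>\<^sup>+x. ennreal (indicator {0<..} x * (2 * x powr s)) *
        ennreal (indicator {0<..} u * (u powr (1 - 1) * exp (- ((x\<^sup>2 + c\<^sup>2) * u)))) \<partial>lborel) =
        (\<integral>\<^sup>+x. ennreal (exp (- (c\<^sup>2 * u))) * ennreal (indicator {0<..} x * (2 * x powr s * exp (- (u * x\<^sup>2)))) \<partial>lborel)"
        using u by (intro nn_integral_cong, subst (1 2) ennreal_mult[symmetric])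
          (auto simp: algebra_simps indicator_def simp flip: exp_add)
      also have "\<dots> = ennreal (exp (- (c\<^sup>2 * u))) * ennreal (Gamma ((s + 1) / 2) * u powr (- ((s + 1) / 2)))"
        by (subst nn_integral_cmult) (use nn_integral_Gauss_moment[OF s(1) u] in auto)
      also have "\<dots> = ennreal (Gamma ((s + 1) / 2)) * ennreal (u powr ((1 - s) / 2 - 1) * exp (- (c\<^sup>2 * u)))"
      proof -
        have "- ((s + 1) / 2) = (1 - s) / 2 - 1" by (simp add: field_simps)
        moreover have "Gamma ((s + 1) / 2) \<ge> 0" using s by (intro Gamma_real_nonneg) auto
        ultimately show ?thesis by (simp add: ennreal_mult' mult_ac)
      qed
      finally show ?thesis using u by simp
    qed auto
  qed
  also have "\<dots> = ennreal (Gamma ((s + 1) / 2)) * ennreal (Gamma ((1 - s) / 2) * (c\<^sup>2) powr (- ((1 - s) / 2)))"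
    using s c by (subst nn_integral_cmult) (auto simp: nn_integral_Gamma_scaled)
  also have "(c\<^sup>2) powr (- ((1 - s) / 2)) = c powr (s - 1)"
  proof -
    have "(c\<^sup>2) powr (- ((1 - s) / 2)) = (c powr 2) powr (- ((1 - s) / 2))" using c by (simp add: powr_numeral)
    also have "\<dots> = c powr (2 * (- ((1 - s) / 2)))" by (rule powr_powr)
    also have "2 * (- ((1 - s) / 2)) = s - 1" by (simp add: field_simps)
    finally show ?thesis .
  qed
  also have "ennreal (Gamma ((s + 1) / 2)) * ennreal (Gamma ((1 - s) / 2) * c powr (s - 1)) =
     ennreal (Gamma ((1 + s) / 2) * Gamma ((1 - s) / 2) * c powr (s - 1))"
    using s by (subst ennreal_mult[symmetric]) (auto intro!: Gamma_real_nonneg mult_nonneg_nonneg simp: add_ac mult_ac)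
  finally show ?thesis .
qed

lemma sums_zeta_real:
  fixes s :: real
  assumes "s > 1"
  shows "(\<lambda>n. real (Suc n) powr (- s)) sums Re (zeta (of_real s))" "Im (zeta (of_real s)) = 0"
proof -
  have "is_zeta zeta" by (simp add: zeta_characterization)
  then have "zeta (of_real s) = (\<Sum>n. of_nat (Suc n) powr (- of_real s))"
    using assms unfolding is_zeta_def by auto
  then have "(\<lambda>n. of_nat (Suc n) powr (- of_real s) :: complex) sums zeta (of_real s)"
    using summable_zeta_series[of "of_real s"] assms by (simp add: summable_sums)
  moreover have "of_nat (Suc n) powr (- complex_of_real s) = of_real (real (Suc n) powr (- s))" for n
    by (metis of_real_minus of_real_of_nat_eq powr_of_real of_nat_0_le_iff)
  ultimately have sm: "(\<lambda>n. complex_of_real (real (Suc n) powr (- s))) sums zeta (of_real s)" by simp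
  show "(\<lambda>n. real (Suc n) powr (- s)) sums Re (zeta (of_real s))" using sums_Re[OF sm] by simp
  have "(\<lambda>n. 0) sums Im (zeta (of_real s))" using sums_Im[OF sm] by simp
  then show "Im (zeta (of_real s)) = 0" using sums_unique2 sums_zero by blast
qed

lemma zeta_of_real: "s > 1 \<Longrightarrow> zeta (of_real s) = of_real (Re (zeta (of_real s)))"
  using sums_zeta_real(2)[of s] by (simp add: complex_eq_iff)

text \<open>Monotone convergence in \<open>ennreal\<close>; the finite total \<open>C\<close> then
  gives integrability of the sum function.\<close>

lemma nn_integral_suminf_const:
  fixes f :: "nat \<Rightarrow> real \<Rightarrow> real"
  assumes m: "\<And>n. f n \<in> borel_measurable lborel" and nn: "\<And>n x. 0 \<le> f n x"
    and s: "\<And>x. (\<lambda>n. f n x) sums g x"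
    and i: "\<And>n. (\<integral>\<^sup>+x. ennreal (f n x) \<partial>lborel) = ennreal (c n)" and c: "\<And>n. 0 \<le> c n" "c sums C"
  shows "has_bochner_integral lborel g C"
proof (rule has_bochner_integral_nn_integral)
  have "(\<lambda>x. suminf (\<lambda>n. f n x)) \<in> borel_measurable lborel" using m by measurable
  also have "(\<lambda>x. suminf (\<lambda>n. f n x)) = g" using sums_unique[OF s] by auto
  finally show "g \<in> borel_measurable lborel" .
  show "AE x in lborel. 0 \<le> g x" using sums_le[OF _ sums_zero s] nn by auto
  show "0 \<le> C" using sums_le[OF _ sums_zero c(2)] c(1) by auto
  have "(\<integral>\<^sup>+x. ennreal (g x) \<partial>lborel) = (\<integral>\<^sup>+x. (\<Sum>n. ennreal (f n x)) \<partial>lborel)"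
    using nn s by (intro nn_integral_cong) (simp add: suminf_ennreal2 sums_iff)
  also have "\<dots> = (\<Sum>n. ennreal (c n))" using m by (subst nn_integral_suminf) (auto simp: i)
  also have "\<dots> = ennreal C" using c by (simp add: suminf_ennreal2 sums_iff)
  finally show "(\<integral>\<^sup>+x. ennreal (g x) \<partial>lborel) = ennreal C" .
qed

lemma has_bochner_integral_bose_gt_1:
  assumes s: "s > 1"
  shows "has_bochner_integral lborel (\<lambda>x. indicator {0<..} x * (x powr (s - 1) / (exp x - 1)))
           (Gamma s * Re (zeta (of_real s)))"
proof (rule nn_integral_suminf_const)
  show "(\<lambda>x. indicator {0<..} x * (x powr (s - 1) * exp (- (real (Suc n) * x)))) \<in> borel_measurable lborel" for n
    by measurable
  show "(\<lambda>n. indicator {0<..} x * (x powr (s - 1) * exp (- (real (Suc n) * x)))) sums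
      (indicator {0<..} x * (x powr (s - 1) / (exp x - 1)))" for x :: real
  proof (cases "x > 0")
    case True
    have "(\<lambda>n. exp (- x) ^ n) sums (1 / (1 - exp (- x)))" using True by (intro geometric_sums) auto
    then have "(\<lambda>n. (x powr (s - 1) * exp (- x)) * exp (- x) ^ n) sums ((x powr (s - 1) * exp (- x)) * (1 / (1 - exp (- x))))"
      by (rule sums_mult)
    also have "(\<lambda>n. (x powr (s - 1) * exp (- x)) * exp (- x) ^ n) = (\<lambda>n. x powr (s - 1) * exp (- (real (Suc n) * x)))"
      by (auto simp: algebra_simps simp flip: exp_of_nat_mult exp_add)
    also have "(x powr (s - 1) * exp (- x)) * (1 / (1 - exp (- x))) = x powr (s - 1) / (exp x - 1)"
      using True by (simp add: exp_minus field_simps)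
    finally show ?thesis using True by simp
  qed simp
  show "(\<integral>\<^sup>+x. ennreal (indicator {0<..} x * (x powr (s - 1) * exp (- (real (Suc n) * x)))) \<partial>lborel) =
     ennreal (Gamma s * real (Suc n) powr (- s))" for n
    using s by (intro nn_integral_Gamma_scaled) auto
  show "(\<lambda>n. Gamma s * real (Suc n) powr (- s)) sums (Gamma s * Re (zeta (of_real s)))"
    using s by (intro sums_mult sums_zeta_real)
qed (use s in \<open>auto intro!: Gamma_real_nonneg mult_nonneg_nonneg\<close>)

text \<open>This is where s turns into 1 - s: the frequencies 2 pi n of the partial fractions
  contribute n^(s-1), which sums to zeta(1 - s).\<close>

lemma has_bochner_integral_bose_neg:
  assumes s: "-1 < s" "s < 0"
  shows "has_bochner_integral lborel (\<lambda>x. indicator {0<..} x * (bose x * x powr (s - 1)))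
           ((2 * pi) powr (s - 1) * Gamma ((1 + s) / 2) * Gamma ((1 - s) / 2) * Re (zeta (of_real (1 - s))))"
proof (rule nn_integral_suminf_const)
  show "(\<lambda>x. indicator {0<..} x * (2 * x / (x\<^sup>2 + (2 * pi * real (Suc n))\<^sup>2) * x powr (s - 1))) \<in> borel_measurable lborel" for n
    by measurable
  show "(\<lambda>n. indicator {0<..} x * (2 * x / (x\<^sup>2 + (2 * pi * real (Suc n))\<^sup>2) * x powr (s - 1))) sums
      (indicator {0<..} x * (bose x * x powr (s - 1)))" for x :: real
  proof (cases "x > 0")
    case True
    then show ?thesis using sums_mult2[OF bose_sums[OF True], of "x powr (s - 1)"] by simp
  qed simp
  show "0 \<le> indicator {0<..} x * (2 * x / (x\<^sup>2 + (2 * pi * real (Suc n))\<^sup>2) * x powr (s - 1))" for n and x :: real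
    by (cases "x > 0") auto
  show "(\<integral>\<^sup>+x. ennreal (indicator {0<..} x * (2 * x / (x\<^sup>2 + (2 * pi * real (Suc n))\<^sup>2) * x powr (s - 1))) \<partial>lborel) =
     ennreal (Gamma ((1 + s) / 2) * Gamma ((1 - s) / 2) * (2 * pi * real (Suc n)) powr (s - 1))" for n
    by (intro nn_integral_bose_term s) auto
  have "(\<lambda>n. ((2 * pi) powr (s - 1) * Gamma ((1 + s) / 2) * Gamma ((1 - s) / 2)) * real (Suc n) powr (- (1 - s))) sums
     ((2 * pi) powr (s - 1) * Gamma ((1 + s) / 2) * Gamma ((1 - s) / 2) * Re (zeta (of_real (1 - s))))"
    using s by (intro sums_mult sums_zeta_real) auto
  then show "(\<lambda>n. Gamma ((1 + s) / 2) * Gamma ((1 - s) / 2) * (2 * pi * real (Suc n)) powr (s - 1)) sums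
     ((2 * pi) powr (s - 1) * Gamma ((1 + s) / 2) * Gamma ((1 - s) / 2) * Re (zeta (of_real (1 - s))))"
    by (simp add: powr_mult mult_ac del: of_nat_Suc)
qed (use s in \<open>auto intro!: Gamma_real_nonneg mult_nonneg_nonneg\<close>)

lemma is_zeta_zeta: "is_zeta zeta"
  by (simp add: zeta_characterization)

lemma zeta_holomorphic: "zeta holomorphic_on - {1}"
  using is_zeta_zeta by (simp add: is_zeta_def)

lemma zeta_eq_series: "Re s > 1 \<Longrightarrow> zeta s = zeta_series s"
  using is_zeta_zeta by (simp add: is_zeta_def zeta_series_def)

text \<open>Near an abscissa sigma the kernel is dominated by x^(sigma-r-1) + x^(sigma+r-1): the
  first power serves x < 1, the second x >= 1, and both are integrable against \<open>w\<close> by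
  assumption.\<close>

lemma Mellin_holomorphic:
  fixes w :: "real \<Rightarrow> real"
  assumes w: "w \<in> borel_measurable lborel" "\<And>x. x \<le> 0 \<Longrightarrow> w x = 0"
    and int: "\<And>\<sigma>. a < \<sigma> \<Longrightarrow> \<sigma> < b \<Longrightarrow> integrable lborel (\<lambda>x. \<bar>w x\<bar> * x powr (\<sigma> - 1))"
  shows "(\<lambda>s. \<integral>x. of_real (w x) * exp ((s - 1) * of_real (ln x)) \<partial>lborel) holomorphic_on {s. a < Re s \<and> Re s < b}"
proof -
  define S where "S = {s. a < Re s \<and> Re s < b}"
  have S: "open S"
  proof -
    have "S = {z. a < Re z} \<inter> {z. Re z < b}" by (auto simp: S_def)
    then show ?thesis by (auto intro!: open_Int open_halfspace_Re_gt open_halfspace_Re_lt)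
  qed
  have meas: "(\<lambda>x. of_real (w x) * exp ((s - 1) * of_real (ln x)) :: complex) \<in> borel_measurable lborel" for s
  proof -
    have "(\<lambda>x. exp ((s - 1) * of_real (ln x)) :: complex) \<in> borel_measurable lborel" by measurable
    then show ?thesis using w(1) by measurable
  qed
  have "((\<lambda>s. \<integral>x. of_real (w x) * exp ((s - 1) * of_real (ln x)) \<partial>lborel) has_field_derivative
       (\<integral>x. deriv (\<lambda>s. of_real (w x) * exp ((s - 1) * of_real (ln x))) s0 \<partial>lborel)) (at s0)" if s0: "s0 \<in> S" for s0
  proof (rule holomorphic_on_lebesgue_integral[OF S _ meas _ s0])
    fix z0 assume z0: "z0 \<in> S"
    define r where "r = min (Re z0 - a) (b - Re z0) / 2"
    have r: "r > 0" "a < Re z0 - r" "Re z0 + r < b" using z0 by (auto simp: S_def r_def min_def field_simps)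
    define g where "g = (\<lambda>x. \<bar>w x\<bar> * x powr (Re z0 - r - 1) + \<bar>w x\<bar> * x powr (Re z0 + r - 1))"
    have "integrable lborel g" unfolding g_def using r by (intro Bochner_Integration.integrable_add int) auto
    moreover have "norm (of_real (w x) * exp ((z - 1) * of_real (ln x)) :: complex) \<le> g x" if z: "dist z0 z \<le> r" for x z
    proof (cases "x > 0")
      case True
      have "\<bar>Re z0 - Re z\<bar> \<le> r" using z abs_Re_le_cmod[of "z0 - z"] by (simp add: dist_norm)
      then have le: "Re z0 - r - 1 \<le> Re z - 1" "Re z - 1 \<le> Re z0 + r - 1" by auto
      have "x powr (Re z - 1) \<le> x powr (Re z0 - r - 1) + x powr (Re z0 + r - 1)"
      proof (cases "x \<ge> 1")
        case x1: True
        then have "x powr (Re z - 1) \<le> x powr (Re z0 + r - 1)" using le by (intro powr_mono) auto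
        then show ?thesis using powr_ge_zero[of x "Re z0 - r - 1"] by linarith
      next
        case x1: False
        then have "x powr (Re z - 1) \<le> x powr (Re z0 - r - 1)" using le True by (intro powr_mono') auto
        then show ?thesis using powr_ge_zero[of x "Re z0 + r - 1"] by linarith
      qed
      moreover have "norm (exp ((z - 1) * of_real (ln x)) :: complex) = x powr (Re z - 1)"
        using True by (simp add: norm_exp_eq_Re powr_def)
      ultimately show ?thesis unfolding g_def norm_mult distrib_left[symmetric]
        by (intro mult_mono) auto
    qed (simp add: w(2) g_def)
    ultimately show "\<exists>r>0. \<exists>g. integrable lborel g \<and> (\<forall>x\<in>space lborel. \<forall>z\<in>S. dist z0 z \<le> r \<longrightarrow>
        norm (of_real (w x) * exp ((z - 1) * of_real (ln x)) :: complex) \<le> g x)" using r(1) by blast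
  qed (auto intro!: holomorphic_intros)
  then show ?thesis unfolding S_def[symmetric] by (meson S holomorphic_on_open)
qed

lemma has_bochner_integral_nonneg_has_integral:
  fixes f :: "real \<Rightarrow> real"
  assumes "f \<in> borel_measurable borel" "S \<in> sets borel" "\<And>x. x \<in> S \<Longrightarrow> 0 \<le> f x" "(f has_integral I) S"
  shows "has_bochner_integral lborel (\<lambda>x. indicator S x * f x) I"
proof (rule has_bochner_integral_nn_integral)
  show "(\<integral>\<^sup>+x. ennreal (indicator S x * f x) \<partial>lborel) = ennreal I"
    using nn_integral_has_integral_lebesgue[OF assms(3,4)] by simp
  show "0 \<le> I" using assms(3,4) by (rule has_integral_nonneg[rotated])
  show "(\<lambda>x. indicator S x * f x) \<in> borel_measurable lborel"
    using assms(1,2) by simp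
  show "AE x in lborel. 0 \<le> indicator S x * f x" using assms(3) by (auto simp: indicator_def)
qed

lemma has_bochner_integral_powr_0_1:
  fixes a :: real
  shows "a > -1 \<Longrightarrow> has_bochner_integral lborel (\<lambda>x. indicator {0<..<1} x * x powr a) (1 / (a + 1))"
  using has_integral_powr_from_0[of a 1]
  by (intro has_bochner_integral_nonneg_has_integral) (auto simp: has_integral_Icc_iff_Ioo)

lemma has_bochner_integral_powr_1_inf:
  fixes a :: real
  shows "a < -1 \<Longrightarrow> has_bochner_integral lborel (\<lambda>x. indicator {1..} x * x powr a) (- 1 / (a + 1))"
  using has_integral_powr_to_inf[of a 1]
  by (intro has_bochner_integral_nonneg_has_integral) auto

lemma bose_measurable [measurable]: "bose \<in> borel_measurable borel"
  unfolding bose_def by measurable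

lemma integrable_bose_0_1:
  fixes \<sigma> :: real
  assumes "\<sigma> > -1"
  shows "integrable lborel (\<lambda>x. indicator {0<..<1} x * bose x * x powr (\<sigma> - 1))"
proof (rule Bochner_Integration.integrable_bound)
  show "integrable lborel (\<lambda>x. indicator {0<..<1} x * x powr \<sigma>)"
    using has_bochner_integral_powr_0_1[OF assms] by (simp add: has_bochner_integral_iff)
  show "AE x in lborel. norm (indicator {0<..<1} x * bose x * x powr (\<sigma> - 1)) \<le> norm (indicator {0<..<1} x * x powr \<sigma>)"
  proof (rule AE_I2)
    fix x :: real
    show "norm (indicator {0<..<1} x * bose x * x powr (\<sigma> - 1)) \<le> norm (indicator {0<..<1} x * x powr \<sigma>)"
    proof (cases "x > 0")
      case True
      have "bose x * x powr (\<sigma> - 1) \<le> x * x powr (\<sigma> - 1)" using bose_bounds[OF True] by (intro mult_right_mono) auto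
      also have "\<dots> = x powr \<sigma>" using True powr_add[of x 1 "\<sigma> - 1"] by simp
      finally show ?thesis using bose_bounds[OF True] by (auto simp: indicator_def abs_mult)
    qed auto
  qed
qed measurable

lemma integrable_bose_1_inf:
  fixes \<sigma> :: real
  shows
  "integrable lborel (\<lambda>x. indicator {1..} x / (exp x - 1) * x powr (\<sigma> - 1))"
proof (rule Bochner_Integration.integrable_bound)
  \<comment> \<open>For x >= 1 a larger exponent only enlarges the power, and with exponent at least
    1 the majorant is a convergent Gamma integral.\<close>
  define m where "m = max \<sigma> 1"
  have "has_bochner_integral lborel (\<lambda>x. indicator {0<..} x * (x powr (m - 1) * exp (- (1 * x)))) (Gamma m * 1 powr (- m))"
    by (intro has_bochner_integral_nonneg_has_integral Gamma_integral_scaled) (auto simp: m_def)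
  then show "integrable lborel (\<lambda>x. 2 * (indicator {0<..} x * (x powr (m - 1) * exp (- (1 * x)))))"
    by (intro integrable_mult_right) (simp add: has_bochner_integral_iff)
  show "AE x in lborel. norm (indicator {1..} x / (exp x - 1) * x powr (\<sigma> - 1)) \<le>
     norm (2 * (indicator {0<..} x * (x powr (m - 1) * exp (- (1 * x)))))"
  proof (rule AE_I2)
    fix x :: real
    show "norm (indicator {1..} x / (exp x - 1) * x powr (\<sigma> - 1)) \<le>
     norm (2 * (indicator {0<..} x * (x powr (m - 1) * exp (- (1 * x)))))"
    proof (cases "x \<ge> 1")
      case True
      have "exp x \<ge> 2" using True exp_ge_add_one_self[of x] by linarith
      moreover have "1 / (e - 1) \<le> 2 / e" if "e \<ge> 2" for e :: real using that by (simp add: field_simps)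
      ultimately have "1 / (exp x - 1) \<le> 2 / exp x" by blast
      moreover have "x powr (\<sigma> - 1) \<le> x powr (m - 1)" using True by (intro powr_mono) (auto simp: m_def)
      ultimately have "1 / (exp x - 1) * x powr (\<sigma> - 1) \<le> 2 / exp x * x powr (m - 1)"
        by (intro mult_mono) auto
      then show ?thesis using True \<open>exp x \<ge> 2\<close> by (simp add: exp_minus divide_inverse abs_mult mult_ac)
    qed auto
  qed
qed measurable

text \<open>The continuation of Gamma(s) zeta(s) to \<open>Re s > -1\<close>. For s > 1 the rational
  terms are the integrals over (0,1) of the parts x^(s-2) and - x^(s-1)/2 that \<open>bose\<close>
  removes; for -1 < s < 0 the same terms are the integrals over [1, infinity) of the opposite
  parts.\<close>

definition bose_mellin :: "complex \<Rightarrow> complex" where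
  "bose_mellin s = (\<integral>x. of_real (indicator {0<..<1} x * bose x) * exp ((s - 1) * of_real (ln x)) \<partial>lborel) +
     (\<integral>x. of_real (indicator {1..} x / (exp x - 1)) * exp ((s - 1) * of_real (ln x)) \<partial>lborel) +
     1 / (s - 1) - 1 / (2 * s)"

lemma bose_mellin_holomorphic: "bose_mellin holomorphic_on {s. -1 < Re s} - {0, 1}"
proof -
  have 1: "(\<lambda>s. \<integral>x. of_real (indicator {0<..<1} x * bose x) * exp ((s - 1) * of_real (ln x)) \<partial>lborel)
      holomorphic_on {s. -1 < Re s \<and> Re s < b}" for b
  proof (rule Mellin_holomorphic)
    fix \<sigma> :: real assume "-1 < \<sigma>"
    from integrable_bose_0_1[OF this]
    have "integrable lborel (\<lambda>x. \<bar>indicator {0<..<1} x * bose x * x powr (\<sigma> - 1)\<bar>)" by simp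
    then show "integrable lborel (\<lambda>x. \<bar>indicator {0<..<1} x * bose x\<bar> * x powr (\<sigma> - 1))"
      by (simp add: abs_mult)
  qed (auto simp: indicator_def)
  have 2: "(\<lambda>s. \<integral>x. of_real (indicator {1..} x / (exp x - 1)) * exp ((s - 1) * of_real (ln x)) \<partial>lborel)
      holomorphic_on {s. -1 < Re s \<and> Re s < b}" for b
  proof (rule Mellin_holomorphic)
    fix \<sigma> :: real
    from integrable_bose_1_inf[of \<sigma>]
    have "integrable lborel (\<lambda>x. \<bar>indicator {1..} x / (exp x - 1) * x powr (\<sigma> - 1)\<bar>)" by (rule integrable_abs)
    then show "integrable lborel (\<lambda>x. \<bar>indicator {1..} x / (exp x - 1)\<bar> * x powr (\<sigma> - 1))"
      by (simp add: abs_mult)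
  qed (auto simp: indicator_def)
  \<comment> \<open>\<open>Mellin_holomorphic\<close> works in strips of finite width; the
    half-plane is exhausted by varying \<open>b\<close>.\<close>
  have "bose_mellin holomorphic_on ({s. -1 < Re s \<and> Re s < b} - {0, 1})" for b
    unfolding bose_mellin_def
    by (intro holomorphic_intros holomorphic_on_subset[OF 1[of b]] holomorphic_on_subset[OF 2[of b]]) auto
  moreover have op: "open ({s. -1 < Re s \<and> Re s < b} - {0, 1})" for b
  proof -
    have "{s. -1 < Re s \<and> Re s < b} = {z. -1 < Re z} \<inter> {z. Re z < b}" by auto
    then show ?thesis by (auto intro!: open_Diff open_Int open_halfspace_Re_gt open_halfspace_Re_lt finite_imp_closed)
  qed
  ultimately have "bose_mellin field_differentiable (at s)" if "-1 < Re s" "s \<noteq> 0" "s \<noteq> 1" for s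
    by (rule holomorphic_on_imp_differentiable_at[of _ "{z. -1 < Re z \<and> Re z < Re s + 1} - {0, 1}"]) (use that in auto)
  then show ?thesis unfolding holomorphic_on_def by (auto intro: field_differentiable_at_within)
qed

lemma bose_mellin_real:
  assumes "s > -1"
  shows "bose_mellin (of_real s) = of_real ((\<integral>x. indicator {0<..<1} x * bose x * x powr (s - 1) \<partial>lborel) +
     (\<integral>x. indicator {1..} x / (exp x - 1) * x powr (s - 1) \<partial>lborel) + 1 / (s - 1) - 1 / (2 * s))"
proof -
  have "complex_of_real (indicator {0<..<1} x * bose x) * exp ((of_real s - 1) * of_real (ln x)) =
      of_real (indicator {0<..<1} x * bose x * x powr (s - 1))" for x
    by (cases "x > 0") (auto simp: powr_def exp_of_real[symmetric])
  moreover have "complex_of_real (indicator {1..} x / (exp x - 1)) * exp ((of_real s - 1) * of_real (ln x)) =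
      of_real (indicator {1..} x / (exp x - 1) * x powr (s - 1))" for x
    by (cases "x \<ge> 1") (auto simp: powr_def exp_of_real[symmetric])
  ultimately show ?thesis unfolding bose_mellin_def by (simp only: integral_complex_of_real) simp
qed

lemma bose_mellin_gt_1:
  assumes s: "s > 1"
  shows "bose_mellin (of_real s) = Gamma (of_real s) * zeta (of_real s)"
proof -
  have 1: "has_bochner_integral lborel (\<lambda>x. indicator {0<..<1} x * bose x * x powr (s - 1))
     (\<integral>x. indicator {0<..<1} x * bose x * x powr (s - 1) \<partial>lborel)"
    using integrable_bose_0_1[of s] s by (intro has_bochner_integral_integrable) auto
  have 2: "has_bochner_integral lborel (\<lambda>x. indicator {1..} x / (exp x - 1) * x powr (s - 1))
     (\<integral>x. indicator {1..} x / (exp x - 1) * x powr (s - 1) \<partial>lborel)"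
    using integrable_bose_1_inf[of s] by (intro has_bochner_integral_integrable) auto
  have 3: "has_bochner_integral lborel (\<lambda>x. indicator {0<..<1} x * x powr (s - 2)) (1 / (s - 2 + 1))"
    "has_bochner_integral lborel (\<lambda>x. indicator {0<..<1} x * x powr (s - 1)) (1 / (s - 1 + 1))"
    using s by (intro has_bochner_integral_powr_0_1; simp)+
  have 4: "has_bochner_integral lborel (\<lambda>x. indicator {0<..<1} x * bose x * x powr (s - 1) +
     indicator {1..} x / (exp x - 1) * x powr (s - 1) + indicator {0<..<1} x * x powr (s - 2) -
     (indicator {0<..<1} x * x powr (s - 1)) / 2) ((\<integral>x. indicator {0<..<1} x * bose x * x powr (s - 1) \<partial>lborel) +
     (\<integral>x. indicator {1..} x / (exp x - 1) * x powr (s - 1) \<partial>lborel) + 1 / (s - 2 + 1) - (1 / (s - 1 + 1)) / 2)"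
    by (intro has_bochner_integral_add has_bochner_integral_diff has_bochner_integral_divide_zero 1 2 3)
  also have "(\<lambda>x. indicator {0<..<1} x * bose x * x powr (s - 1) +
     indicator {1..} x / (exp x - 1) * x powr (s - 1) + indicator {0<..<1} x * x powr (s - 2) -
     (indicator {0<..<1} x * x powr (s - 1)) / 2) = (\<lambda>x. indicator {0<..} x * (x powr (s - 1) / (exp x - 1)))"
  proof
    fix x :: real
    have "x powr (s - 1) / x = x powr (s - 2)" if "x > 0"
      using that powr_diff[of x "s - 1" 1] by simp
    then show "indicator {0<..<1} x * bose x * x powr (s - 1) +
     indicator {1..} x / (exp x - 1) * x powr (s - 1) + indicator {0<..<1} x * x powr (s - 2) -
     (indicator {0<..<1} x * x powr (s - 1)) / 2 = indicator {0<..} x * (x powr (s - 1) / (exp x - 1))"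
      by (cases "x > 0"; cases "x \<ge> 1") (auto simp: bose_def algebra_simps)
  qed
  finally have "(\<integral>x. indicator {0<..<1} x * bose x * x powr (s - 1) \<partial>lborel) +
     (\<integral>x. indicator {1..} x / (exp x - 1) * x powr (s - 1) \<partial>lborel) + 1 / (s - 2 + 1) - (1 / (s - 1 + 1)) / 2 =
     Gamma s * Re (zeta (of_real s))"
    using has_bochner_integral_eq has_bochner_integral_bose_gt_1[OF s] by blast
  then have "bose_mellin (of_real s) = of_real (Gamma s * Re (zeta (of_real s)))"
    using s by (subst bose_mellin_real) (auto simp: algebra_simps)
  then show ?thesis using zeta_of_real[OF s] by (simp add: Gamma_complex_of_real)
qed

lemma bose_mellin_neg:
  assumes s: "-1 < s" "s < 0"
  shows "bose_mellin (of_real s) = of_real ((2 * pi) powr (s - 1) * Gamma ((1 + s) / 2) * Gamma ((1 - s) / 2)) * zeta (of_real (1 - s))"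
proof -
  have 1: "has_bochner_integral lborel (\<lambda>x. indicator {0<..<1} x * bose x * x powr (s - 1))
     (\<integral>x. indicator {0<..<1} x * bose x * x powr (s - 1) \<partial>lborel)"
    using integrable_bose_0_1[of s] s by (intro has_bochner_integral_integrable) auto
  have 2: "has_bochner_integral lborel (\<lambda>x. indicator {1..} x / (exp x - 1) * x powr (s - 1))
     (\<integral>x. indicator {1..} x / (exp x - 1) * x powr (s - 1) \<partial>lborel)"
    using integrable_bose_1_inf[of s] by (intro has_bochner_integral_integrable) auto
  have 3: "has_bochner_integral lborel (\<lambda>x. indicator {1..} x * x powr (s - 2)) (- 1 / (s - 2 + 1))"
    "has_bochner_integral lborel (\<lambda>x. indicator {1..} x * x powr (s - 1)) (- 1 / (s - 1 + 1))"
    using s by (intro has_bochner_integral_powr_1_inf; simp)+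
  have 4: "has_bochner_integral lborel (\<lambda>x. indicator {0<..<1} x * bose x * x powr (s - 1) +
     indicator {1..} x / (exp x - 1) * x powr (s - 1) - indicator {1..} x * x powr (s - 2) +
     (indicator {1..} x * x powr (s - 1)) / 2) ((\<integral>x. indicator {0<..<1} x * bose x * x powr (s - 1) \<partial>lborel) +
     (\<integral>x. indicator {1..} x / (exp x - 1) * x powr (s - 1) \<partial>lborel) - (- 1 / (s - 2 + 1)) + (- 1 / (s - 1 + 1)) / 2)"
    by (intro has_bochner_integral_add has_bochner_integral_diff has_bochner_integral_divide_zero 1 2 3)
  also have "(\<lambda>x. indicator {0<..<1} x * bose x * x powr (s - 1) +
     indicator {1..} x / (exp x - 1) * x powr (s - 1) - indicator {1..} x * x powr (s - 2) +
     (indicator {1..} x * x powr (s - 1)) / 2) = (\<lambda>x. indicator {0<..} x * (bose x * x powr (s - 1)))"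
  proof
    fix x :: real
    have "x powr (s - 1) / x = x powr (s - 2)" if "x > 0"
      using that powr_diff[of x "s - 1" 1] by simp
    then show "indicator {0<..<1} x * bose x * x powr (s - 1) +
     indicator {1..} x / (exp x - 1) * x powr (s - 1) - indicator {1..} x * x powr (s - 2) +
     (indicator {1..} x * x powr (s - 1)) / 2 = indicator {0<..} x * (bose x * x powr (s - 1))"
      by (cases "x > 0"; cases "x \<ge> 1") (auto simp: bose_def algebra_simps)
  qed
  finally have "(\<integral>x. indicator {0<..<1} x * bose x * x powr (s - 1) \<partial>lborel) +
     (\<integral>x. indicator {1..} x / (exp x - 1) * x powr (s - 1) \<partial>lborel) - (- 1 / (s - 2 + 1)) + (- 1 / (s - 1 + 1)) / 2 =
     (2 * pi) powr (s - 1) * Gamma ((1 + s) / 2) * Gamma ((1 - s) / 2) * Re (zeta (of_real (1 - s)))"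
    using has_bochner_integral_eq has_bochner_integral_bose_neg[OF s] by blast
  then have "bose_mellin (of_real s) = of_real ((2 * pi) powr (s - 1) * Gamma ((1 + s) / 2) * Gamma ((1 - s) / 2) * Re (zeta (of_real (1 - s))))"
    using s by (subst bose_mellin_real) (auto simp: algebra_simps)
  then show ?thesis using zeta_of_real[of "1 - s"] s by simp
qed

lemma Gamma_zeta_eq_bose_mellin:
  assumes "-1 < Re s" "s \<noteq> 0" "s \<noteq> 1"
  shows "Gamma s * zeta s = bose_mellin s"
proof -
  define S where "S = {s. -1 < Re s} - {0, 1::complex}"
  have op: "open {s. -1 < Re s}" by (rule open_halfspace_Re_gt)
  have S: "open S" unfolding S_def using op by (intro open_Diff finite_imp_closed) auto
  have S': "connected S" unfolding S_def
    by (rule connected_open_delete_finite) (simp_all add: op convex_connected convex_halfspace_Re_gt)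
  have "(\<lambda>s. Gamma s * zeta s - bose_mellin s) s = 0"
  proof (rule analytic_continuation[of "\<lambda>s. Gamma s * zeta s - bose_mellin s" S "of_real ` {1<..}" 2])
    have "z \<notin> \<int>\<^sub>\<le>\<^sub>0" if "z \<in> S" for z
    proof
      assume "z \<in> \<int>\<^sub>\<le>\<^sub>0"
      then obtain n :: int where "z = of_int n" "n \<le> 0" by (auto elim!: nonpos_Ints_cases)
      then show False using that by (auto simp: S_def)
    qed
    then have "Gamma holomorphic_on S" by (intro holomorphic_Gamma) auto
    moreover have "zeta holomorphic_on S" by (rule holomorphic_on_subset[OF zeta_holomorphic]) (auto simp: S_def)
    moreover have "bose_mellin holomorphic_on S" unfolding S_def by (rule bose_mellin_holomorphic)
    ultimately show "(\<lambda>s. Gamma s * zeta s - bose_mellin s) holomorphic_on S"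
      by (intro holomorphic_on_diff holomorphic_on_mult)
    show "2 islimpt complex_of_real ` {1<..}"
    proof (unfold islimpt_approachable, intro allI impI)
      fix e :: real assume "e > 0"
      then show "\<exists>x'\<in>complex_of_real ` {1<..}. x' \<noteq> 2 \<and> dist x' 2 < e"
        by (intro bexI[of _ "of_real (2 + e / 2)"]) (auto simp: dist_norm complex_eq_iff)
    qed
    show "Gamma z * zeta z - bose_mellin z = 0" if "z \<in> of_real ` {1<..}" for z
      using that bose_mellin_gt_1 by auto
  qed (use S S' assms in \<open>auto simp: S_def complex_eq_iff\<close>)
  then show ?thesis by simp
qed

text \<open>Both sides are compared on the real segment (-1,0), where \<open>bose_mellin_neg\<close>
  already contains zeta(1 - s), and the identity theorem carries the equation over to the critical
  strip. The domain omits 0, where Gamma(s/2) has its pole, and stops at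
  \<open>Re s = 1\<close>.\<close>

theorem zeta_functional_equation:
  assumes "0 < Re s" "Re s < 1"
  shows "Gamma (s / 2) * zeta s = of_real pi powr (s - 1/2) * (Gamma ((1 - s) / 2) * zeta (1 - s))"
proof -
  define T where "T = {s. Re s > -1} \<inter> {s. Re s < 1}"
  define S where "S = T - {0::complex}"
  have T: "open T" "convex T"
    by (auto simp: T_def intro!: open_Int convex_Int open_halfspace_Re_gt open_halfspace_Re_lt
          convex_halfspace_Re_gt convex_halfspace_Re_lt)
  have S: "open S" unfolding S_def using T by (intro open_delete)
  have S': "connected S" unfolding S_def
    by (rule connected_open_delete) (simp_all add: T convex_connected)
  have "(\<lambda>s. Gamma (s / 2) * zeta s - of_real pi powr (s - 1/2) * (Gamma ((1 - s) / 2) * zeta (1 - s))) s = 0"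
  proof (rule analytic_continuation[of "\<lambda>s. Gamma (s / 2) * zeta s - of_real pi powr (s - 1/2) * (Gamma ((1 - s) / 2) * zeta (1 - s))"
        S "of_real ` {-1<..<0}" "-1/2"])
    have "z / 2 \<notin> \<int>\<^sub>\<le>\<^sub>0" if "z \<in> S" for z
    proof
      assume "z / 2 \<in> \<int>\<^sub>\<le>\<^sub>0"
      then obtain n :: int where n: "z / 2 = of_int n" "n \<le> 0" by (auto elim!: nonpos_Ints_cases)
      then have "z = of_int (2 * n)" by (simp add: field_simps)
      then show False using that n by (auto simp: S_def T_def)
    qed
    then have "(\<lambda>s. Gamma (s / 2)) holomorphic_on S" by (intro holomorphic_Gamma' holomorphic_intros) auto
    moreover have "(\<lambda>s. Gamma ((1 - s) / 2)) holomorphic_on S"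
      by (rule holomorphic_Gamma') (auto simp: S_def T_def intro!: Gamma_not_nonpos_Ints holomorphic_intros)
    moreover have "zeta holomorphic_on S" by (rule holomorphic_on_subset[OF zeta_holomorphic]) (auto simp: S_def T_def)
    moreover have "(zeta \<circ> (\<lambda>s. 1 - s)) holomorphic_on S"
      by (rule holomorphic_on_compose_gen[OF _ zeta_holomorphic]) (auto simp: S_def intro!: holomorphic_intros)
    moreover have "(\<lambda>s. complex_of_real pi powr (s - 1/2)) holomorphic_on S" by (intro holomorphic_intros)
    ultimately show "(\<lambda>s. Gamma (s / 2) * zeta s - of_real pi powr (s - 1/2) * (Gamma ((1 - s) / 2) * zeta (1 - s))) holomorphic_on S"
      unfolding o_def by (intro holomorphic_on_diff holomorphic_on_mult)
    show "-1/2 islimpt complex_of_real ` {-1<..<0}"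
    proof (unfold islimpt_approachable, intro allI impI)
      fix e :: real assume "e > 0"
      define d where "d = min e (1/2) / 2"
      have d: "0 < d" "d < e" "d < 1/2" using \<open>e > 0\<close> by (auto simp: d_def min_def)
      have dd: "dist (complex_of_real (-1/2 + d)) (-1/2) = d" using d by (simp add: dist_norm)
      show "\<exists>x'\<in>complex_of_real ` {-1<..<0}. x' \<noteq> -1/2 \<and> dist x' (-1/2) < e"
      proof (intro bexI[of _ "complex_of_real (-1/2 + d)"] conjI)
        show "complex_of_real (-1/2 + d) \<noteq> -1/2" using dd d by (metis dist_self less_irrefl)
        show "dist (complex_of_real (-1/2 + d)) (-1/2) < e" using dd d by simp
        show "complex_of_real (-1/2 + d) \<in> complex_of_real ` {-1<..<0}" using d by (intro imageI) auto
      qed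
    qed
    show "Gamma (z / 2) * zeta z - of_real pi powr (z - 1/2) * (Gamma ((1 - z) / 2) * zeta (1 - z)) = 0"
      if zS: "z \<in> of_real ` {-1<..<0}" for z
    proof -
      obtain x where x: "z = of_real x" "-1 < x" "x < 0" using zS by auto
      have G0: "Gamma ((z + 1) / 2) \<noteq> 0"
        using x by (auto simp: Gamma_eq_zero_iff intro!: Gamma_not_nonpos_Ints)
      have nz: "z / 2 \<notin> \<int>\<^sub>\<le>\<^sub>0"
      proof
        assume "z / 2 \<in> \<int>\<^sub>\<le>\<^sub>0"
        then obtain n :: int where n: "z / 2 = of_int n" "n \<le> 0" by (auto elim!: nonpos_Ints_cases)
        then have "complex_of_real x = of_real (2 * of_int n)" using x by (simp add: field_simps)
        then have "x = 2 * of_int n" using of_real_eq_iff by blast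
        then show False using x by auto
      qed
      \<comment> \<open>Legendre's duplication formula splits \<open>Gamma z\<close>; the factor
        \<open>Gamma ((z + 1) / 2)\<close> also occurs on the other side and cancels at the
        end.\<close>
      have "z / 2 + 1/2 \<notin> \<int>\<^sub>\<le>\<^sub>0" using x by (intro Gamma_not_nonpos_Ints) auto
      from Gamma_legendre_duplication[OF nz this]
      have dup: "Gamma (z / 2) * Gamma ((z + 1) / 2) = exp ((1 - z) * of_real (ln 2)) * of_real (sqrt pi) * Gamma z"
        by (simp add: add_divide_distrib)
      have "Gamma z * zeta z = of_real ((2 * pi) powr (x - 1) * Gamma ((1 + x) / 2) * Gamma ((1 - x) / 2)) * zeta (of_real (1 - x))"
      proof -
        have "-1 < Re z" "z \<noteq> 0" "z \<noteq> 1" using x by (auto simp: complex_eq_iff)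
        then have "Gamma z * zeta z = bose_mellin z" by (rule Gamma_zeta_eq_bose_mellin)
        then show ?thesis using bose_mellin_neg[OF x(2,3)] unfolding x(1) by simp
      qed
      also have "\<dots> = of_real ((2 * pi) powr (x - 1)) * Gamma ((z + 1) / 2) * Gamma ((1 - z) / 2) * zeta (1 - z)"
        by (simp add: x(1) Gamma_complex_of_real[symmetric] add_ac)
      finally have gz: "Gamma z * zeta z = of_real ((2 * pi) powr (x - 1)) * Gamma ((z + 1) / 2) * Gamma ((1 - z) / 2) * zeta (1 - z)" .
      have c: "exp ((1 - z) * of_real (ln 2)) * of_real (sqrt pi) * of_real ((2 * pi) powr (x - 1)) = of_real pi powr (z - 1/2)"
      proof -
        have "exp ((1 - z) * of_real (ln 2)) = complex_of_real (2 powr (1 - x))"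
          by (simp add: x(1) powr_def flip: exp_of_real)
        moreover have "of_real pi powr (z - 1/2) = complex_of_real (pi powr (x - 1/2))"
          using powr_of_real[of pi "x - 1/2", symmetric] by (simp add: x(1))
        moreover have "2 powr (1 - x) * sqrt pi * (2 * pi) powr (x - 1) = pi powr (x - 1/2)"
        proof -
          have "2 powr (1 - x) * 2 powr (x - 1) = (1::real)" by (simp flip: powr_add)
          moreover have "sqrt pi * pi powr (x - 1) = pi powr (x - 1/2)"
          proof -
            have h: "sqrt pi = pi powr (1/2)" by (simp add: powr_half_sqrt)
            have "sqrt pi * pi powr (x - 1) = pi powr (1/2 + (x - 1))" unfolding h by (rule powr_add[symmetric])
            also have "1/2 + (x - 1) = x - 1/2" by simp
            finally show ?thesis .
          qed
          ultimately show ?thesis by (simp add: powr_mult mult_ac)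
        qed
        ultimately show ?thesis by (simp only: of_real_mult[symmetric])
      qed
      have "Gamma ((z + 1) / 2) * (Gamma (z / 2) * zeta z) = exp ((1 - z) * of_real (ln 2)) * of_real (sqrt pi) * (Gamma z * zeta z)"
        using dup by (simp add: mult_ac)
      also have "\<dots> = Gamma ((z + 1) / 2) * (of_real pi powr (z - 1/2) * (Gamma ((1 - z) / 2) * zeta (1 - z)))"
        unfolding gz c[symmetric] by (simp only: mult_ac)
      finally show ?thesis using G0 by simp
    qed
  qed (use S S' assms in \<open>auto simp: S_def T_def\<close>)
  then show ?thesis by simp
qed

text \<open>The entire function (s - 1) zeta(s). Since \<open>zeta 1 = 0\<close> is a convention and
  not a zero, working with this function keeps the point 1 out of the zero set.\<close>

definition zeta_reg :: "complex \<Rightarrow> complex" where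
  "zeta_reg s = (if s = 1 then 1 else (s - 1) * zeta s)"

text \<open>The first-order Taylor case of the construction of zeta; it represents the function for
  all \<open>Re s > 0\<close> and thus in the critical strip.\<close>

lemma zeta_reg_series:
  assumes "Re s > 0"
  shows "zeta_reg s = 1 + (\<Sum>n. taylor_rem (Suc 0) n s)"
proof (cases "s = 1")
  case True
  have "taylor_rem (Suc 0) n 1 = 0" for n by (simp add: taylor_rem_def ffc_def del: of_nat_Suc)
  then show ?thesis using True by (simp add: zeta_reg_def)
next
  case False
  define T where "T = {s. Re s > 0} - {1::complex}"
  have T: "open T" "connected T" unfolding T_def
    using connected_open_delete[of "{s::complex. Re s > 0}" 1]
    by (auto simp: open_halfspace_Re_gt convex_connected convex_halfspace_Re_gt)
  have "(s - 1) * zeta s = 1 + (\<Sum>n. taylor_rem (Suc 0) n s)"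
  proof (rule analytic_continuation_open[of "{s. Re s > 1}" T "\<lambda>s. (s - 1) * zeta s"
        "\<lambda>s. 1 + (\<Sum>n. taylor_rem (Suc 0) n s)"])
    show "(s - 1) * zeta s = 1 + (\<Sum>n. taylor_rem (Suc 0) n s)" if "s \<in> {s. Re s > 1}" for s
      using that taylor_rem_suminf[of s 0] by (simp add: zeta_eq_series ffc_def)
    show "(\<lambda>s. (s - 1) * zeta s) holomorphic_on T"
      by (intro holomorphic_intros holomorphic_on_subset[OF zeta_holomorphic]) (auto simp: T_def)
    show "(\<lambda>s. 1 + (\<Sum>n. taylor_rem (Suc 0) n s)) holomorphic_on T"
      by (intro holomorphic_intros holomorphic_on_subset[OF taylor_rem_sum_holomorphic[of 0]]) (auto simp: T_def)
  qed (use T False assms in \<open>auto simp: T_def open_halfspace_Re_gt intro!: exI[of _ 2]\<close>)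
  then show ?thesis using False by (simp add: zeta_reg_def)
qed

lemma zeta_reg_holomorphic: "zeta_reg holomorphic_on A"
proof -
  have 1: "zeta_reg holomorphic_on {s. Re s > 0}"
  proof (rule holomorphic_transform)
    show "(\<lambda>s. 1 + (\<Sum>n. taylor_rem (Suc 0) n s)) holomorphic_on {s. Re s > 0}"
      using taylor_rem_sum_holomorphic[of 0] by (intro holomorphic_intros) simp
  qed (use zeta_reg_series in auto)
  have 2: "zeta_reg holomorphic_on - {1}"
  proof (rule holomorphic_transform)
    show "(\<lambda>s. (s - 1) * zeta s) holomorphic_on - {1}" by (intro holomorphic_intros zeta_holomorphic)
  qed (auto simp: zeta_reg_def)
  have "zeta_reg holomorphic_on ({s. Re s > 0} \<union> - {1})"
    by (rule holomorphic_on_Un[OF 1 2]) (auto simp: open_halfspace_Re_gt)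
  moreover have "{s. Re s > 0} \<union> - {1::complex} = UNIV" by auto
  ultimately show ?thesis using holomorphic_on_subset by fastforce
qed

lemma zeta_reg_eq_0_iff: "zeta_reg s = 0 \<longleftrightarrow> s \<noteq> 1 \<and> zeta s = 0"
  by (simp add: zeta_reg_def)

text \<open>The remainders carry the coefficient s(s - 1) in front of a convergent series, hence
  quadratic growth. This is the upper bound in the count of zeros.\<close>

lemma zeta_reg_bound:
  assumes "a > 0"
  obtains K where "K > 0" "\<And>s. Re s \<ge> a \<Longrightarrow> norm (zeta_reg s) \<le> K * (1 + norm s)\<^sup>2"
proof -
  have sm: "summable (\<lambda>n. real (Suc n) powr (- a - 1))"
    using assms summable_Suc_iff[of "\<lambda>n. real n powr (- a - 1)"] by (simp add: summable_real_powr_iff)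
  define M where "M = (\<Sum>n. real (Suc n) powr (- a - 1))"
  have M: "M \<ge> 0" unfolding M_def by (intro suminf_nonneg sm) auto
  have "norm (zeta_reg s) \<le> (1 + M) * (1 + norm s)\<^sup>2" if s: "Re s \<ge> a" for s
  proof -
    define A where "A = norm (ffc (Suc (Suc 0)) s)"
    have A: "A \<le> (1 + norm s)\<^sup>2"
    proof -
      have "ffc (Suc (Suc 0)) s = (1 - s) * (- s)" by (simp add: ffc_def)
      then have "A = norm (1 - s) * norm s" by (simp add: A_def norm_mult)
      also have "\<dots> \<le> (1 + norm s) * (1 + norm s)"
        using norm_triangle_ineq4[of 1 s] by (intro mult_mono) auto
      finally show ?thesis by (simp add: power2_eq_square)
    qed
    have b: "norm (taylor_rem (Suc 0) n s) \<le> A * real (Suc n) powr (- a - 1)" for n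
    proof -
      have "norm (taylor_rem (Suc 0) n s) \<le> A * real (Suc n) powr (- Re s - real (Suc 0))"
        unfolding A_def using s assms by (intro taylor_rem_bound) auto
      also have "\<dots> \<le> A * real (Suc n) powr (- a - 1)"
        using s by (intro mult_left_mono powr_mono) (auto simp: A_def)
      finally show ?thesis .
    qed
    have "norm (\<Sum>n. taylor_rem (Suc 0) n s) \<le> (\<Sum>n. A * real (Suc n) powr (- a - 1))"
      by (rule norm_suminf_le[OF b summable_mult[OF sm]])
    also have "\<dots> = A * M" unfolding M_def by (rule suminf_mult[OF sm])
    also have "\<dots> \<le> (1 + norm s)\<^sup>2 * M" using A M by (intro mult_right_mono)
    finally have "norm (zeta_reg s) \<le> 1 + (1 + norm s)\<^sup>2 * M"
      using zeta_reg_series[of s] s assms norm_triangle_ineq[of 1 "\<Sum>n. taylor_rem (Suc 0) n s"] by simp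
    also have "\<dots> \<le> (1 + norm s)\<^sup>2 + (1 + norm s)\<^sup>2 * M"
      using power_mono[of 1 "1 + norm s" 2] by simp
    finally show ?thesis by (simp add: algebra_simps)
  qed
  then show ?thesis using M by (intro that[of "1 + M"]) auto
qed

text \<open>Excludes the ordinate 0, so that the zeros fall into conjugate pairs. At 1/2 the series
  for \<open>zeta_reg\<close> is real and each remainder is at least the increment of 1/(2 sqrt n);
  telescoping shows that \<open>zeta_reg (1/2)\<close> is at least 1/2.\<close>

lemma zeta_half_nonzero: "zeta (1/2) \<noteq> 0"
proof -
  define t where "t = (\<lambda>n. sqrt (real (Suc (Suc n))) - (sqrt (real (Suc n)) + 1/2 / sqrt (real (Suc n))))"
  define u where "u = (\<lambda>n. 1 / sqrt (real (Suc n)) / 2)"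
  have powr_half: "of_nat (Suc n) powr (1 - 1/2 :: complex) = of_real (sqrt (real (Suc n)))"
    "of_nat (Suc n) powr (1 - 1/2 - of_nat (Suc 0) :: complex) = of_real (1 / sqrt (real (Suc n)))" for n
  proof -
    have "of_nat (Suc n) powr (1 - 1/2 :: complex) = of_real (real (Suc n)) powr of_real (1/2)" by simp
    then show "of_nat (Suc n) powr (1 - 1/2 :: complex) = of_real (sqrt (real (Suc n)))"
      by (subst (asm) powr_of_real) (auto simp: powr_half_sqrt)
    have "of_nat (Suc n) powr (1 - 1/2 - of_nat (Suc 0) :: complex) = of_real (real (Suc n)) powr of_real (-1/2)" by simp
    also have "\<dots> = of_real (real (Suc n) powr (- (1/2)))" by (subst powr_of_real) auto
    also have "real (Suc n) powr (- (1/2)) = inverse (real (Suc n) powr (1/2))" by (rule powr_minus)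
    also have "\<dots> = 1 / sqrt (real (Suc n))" by (subst powr_half_sqrt) (simp_all add: divide_inverse)
    finally show "of_nat (Suc n) powr (1 - 1/2 - of_nat (Suc 0) :: complex) = of_real (1 / sqrt (real (Suc n)))" .
  qed
  have tr: "taylor_rem (Suc 0) n (1/2) = of_real (t n)" for n
  proof -
    have "taylor_rem (Suc 0) n (1/2) = of_nat (Suc (Suc n)) powr (1 - 1/2) -
       (of_nat (Suc n) powr (1 - 1/2) + 1/2 * of_nat (Suc n) powr (1 - 1/2 - of_nat (Suc 0)))"
      by (simp add: taylor_rem_def ffc_def)
    then show ?thesis unfolding powr_half t_def by simp
  qed
  have tu: "u (Suc n) - u n \<le> t n" for n
  proof -
    define p q where "p = sqrt (real (Suc n))" and "q = sqrt (real (Suc (Suc n)))"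
    have pq: "0 < p" "p \<le> q" "q\<^sup>2 = p\<^sup>2 + 1" by (auto simp: p_def q_def)
    have "1 / q / 2 \<le> q - p"
    proof -
      have "(q - p) * (q + p) = 1" using pq by (simp add: power2_eq_square algebra_simps)
      then have "q - p = 1 / (q + p)" using pq by (simp add: field_simps)
      moreover have "1 / (q + q) \<le> 1 / (q + p)" using pq by (intro divide_left_mono) auto
      ultimately show ?thesis by simp
    qed
    then show ?thesis by (simp add: u_def t_def p_def q_def)
  qed
  have sm: "summable t"
  proof -
    have "summable (\<lambda>n. norm (ffc (Suc (Suc 0)) (1/2)) * real (Suc n) powr (- (1/2) - 1))"
      using summable_Suc_iff[of "\<lambda>n. real n powr (- (1/2) - 1)"] by (intro summable_mult) (simp add: summable_real_powr_iff)
    then have "summable (\<lambda>n. norm (taylor_rem (Suc 0) n (1/2)))"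
      by (rule summable_comparison_test') (use taylor_rem_bound[of "1/2" "Suc 0"] in auto)
    then have "summable (\<lambda>n. \<bar>t n\<bar>)" unfolding tr by simp
    then show ?thesis by (rule summable_rabs_cancel)
  qed
  have "(\<lambda>n. u n) \<longlonglongrightarrow> 0" unfolding u_def by real_asymp
  then have "(\<lambda>n. u (Suc n) - u n) sums (0 - u 0)" by (rule telescope_sums)
  then have "0 - u 0 \<le> suminf t" using sums_le[OF tu _ summable_sums[OF sm]] by blast
  then have "suminf t \<ge> -1/2" by (simp add: u_def)
  moreover have "zeta_reg (1/2) = of_real (1 + suminf t)"
    using zeta_reg_series[of "1/2"] suminf_of_real[OF sm, where ?'a = complex] by (simp add: tr)
  ultimately have "zeta_reg (1/2) \<noteq> 0" by (auto simp: complex_eq_iff)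
  then show ?thesis by (simp add: zeta_reg_eq_0_iff)
qed

text \<open>The conjugated function satisfies \<open>is_zeta\<close> as well, so uniqueness gives
  the symmetry.\<close>

lemma zeta_cnj: "zeta (cnj s) = cnj (zeta s)"
proof -
  have "is_zeta (\<lambda>s. cnj (zeta (cnj s)))"
    unfolding is_zeta_def
  proof (intro conjI allI impI)
    have "cnj \<circ> zeta \<circ> cnj holomorphic_on - {1}"
      by (rule holomorphic_on_compose_cnj_cnj) (auto intro!: holomorphic_on_subset[OF zeta_holomorphic])
    then show "(\<lambda>s. cnj (zeta (cnj s))) holomorphic_on - {1}" by (simp add: o_def)
    show "cnj (zeta (cnj 1)) = 0" using is_zeta_zeta by (simp add: is_zeta_def)
    fix s :: complex assume s: "Re s > 1"
    then have "cnj (zeta (cnj s)) = cnj (\<Sum>n. of_nat (Suc n) powr (- cnj s))"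
      using zeta_eq_series[of "cnj s"] by (simp add: zeta_series_def)
    also have "\<dots> = (\<Sum>n. cnj (of_nat (Suc n) powr (- cnj s)))"
      using s by (intro bounded_linear.suminf[OF bounded_linear_cnj] summable_zeta_series) simp
    also have "\<dots> = (\<Sum>n. of_nat (Suc n) powr (- s))"
      by (intro suminf_cong) (simp add: cnj_powr)
    finally show "cnj (zeta (cnj s)) = (\<Sum>n. of_nat (Suc n) powr (- s))" .
  qed
  then have "(\<lambda>s. cnj (zeta (cnj s))) = zeta" using zeta_characterization by blast
  then have "cnj (zeta (cnj s)) = zeta s" by (rule fun_cong)
  then show ?thesis by (metis complex_cnj_cnj)
qed

section \<open>The Moebius function\<close>

lemma prime_factors_prime_mult:
  fixes p d :: nat
  assumes "prime p" "d \<noteq> 0"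
  shows "prime_factors (p * d) = insert p (prime_factors d)"
proof -
  have "prime_factorization (p * d) = prime_factorization p + prime_factorization d"
    using assms by (intro prime_factorization_mult) auto
  then show ?thesis using assms by (simp add: prime_factorization_prime)
qed

lemma moebius_prime_mult:
  assumes p: "prime p" and d: "\<not> p dvd d"
  shows "moebius (p * d) = - moebius d"
proof -
  have cop: "coprime p d" using p d by (rule prime_imp_coprime)
  have d0: "d \<noteq> 0" using d by (metis dvd_0_right)
  have "squarefree (p * d) \<longleftrightarrow> squarefree d"
    using squarefree_mult_coprime[OF cop] squarefree_multD(2)[of p d] p squarefree_prime by blast
  moreover have "card (prime_factors (p * d)) = Suc (card (prime_factors d))"
    using p d d0 by (subst prime_factors_prime_mult) (auto simp: card_insert_if)
  ultimately show ?thesis by (simp add: moebius_def)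
qed

text \<open>For a prime p dividing n, multiplication by p matches the squarefree divisors prime to p
  with those divisible by p and reverses the sign.\<close>

lemma sum_moebius_divisors:
  assumes "n > 0"
  shows "(\<Sum>d | d dvd n. moebius d) = (if n = 1 then 1 else 0)"
proof (cases "n = 1")
  case True
  then show ?thesis by (simp add: moebius_def)
next
  case False
  then obtain p where p: "prime p" "p dvd n" using prime_factor_nat by blast
  define A where "A = {d. d dvd n \<and> \<not> p dvd d}"
  define B where "B = {d. d dvd n \<and> p dvd d \<and> squarefree d}"
  have fin: "finite {d. d dvd n}" using assms by simp
  have finAB: "finite A" "finite B" using fin by (auto simp: A_def B_def intro: finite_subset)
  have "(\<Sum>d | d dvd n. moebius d) = (\<Sum>d\<in>A \<union> B. moebius d)"
    using fin by (intro sum.mono_neutral_right) (auto simp: A_def B_def moebius_def)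
  also have "\<dots> = (\<Sum>d\<in>A. moebius d) + (\<Sum>d\<in>B. moebius d)"
    using finAB by (intro sum.union_disjoint) (auto simp: A_def B_def)
  \<comment> \<open>The image also contains divisors that are not squarefree, but
    \<open>moebius\<close> vanishes on them.\<close>
  also have "(\<Sum>d\<in>B. moebius d) = (\<Sum>d\<in>(\<lambda>d. p * d) ` A. moebius d)"
  proof (rule sum.mono_neutral_left)
    show "finite ((\<lambda>d. p * d) ` A)" using finAB by simp
    show "B \<subseteq> (\<lambda>d. p * d) ` A"
    proof
      fix e assume e: "e \<in> B"
      then obtain d where d: "e = p * d" by (auto simp: B_def)
      have "\<not> p dvd d"
      proof
        assume "p dvd d"
        then have "p ^ 2 dvd e" unfolding d power2_eq_square by (intro mult_dvd_mono) auto
        moreover have "squarefree e" using e by (simp add: B_def)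
        ultimately have "p dvd 1" using squarefreeD by blast
        then show False using p by simp
      qed
      moreover have "d dvd n" using e d by (auto simp: B_def dest: dvd_mult_right)
      ultimately show "e \<in> (\<lambda>d. p * d) ` A" using d by (auto simp: A_def)
    qed
    have "p * d dvd n" if "d \<in> A" for d
      using that p prime_imp_coprime[of p d] by (intro divides_mult) (auto simp: A_def)
    then show "\<forall>i\<in>(\<lambda>d. p * d) ` A - B. moebius i = 0" by (auto simp: B_def moebius_def)
  qed
  also have "\<dots> = (\<Sum>d\<in>A. moebius (p * d))"
    using p by (subst sum.reindex) (auto simp: inj_on_def prime_gt_0_nat)
  also have "\<dots> = (\<Sum>d\<in>A. - moebius d)"
    using p by (intro sum.cong) (auto simp: A_def moebius_prime_mult)
  finally show ?thesis using False by (simp add: sum_negf)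
qed

lemma abs_moebius_le: "\<bar>moebius n\<bar> \<le> 1"
  by (auto simp: moebius_def)

text \<open>The product of the two absolutely convergent series is a double sum over pairs (d, k);
  collecting the pairs with the same product n leaves the divisor sums of
  \<open>moebius\<close>.\<close>

lemma moebius_zeta:
  assumes s: "Re s > 1"
  shows "summable (\<lambda>n. of_int (moebius (Suc n)) * of_nat (Suc n) powr (- s) :: complex)"
    and "(\<Sum>n. of_int (moebius (Suc n)) * of_nat (Suc n) powr (- s)) * zeta s = 1"
proof -
  define a where "a = (\<lambda>n. of_nat n powr (- s) :: complex)"
  define m where "m = (\<lambda>n. of_int (moebius n) * a n)"
  have a0: "a 0 = 0" "m 0 = 0" by (simp_all add: a_def m_def)
  have amult: "a (d * k) = a d * a k" for d k
    unfolding a_def of_nat_mult by (rule powr_times_real) auto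
  have norm_a: "norm (a n) = real n powr (- Re s)" for n
    by (cases "n = 0") (auto simp: a_def norm_powr_real_powr)
  have sa: "summable (\<lambda>n. norm (a n))" unfolding norm_a using s by (subst summable_real_powr_iff) auto
  have nm: "norm (m n) \<le> norm (a n)" for n
  proof -
    have "norm (of_int (moebius n) :: complex) \<le> 1"
      using abs_moebius_le[of n] by (simp add: norm_of_int)
    then show ?thesis unfolding m_def norm_mult using mult_right_mono[of _ 1 "norm (a n)"] by simp
  qed
  have sm: "summable (\<lambda>n. norm (m n))" by (rule summable_comparison_test'[OF sa]) (use nm in simp)
  have sm': "summable (\<lambda>n. norm (m (Suc n)))" using sm by (subst summable_Suc_iff)
  show "summable (\<lambda>n. of_int (moebius (Suc n)) * of_nat (Suc n) powr (- s) :: complex)"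
    using summable_norm_cancel[OF sm'] by (simp add: m_def a_def)
  have hs: "(a has_sum (suminf a)) UNIV" "(m has_sum (suminf m)) UNIV"
    using norm_summable_imp_has_sum[OF sa] norm_summable_imp_has_sum[OF sm] sa sm
    by (auto intro: summable_norm_cancel summable_sums)
  define U where "U = (\<lambda>(d, k). m d * a k)"
  have absU: "(\<lambda>x. norm (U x)) summable_on UNIV \<times> UNIV"
  proof (rule Infinite_Sum.abs_summable_on_Sigma_iff[THEN iffD2], intro conjI ballI)
    have sa': "(\<lambda>k. norm (a k)) summable_on UNIV" using sa by (simp add: summable_on_UNIV_nonneg_real_iff)
    have sm'': "(\<lambda>k. norm (m k)) summable_on UNIV" using sm by (simp add: summable_on_UNIV_nonneg_real_iff)
    show "(\<lambda>y. norm (U (x, y))) summable_on UNIV" for x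
      unfolding U_def by (simp add: norm_mult) (intro summable_on_cmult_right sa')
    have "(\<lambda>x. norm (m x) * infsum (\<lambda>k. norm (a k)) UNIV) summable_on UNIV"
      by (intro summable_on_cmult_left sm'')
    then show "(\<lambda>x. norm (\<Sum>\<^sub>\<infinity>y. norm (U (x, y)))) summable_on UNIV"
      unfolding U_def by (simp add: norm_mult infsum_cmult_right' abs_mult infsum_nonneg)
  qed
  then have sU: "U summable_on UNIV \<times> UNIV" by (rule Infinite_Sum.abs_summable_summable)
  have hU: "(U has_sum (suminf m * suminf a)) (UNIV \<times> UNIV)"
  proof (rule has_sum_SigmaI[OF _ _ sU])
    show "((\<lambda>y. U (x, y)) has_sum (m x * suminf a)) UNIV" for x
      unfolding U_def using has_sum_cmult_right[OF hs(1), of "m x"] by simp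
    show "((\<lambda>x. m x * suminf a) has_sum suminf m * suminf a) UNIV"
      by (rule has_sum_cmult_left[OF hs(2)])
  qed
  define D where "D = Sigma {n::nat. n > 0} (\<lambda>n. {d. d dvd n})"
  define g where "g = (\<lambda>(n::nat, d::nat). (d, n div d))"
  have bij: "bij_betw g D ({d. d > 0} \<times> {k. k > 0})"
  proof (rule bij_betwI[where g = "\<lambda>(d, k). (d * k, d)"])
    show "g \<in> D \<rightarrow> {d. d > 0} \<times> {k. k > 0}"
      by (auto simp: D_def g_def div_greater_zero_iff dvd_imp_le dest: dvd_pos_nat)
    show "(\<lambda>(d, k). (d * k, d)) \<in> {d. d > 0} \<times> {k. k > 0} \<rightarrow> D" by (auto simp: D_def)
    show "(\<lambda>(d, k). (d * k, d)) (g x) = x" if "x \<in> D" for x using that by (auto simp: D_def g_def)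
    show "g ((\<lambda>(d, k). (d * k, d)) y) = y" if "y \<in> {d. d > 0} \<times> {k. k > 0}" for y
      using that by (auto simp: g_def)
  qed
  have "(U has_sum (suminf m * suminf a)) ({d. d > 0} \<times> {k. k > 0})"
    using hU by (rule has_sum_cong_neutral[THEN iffD1, rotated -1]) (auto simp: U_def a0 mem_Times_iff case_prod_beta)
  then have "((\<lambda>x. U (g x)) has_sum (suminf m * suminf a)) D"
    using has_sum_reindex_bij_betw[OF bij] by blast
  moreover have "((\<lambda>d. U (g (n, d))) has_sum (if n = 1 then 1 else 0)) {d. d dvd n}" if n: "n \<in> {n. n > 0}" for n
  proof -
    have "U (g (n, d)) = of_int (moebius d) * a n" if "d \<in> {d. d dvd n}" for d
      using that amult[of d "n div d"] by (simp add: U_def g_def m_def mult.assoc)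
    then have "(\<Sum>d | d dvd n. U (g (n, d))) = (\<Sum>d | d dvd n. of_int (moebius d) * a n)"
      by (intro sum.cong) auto
    also have "\<dots> = of_int (\<Sum>d | d dvd n. moebius d) * a n" by (simp add: sum_distrib_right)
    also have "\<dots> = (if n = 1 then 1 else 0)" using n by (subst sum_moebius_divisors) (auto simp: a_def)
    finally show ?thesis using n has_sum_finite[of "{d. d dvd n}" "\<lambda>d. U (g (n, d))"] by simp
  qed
  ultimately have "((\<lambda>n. if n = 1 then 1 else 0) has_sum (suminf m * suminf a)) {n::nat. n > 0}"
    unfolding D_def by (rule has_sum_SigmaD)
  moreover have "((\<lambda>n. if n = 1 then 1 else 0) has_sum (1::complex)) {n::nat. n > 0}"
    by (rule has_sum_finite_neutralI[of "{1}"]) auto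
  ultimately have "suminf m * suminf a = 1" using has_sum_unique by blast
  moreover have "suminf m = (\<Sum>n. m (Suc n))" using suminf_split_head[of m] summable_norm_cancel[OF sm] a0 by simp
  moreover have "suminf a = zeta s"
    using suminf_split_head[of a] summable_norm_cancel[OF sa] a0 zeta_eq_series[OF s] by (simp add: zeta_series_def a_def)
  ultimately show "(\<Sum>n. of_int (moebius (Suc n)) * of_nat (Suc n) powr (- s)) * zeta s = 1"
    by (simp add: m_def a_def)
qed

lemma mertens_Suc: "mertens (real (Suc n)) = mertens (real n) + of_int (moebius (Suc n))"
proof -
  have "nat \<lfloor>real (Suc n)\<rfloor> = Suc n" "nat \<lfloor>real n\<rfloor> = n" by simp_all
  then show ?thesis by (simp only: mertens_def) simp
qed

lemma mertens_0: "mertens 0 = 0"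
  by (simp add: mertens_def)

lemma abs_mertens_diff_le: "\<bar>mertens (real (n + k)) - mertens (real n)\<bar> \<le> real k"
proof (induction k)
  case (Suc k)
  have "\<bar>of_int (moebius (Suc (n + k))) :: real\<bar> \<le> 1"
    using abs_moebius_le[of "Suc (n + k)"] by (metis of_int_abs of_int_le_1_iff)
  then show ?case using Suc mertens_Suc[of "n + k"] by simp
qed simp

lemma abs_mertens_le: "\<bar>mertens (real n)\<bar> \<le> real n"
  using abs_mertens_diff_le[of 0 n] by (simp add: mertens_0)

text \<open>Here \<open>f n\<close> stands for the value at n + 1, so the boundary term pairs M(N)
  with the value at N + 1.\<close>

lemma moebius_Abel_summation:
  fixes f :: "nat \<Rightarrow> 'a :: real_normed_field"
  shows "(\<Sum>n<N. of_int (moebius (Suc n)) * f n) =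
    (\<Sum>n<N. of_real (mertens (real (Suc n))) * (f n - f (Suc n))) + of_real (mertens (real N)) * f N"
proof (induction N)
  case 0
  then show ?case by (simp add: mertens_0)
next
  case (Suc N)
  show ?case unfolding sum.lessThan_Suc Suc mertens_Suc[of N] by (simp add: algebra_simps)
qed

section \<open>Consequences of the weak Mertens hypothesis\<close>

text \<open>Summation by parts: decreasing nonnegative weights preserve an inequality between all
  partial sums. This brings the factor n^(-eps) into the averaged bound for M(n).\<close>

lemma sum_le_weighted:
  fixes a b w :: "nat \<Rightarrow> real"
  assumes le: "\<And>N. (\<Sum>n<N. a n) \<le> (\<Sum>n<N. b n)" and w: "decseq w" "\<And>n. w n \<ge> 0"
  shows "(\<Sum>n<N. a n * w n) \<le> (\<Sum>n<N. b n * w n)"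
proof -
  have "(\<Sum>n<N. (b n - a n)) * w N \<le> (\<Sum>n<N. (b n - a n) * w n)"
  proof (induction N)
    case (Suc N)
    have "(\<Sum>n<Suc N. (b n - a n)) * w (Suc N) \<le> (\<Sum>n<Suc N. (b n - a n)) * w N"
      using le[of "Suc N"] w(1) by (intro mult_left_mono) (auto simp: sum_subtractf decseq_Suc_iff)
    also have "\<dots> \<le> (\<Sum>n<Suc N. (b n - a n) * w n)" using Suc by (simp add: algebra_simps)
    finally show ?case .
  qed simp
  moreover have "0 \<le> (\<Sum>n<N. (b n - a n)) * w N" using le[of N] w(2) by (simp add: sum_subtractf)
  ultimately show ?thesis by (simp add: left_diff_distrib sum_subtractf)
qed

text \<open>Comparison with the integral, by the mean value theorem. The single power of 1/eps
  matters: it becomes the order of the poles of 1/zeta.\<close>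

lemma sum_powr_le:
  fixes \<epsilon> :: real
  assumes "\<epsilon> > 0"
  shows "(\<Sum>n<N. real (Suc n) powr (- 1 - \<epsilon>)) \<le> 1 + 1 / \<epsilon>"
proof -
  have "(\<Sum>n<Suc N. real (Suc n) powr (- 1 - \<epsilon>)) \<le> 1 + (1 - real (Suc N) powr (- \<epsilon>)) / \<epsilon>" for N
  proof (induction N)
    case (Suc N)
    have "\<exists>z. real (Suc N) < z \<and> z < real (Suc (Suc N)) \<and>
       - (real (Suc (Suc N)) powr (- \<epsilon>) / \<epsilon>) - (- (real (Suc N) powr (- \<epsilon>) / \<epsilon>)) =
       (real (Suc (Suc N)) - real (Suc N)) * (z powr (- 1 - \<epsilon>))"
    proof (rule MVT2[where f = "\<lambda>x. - (x powr (- \<epsilon>) / \<epsilon>)"])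
      fix x assume x: "real (Suc N) \<le> x"
      have "x > 0" using x by (rule less_le_trans[rotated]) simp
      then show "((\<lambda>x. - (x powr (- \<epsilon>) / \<epsilon>)) has_real_derivative x powr (- 1 - \<epsilon>)) (at x)"
        using assms by (auto intro!: derivative_eq_intros simp: powr_diff powr_minus field_simps)
    qed auto
    then obtain z where z: "real (Suc N) < z" "z < real (Suc (Suc N))"
      "(real (Suc N) powr (- \<epsilon>) / \<epsilon>) - (real (Suc (Suc N)) powr (- \<epsilon>) / \<epsilon>) = z powr (- 1 - \<epsilon>)" by auto
    have "z > 0" using z(1) by (rule less_trans[rotated]) simp
    then have "real (Suc (Suc N)) powr (- 1 - \<epsilon>) \<le> z powr (- 1 - \<epsilon>)"
      using z assms by (intro powr_mono2') auto
    then show ?case using Suc z(3) by (simp add: diff_divide_distrib)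
  qed simp
  moreover have "1 + (1 - real (Suc N) powr (- \<epsilon>)) / \<epsilon> \<le> 1 + 1 / \<epsilon>" for N
    using assms by (simp add: divide_right_mono)
  ultimately have "(\<Sum>n<Suc N. real (Suc n) powr (- 1 - \<epsilon>)) \<le> 1 + 1 / \<epsilon>" for N by (meson order_trans)
  moreover have "(\<Sum>n<N. real (Suc n) powr (- 1 - \<epsilon>)) \<le> (\<Sum>n<Suc N. real (Suc n) powr (- 1 - \<epsilon>))" by simp
  ultimately show ?thesis by (meson order_trans)
qed

text \<open>\<open>mertens\<close> is constant on \<open>[n, n+1)\<close>, so the integral dominates the corresponding sum.\<close>
lemma weak_Mertens_integral_ge:
  "(\<lambda>x. (mertens x / x)\<^sup>2) integrable_on {1..real (Suc N)} \<and>
   (\<Sum>n<N. (mertens (real (Suc n)) / real (Suc n))\<^sup>2) \<le> 4 * integral {1..real (Suc N)} (\<lambda>x. (mertens x / x)\<^sup>2)"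
proof (induction N)
  case (Suc N)
  define k where "k = real (Suc N)"
  define g where "g = (\<lambda>x::real. (mertens x / x)\<^sup>2)"
  define h where "h = (\<lambda>x::real. (mertens k / x)\<^sup>2)"
  have k: "k \<ge> 1" by (simp add: k_def)
  have eq: "g x = h x" if "x \<in> {k..k+1} - {k + 1}" for x
  proof -
    have "\<lfloor>x\<rfloor> = int (Suc N)" using that by (intro floor_unique) (auto simp: k_def)
    moreover have "\<lfloor>k\<rfloor> = int (Suc N)" by (simp add: k_def)
    ultimately show ?thesis by (simp add: g_def h_def mertens_def)
  qed
  have ih: "h integrable_on {k..k+1}" unfolding h_def using k
    by (intro integrable_continuous_real continuous_intros) auto
  have ig: "g integrable_on {k..k+1}"
    by (rule integrable_spike_finite[OF _ _ ih, of "{k + 1}"]) (use eq in auto)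
  have "integral {k..k+1} g = integral {k..k+1} h"
    by (rule integral_spike[of "{k + 1}"]) (use eq in auto)
  also have "integral {k..k+1} h \<ge> integral {k..k+1} (\<lambda>_. (mertens k / k)\<^sup>2 / 4)"
  proof (rule integral_le[OF _ ih])
    fix x assume x: "x \<in> {k..k+1}"
    \<comment> \<open>On [k, k+1] with k >= 1 one has x <= 2k; this is the source of the factor
      4.\<close>
    have "x\<^sup>2 \<le> (2 * k)\<^sup>2" using x k by (intro power_mono) auto
    then have "(mertens k)\<^sup>2 / (2 * k)\<^sup>2 \<le> (mertens k)\<^sup>2 / x\<^sup>2" using x k by (intro divide_left_mono) auto
    then show "(mertens k / k)\<^sup>2 / 4 \<le> h x" by (simp add: h_def power_divide power_mult_distrib)
  qed auto
  finally have le: "(mertens k / k)\<^sup>2 \<le> 4 * integral {k..k+1} g" by simp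
  have i1: "g integrable_on {1..k}" using Suc by (simp add: g_def k_def)
  have i2: "g integrable_on {1..k+1}"
    by (rule Henstock_Kurzweil_Integration.integrable_combine[OF _ _ i1 ig]) (use k in auto)
  have "integral {1..k} g + integral {k..k+1} g = integral {1..k+1} g"
    by (rule Henstock_Kurzweil_Integration.integral_combine[OF _ _ i2]) (use k in auto)
  moreover note i2
  moreover have "(\<Sum>n<N. (mertens (real (Suc n)) / real (Suc n))\<^sup>2) \<le> 4 * integral {1..k} g"
    using Suc by (simp add: g_def k_def)
  moreover have "real (Suc (Suc N)) = k + 1" by (simp add: k_def)
  ultimately show ?case using le unfolding g_def[symmetric] sum.lessThan_Suc k_def[symmetric] by auto
next
  case 0
  have "(\<lambda>x. (mertens x / x)\<^sup>2) integrable_on {1..1}"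
    unfolding cbox_interval[symmetric] by (rule integrable_on_refl)
  then show ?case by simp
qed

lemma ln_le_harmonic: "ln (real (Suc N)) \<le> (\<Sum>n<N. 1 / real (Suc n))"
proof (induction N)
  case (Suc N)
  have "ln (real (Suc (Suc N))) - ln (real (Suc N)) = ln (1 + 1 / real (Suc N))"
  proof -
    have "1 + 1 / real (Suc N) = real (Suc (Suc N)) / real (Suc N)" by (simp add: field_simps)
    then show ?thesis by (simp add: ln_div del: of_nat_Suc)
  qed
  also have "\<dots> \<le> 1 / real (Suc N)" by (rule ln_add_one_self_le_self) simp
  finally show ?case using Suc by simp
qed simp

text \<open>The logarithm is replaced by harmonic partial sums and the bound is made valid for every
  \<open>N\<close>, the form that \<open>sum_le_weighted\<close> accepts.\<close>

lemma weak_Mertens_sum_bound: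
  assumes weak_Mertens_hypothesis
  obtains C where "C > 0"
    "\<And>N. (\<Sum>n<N. (mertens (real (Suc n)) / real (Suc n))\<^sup>2) \<le> (\<Sum>n<N. C * (1 / real (Suc n)))"
proof -
  define a where "a = (\<lambda>n. (mertens (real (Suc n)) / real (Suc n))\<^sup>2)"
  define I where "I = (\<lambda>X. integral {1..X} (\<lambda>x. (mertens x / x)\<^sup>2))"
  from assms obtain c where c: "c > 0" "eventually (\<lambda>X. norm (I X) \<le> c * norm (ln X)) at_top"
    unfolding weak_Mertens_hypothesis_def I_def by (elim landau_o.bigE) auto
  then obtain X0 where X0: "\<And>X. X \<ge> X0 \<Longrightarrow> \<bar>I X\<bar> \<le> c * \<bar>ln X\<bar>"
    unfolding eventually_at_top_linorder by auto
  obtain N0 where N0: "X0 \<le> real N0" using real_arch_simple by blast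
  \<comment> \<open>The second summand covers the finitely many \<open>N\<close> below the
    threshold: for N > 0 the harmonic sum is at least 1.\<close>
  define C where "C = 4 * c + (\<Sum>n<N0. a n)"
  have a0: "a n \<ge> 0" for n by (simp add: a_def)
  have C: "C \<ge> 4 * c" "C \<ge> (\<Sum>n<N0. a n)" "C > 0"
    using c(1) a0 by (auto simp: C_def intro!: sum_nonneg add_pos_nonneg)
  have "(\<Sum>n<N. a n) \<le> C * (\<Sum>n<N. 1 / real (Suc n))" for N
  proof (cases "N0 \<le> N")
    case True
    have "(\<Sum>n<N. a n) \<le> 4 * I (real (Suc N))"
      using weak_Mertens_integral_ge[of N] by (simp add: a_def I_def)
    also have "\<dots> \<le> 4 * (c * \<bar>ln (real (Suc N))\<bar>)" using X0[of "real (Suc N)"] N0 True by auto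
    also have "\<dots> = (4 * c) * ln (real (Suc N))" by simp
    also have "\<dots> \<le> C * (\<Sum>n<N. 1 / real (Suc n))"
      using C ln_le_harmonic c(1) by (intro mult_mono) auto
    finally show ?thesis .
  next
    case False
    show ?thesis
    proof (cases N)
      case (Suc M)
      have "(\<Sum>n<N. a n) \<le> (\<Sum>n<N0. a n)" using False a0 by (intro sum_mono2) auto
      also have "\<dots> \<le> C * 1" using C by simp
      also have "1 \<le> (\<Sum>n<N. 1 / real (Suc n))"
        using sum_mono2[of "{..<N}" "{0}" "\<lambda>n. 1 / real (Suc n)"] Suc by simp
      finally show ?thesis using C by (simp add: mult_left_mono)
    qed simp
  qed
  then show ?thesis using C(3) by (intro that[of C]) (simp_all add: a_def sum_distrib_left)
qed

text \<open>Summand by summand this is s times the integral of M(x) x^(-s-1) over [n, n+1], that is,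
  the Dirichlet series of the Moebius function after Abel summation.\<close>

definition mertens_series :: "complex \<Rightarrow> complex" where
  "mertens_series s = (\<Sum>n. of_real (mertens (real (Suc n))) *
     (of_nat (Suc n) powr (- s) - of_nat (Suc (Suc n)) powr (- s)))"

lemma norm_powr_diff_le:
  assumes "Re s \<ge> -1"
  shows "norm (of_nat (Suc n) powr (- s) - of_nat (Suc (Suc n)) powr (- s) :: complex) \<le>
     norm s * real (Suc n) powr (- Re s - 1)"
proof -
  have "norm (taylor_rem 0 n (s + 1)) \<le> norm (ffc (Suc 0) (s + 1)) * real (Suc n) powr (- Re (s + 1) - real 0)"
    using assms by (intro taylor_rem_bound) auto
  moreover have "taylor_rem 0 n (s + 1) = of_nat (Suc (Suc n)) powr (- s) - of_nat (Suc n) powr (- s)"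
    by (simp add: taylor_rem_def ffc_def)
  moreover have "ffc (Suc 0) (s + 1) = - s" "- Re (s + 1) - real 0 = - Re s - 1" by (simp_all add: ffc_def)
  ultimately show ?thesis by (simp only: norm_minus_commute norm_minus_cancel)
qed

context
  assumes WM: weak_Mertens_hypothesis
begin

text \<open>Cauchy-Schwarz with n^(-3/2-eps) split as n^(-1-eps/2) n^(-1/2-eps/2): both sums of
  squares are O(1 + 1/eps), so the product of their square roots still has only one factor
  1/eps.\<close>

lemma mertens_abs_sum_bound:
  obtains K where "K > 0"
    "\<And>\<epsilon>. \<epsilon> > 0 \<Longrightarrow> summable (\<lambda>n. \<bar>mertens (real (Suc n))\<bar> * real (Suc n) powr (- 3/2 - \<epsilon>))"
    "\<And>\<epsilon>. \<epsilon> > 0 \<Longrightarrow> (\<Sum>n. \<bar>mertens (real (Suc n))\<bar> * real (Suc n) powr (- 3/2 - \<epsilon>)) \<le> K * (1 + 1 / \<epsilon>)"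
proof -
  obtain C where C: "C > 0"
    "\<And>N. (\<Sum>n<N. (mertens (real (Suc n)) / real (Suc n))\<^sup>2) \<le> (\<Sum>n<N. C * (1 / real (Suc n)))"
    by (rule weak_Mertens_sum_bound[OF WM]) (rule that)
  have main: "(\<Sum>n<N. \<bar>mertens (real (Suc n))\<bar> * real (Suc n) powr (- 3/2 - \<epsilon>)) \<le> sqrt C * (1 + 1 / \<epsilon>)" if \<epsilon>: "\<epsilon> > 0" for \<epsilon> N
  proof -
    define x where "x = (\<lambda>n. \<bar>mertens (real (Suc n))\<bar> * real (Suc n) powr (- 1 - \<epsilon> / 2))"
    define y where "y = (\<lambda>n. real (Suc n) powr (- 1/2 - \<epsilon> / 2))"
    have xy: "x n * y n = \<bar>mertens (real (Suc n))\<bar> * real (Suc n) powr (- 3/2 - \<epsilon>)" for n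
      by (simp add: x_def y_def mult.assoc flip: powr_add)
    have y2: "(y n)\<^sup>2 = real (Suc n) powr (- 1 - \<epsilon>)" for n
      by (simp add: y_def power2_eq_square flip: powr_add)
    have x2: "(x n)\<^sup>2 = (mertens (real (Suc n)) / real (Suc n))\<^sup>2 * real (Suc n) powr (- \<epsilon>)" for n
    proof -
      have "(real (Suc n) powr (- 1 - \<epsilon> / 2))\<^sup>2 = real (Suc n) powr (- 2 + (- \<epsilon>))"
        by (simp add: power2_eq_square flip: powr_add)
      also have "\<dots> = real (Suc n) powr (- 2) * real (Suc n) powr (- \<epsilon>)" by (rule powr_add)
      also have "real (Suc n) powr (- 2) = 1 / (real (Suc n))\<^sup>2" by (simp add: powr_minus powr_numeral divide_inverse)
      finally show ?thesis by (simp add: x_def power_mult_distrib power_divide del: of_nat_Suc)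
    qed
    have "(\<Sum>n<N. (x n)\<^sup>2) \<le> (\<Sum>n<N. C * (1 / real (Suc n)) * real (Suc n) powr (- \<epsilon>))"
      unfolding x2
    proof (rule sum_le_weighted[OF C(2)])
      show "decseq (\<lambda>n. real (Suc n) powr (- \<epsilon>))"
        unfolding decseq_Suc_iff using \<epsilon> by (intro allI powr_mono2') auto
    qed auto
    also have "\<dots> = C * (\<Sum>n<N. real (Suc n) powr (- 1 - \<epsilon>))"
    proof -
      have "(1 / real (Suc n)) * real (Suc n) powr (- \<epsilon>) = real (Suc n) powr (- 1 - \<epsilon>)" for n
        using powr_add[of "real (Suc n)" "-1" "- \<epsilon>"] by (simp add: powr_minus divide_inverse)
      then show ?thesis by (simp only: sum_distrib_left mult.assoc)
    qed
    also have "\<dots> \<le> C * (1 + 1 / \<epsilon>)" using C sum_powr_le[OF \<epsilon>] by (intro mult_left_mono) auto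
    finally have X: "(\<Sum>n<N. (x n)\<^sup>2) \<le> C * (1 + 1 / \<epsilon>)" .
    have "(\<Sum>n<N. x n * y n)\<^sup>2 \<le> (\<Sum>n<N. (x n)\<^sup>2) * (\<Sum>n<N. (y n)\<^sup>2)" by (rule Cauchy_Schwarz_ineq_sum)
    also have "\<dots> \<le> (C * (1 + 1 / \<epsilon>)) * (1 + 1 / \<epsilon>)"
      unfolding y2 using X sum_powr_le[OF \<epsilon>] C \<epsilon> by (intro mult_mono) (auto intro!: sum_nonneg)
    finally have "(\<Sum>n<N. x n * y n)\<^sup>2 \<le> (C * (1 + 1 / \<epsilon>)) * (1 + 1 / \<epsilon>)" .
    moreover have "(C * (1 + 1 / \<epsilon>)) * (1 + 1 / \<epsilon>) = (sqrt C * (1 + 1 / \<epsilon>))\<^sup>2"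
      using C by (simp add: power_mult_distrib power2_eq_square)
    ultimately have "(\<Sum>n<N. x n * y n)\<^sup>2 \<le> (sqrt C * (1 + 1 / \<epsilon>))\<^sup>2" by (simp only:)
    then have "(\<Sum>n<N. x n * y n) \<le> sqrt C * (1 + 1 / \<epsilon>)"
      by (rule power2_le_imp_le) (use C \<epsilon> in auto)
    then show ?thesis unfolding xy .
  qed
  have s: "summable (\<lambda>n. \<bar>mertens (real (Suc n))\<bar> * real (Suc n) powr (- 3/2 - \<epsilon>))" if "\<epsilon> > 0" for \<epsilon>
    by (rule summableI_nonneg_bounded[OF _ main[OF that]]) auto
  show ?thesis
  proof (rule that[of "sqrt C"])
    show "(\<Sum>n. \<bar>mertens (real (Suc n))\<bar> * real (Suc n) powr (- 3/2 - \<epsilon>)) \<le> sqrt C * (1 + 1 / \<epsilon>)" if "\<epsilon> > 0" for \<epsilon>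
      by (rule suminf_le_const[OF s[OF that] main[OF that]])
  qed (use C s in auto)
qed

lemma mertens_series_bound:
  obtains K where "K > 0"
    "\<And>s. Re s > 1/2 \<Longrightarrow> summable (\<lambda>n. of_real (mertens (real (Suc n))) *
     (of_nat (Suc n) powr (- s) - of_nat (Suc (Suc n)) powr (- s)) :: complex)"
    "\<And>s. Re s > 1/2 \<Longrightarrow> norm (mertens_series s) \<le> norm s * K * (1 + 1 / (Re s - 1/2))"
proof -
  obtain K where K: "K > 0"
    "\<And>\<epsilon>. \<epsilon> > 0 \<Longrightarrow> summable (\<lambda>n. \<bar>mertens (real (Suc n))\<bar> * real (Suc n) powr (- 3/2 - \<epsilon>))"
    "\<And>\<epsilon>. \<epsilon> > 0 \<Longrightarrow> (\<Sum>n. \<bar>mertens (real (Suc n))\<bar> * real (Suc n) powr (- 3/2 - \<epsilon>)) \<le> K * (1 + 1 / \<epsilon>)"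
    by (rule mertens_abs_sum_bound) (rule that)
  have b: "norm (of_real (mertens (real (Suc n))) * (of_nat (Suc n) powr (- s) - of_nat (Suc (Suc n)) powr (- s)) :: complex)
     \<le> norm s * (\<bar>mertens (real (Suc n))\<bar> * real (Suc n) powr (- 3/2 - (Re s - 1/2)))" if s: "Re s > 1/2" for s n
  proof -
    have "norm (of_real (mertens (real (Suc n))) * (of_nat (Suc n) powr (- s) - of_nat (Suc (Suc n)) powr (- s)) :: complex)
      \<le> \<bar>mertens (real (Suc n))\<bar> * (norm s * real (Suc n) powr (- Re s - 1))"
      unfolding norm_mult norm_of_real using s by (intro mult_left_mono norm_powr_diff_le) auto
    also have "- Re s - 1 = - 3/2 - (Re s - 1/2)" by simp
    finally show ?thesis by (simp only: mult_ac)
  qed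
  have sn: "summable (\<lambda>n. norm s * (\<bar>mertens (real (Suc n))\<bar> * real (Suc n) powr (- 3/2 - (Re s - 1/2))))" if "Re s > 1/2" for s
    using that by (intro summable_mult K(2)) simp
  show ?thesis
  proof (rule that[OF K(1)])
    fix s :: complex assume s: "Re s > 1/2"
    show "summable (\<lambda>n. of_real (mertens (real (Suc n))) * (of_nat (Suc n) powr (- s) - of_nat (Suc (Suc n)) powr (- s)) :: complex)"
      by (rule summable_norm_cancel, rule summable_comparison_test'[OF sn[OF s]]) (use b[OF s] in simp)
    have "norm (mertens_series s) \<le> (\<Sum>n. norm s * (\<bar>mertens (real (Suc n))\<bar> * real (Suc n) powr (- 3/2 - (Re s - 1/2))))"
      unfolding mertens_series_def by (rule norm_suminf_le[OF b[OF s] sn[OF s]])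
    also have "\<dots> = norm s * (\<Sum>n. \<bar>mertens (real (Suc n))\<bar> * real (Suc n) powr (- 3/2 - (Re s - 1/2)))"
      using s by (intro suminf_mult K(2)) simp
    also have "\<dots> \<le> norm s * (K * (1 + 1 / (Re s - 1/2)))" using s by (intro mult_left_mono K(3)) auto
    finally show "norm (mertens_series s) \<le> norm s * K * (1 + 1 / (Re s - 1/2))" by simp
  qed
qed

lemma mertens_series_holomorphic: "mertens_series holomorphic_on {s. Re s > 1/2}"
proof (unfold mertens_series_def, rule holomorphic_uniform_sequence)
  show "open {s. Re s > 1/2}" by (rule open_halfspace_Re_gt)
  show "(\<lambda>s. \<Sum>n<m. of_real (mertens (real (Suc n))) * (of_nat (Suc n) powr (- s) - of_nat (Suc (Suc n)) powr (- s)))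
     holomorphic_on {s. Re s > 1/2}" for m
    by (intro holomorphic_intros)
next
  fix s0 :: complex assume "s0 \<in> {s. Re s > 1/2}"
  define d where "d = (Re s0 - 1/2) / 2"
  have d: "d > 0" using \<open>s0 \<in> _\<close> by (simp add: d_def)
  have re: "Re s \<ge> 1/2 + d" "norm s \<le> norm s0 + d" if "s \<in> cball s0 d" for s
  proof -
    have "Re s0 - Re s \<le> norm (s0 - s)" using complex_Re_le_cmod[of "s0 - s"] by simp
    then show "Re s \<ge> 1/2 + d" using that by (simp add: dist_norm d_def field_simps)
    show "norm s \<le> norm s0 + d" using that norm_triangle_sub[of s s0] by (simp add: dist_norm norm_minus_commute)
  qed
  obtain K where K: "K > 0"
    "\<And>\<epsilon>. \<epsilon> > 0 \<Longrightarrow> summable (\<lambda>n. \<bar>mertens (real (Suc n))\<bar> * real (Suc n) powr (- 3/2 - \<epsilon>))"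
    "\<And>\<epsilon>. \<epsilon> > 0 \<Longrightarrow> (\<Sum>n. \<bar>mertens (real (Suc n))\<bar> * real (Suc n) powr (- 3/2 - \<epsilon>)) \<le> K * (1 + 1 / \<epsilon>)"
    by (rule mertens_abs_sum_bound) (rule that)
  have "uniform_limit (cball s0 d) (\<lambda>m s. \<Sum>n<m. of_real (mertens (real (Suc n))) * (of_nat (Suc n) powr (- s) - of_nat (Suc (Suc n)) powr (- s)))
     (\<lambda>s. \<Sum>n. of_real (mertens (real (Suc n))) * (of_nat (Suc n) powr (- s) - of_nat (Suc (Suc n)) powr (- s))) sequentially"
  proof (rule Weierstrass_m_test)
    fix n s assume s: "s \<in> cball s0 d"
    have "norm (of_real (mertens (real (Suc n))) * (of_nat (Suc n) powr (- s) - of_nat (Suc (Suc n)) powr (- s)) :: complex)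
      \<le> \<bar>mertens (real (Suc n))\<bar> * (norm s * real (Suc n) powr (- Re s - 1))"
      unfolding norm_mult norm_of_real using re[OF s] d by (intro mult_left_mono norm_powr_diff_le) auto
    also have "\<dots> \<le> \<bar>mertens (real (Suc n))\<bar> * ((norm s0 + d) * real (Suc n) powr (- 3/2 - d))"
      using re[OF s] d by (intro mult_left_mono mult_mono powr_mono) auto
    finally show "norm (of_real (mertens (real (Suc n))) * (of_nat (Suc n) powr (- s) - of_nat (Suc (Suc n)) powr (- s)) :: complex)
      \<le> (norm s0 + d) * (\<bar>mertens (real (Suc n))\<bar> * real (Suc n) powr (- 3/2 - d))" by (simp only: mult_ac)
  qed (use K(2)[OF d] in \<open>rule summable_mult\<close>)
  moreover have "cball s0 d \<subseteq> {s. Re s > 1/2}" using re d by fastforce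
  ultimately show "\<exists>d>0. cball s0 d \<subseteq> {s. Re s > 1/2} \<and> uniform_limit (cball s0 d)
     (\<lambda>m s. \<Sum>n<m. of_real (mertens (real (Suc n))) * (of_nat (Suc n) powr (- s) - of_nat (Suc (Suc n)) powr (- s)))
     (\<lambda>s. \<Sum>n. of_real (mertens (real (Suc n))) * (of_nat (Suc n) powr (- s) - of_nat (Suc (Suc n)) powr (- s))) sequentially"
    using d by blast
qed

text \<open>For \<open>Re s > 1\<close> the trivial bound |M(N)| <= N makes the boundary term of the
  Abel summation vanish.\<close>

lemma mertens_series_eq_moebius:
  assumes s: "Re s > 1"
  shows "mertens_series s = (\<Sum>n. of_int (moebius (Suc n)) * of_nat (Suc n) powr (- s))"
proof -
  obtain K where K: "K > 0"
    "\<And>s. Re s > 1/2 \<Longrightarrow> summable (\<lambda>n. of_real (mertens (real (Suc n))) *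
     (of_nat (Suc n) powr (- s) - of_nat (Suc (Suc n)) powr (- s)) :: complex)"
    "\<And>s. Re s > 1/2 \<Longrightarrow> norm (mertens_series s) \<le> norm s * K * (1 + 1 / (Re s - 1/2))"
    by (rule mertens_series_bound) (rule that)
  then have "(\<lambda>n. of_real (mertens (real (Suc n))) * (of_nat (Suc n) powr (- s) - of_nat (Suc (Suc n)) powr (- s))) sums mertens_series s"
    using s unfolding mertens_series_def by (intro summable_sums) auto
  then have 1: "(\<lambda>N. \<Sum>n<N. of_real (mertens (real (Suc n))) * (of_nat (Suc n) powr (- s) - of_nat (Suc (Suc n)) powr (- s))) \<longlonglongrightarrow> mertens_series s"
    by (simp add: sums_def)
  have 2: "(\<lambda>N. of_real (mertens (real N)) * of_nat (Suc N) powr (- s) :: complex) \<longlonglongrightarrow> 0"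
  proof (rule Lim_null_comparison)
    show "\<forall>\<^sub>F N in sequentially. norm (of_real (mertens (real N)) * of_nat (Suc N) powr (- s) :: complex) \<le> real (Suc N) powr (1 - Re s)"
    proof (intro always_eventually allI)
      fix N
      have "norm (of_real (mertens (real N)) * of_nat (Suc N) powr (- s) :: complex) = \<bar>mertens (real N)\<bar> * real (Suc N) powr (- Re s)"
        unfolding norm_mult norm_nat_powr by simp
      also have "\<dots> \<le> real (Suc N) * real (Suc N) powr (- Re s)"
        using abs_mertens_le[of N] by (intro mult_right_mono) auto
      also have "\<dots> = real (Suc N) powr (1 - Re s)" using powr_add[of "real (Suc N)" 1 "- Re s"] by simp
      finally show "norm (of_real (mertens (real N)) * of_nat (Suc N) powr (- s) :: complex) \<le> real (Suc N) powr (1 - Re s)" .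
    qed
    show "(\<lambda>N. real (Suc N) powr (1 - Re s)) \<longlonglongrightarrow> 0"
      using s by (intro tendsto_neg_powr filterlim_compose[OF filterlim_real_sequentially filterlim_Suc]) auto
  qed
  have "(\<lambda>N. \<Sum>n<N. of_int (moebius (Suc n)) * of_nat (Suc n) powr (- s)) \<longlonglongrightarrow> mertens_series s + 0"
    unfolding moebius_Abel_summation[where f = "\<lambda>n. of_nat (Suc n) powr (- s)"] by (intro tendsto_add 1 2)
  then show ?thesis by (simp add: sums_def[symmetric] sums_iff)
qed

text \<open>Stated with \<open>zeta_reg\<close> so that the point 1 is included; there it gives
  \<open>mertens_series 1 = 0\<close>.\<close>

lemma mertens_series_zeta_reg:
  assumes "Re s > 1/2"
  shows "mertens_series s * zeta_reg s = s - 1"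
proof (rule analytic_continuation_open[of "{s. Re s > 1}" "{s. Re s > 1/2}" "\<lambda>s. mertens_series s * zeta_reg s" "\<lambda>s. s - 1"])
  show "mertens_series z * zeta_reg z = z - 1" if "z \<in> {s. Re s > 1}" for z
    using that moebius_zeta(2)[of z] mertens_series_eq_moebius[of z] by (auto simp: zeta_reg_def)
  show "(\<lambda>s. mertens_series s * zeta_reg s) holomorphic_on {s. Re s > 1/2}"
    by (intro holomorphic_intros mertens_series_holomorphic zeta_reg_holomorphic)
  show "open {s. Re s > 1}" "open {s. Re s > 1/2}" by (rule open_halfspace_Re_gt)+
  show "connected {s. Re s > 1/2}" by (intro convex_connected convex_halfspace_Re_gt)
  show "{s. Re s > 1} \<noteq> {}" by (auto intro!: exI[of _ 2])
  show "(\<lambda>s. s - 1) holomorphic_on {s. Re s > 1/2}" by (intro holomorphic_intros)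
qed (use assms in auto)

lemma mertens_series_zeta:
  assumes "Re s > 1/2" "s \<noteq> 1"
  shows "mertens_series s * zeta s = 1"
proof -
  have "(s - 1) * (mertens_series s * zeta s) = (s - 1) * 1"
    using mertens_series_zeta_reg[OF assms(1)] assms(2) by (simp add: zeta_reg_def mult_ac)
  then show ?thesis using assms(2) by (metis mult_left_cancel right_minus_eq)
qed

lemma zeta_nonzero_right:
  assumes "Re s > 1/2" "s \<noteq> 1"
  shows "zeta s \<noteq> 0"
  using mertens_series_zeta[OF assms] by auto

text \<open>The functional equation would reflect a zero left of the line to one on its right, where
  the Mertens series excludes zeros.\<close>

lemma zeta_zero_Re:
  assumes "zeta s = 0" "0 < Re s" "Re s < 1"
  shows "Re s = 1/2"
proof (rule antisym)
  show "Re s \<le> 1/2" using zeta_nonzero_right[of s] assms by fastforce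
  show "Re s \<ge> 1/2"
  proof (rule ccontr)
    assume "\<not> Re s \<ge> 1/2"
    then have "Re (1 - s) > 1/2" "1 - s \<noteq> 1" using assms by auto
    then have "zeta (1 - s) \<noteq> 0" by (rule zeta_nonzero_right)
    moreover have "Gamma ((1 - s) / 2) \<noteq> 0"
      using assms Gamma_not_nonpos_Ints[of "(1 - s) / 2"] by (simp add: Gamma_eq_zero_iff)
    moreover have "of_real pi powr (s - 1/2) \<noteq> (0::complex)" by simp
    ultimately show False using zeta_functional_equation[of s] assms by simp
  qed
qed

lemma nontrivial_zeta_zeros_eq: "nontrivial_zeta_zeros = {1/2 + \<i> * of_real \<gamma> | \<gamma>. zeta (1/2 + \<i> * of_real \<gamma>) = 0}"
proof (intro equalityI subsetI)
  fix \<rho> assume "\<rho> \<in> nontrivial_zeta_zeros"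
  then have "zeta \<rho> = 0" "Re \<rho> = 1/2" using zeta_zero_Re by (auto simp: nontrivial_zeta_zeros_def)
  then show "\<rho> \<in> {1/2 + \<i> * of_real \<gamma> | \<gamma>. zeta (1/2 + \<i> * of_real \<gamma>) = 0}"
  proof -
    assume *: "zeta \<rho> = 0" "Re \<rho> = 1/2"
    then have "\<rho> = 1/2 + \<i> * of_real (Im \<rho>)" by (simp add: complex_eq_iff)
    then show ?thesis using *(1) by (metis (mono_tags, lifting) mem_Collect_eq)
  qed
qed (auto simp: nontrivial_zeta_zeros_def)

lemma inverse_zeta_bound:
  obtains K where "K > 0"
    "\<And>s. Re s > 1/2 \<Longrightarrow> s \<noteq> 1 \<Longrightarrow> norm (1 / zeta s) \<le> norm s * K * (1 + 1 / (Re s - 1/2))"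
proof -
  obtain K where K: "K > 0"
    "\<And>s. Re s > 1/2 \<Longrightarrow> summable (\<lambda>n. of_real (mertens (real (Suc n))) *
     (of_nat (Suc n) powr (- s) - of_nat (Suc (Suc n)) powr (- s)) :: complex)"
    "\<And>s. Re s > 1/2 \<Longrightarrow> norm (mertens_series s) \<le> norm s * K * (1 + 1 / (Re s - 1/2))"
    by (rule mertens_series_bound) (rule that)
  have "1 / zeta s = mertens_series s" if "Re s > 1/2" "s \<noteq> 1" for s
    using mertens_series_zeta[OF that] by (metis nonzero_eq_divide_eq zeta_nonzero_right that)
  then show ?thesis using K(1,3) by (intro that[of K]) auto
qed

text \<open>At distance e to the right of the zero, |zeta(rho + e)| / e is at least 1 / (K |rho + e|
  (1 + e)), and as e tends to 0 the left side tends to |zeta'(rho)|. Simplicity of the zeros is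
  included.\<close>

lemma zeta_deriv_zero_bound:
  obtains K where "K > 0"
    "\<And>\<gamma>. zeta (1/2 + \<i> * of_real \<gamma>) = 0 \<Longrightarrow> 1 \<le> norm (deriv zeta (1/2 + \<i> * of_real \<gamma>)) * (K * norm (1/2 + \<i> * complex_of_real \<gamma>))"
proof -
  obtain K where K: "K > 0"
    "\<And>s. Re s > 1/2 \<Longrightarrow> s \<noteq> 1 \<Longrightarrow> norm (1 / zeta s) \<le> norm s * K * (1 + 1 / (Re s - 1/2))"
    by (rule inverse_zeta_bound) (rule that)
  have "1 \<le> norm (deriv zeta (1/2 + \<i> * of_real \<gamma>)) * (K * norm (1/2 + \<i> * complex_of_real \<gamma>))"
    if z: "zeta (1/2 + \<i> * of_real \<gamma>) = 0" for \<gamma>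
  proof -
    define \<rho> where "\<rho> = 1/2 + \<i> * complex_of_real \<gamma>"
    \<comment> \<open>Starting at 1/3 keeps the real part of \<open>\<rho> + of_real (e n)\<close>
      below 1, so the point 1 is never met.\<close>
    define e where "e = (\<lambda>n. 1 / real (Suc (Suc (Suc n))))"
    have e: "0 < e n" "e n < 1/2" for n by (auto simp: e_def)
    have e0: "e \<longlonglongrightarrow> 0" unfolding e_def by real_asymp
    have "\<rho> \<in> - {1}" by (auto simp: \<rho>_def complex_eq_iff)
    then have "(zeta has_field_derivative deriv zeta \<rho>) (at \<rho>)"
      using zeta_holomorphic by (intro holomorphic_derivI) auto
    then have *: "(\<lambda>n. (zeta (X n) - zeta \<rho>) / (X n - \<rho>)) \<longlonglongrightarrow> deriv zeta \<rho>"
      if "\<And>n. X n \<noteq> \<rho>" "X \<longlonglongrightarrow> \<rho>" for X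
      using that unfolding has_field_derivative_iff tendsto_at_iff_sequentially comp_def by auto
    have "(\<lambda>n. (zeta (\<rho> + of_real (e n)) - zeta \<rho>) / (\<rho> + of_real (e n) - \<rho>)) \<longlonglongrightarrow> deriv zeta \<rho>"
    proof (rule *)
      show "\<rho> + of_real (e n) \<noteq> \<rho>" for n using e(1)[of n] by simp
      show "(\<lambda>n. \<rho> + of_real (e n)) \<longlonglongrightarrow> \<rho>"
        using tendsto_add[OF tendsto_const[of \<rho>] tendsto_of_real[OF e0]] by simp
    qed
    then have lim: "(\<lambda>n. zeta (\<rho> + of_real (e n)) / of_real (e n)) \<longlonglongrightarrow> deriv zeta \<rho>"
      using z by (simp add: \<rho>_def)
    have "(\<lambda>n. norm (zeta (\<rho> + of_real (e n)) / of_real (e n)) * (norm (\<rho> + of_real (e n)) * K * (e n + 1)))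
        \<longlonglongrightarrow> norm (deriv zeta \<rho>) * (norm (\<rho> + of_real 0) * K * (0 + 1))"
      by (intro tendsto_intros lim e0)
    moreover have "1 \<le> norm (zeta (\<rho> + of_real (e n)) / of_real (e n)) * (norm (\<rho> + of_real (e n)) * K * (e n + 1))" for n
    proof -
      define s where "s = \<rho> + of_real (e n)"
      have s: "Re s - 1/2 = e n" "Re s > 1/2" "s \<noteq> 1" using e[of n] by (auto simp: s_def \<rho>_def complex_eq_iff)
      have nz: "zeta s \<noteq> 0" using s by (intro zeta_nonzero_right) auto
      have "1 = norm (zeta s) * norm (1 / zeta s)" using nz by (simp add: norm_divide)
      also have "\<dots> \<le> norm (zeta s) * (norm s * K * (1 + 1 / e n))"
        using K(2)[of s] s by (intro mult_left_mono) auto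
      also have "1 + 1 / e n = (e n + 1) / e n" using e[of n] by (simp add: field_simps)
      also have "norm (zeta s) * (norm s * K * ((e n + 1) / e n)) = norm (zeta s / of_real (e n)) * (norm s * K * (e n + 1))"
        using e[of n] by (simp add: norm_divide)
      finally show ?thesis by (simp add: s_def)
    qed
    ultimately have "1 \<le> norm (deriv zeta \<rho>) * (norm (\<rho> + of_real 0) * K * (0 + 1))"
      by (intro LIMSEQ_le_const) auto
    then show ?thesis by (simp add: \<rho>_def mult_ac)
  qed
  then show ?thesis using K(1) that by blast
qed

text \<open>M changes by at most 1 per step, so |M(x)| >= delta x persists with half the size over a
  block of length about delta x / 2, and such a block adds at least delta^2/16 to the sum of
  |M(n)|/n^2. That sum converges, so this cannot happen for arbitrarily large x.\<close>

lemma mertens_over_n_tendsto_0: "(\<lambda>N. mertens (real N) / real (Suc N)) \<longlonglongrightarrow> 0"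
proof -
  define t where "t = (\<lambda>n. \<bar>mertens (real (Suc n))\<bar> / (real (Suc n))\<^sup>2)"
  have t: "summable t"
  proof -
    obtain K where K: "K > 0"
      "\<And>\<epsilon>. \<epsilon> > 0 \<Longrightarrow> summable (\<lambda>n. \<bar>mertens (real (Suc n))\<bar> * real (Suc n) powr (- 3/2 - \<epsilon>))"
      "\<And>\<epsilon>. \<epsilon> > 0 \<Longrightarrow> (\<Sum>n. \<bar>mertens (real (Suc n))\<bar> * real (Suc n) powr (- 3/2 - \<epsilon>)) \<le> K * (1 + 1 / \<epsilon>)"
      by (rule mertens_abs_sum_bound) (rule that)
    have "real (Suc n) powr (- 3/2 - 1/2) = 1 / (real (Suc n))\<^sup>2" for n
    proof -
      have "real (Suc n) powr (- 3/2 - 1/2) = real (Suc n) powr (- 2)" by (rule arg_cong) simp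
      also have "\<dots> = inverse (real (Suc n) powr 2)" by (rule powr_minus)
      also have "\<dots> = 1 / (real (Suc n))\<^sup>2" by (subst powr_numeral) (simp_all add: inverse_eq_divide)
      finally show ?thesis .
    qed
    then show ?thesis using K(2)[of "1/2"] by (simp only: t_def) simp
  qed
  have "\<exists>N0. \<forall>N\<ge>N0. \<bar>mertens (real (Suc N))\<bar> < \<delta> * real (Suc N)" if \<delta>: "0 < \<delta>" "\<delta> \<le> 1" for \<delta>
  proof -
    have "Cauchy (\<lambda>n. \<Sum>k<n. t k)" using t unfolding summable_iff_convergent by (rule convergent_Cauchy)
    then obtain N0 where N0: "\<And>m n. m \<ge> N0 \<Longrightarrow> n \<ge> N0 \<Longrightarrow> \<bar>(\<Sum>k<m. t k) - (\<Sum>k<n. t k)\<bar> < \<delta>\<^sup>2 / 16"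
      using CauchyD[of _ "\<delta>\<^sup>2 / 16"] \<delta> by fastforce
    have "\<bar>mertens (real (Suc N))\<bar> < \<delta> * real (Suc N)" if N: "N \<ge> N0" for N
    proof (rule ccontr)
      define x where "x = real (Suc N)"
      assume "\<not> \<bar>mertens (real (Suc N))\<bar> < \<delta> * real (Suc N)"
      then have big: "\<bar>mertens x\<bar> \<ge> \<delta> * x" by (simp add: x_def)
      define k where "k = nat \<lfloor>\<delta> * x / 2\<rfloor>"
      have x: "x \<ge> 1" by (simp add: x_def)
      have k: "real k \<le> \<delta> * x / 2" "\<delta> * x / 2 \<le> real (Suc k)"
      proof -
        have "real k = of_int \<lfloor>\<delta> * x / 2\<rfloor>" using \<delta> x by (simp add: k_def)
        then show "real k \<le> \<delta> * x / 2" "\<delta> * x / 2 \<le> real (Suc k)" by linarith+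
      qed
      have kx: "real k \<le> x" using k(1) \<delta> mult_right_mono[of \<delta> 1 x] x by linarith
      have lower: "\<delta> / (8 * x) \<le> t n" if n: "n \<in> {N..<N + Suc k}" for n
      proof -
        define j where "j = n - N"
        have j: "n = N + j" "j \<le> k" using n by (auto simp: j_def)
        have "\<bar>mertens (real (Suc N + j)) - mertens (real (Suc N))\<bar> \<le> real j" by (rule abs_mertens_diff_le)
        then have "\<bar>mertens (real (Suc n))\<bar> \<ge> \<delta> * x - real j" using big j by (simp add: x_def)
        then have 1: "\<bar>mertens (real (Suc n))\<bar> \<ge> \<delta> * x / 2" using k j by linarith
        have "real (Suc n) \<le> 2 * x" using j kx by (simp add: x_def)
        then have "(real (Suc n))\<^sup>2 \<le> (2 * x)\<^sup>2" by (intro power_mono) auto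
        then have "(\<delta> * x / 2) / (2 * x)\<^sup>2 \<le> \<bar>mertens (real (Suc n))\<bar> / (real (Suc n))\<^sup>2"
          using 1 \<delta> x by (intro frac_le) auto
        then show ?thesis using x by (simp add: t_def power2_eq_square field_simps)
      qed
      have "(\<Sum>n<N + Suc k. t n) - (\<Sum>n<N. t n) = (\<Sum>n\<in>{N..<N + Suc k}. t n)"
        by (subst sum_diff_nat_ivl[of 0 N "N + Suc k", symmetric]) (auto simp: atLeast0LessThan)
      also have "\<dots> \<ge> (\<Sum>n\<in>{N..<N + Suc k}. \<delta> / (8 * x))" using lower by (intro sum_mono) auto
      also have "(\<Sum>n\<in>{N..<N + Suc k}. \<delta> / (8 * x)) = real (Suc k) * (\<delta> / (8 * x))" by simp
      also have "real (Suc k) * (\<delta> / (8 * x)) \<ge> (\<delta> * x / 2) * (\<delta> / (8 * x))"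
        using k \<delta> x by (intro mult_right_mono) auto
      also have "(\<delta> * x / 2) * (\<delta> / (8 * x)) = \<delta>\<^sup>2 / 16" using x by (simp add: power2_eq_square)
      finally show False using N0[OF trans_le_add1[OF N] N, of "Suc k"] by linarith
    qed
    then show ?thesis by blast
  qed
  note small = this
  have "(\<lambda>N. mertens (real (Suc N)) / real (Suc N)) \<longlonglongrightarrow> 0"
  proof (rule LIMSEQ_I)
    fix r :: real assume r: "r > 0"
    obtain N0 where N0: "\<And>N. N \<ge> N0 \<Longrightarrow> \<bar>mertens (real (Suc N))\<bar> < min r 1 * real (Suc N)"
      using small[of "min r 1"] r by auto
    have "norm (mertens (real (Suc N)) / real (Suc N) - 0) < r" if "N \<ge> N0" for N
    proof -
      have "\<bar>mertens (real (Suc N))\<bar> < min r 1 * real (Suc N)" using N0 that by blast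
      also have "\<dots> \<le> r * real (Suc N)" by (intro mult_right_mono) auto
      finally show ?thesis by (simp add: abs_divide divide_less_eq del: of_nat_Suc)
    qed
    then show "\<exists>no. \<forall>n\<ge>no. norm (mertens (real (Suc n)) / real (Suc n) - 0) < r" by blast
  qed
  then have "(\<lambda>N. mertens (real N) / real N) \<longlonglongrightarrow> 0" using filterlim_sequentially_Suc[of "\<lambda>N. mertens (real N) / real N"] by simp
  moreover have "(\<lambda>N. real N / real (Suc N)) \<longlonglongrightarrow> 1" by real_asymp
  ultimately have "(\<lambda>N. (mertens (real N) / real N) * (real N / real (Suc N))) \<longlonglongrightarrow> 0 * 1" by (intro tendsto_mult)
  moreover have "(mertens (real N) / real N) * (real N / real (Suc N)) = mertens (real N) / real (Suc N)" for N
    by (cases "N = 0") (auto simp: mertens_0)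
  ultimately show ?thesis by simp
qed

text \<open>The pole of zeta forces \<open>mertens_series 1 = 0\<close>, and M(N) = o(N) removes the
  boundary term of the Abel summation. The result disposes of the terms - 1 left by the Mellin
  formula.\<close>

lemma moebius_over_n_sums_0: "(\<lambda>n. of_int (moebius (Suc n)) / real (Suc n)) sums 0"
proof -
  have "mertens_series 1 = 0" using mertens_series_zeta_reg[of 1] by (simp add: zeta_reg_def)
  moreover obtain K where K: "K > 0"
    "\<And>s. Re s > 1/2 \<Longrightarrow> summable (\<lambda>n. of_real (mertens (real (Suc n))) *
     (of_nat (Suc n) powr (- s) - of_nat (Suc (Suc n)) powr (- s)) :: complex)"
    "\<And>s. Re s > 1/2 \<Longrightarrow> norm (mertens_series s) \<le> norm s * K * (1 + 1 / (Re s - 1/2))"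
    by (rule mertens_series_bound) (rule that)
  ultimately have "(\<lambda>n. of_real (mertens (real (Suc n))) * (of_nat (Suc n) powr (- 1) - of_nat (Suc (Suc n)) powr (- 1)) :: complex) sums 0"
    using summable_sums[of "\<lambda>n. of_real (mertens (real (Suc n))) * (of_nat (Suc n) powr (- 1) - of_nat (Suc (Suc n)) powr (- 1)) :: complex"]
    unfolding mertens_series_def by simp
  moreover have "of_real (mertens (real (Suc n))) * (of_nat (Suc n) powr (- 1) - of_nat (Suc (Suc n)) powr (- 1) :: complex) =
     of_real (mertens (real (Suc n)) * (1 / real (Suc n) - 1 / real (Suc (Suc n))))" for n
    by (simp add: powr_minus divide_inverse del: of_nat_Suc)
  ultimately have "(\<lambda>n. complex_of_real (mertens (real (Suc n)) * (1 / real (Suc n) - 1 / real (Suc (Suc n))))) sums of_real 0"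
    by (simp only: of_real_0)
  then have "(\<lambda>n. mertens (real (Suc n)) * (1 / real (Suc n) - 1 / real (Suc (Suc n)))) sums 0"
    by (subst (asm) sums_of_real_iff)
  then have 1: "(\<lambda>N. \<Sum>n<N. of_real (mertens (real (Suc n))) * (1 / real (Suc n) - 1 / real (Suc (Suc n)))) \<longlonglongrightarrow> 0"
    by (simp add: sums_def)
  have "(\<lambda>N. \<Sum>n<N. of_int (moebius (Suc n)) * (1 / real (Suc n))) \<longlonglongrightarrow> 0 + 0"
    unfolding moebius_Abel_summation[where f = "\<lambda>n. 1 / real (Suc n)"]
    using mertens_over_n_tendsto_0 by (intro tendsto_add 1) simp
  then show ?thesis by (simp add: sums_def)
qed

end

section \<open>The zeros on the critical line\<close>

definition crit :: "real \<Rightarrow> complex" where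
  "crit \<gamma> = 1/2 + \<i> * of_real \<gamma>"

definition ordinates :: "real set" where
  "ordinates = {\<gamma>. zeta (crit \<gamma>) = 0}"

text \<open>This is \<open>Gamma ((1 - v) / 2) / (2 * zeta v)\<close>, written so that it is regular at \<open>v = 1\<close>.\<close>
definition mellin_F :: "complex \<Rightarrow> complex" where
  "mellin_F v = - Gamma ((3 - v) / 2) / zeta_reg v"

lemma crit_simps [simp]: "Re (crit \<gamma>) = 1/2" "Im (crit \<gamma>) = \<gamma>" "crit \<gamma> \<noteq> 1" "crit \<gamma> \<noteq> 0"
  by (auto simp: crit_def complex_eq_iff)

lemma inj_crit: "inj crit"
  by (auto simp: inj_def complex_eq_iff)

lemma zeta_reg_crit_eq_0_iff: "zeta_reg (crit \<gamma>) = 0 \<longleftrightarrow> \<gamma> \<in> ordinates"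
  by (simp add: zeta_reg_eq_0_iff ordinates_def)

lemma mellin_F_eq:
  assumes "v \<noteq> 1" "Re v < 3"
  shows "mellin_F v = Gamma ((1 - v) / 2) / (2 * zeta v)"
proof -
  have "(1 - v) / 2 \<notin> \<int>\<^sub>\<le>\<^sub>0"
  proof
    assume "(1 - v) / 2 \<in> \<int>\<^sub>\<le>\<^sub>0"
    then obtain n :: int where n: "(1 - v) / 2 = of_int n" "n \<le> 0" by (auto elim!: nonpos_Ints_cases)
    then have v: "v = of_int (1 - 2 * n)" by (simp add: field_simps)
    then have "real_of_int (1 - 2 * n) < 3" using assms(2) by (metis Re_complex_of_real of_real_of_int_eq)
    then have "n = 0" using n(2) by linarith
    then show False using v assms(1) by simp
  qed
  then have "Gamma ((1 - v) / 2 + 1) = (1 - v) / 2 * Gamma ((1 - v) / 2)" by (rule Gamma_plus1)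
  moreover have "(1 - v) / 2 + 1 = (3 - v) / 2" by (simp add: field_simps)
  ultimately have g: "Gamma ((3 - v) / 2) = (1 - v) / 2 * Gamma ((1 - v) / 2)" by simp
  have e: "- ((1 - v) / 2 * x) = (v - 1) * (x / 2)" for x by (simp add: field_simps)
  have "mellin_F v = ((v - 1) * (Gamma ((1 - v) / 2) / 2)) / ((v - 1) * zeta v)"
    using assms(1) unfolding mellin_F_def g zeta_reg_def by (simp only: e if_False)
  then show ?thesis using assms(1) by simp
qed

lemma cnj_crit: "cnj (crit \<gamma>) = crit (- \<gamma>)"
  by (simp add: crit_def)

lemma zeta_deriv_cnj: "s \<noteq> 1 \<Longrightarrow> deriv zeta (cnj s) = cnj (deriv zeta s)"
proof (rule DERIV_imp_deriv)
  assume s: "s \<noteq> 1"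
  have "(zeta has_field_derivative deriv zeta (cnj (cnj s))) (at (cnj (cnj s)))"
    using s zeta_holomorphic by (intro holomorphic_derivI) auto
  then have "(cnj \<circ> zeta \<circ> cnj has_field_derivative cnj (deriv zeta s)) (at (cnj s))"
    using has_field_derivative_cnj_cnj[of zeta "deriv zeta s" "cnj s"] by simp
  moreover have "cnj \<circ> zeta \<circ> cnj = zeta" by (auto simp: zeta_cnj)
  ultimately show "(zeta has_field_derivative cnj (deriv zeta s)) (at (cnj s))" by simp
qed

lemma ordinates_uminus: "- \<gamma> \<in> ordinates \<longleftrightarrow> \<gamma> \<in> ordinates"
  by (simp add: ordinates_def cnj_crit[symmetric] zeta_cnj)

lemma zero_coeff_uminus: "zero_coeff (- \<gamma>) = cnj (zero_coeff \<gamma>)"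
proof -
  have "deriv zeta (crit (- \<gamma>)) = cnj (deriv zeta (crit \<gamma>))"
    by (simp add: cnj_crit[symmetric] zeta_deriv_cnj)
  then show ?thesis by (simp add: zero_coeff_def crit_def cnj_Gamma)
qed

lemma zero_notin_ordinates: "0 \<notin> ordinates"
  using zeta_half_nonzero by (simp add: ordinates_def crit_def)

section \<open>Counting zeros in discs\<close>

lemma factor_zeros:
  assumes "f holomorphic_on UNIV" "finite F" "\<And>a. a \<in> F \<Longrightarrow> f a = (0::complex)"
  obtains q where "q holomorphic_on UNIV" "\<And>z. f z = q z * (\<Prod>a\<in>F. z - a)"
proof -
  from assms(2,3) have "\<exists>q. q holomorphic_on UNIV \<and> (\<forall>z. f z = q z * (\<Prod>a\<in>F. z - a))"
  proof (induction F rule: finite_induct)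
    case empty
    then show ?case using assms(1) by (intro exI[of _ f]) simp
  next
    case (insert a F)
    then obtain q where q: "q holomorphic_on UNIV" "\<And>z. f z = q z * (\<Prod>a\<in>F. z - a)" by auto
    define q' where "q' = (\<lambda>z. if z = a then deriv q a else (q z - q a) / (z - a))"
    have "q' holomorphic_on UNIV" unfolding q'_def using q(1) by (intro pole_lemma) auto
    moreover have "f z = q' z * (\<Prod>a\<in>insert a F. z - a)" for z
    proof -
      have "(\<Prod>b\<in>F. a - b) \<noteq> 0" using insert by (auto simp: prod_zero_iff)
      then have "q a = 0" using q(2)[of a] insert by auto
      then have "q' z * (z - a) = q z" by (simp add: q'_def)
      then show ?thesis using insert q(2)[of z] by (simp add: mult.assoc[symmetric])
    qed
    ultimately show ?case by blast
  qed
  then show ?thesis using that by blast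
qed

text \<open>A form of Jensen's inequality: after division by the product of the \<open>z - a\<close>
  the maximum principle is used on the circle of radius \<open>R\<close>, where each factor is at
  least \<open>R - r\<close>, while at the centre it is at most \<open>r\<close>. As
  \<open>2 * r < R\<close>, every zero gains a factor above 1.\<close>

lemma card_zeros_le:
  fixes f :: "complex \<Rightarrow> complex"
  assumes f: "f holomorphic_on UNIV" and F: "finite F" "\<And>a. a \<in> F \<Longrightarrow> f a = 0" "\<And>a. a \<in> F \<Longrightarrow> dist c a \<le> r"
    and r: "0 < r" "2 * r < R" and B: "\<And>z. dist c z = R \<Longrightarrow> norm (f z) \<le> B"
  shows "norm (f c) * ((R - r) / r) ^ card F \<le> B"
proof -
  obtain q where q: "q holomorphic_on UNIV" "\<And>z. f z = q z * (\<Prod>a\<in>F. z - a)"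
    using factor_zeros[OF f F(1,2)] by blast
  have Rr: "R - r > 0" "R > 0" using r by auto
  have "norm (q c) \<le> B / (R - r) ^ card F"
  proof (rule maximum_modulus_frontier[where S = "cball c R" and f = q])
    show "q holomorphic_on interior (cball c R)" "continuous_on (closure (cball c R)) q"
      using q(1) by (auto intro: holomorphic_on_subset continuous_on_subset holomorphic_on_imp_continuous_on)
    fix z assume "z \<in> frontier (cball c R)"
    then have z: "dist c z = R" using Rr by simp
    have "(R - r) ^ card F \<le> norm (\<Prod>a\<in>F. z - a)"
    proof -
      have "(\<Prod>a\<in>F. R - r) \<le> (\<Prod>a\<in>F. norm (z - a))"
      proof (intro prod_mono conjI)
        fix a assume "a \<in> F"
        then have "dist c a \<le> r" using F by blast
        then show "R - r \<le> norm (z - a)" using z dist_triangle[of c z a] by (simp add: dist_norm norm_minus_commute)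
      qed (use Rr in auto)
      then show ?thesis by (simp add: prod_norm)
    qed
    then have "norm (q z) * (R - r) ^ card F \<le> norm (q z) * norm (\<Prod>a\<in>F. z - a)" by (intro mult_left_mono) auto
    also have "\<dots> \<le> B" using B[OF z] q(2)[of z] by (simp add: norm_mult)
    finally show "norm (q z) \<le> B / (R - r) ^ card F" using Rr by (simp add: field_simps)
  qed (use Rr in auto)
  moreover have "norm (\<Prod>a\<in>F. c - a) \<le> r ^ card F"
  proof -
    have "(\<Prod>a\<in>F. norm (c - a)) \<le> (\<Prod>a\<in>F. r)" using F by (intro prod_mono) (auto simp: dist_norm)
    then show ?thesis by (simp add: prod_norm)
  qed
  ultimately have "norm (q c) * norm (\<Prod>a\<in>F. c - a) \<le> (B / (R - r) ^ card F) * r ^ card F"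
    by (intro mult_mono) (auto intro: order_trans[OF norm_ge_zero])
  then have "norm (f c) \<le> (B / (R - r) ^ card F) * r ^ card F" using q(2)[of c] by (simp add: norm_mult)
  then show ?thesis using Rr r by (simp add: power_divide field_simps)
qed

text \<open>Trades the Gaussian centred at gamma for a decay in \<open>y\<close> that is uniform in
  gamma, at the price exp(|gamma|/64), which the coefficients can afford.\<close>

lemma exp_neg_square_le: "exp (- (y - \<gamma>)\<^sup>2) \<le> exp 1 * (exp (\<bar>\<gamma>\<bar> / 64) * exp (- \<bar>y\<bar> / 64))" for y \<gamma> :: real
proof -
  define u where "u = \<bar>y - \<gamma>\<bar>"
  have u2: "(y - \<gamma>)\<^sup>2 = u\<^sup>2" by (simp add: u_def)
  \<comment> \<open>Completing the square in u^2 - u/64, which is therefore above - 1.\<close>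
  have "0 \<le> (u - 1/128)\<^sup>2" by simp
  then have "u / 64 \<le> u\<^sup>2 + 1" by (simp add: power2_eq_square algebra_simps)
  moreover have "\<bar>y\<bar> \<le> \<bar>\<gamma>\<bar> + u" by (simp add: u_def)
  ultimately have "- (y - \<gamma>)\<^sup>2 \<le> 1 + (\<bar>\<gamma>\<bar> / 64 + - \<bar>y\<bar> / 64)" unfolding u2 by linarith
  then show ?thesis by (simp flip: exp_add)
qed

lemma one_plus_abs_exp: "(1 + \<bar>y\<bar>) * exp (- \<bar>y\<bar> / 8) \<le> 16 * exp (- \<bar>y\<bar> / 16)" for y :: real
proof -
  have "1 + \<bar>y\<bar> \<le> 16 * (1 + \<bar>y\<bar> / 16)" by simp
  also have "\<dots> \<le> 16 * exp (\<bar>y\<bar> / 16)" by (intro mult_left_mono exp_ge_add_one_self) auto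
  finally have "(1 + \<bar>y\<bar>) * exp (- \<bar>y\<bar> / 8) \<le> (16 * exp (\<bar>y\<bar> / 16)) * exp (- \<bar>y\<bar> / 8)"
    by (intro mult_right_mono) auto
  also have "\<dots> = 16 * exp (- \<bar>y\<bar> / 16)" by (simp flip: exp_add)
  finally show ?thesis .
qed

context
  assumes WM: weak_Mertens_hypothesis
begin

lemma zeta_reg_zero_iff:
  assumes "Re v > 0"
  shows "zeta_reg v = 0 \<longleftrightarrow> v \<in> crit ` ordinates"
proof
  assume "zeta_reg v = 0"
  then have z: "v \<noteq> 1" "zeta v = 0" by (auto simp: zeta_reg_eq_0_iff)
  then have "Re v \<le> 1/2" using zeta_nonzero_right[OF WM, of v] by fastforce
  then have "Re v = 1/2" using zeta_zero_Re[OF WM z(2) assms] by auto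
  then have "v = crit (Im v)" by (simp add: complex_eq_iff)
  then show "v \<in> crit ` ordinates" using z by (metis (mono_tags, lifting) imageI mem_Collect_eq ordinates_def)
qed (auto simp: zeta_reg_crit_eq_0_iff)

lemma positive_ordinates_eq: "positive_ordinates = {\<gamma> \<in> ordinates. \<gamma> > 0}"
proof -
  have "(\<exists>\<rho>\<in>{1/2 + \<i> * of_real \<gamma> | \<gamma>. P \<gamma>}. Im \<rho> = g) \<longleftrightarrow> P g" for P g
  proof
    assume "\<exists>\<rho>\<in>{1/2 + \<i> * of_real \<gamma> | \<gamma>. P \<gamma>}. Im \<rho> = g"
    then obtain x where "P x" "Im (1/2 + \<i> * of_real x) = g" by blast
    then show "P g" by simp
  qed (auto intro!: bexI[of _ "1/2 + \<i> * of_real g"])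
  then show ?thesis
    unfolding positive_ordinates_def nontrivial_zeta_zeros_eq[OF WM] ordinates_def crit_def by auto
qed

text \<open>Right of the critical line this is the bound for 1/zeta; left of it the functional
  equation turns Gamma((1-v)/2) / zeta(v) into pi^(1/2-v) Gamma(v/2) / zeta(1-v), with 1 - v on the
  right. The strip keeps clear of the points 0 and 1.\<close>

lemma mellin_F_bound_near:
  obtains K where "K > 0"
    "\<And>v. 1/4 \<le> Re v \<Longrightarrow> Re v \<le> 3/4 \<Longrightarrow> Re v \<noteq> 1/2 \<Longrightarrow>
        norm (mellin_F v) \<le> K * exp (- \<bar>Im v\<bar> / 16) / \<bar>Re v - 1/2\<bar>"
proof -
  obtain KG where KG: "KG > 0" "\<And>z. 1/8 \<le> Re z \<Longrightarrow> Re z \<le> 2 \<Longrightarrow> norm (Gamma z) \<le> KG * exp (- \<bar>Im z\<bar> / 4)"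
    using Gamma_strip_bound[of "1/8"] by auto
  obtain KZ where KZ: "KZ > 0"
    "\<And>s. Re s > 1/2 \<Longrightarrow> s \<noteq> 1 \<Longrightarrow> norm (1 / zeta s) \<le> norm s * KZ * (1 + 1 / (Re s - 1/2))"
    by (rule inverse_zeta_bound[OF WM]) (rule that)
  \<comment> \<open>Stated with independent points \<open>z\<close> for Gamma and \<open>s\<close>
    for zeta, as the two sides of the line pair them differently.\<close>
  have right: "norm (Gamma z * (1 / zeta s)) \<le> 32 * KG * KZ * exp (- \<bar>y\<bar> / 16) / x"
    if z: "1/8 \<le> Re z" "Re z \<le> 2" "\<bar>Im z\<bar> = \<bar>y\<bar> / 2" and s: "Re s = 1/2 + x" "\<bar>Im s\<bar> = \<bar>y\<bar>" "0 < x" "x \<le> 1/4" for z s x y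
  proof -
    have "norm s \<le> \<bar>Re s\<bar> + \<bar>Im s\<bar>" by (rule cmod_le)
    then have ns: "norm s \<le> 1 + \<bar>y\<bar>" using s by simp
    have "s \<noteq> 1" "Re s > 1/2" using s by auto
    then have "norm (1 / zeta s) \<le> norm s * KZ * (1 + 1 / (Re s - 1/2))" by (intro KZ) auto
    also have "\<dots> \<le> (1 + \<bar>y\<bar>) * KZ * (2 / x)"
    proof (intro mult_mono)
      show "1 + 1 / (Re s - 1/2) \<le> 2 / x" using s by (simp add: field_simps)
    qed (use ns KZ s in auto)
    finally have "norm (1 / zeta s) \<le> (1 + \<bar>y\<bar>) * KZ * (2 / x)" .
    moreover have "norm (Gamma z) \<le> KG * exp (- \<bar>y\<bar> / 8)" using KG(2)[OF z(1,2)] z(3) by simp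
    ultimately have "norm (Gamma z * (1 / zeta s)) \<le> (KG * exp (- \<bar>y\<bar> / 8)) * ((1 + \<bar>y\<bar>) * KZ * (2 / x))"
      unfolding norm_mult using KG(1) by (intro mult_mono) auto
    also have "\<dots> = (KG * KZ * (2 / x)) * ((1 + \<bar>y\<bar>) * exp (- \<bar>y\<bar> / 8))" by simp
    also have "\<dots> \<le> (KG * KZ * (2 / x)) * (16 * exp (- \<bar>y\<bar> / 16))"
      using KG(1) KZ(1) s by (intro mult_left_mono one_plus_abs_exp) auto
    finally show ?thesis by simp
  qed
  have "norm (mellin_F v) \<le> (128 * KG * KZ) * exp (- \<bar>Im v\<bar> / 16) / \<bar>Re v - 1/2\<bar>"
    if v: "1/4 \<le> Re v" "Re v \<le> 3/4" "Re v \<noteq> 1/2" for v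
  proof -
    have v1: "v \<noteq> 1" using v by auto
    define E where "E = 32 * KG * KZ * exp (- \<bar>Im v\<bar> / 16) / \<bar>Re v - 1/2\<bar>"
    have E0: "E \<ge> 0" using KG(1) KZ(1) by (simp add: E_def)
    have "norm (mellin_F v) \<le> 4 * E"
    proof (cases "Re v > 1/2")
      case True
      have "mellin_F v = 1/2 * (Gamma ((1 - v) / 2) * (1 / zeta v))" using v mellin_F_eq[OF v1] by simp
      then have "norm (mellin_F v) = 1/2 * norm (Gamma ((1 - v) / 2) * (1 / zeta v))"
        by (simp only: norm_mult) simp
      moreover have "norm (Gamma ((1 - v) / 2) * (1 / zeta v)) \<le> 32 * KG * KZ * exp (- \<bar>Im v\<bar> / 16) / (Re v - 1/2)"
        by (rule right) (use v True in auto)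
      moreover have "\<dots> = E" using True by (simp add: E_def)
      ultimately show ?thesis using E0 by linarith
    next
      case False
      then have lt: "Re v < 1/2" using v by simp
      have v0: "v \<noteq> 0" using v by auto
      have nz: "zeta (1 - v) \<noteq> 0" "zeta v \<noteq> 0"
        using zeta_nonzero_right[OF WM, of "1 - v"] lt v v0 zeta_zero_Re[OF WM, of v] by auto
      have "Gamma (v / 2) * zeta v = of_real pi powr (v - 1/2) * (Gamma ((1 - v) / 2) * zeta (1 - v))"
        using v by (intro zeta_functional_equation) auto
      moreover have pp: "of_real pi powr (1/2 - v) * of_real pi powr (v - 1/2) = (1::complex)"
        by (simp flip: powr_add)
      ultimately have "of_real pi powr (1/2 - v) * (Gamma (v / 2) * zeta v) = Gamma ((1 - v) / 2) * zeta (1 - v)"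
        by (simp add: mult.assoc[symmetric])
      then have "Gamma ((1 - v) / 2) / zeta v = of_real pi powr (1/2 - v) * (Gamma (v / 2) * (1 / zeta (1 - v)))"
        using nz by (simp add: field_simps)
      moreover have "mellin_F v = 1/2 * (Gamma ((1 - v) / 2) / zeta v)" using v mellin_F_eq[OF v1] by simp
      ultimately have "mellin_F v = 1/2 * (of_real pi powr (1/2 - v) * (Gamma (v / 2) * (1 / zeta (1 - v))))"
        by (simp only:)
      moreover have "norm (Gamma (v / 2) * (1 / zeta (1 - v))) \<le> 32 * KG * KZ * exp (- \<bar>Im v\<bar> / 16) / (1/2 - Re v)"
        by (rule right) (use v lt in auto)
      moreover have "norm (of_real pi powr (1/2 - v) :: complex) \<le> 4"
      proof -
        have "norm (of_real pi powr (1/2 - v) :: complex) = pi powr (1/2 - Re v)" by (subst norm_powr_real_powr) auto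
        also have "\<dots> \<le> pi powr 1" using v pi_ge_two by (intro powr_mono) auto
        finally show ?thesis using pi_less_4 by simp
      qed
      ultimately have "norm (mellin_F v) \<le> 1/2 * (4 * E)"
        unfolding E_def using lt by (simp only: norm_mult) (intro mult_mono, auto simp: norm_mult)
      then show ?thesis using E0 by simp
    qed
    then show ?thesis by (simp add: E_def)
  qed
  then show ?thesis using KG(1) KZ(1) by (intro that[of "128 * KG * KZ"]) auto
qed

lemma mellin_F_holomorphic: "mellin_F holomorphic_on {v. 0 < Re v \<and> Re v < 3} - crit ` ordinates"
proof -
  have "(\<lambda>v. Gamma ((3 - v) / 2)) holomorphic_on {v. 0 < Re v \<and> Re v < 3} - crit ` ordinates"
    by (intro holomorphic_Gamma' holomorphic_intros Gamma_not_nonpos_Ints) auto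
  then show ?thesis unfolding mellin_F_def
    by (intro holomorphic_on_divide holomorphic_on_minus zeta_reg_holomorphic) (auto simp: zeta_reg_zero_iff)
qed

lemma zeta_reg_lower_bound:
  obtains K where "K > 0"
    "\<And>v. Re v > 1/2 \<Longrightarrow> norm (v - 1) \<le> norm (zeta_reg v) * (norm v * K * (1 + 1 / (Re v - 1/2)))"
proof -
  obtain K where K: "K > 0"
    "\<And>s. Re s > 1/2 \<Longrightarrow> summable (\<lambda>n. of_real (mertens (real (Suc n))) *
     (of_nat (Suc n) powr (- s) - of_nat (Suc (Suc n)) powr (- s)) :: complex)"
    "\<And>s. Re s > 1/2 \<Longrightarrow> norm (mertens_series s) \<le> norm s * K * (1 + 1 / (Re s - 1/2))"
    by (rule mertens_series_bound[OF WM]) (rule that)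
  have "norm (v - 1) \<le> norm (zeta_reg v) * (norm v * K * (1 + 1 / (Re v - 1/2)))" if v: "Re v > 1/2" for v
  proof -
    have "norm (v - 1) = norm (zeta_reg v) * norm (mertens_series v)"
      using mertens_series_zeta_reg[OF WM v] by (metis norm_mult mult.commute)
    also have "\<dots> \<le> norm (zeta_reg v) * (norm v * K * (1 + 1 / (Re v - 1/2)))"
      using K(3)[OF v] by (intro mult_left_mono) auto
    finally show ?thesis .
  qed
  then show ?thesis using K(1) that by blast
qed

lemma mellin_F_bound_right:
  obtains K where "K > 0" "\<And>v. 5/8 \<le> Re v \<Longrightarrow> Re v \<le> 2 \<Longrightarrow> norm (mellin_F v) \<le> K * exp (- \<bar>Im v\<bar> / 16)"
proof -
  obtain KG where KG: "KG > 0" "\<And>z. 1/2 \<le> Re z \<Longrightarrow> Re z \<le> 2 \<Longrightarrow> norm (Gamma z) \<le> KG * exp (- \<bar>Im z\<bar> / 4)"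
    using Gamma_strip_bound[of "1/2"] by auto
  obtain KZ where KZ: "KZ > 0"
    "\<And>v. Re v > 1/2 \<Longrightarrow> norm (v - 1) \<le> norm (zeta_reg v) * (norm v * KZ * (1 + 1 / (Re v - 1/2)))"
    by (rule zeta_reg_lower_bound) (rule that)
  \<comment> \<open>Close to the real axis \<open>norm (v - 1)\<close> has no positive lower bound,
    so compactness is used there instead.\<close>
  define S where "S = cbox (Complex (5/8) (-1)) (Complex 2 1)"
  have nz: "zeta_reg v \<noteq> 0" if "5/8 \<le> Re v" for v
    using that zeta_reg_zero_iff[of v] by auto
  have "mellin_F holomorphic_on S"
    by (rule holomorphic_on_subset[OF mellin_F_holomorphic]) (auto simp: S_def in_cbox_complex_iff)
  then have "bounded (mellin_F ` S)"
    by (intro compact_imp_bounded compact_continuous_image holomorphic_on_imp_continuous_on) (auto simp: S_def)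
  then obtain M where M: "\<And>v. v \<in> S \<Longrightarrow> norm (mellin_F v) \<le> M" unfolding bounded_iff by auto
  define K where "K = \<bar>M\<bar> * exp 1 + KG * (2 * KZ * 9 * 16) + 1"
  have "norm (mellin_F v) \<le> K * exp (- \<bar>Im v\<bar> / 16)" if v: "5/8 \<le> Re v" "Re v \<le> 2" for v
  proof (cases "\<bar>Im v\<bar> \<le> 1")
    case True
    then have "v \<in> S" using v by (auto simp: S_def in_cbox_complex_iff)
    then have "norm (mellin_F v) \<le> \<bar>M\<bar> * (exp 1 * exp (- 1))" using M by (fastforce simp flip: exp_add)
    also have "\<dots> = (\<bar>M\<bar> * exp 1) * exp (- 1)" by simp
    also have "\<dots> \<le> K * exp (- \<bar>Im v\<bar> / 16)"
      using True KG KZ by (intro mult_mono) (auto simp: K_def)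
    finally show ?thesis .
  next
    case False
    define y where "y = Im v"
    have y: "\<bar>y\<bar> > 1" using False by (simp add: y_def)
    have "1 \<le> norm (v - 1)" using abs_Im_le_cmod[of "v - 1"] y by (simp add: y_def)
    also have "\<dots> \<le> norm (zeta_reg v) * (norm v * KZ * (1 + 1 / (Re v - 1/2)))" using v by (intro KZ) auto
    also have "\<dots> \<le> norm (zeta_reg v) * ((2 * (1 + \<bar>y\<bar>)) * KZ * 9)"
    proof (intro mult_left_mono mult_mono)
      show "norm v \<le> 2 * (1 + \<bar>y\<bar>)" using cmod_le[of v] v by (simp add: y_def)
      show "1 + 1 / (Re v - 1/2) \<le> 9" using v by (simp add: field_simps)
    qed (use KZ v in auto)
    finally have "1 \<le> norm (zeta_reg v) * ((2 * (1 + \<bar>y\<bar>)) * KZ * 9)" .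
    then have "1 / norm (zeta_reg v) \<le> (2 * (1 + \<bar>y\<bar>)) * KZ * 9"
      using nz[OF v(1)] by (simp add: field_simps)
    moreover have "norm (Gamma ((3 - v) / 2)) \<le> KG * exp (- \<bar>y\<bar> / 8)"
      using KG(2)[of "(3 - v) / 2"] v by (simp add: y_def)
    ultimately have "norm (Gamma ((3 - v) / 2)) * (1 / norm (zeta_reg v)) \<le> (KG * exp (- \<bar>y\<bar> / 8)) * ((2 * (1 + \<bar>y\<bar>)) * KZ * 9)"
      using KG(1) by (intro mult_mono) auto
    also have "\<dots> = KG * (2 * KZ * 9) * ((1 + \<bar>y\<bar>) * exp (- \<bar>y\<bar> / 8))" by simp
    also have "\<dots> \<le> KG * (2 * KZ * 9) * (16 * exp (- \<bar>y\<bar> / 16))"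
      using KG(1) KZ(1) by (intro mult_left_mono one_plus_abs_exp) auto
    also have "\<dots> = (KG * (2 * KZ * 9 * 16)) * exp (- \<bar>y\<bar> / 16)" by simp
    also have "\<dots> \<le> K * exp (- \<bar>y\<bar> / 16)" by (intro mult_right_mono) (auto simp: K_def)
    finally show ?thesis by (simp add: mellin_F_def norm_divide y_def)
  qed
  moreover have "K > 0" using KG KZ by (auto simp: K_def intro!: add_nonneg_pos add_nonneg_nonneg)
  ultimately show ?thesis using that by blast
qed

text \<open>The centre 3/4 + iT lies where the Mertens series bounds zeta from below. The window of
  half-width 1/8 on the critical line fits into radius 7/25, since 1/16 + 1/64 < 49/625; the outer
  radius 3/5 exceeds twice that and leaves real parts above 1/10. Each zero gains (3/5 - 7/25) /
  (7/25) = 8/7, and Bernoulli's inequality turns this into a cubic bound, crude but sufficient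
  against exponential weights.\<close>

lemma card_ordinates_le:
  obtains K where "K > 0"
    "\<And>T F. finite F \<Longrightarrow> F \<subseteq> ordinates \<inter> {T - 1/8..T + 1/8} \<Longrightarrow> real (card F) \<le> K * (3 + \<bar>T\<bar>) ^ 3"
proof -
  obtain KU where KU: "KU > 0" "\<And>s. Re s \<ge> 1/10 \<Longrightarrow> norm (zeta_reg s) \<le> KU * (1 + norm s)\<^sup>2"
    using zeta_reg_bound[of "1/10"] by auto
  obtain KZ where KZ: "KZ > 0"
    "\<And>v. Re v > 1/2 \<Longrightarrow> norm (v - 1) \<le> norm (zeta_reg v) * (norm v * KZ * (1 + 1 / (Re v - 1/2)))"
    by (rule zeta_reg_lower_bound) (rule that)
  define K where "K = 7 * (20 * KZ * KU)"
  have "real (card F) \<le> K * (3 + \<bar>T\<bar>) ^ 3" if F: "finite F" "F \<subseteq> ordinates \<inter> {T - 1/8..T + 1/8}" for T F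
  proof -
    define c where "c = Complex (3/4) T"
    define A where "A = 3 + \<bar>T\<bar>"
    have A: "A \<ge> 3" by (simp add: A_def)
    have nc: "norm c \<le> 1 + \<bar>T\<bar>" using cmod_le[of c] by (simp add: c_def)
    have "norm (zeta_reg c) * ((3/5 - 7/25) / (7/25)) ^ card (crit ` F) \<le> KU * A\<^sup>2"
    proof (rule card_zeros_le[where c = c and r = "7/25" and R = "3/5" and f = zeta_reg and B = "KU * A\<^sup>2"])
      show "zeta_reg holomorphic_on UNIV" by (rule zeta_reg_holomorphic)
      show "finite (crit ` F)" using F by simp
      show "zeta_reg a = 0" if "a \<in> crit ` F" for a using that F by (auto simp: zeta_reg_crit_eq_0_iff)
      show "dist c a \<le> 7/25" if aF: "a \<in> crit ` F" for a
      proof -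
        obtain \<gamma> where g: "a = crit \<gamma>" "\<gamma> \<in> F" using aF by blast
        then have "\<gamma> \<in> {T - 1/8..T + 1/8}" using F by blast
        then have g2: "\<bar>T - \<gamma>\<bar> \<le> 1/8" unfolding atLeastAtMost_iff by linarith
        have "(dist c a)\<^sup>2 = (1/4)\<^sup>2 + (T - \<gamma>)\<^sup>2" by (simp add: g c_def dist_norm cmod_power2)
        also have "(T - \<gamma>)\<^sup>2 \<le> (1/8)\<^sup>2" using g2 by (metis abs_ge_zero power2_abs power_mono)
        also have "(1/4)\<^sup>2 + (1/8)\<^sup>2 \<le> ((7/25)\<^sup>2 :: real)" by (simp add: power2_eq_square)
        finally show ?thesis by (rule power2_le_imp_le) auto
      qed
      show "norm (zeta_reg z) \<le> KU * A\<^sup>2" if z: "dist c z = 3/5" for z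
      proof -
        have "Re c - Re z \<le> 3/5" using complex_Re_le_cmod[of "c - z"] z by (simp add: dist_norm)
        then have "Re z \<ge> 1/10" by (simp add: c_def)
        then have "norm (zeta_reg z) \<le> KU * (1 + norm z)\<^sup>2" by (rule KU)
        also have "\<dots> \<le> KU * A\<^sup>2"
        proof (intro mult_left_mono power_mono)
          have "norm z \<le> norm c + dist c z" using norm_triangle_sub[of z c] by (simp add: dist_norm norm_minus_commute)
          then show "1 + norm z \<le> A" using nc z by (simp add: A_def)
        qed (use KU in auto)
        finally show ?thesis .
      qed
    qed auto
    moreover have "card (crit ` F) = card F" using inj_crit by (intro card_image) (auto intro: inj_on_subset)
    ultimately have 1: "norm (zeta_reg c) * (8/7) ^ card F \<le> KU * A\<^sup>2" by simp
    have "1/4 \<le> norm (c - 1)" using abs_Re_le_cmod[of "c - 1"] by (simp add: c_def)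
    also have "\<dots> \<le> norm (zeta_reg c) * (norm c * KZ * (1 + 1 / (Re c - 1/2)))" by (rule KZ) (simp add: c_def)
    also have "\<dots> \<le> norm (zeta_reg c) * (A * KZ * 5)"
      using nc KZ(1) by (intro mult_left_mono mult_mono) (auto simp: A_def c_def)
    finally have 2: "1/4 \<le> norm (zeta_reg c) * (A * KZ * 5)" .
    have "1 + real (card F) * (1/7) \<le> (1 + 1/7) ^ card F" by (rule Bernoulli_inequality) simp
    then have "real (card F) / 7 \<le> (8/7) ^ card F" by simp
    also have "(8/7) ^ card F = 4 * (1/4 * (8/7 :: real) ^ card F)" by simp
    also have "\<dots> \<le> 4 * ((norm (zeta_reg c) * (A * KZ * 5)) * (8/7) ^ card F)"
      using 2 by (intro mult_left_mono mult_right_mono) auto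
    also have "\<dots> = 20 * KZ * A * (norm (zeta_reg c) * (8/7) ^ card F)" by simp
    also have "\<dots> \<le> 20 * KZ * A * (KU * A\<^sup>2)" using 1 KZ A by (intro mult_left_mono) auto
    finally show ?thesis by (simp add: K_def A_def[symmetric] power3_eq_cube power2_eq_square mult_ac)
  qed
  note main = this
  have "K > 0" using KU KZ by (simp add: K_def)
  then show ?thesis by (rule that[OF _ main])
qed

lemma summable_exp_ordinates:
  assumes a: "a > 0"
  shows "(\<lambda>\<gamma>. exp (- a * \<bar>\<gamma>\<bar>)) summable_on ordinates"
proof (rule nonneg_bdd_above_summable_on)
  obtain K where K: "K > 0"
    "\<And>T F. finite F \<Longrightarrow> F \<subseteq> ordinates \<inter> {T - 1/8..T + 1/8} \<Longrightarrow> real (card F) \<le> K * (3 + \<bar>T\<bar>) ^ 3"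
    by (rule card_ordinates_le) (rule that)
  obtain K2 where K2: "K2 > 0" "\<And>y::real. (1 + \<bar>y\<bar>) ^ 3 * exp (- (a/8) * \<bar>y\<bar>) \<le> K2"
    using exp_decay_cubic[of "a/8"] a by auto
  define w where "w = (\<lambda>k::nat. 2 * K * 64 * K2 * exp (- (a / 8)) ^ k)"
  have w: "summable w" unfolding w_def using a by (intro summable_mult summable_geometric) auto
  have w0: "w k \<ge> 0" for k using K K2 by (simp add: w_def)
  have "(\<Sum>\<gamma>\<in>F. exp (- a * \<bar>\<gamma>\<bar>)) \<le> suminf w" if F: "F \<subseteq> ordinates" "finite F" for F
  proof -
    \<comment> \<open>Blocks of length 1/4 in |gamma|; each is covered by two windows of the size
      counted by \<open>card_ordinates_le\<close>, with midpoints \<open>T\<close> and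
      \<open>- T\<close>.\<close>
    define idx where "idx = (\<lambda>\<gamma>::real. nat \<lfloor>4 * \<bar>\<gamma>\<bar>\<rfloor>)"
    have blk: "(\<Sum>\<gamma>\<in>{\<gamma>\<in>F. idx \<gamma> = k}. exp (- a * \<bar>\<gamma>\<bar>)) \<le> w k" for k
    proof -
      define T where "T = (2 * real k + 1) / 8"
      have T: "3 + \<bar>T\<bar> \<le> 4 * (1 + real k)" by (simp add: T_def)
      have Fk: "{\<gamma>\<in>F. idx \<gamma> = k} \<subseteq> (F \<inter> {T - 1/8..T + 1/8}) \<union> (F \<inter> {- T - 1/8..- T + 1/8})"
        and low: "\<And>\<gamma>. idx \<gamma> = k \<Longrightarrow> real k / 4 \<le> \<bar>\<gamma>\<bar>"
      proof -
        have *: "real k / 4 \<le> \<bar>\<gamma>\<bar> \<and> \<bar>\<gamma>\<bar> \<le> (real k + 1) / 4" if "idx \<gamma> = k" for \<gamma>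
        proof -
          have "int k = \<lfloor>4 * \<bar>\<gamma>\<bar>\<rfloor>" using that by (auto simp: idx_def)
          then have "real k \<le> 4 * \<bar>\<gamma>\<bar>" "4 * \<bar>\<gamma>\<bar> < real k + 1" by linarith+
          then show ?thesis by simp
        qed
        then show "\<And>\<gamma>. idx \<gamma> = k \<Longrightarrow> real k / 4 \<le> \<bar>\<gamma>\<bar>" by blast
        show "{\<gamma>\<in>F. idx \<gamma> = k} \<subseteq> (F \<inter> {T - 1/8..T + 1/8}) \<union> (F \<inter> {- T - 1/8..- T + 1/8})"
        proof
          fix \<gamma> assume "\<gamma> \<in> {\<gamma>\<in>F. idx \<gamma> = k}"
          then have "\<gamma> \<in> F" "real k / 4 \<le> \<bar>\<gamma>\<bar>" "\<bar>\<gamma>\<bar> \<le> (real k + 1) / 4" using * by auto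
          then show "\<gamma> \<in> (F \<inter> {T - 1/8..T + 1/8}) \<union> (F \<inter> {- T - 1/8..- T + 1/8})"
            by (cases "\<gamma> \<ge> 0") (auto simp: T_def field_simps)
        qed
      qed
      have "real (card {\<gamma>\<in>F. idx \<gamma> = k}) \<le> real (card (F \<inter> {T - 1/8..T + 1/8}) + card (F \<inter> {- T - 1/8..- T + 1/8}))"
        using card_mono[OF _ Fk] card_Un_le[of "F \<inter> {T - 1/8..T + 1/8}" "F \<inter> {- T - 1/8..- T + 1/8}"] F(2)
        by (intro of_nat_mono) (auto intro: order_trans)
      also have "\<dots> \<le> K * (3 + \<bar>T\<bar>) ^ 3 + K * (3 + \<bar>- T\<bar>) ^ 3"
        unfolding of_nat_add using F by (intro add_mono K(2)) auto
      also have "\<dots> = 2 * K * (3 + \<bar>T\<bar>) ^ 3" by simp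
      also have "\<dots> \<le> 2 * K * (4 * (1 + real k)) ^ 3" using T K by (intro mult_left_mono power_mono) auto
      finally have card: "real (card {\<gamma>\<in>F. idx \<gamma> = k}) \<le> 2 * K * (4 * (1 + real k)) ^ 3" .
      have "(\<Sum>\<gamma>\<in>{\<gamma>\<in>F. idx \<gamma> = k}. exp (- a * \<bar>\<gamma>\<bar>)) \<le> (\<Sum>\<gamma>\<in>{\<gamma>\<in>F. idx \<gamma> = k}. exp (- a * (real k / 4)))"
        using low a by (intro sum_mono) (auto intro!: mult_left_mono)
      also have "\<dots> = real (card {\<gamma>\<in>F. idx \<gamma> = k}) * exp (- a * (real k / 4))" by simp
      also have "\<dots> \<le> (2 * K * (4 * (1 + real k)) ^ 3) * exp (- a * (real k / 4))"
        using card by (intro mult_right_mono) auto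
      \<comment> \<open>One half of the exponent beats the cubic count, the other half gives a
        geometric series.\<close>
      also have "exp (- a * (real k / 4)) = exp (- (a/8) * \<bar>real k\<bar>) * exp (- (a / 8)) ^ k"
        by (simp flip: exp_of_nat_mult exp_add)
      also have "(2 * K * (4 * (1 + real k)) ^ 3) * (exp (- (a/8) * \<bar>real k\<bar>) * exp (- (a / 8)) ^ k) =
         (2 * K * 64 * exp (- (a / 8)) ^ k) * ((1 + \<bar>real k\<bar>) ^ 3 * exp (- (a/8) * \<bar>real k\<bar>))"
      proof -
        have "(4 * (1 + real k)) ^ 3 = 64 * (1 + \<bar>real k\<bar>) ^ 3" by (simp only: power_mult_distrib) simp
        then show ?thesis by (simp only: mult_ac)
      qed
      also have "\<dots> \<le> (2 * K * 64 * exp (- (a / 8)) ^ k) * K2"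
        using K by (intro mult_left_mono K2) auto
      finally show ?thesis by (simp add: w_def mult_ac)
    qed
    have "(\<Sum>\<gamma>\<in>F. exp (- a * \<bar>\<gamma>\<bar>)) = (\<Sum>k\<in>idx ` F. \<Sum>\<gamma>\<in>{\<gamma>\<in>F. idx \<gamma> = k}. exp (- a * \<bar>\<gamma>\<bar>))"
      by (rule sum.image_gen[OF F(2)])
    also have "\<dots> \<le> (\<Sum>k\<in>idx ` F. w k)" by (intro sum_mono blk)
    also have "\<dots> \<le> suminf w" using F(2) w w0 by (intro sum_le_suminf) auto
    finally show ?thesis .
  qed
  then show "bdd_above (sum (\<lambda>\<gamma>. exp (- a * \<bar>\<gamma>\<bar>)) ` {F. F \<subseteq> ordinates \<and> finite F})"
    by (intro bdd_aboveI[of _ "suminf w"]) auto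
qed auto

text \<open>Gamma gives the rate 1/8, the linear bound for 1/zeta' lowers it to 1/16, and after the
  weight 1/64 there remains 3/64.\<close>

lemma zero_coeff_summable:
  "(\<lambda>\<gamma>. norm (zero_coeff \<gamma>) * exp (\<bar>\<gamma>\<bar> / 64)) summable_on ordinates"
proof -
  obtain KG where KG: "KG > 0" "\<And>z. 1/4 \<le> Re z \<Longrightarrow> Re z \<le> 2 \<Longrightarrow> norm (Gamma z) \<le> KG * exp (- \<bar>Im z\<bar> / 4)"
    using Gamma_strip_bound[of "1/4"] by auto
  obtain KD where KD: "KD > 0"
    "\<And>\<gamma>. zeta (1/2 + \<i> * of_real \<gamma>) = 0 \<Longrightarrow> 1 \<le> norm (deriv zeta (1/2 + \<i> * of_real \<gamma>)) * (KD * norm (1/2 + \<i> * complex_of_real \<gamma>))"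
    by (rule zeta_deriv_zero_bound[OF WM]) (rule that)
  have "norm (zero_coeff \<gamma>) * exp (\<bar>\<gamma>\<bar> / 64) \<le> (16 * KG * KD) * exp (- (3/64) * \<bar>\<gamma>\<bar>)" if "\<gamma> \<in> ordinates" for \<gamma>
  proof -
    define \<rho> where "\<rho> = 1/2 + \<i> * complex_of_real \<gamma>"
    have z: "zeta \<rho> = 0" using that by (simp add: ordinates_def crit_def \<rho>_def)
    have D: "1 \<le> norm (deriv zeta \<rho>) * (KD * norm \<rho>)" using KD(2)[of \<gamma>] z by (simp add: \<rho>_def)
    then have D0: "deriv zeta \<rho> \<noteq> 0" by auto
    have "norm \<rho> \<le> 1 + \<bar>\<gamma>\<bar>" using cmod_le[of \<rho>] by (simp add: \<rho>_def)
    have "1 / norm (deriv zeta \<rho>) \<le> KD * norm \<rho>" using D D0 by (simp add: field_simps)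
    also have "\<dots> \<le> KD * (1 + \<bar>\<gamma>\<bar>)" using KD \<open>norm \<rho> \<le> _\<close> by (intro mult_left_mono) auto
    finally have i: "1 / norm (deriv zeta \<rho>) \<le> KD * (1 + \<bar>\<gamma>\<bar>)" .
    have "norm (zero_coeff \<gamma>) = norm (Gamma (1/4 - \<i> * of_real \<gamma> / 2)) * (1 / norm (deriv zeta \<rho>))"
      by (simp add: zero_coeff_def \<rho>_def norm_divide)
    also have "\<dots> \<le> (KG * exp (- \<bar>\<gamma>\<bar> / 8)) * (KD * (1 + \<bar>\<gamma>\<bar>))"
      using KG(2)[of "1/4 - \<i> * of_real \<gamma> / 2"] i KG(1) by (intro mult_mono) auto
    also have "\<dots> = KG * KD * ((1 + \<bar>\<gamma>\<bar>) * exp (- \<bar>\<gamma>\<bar> / 8))" by simp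
    also have "\<dots> \<le> KG * KD * (16 * exp (- \<bar>\<gamma>\<bar> / 16))" using KG(1) KD(1) by (intro mult_left_mono one_plus_abs_exp) auto
    finally have "norm (zero_coeff \<gamma>) * exp (\<bar>\<gamma>\<bar> / 64) \<le> KG * KD * (16 * exp (- \<bar>\<gamma>\<bar> / 16)) * exp (\<bar>\<gamma>\<bar> / 64)"
      by (intro mult_right_mono) auto
    also have "\<dots> = (16 * KG * KD) * exp (- (3/64) * \<bar>\<gamma>\<bar>)" by (simp flip: exp_add)
    finally show ?thesis .
  qed
  note bound = this
  have "(\<lambda>\<gamma>. (16 * KG * KD) * exp (- (3/64) * \<bar>\<gamma>\<bar>)) summable_on ordinates"
    using summable_exp_ordinates[of "3/64"] by (intro summable_on_cmult_right) simp
  then show ?thesis by (rule summable_on_comparison_test) (use bound in auto)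
qed

end

section \<open>Removing the poles\<close>

definition pole_term :: "real \<Rightarrow> complex \<Rightarrow> complex" where
  "pole_term \<gamma> v = zero_coeff \<gamma> / 2 * exp ((v - crit \<gamma>)\<^sup>2) / (v - crit \<gamma>)"

definition pole_sum :: "real set \<Rightarrow> complex \<Rightarrow> complex" where
  "pole_sum S v = (\<Sum>\<^sub>\<infinity>\<gamma>\<in>S. pole_term \<gamma> v)"

definition weight :: "real \<Rightarrow> real" where
  "weight \<gamma> = norm (zero_coeff \<gamma>) * exp (\<bar>\<gamma>\<bar> / 64)"

lemma weight_nonneg: "weight \<gamma> \<ge> 0"
  by (simp add: weight_def)

lemma norm_exp_square_le:
  "norm (exp ((v - crit \<gamma>)\<^sup>2)) \<le> exp ((Re v - 1/2)\<^sup>2 + 1) * (exp (\<bar>\<gamma>\<bar> / 64) * exp (- \<bar>Im v\<bar> / 64))"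
proof -
  have "norm (exp ((v - crit \<gamma>)\<^sup>2)) = exp ((Re v - 1/2)\<^sup>2) * exp (- (Im v - \<gamma>)\<^sup>2)"
    by (simp add: Re_power2 flip: exp_add)
  also have "\<dots> \<le> exp ((Re v - 1/2)\<^sup>2) * (exp 1 * (exp (\<bar>\<gamma>\<bar> / 64) * exp (- \<bar>Im v\<bar> / 64)))"
    by (intro mult_left_mono exp_neg_square_le) auto
  also have "\<dots> = exp ((Re v - 1/2)\<^sup>2 + 1) * (exp (\<bar>\<gamma>\<bar> / 64) * exp (- \<bar>Im v\<bar> / 64))"
    by (simp add: exp_add)
  finally show ?thesis .
qed

lemma pole_term_bound:
  assumes "d > 0" "d \<le> norm (v - crit \<gamma>)"
  shows "norm (pole_term \<gamma> v) \<le> exp ((Re v - 1/2)\<^sup>2 + 1) * exp (- \<bar>Im v\<bar> / 64) / d * weight \<gamma>"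
proof -
  have "norm (pole_term \<gamma> v) = norm (zero_coeff \<gamma>) / 2 * norm (exp ((v - crit \<gamma>)\<^sup>2)) / norm (v - crit \<gamma>)"
    unfolding pole_term_def norm_mult norm_divide by simp
  also have "\<dots> \<le> norm (zero_coeff \<gamma>) * (exp ((Re v - 1/2)\<^sup>2 + 1) * (exp (\<bar>\<gamma>\<bar> / 64) * exp (- \<bar>Im v\<bar> / 64))) / d"
    using assms by (intro frac_le mult_mono norm_exp_square_le) auto
  finally show ?thesis by (simp add: weight_def mult_ac)
qed

text \<open>Zeros of the nonconstant entire function \<open>zeta_reg\<close> are isolated. The cap
  1/4 keeps discs about the zeros inside the strip between 0 and 1.\<close>

lemma crit_separated:
  obtains \<delta> where "\<delta> > 0" "\<delta> \<le> 1/4" "\<And>\<gamma>. \<gamma> \<in> ordinates \<Longrightarrow> crit \<gamma> \<noteq> z0 \<Longrightarrow> \<delta> \<le> dist z0 (crit \<gamma>)"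
proof -
  have one: "zeta_reg 1 \<noteq> 0" by (simp add: zeta_reg_eq_0_iff)
  have fin: "finite {z \<in> cball z0 1. zeta_reg z = 0}"
  proof (cases "zeta_reg constant_on UNIV")
    case True
    then obtain c where "\<And>z. zeta_reg z = c" unfolding constant_on_def by blast
    then have "zeta_reg z \<noteq> 0" for z using one by metis
    then show ?thesis by simp
  next
    case False
    then show ?thesis
      by (intro holomorphic_compact_finite_zeros[of zeta_reg UNIV] zeta_reg_holomorphic) auto
  qed
  then obtain d where d: "d > 0" "\<And>x. x \<in> {z \<in> cball z0 1. zeta_reg z = 0} \<Longrightarrow> x \<noteq> z0 \<Longrightarrow> d \<le> dist z0 x"
    using finite_set_avoid[OF fin, of z0] by blast
  show ?thesis
  proof (rule that)
    show "min d (1/4) > 0" using d by simp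
    show "min d (1/4) \<le> 1/4" by simp
    fix \<gamma> assume g: "\<gamma> \<in> ordinates" "crit \<gamma> \<noteq> z0"
    show "min d (1/4) \<le> dist z0 (crit \<gamma>)"
    proof (cases "dist z0 (crit \<gamma>) \<le> 1")
      case True
      then have "d \<le> dist z0 (crit \<gamma>)" using g by (intro d(2)) (auto simp: zeta_reg_crit_eq_0_iff)
      then show ?thesis by simp
    qed auto
  qed
qed

lemma open_Compl_crit:
  assumes "S \<subseteq> ordinates"
  shows "open (- crit ` S)"
  unfolding open_contains_ball
proof
  fix z assume z: "z \<in> - crit ` S"
  obtain \<delta> where d: "\<delta> > 0" "\<delta> \<le> 1/4" "\<And>\<gamma>. \<gamma> \<in> ordinates \<Longrightarrow> crit \<gamma> \<noteq> z \<Longrightarrow> \<delta> \<le> dist z (crit \<gamma>)"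
    by (rule crit_separated) (rule that)
  have "w \<notin> crit ` S" if w: "w \<in> ball z \<delta>" for w
  proof
    assume "w \<in> crit ` S"
    then obtain \<gamma> where g: "\<gamma> \<in> S" "w = crit \<gamma>" by blast
    then have "crit \<gamma> \<noteq> z" using z by blast
    then have "\<delta> \<le> dist z (crit \<gamma>)" using g assms by (intro d(3)) auto
    then show False using w g by simp
  qed
  then show "\<exists>e>0. ball z e \<subseteq> - crit ` S" using d(1) by blast
qed

lemma pole_term_holomorphic:
  assumes "crit \<gamma> \<notin> A"
  shows "pole_term \<gamma> holomorphic_on A"
  unfolding pole_term_def using assms by (intro holomorphic_intros) auto

context
  assumes WM: weak_Mertens_hypothesis
begin

lemma weight_summable: "weight summable_on ordinates"
  using zero_coeff_summable[OF WM] by (simp add: weight_def[abs_def])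

lemma pole_term_norm_summable:
  assumes "S \<subseteq> ordinates" "d > 0" "\<And>\<gamma>. \<gamma> \<in> S \<Longrightarrow> d \<le> norm (v - crit \<gamma>)"
  shows "(\<lambda>\<gamma>. norm (pole_term \<gamma> v)) summable_on S"
proof (rule summable_on_comparison_test)
  show "(\<lambda>\<gamma>. exp ((Re v - 1/2)\<^sup>2 + 1) * exp (- \<bar>Im v\<bar> / 64) / d * weight \<gamma>) summable_on S"
    by (intro summable_on_cmult_right summable_on_subset_banach[OF weight_summable] assms)
  show "norm (pole_term \<gamma> v) \<le> exp ((Re v - 1/2)\<^sup>2 + 1) * exp (- \<bar>Im v\<bar> / 64) / d * weight \<gamma>"
    if "\<gamma> \<in> S" for \<gamma>
    using assms(2) assms(3)[OF that] by (rule pole_term_bound)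
  show "norm (pole_term \<gamma> v) \<ge> 0" for \<gamma> by (rule norm_ge_zero)
qed

lemma pole_sum_bound:
  assumes "S \<subseteq> ordinates" "d > 0" "\<And>\<gamma>. \<gamma> \<in> S \<Longrightarrow> d \<le> norm (v - crit \<gamma>)"
  shows "norm (pole_sum S v) \<le> exp ((Re v - 1/2)\<^sup>2 + 1) * exp (- \<bar>Im v\<bar> / 64) / d * infsum weight ordinates"
proof -
  define k where "k = exp ((Re v - 1/2)\<^sup>2 + 1) * exp (- \<bar>Im v\<bar> / 64) / d"
  have k: "k \<ge> 0" using assms by (simp add: k_def)
  have w: "weight summable_on S" by (rule summable_on_subset_banach[OF weight_summable assms(1)])
  have "norm (pole_sum S v) \<le> (\<Sum>\<^sub>\<infinity>\<gamma>\<in>S. k * weight \<gamma>)" unfolding pole_sum_def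
  proof (rule norm_infsum_le)
    show "((\<lambda>\<gamma>. pole_term \<gamma> v) has_sum (\<Sum>\<^sub>\<infinity>\<gamma>\<in>S. pole_term \<gamma> v)) S"
      by (rule has_sum_infsum, rule abs_summable_summable, rule pole_term_norm_summable[OF assms])
    show "((\<lambda>\<gamma>. k * weight \<gamma>) has_sum (\<Sum>\<^sub>\<infinity>\<gamma>\<in>S. k * weight \<gamma>)) S"
      by (intro has_sum_infsum summable_on_cmult_right w)
    show "norm (pole_term \<gamma> v) \<le> k * weight \<gamma>" if "\<gamma> \<in> S" for \<gamma>
      unfolding k_def using that assms by (intro pole_term_bound) auto
  qed
  also have "\<dots> = k * infsum weight S" by (rule infsum_cmult_right')
  also have "\<dots> \<le> k * infsum weight ordinates"
    using k assms(1) by (intro mult_left_mono infsum_mono_neutral w weight_summable) (auto simp: weight_nonneg)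
  finally show ?thesis by (simp add: k_def)
qed

lemma pole_sum_holomorphic:
  assumes S: "S \<subseteq> ordinates"
  shows "pole_sum S holomorphic_on - crit ` S"
  unfolding pole_sum_def
proof (rule holomorphic_on_infsum)
  show "open (- crit ` S)" by (rule open_Compl_crit[OF S])
  show "pole_term \<gamma> holomorphic_on - crit ` S" if "\<gamma> \<in> S" for \<gamma>
    using that by (intro pole_term_holomorphic) auto
  fix z0 assume z0: "z0 \<in> - crit ` S"
  obtain \<delta> where d: "\<delta> > 0" "\<delta> \<le> 1/4" "\<And>\<gamma>. \<gamma> \<in> ordinates \<Longrightarrow> crit \<gamma> \<noteq> z0 \<Longrightarrow> \<delta> \<le> dist z0 (crit \<gamma>)"
    by (rule crit_separated) (rule that)
  define M where "M = exp ((\<bar>Re z0 - 1/2\<bar> + 1)\<^sup>2 + 1) / (\<delta> / 2)"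
  show "\<exists>r>0. \<exists>g. g summable_on S \<and> (\<forall>\<gamma>\<in>S. \<forall>z\<in>- crit ` S. dist z0 z \<le> r \<longrightarrow> norm (pole_term \<gamma> z) \<le> g \<gamma>)"
  proof (intro exI conjI ballI impI)
    show "\<delta> / 2 > 0" using d by simp
    show "(\<lambda>\<gamma>. M * weight \<gamma>) summable_on S"
      by (intro summable_on_cmult_right summable_on_subset_banach[OF weight_summable] S)
    fix \<gamma> z assume g: "\<gamma> \<in> S" and z: "dist z0 z \<le> \<delta> / 2"
    have "crit \<gamma> \<noteq> z0" using g z0 by blast
    then have "\<delta> \<le> dist z0 (crit \<gamma>)" using g S by (intro d(3)) auto
    also have "\<dots> \<le> dist z0 z + dist z (crit \<gamma>)" by (rule dist_triangle)
    finally have dz: "\<delta> / 2 \<le> norm (z - crit \<gamma>)" using z by (simp add: dist_norm)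
    have "\<bar>Re z0 - Re z\<bar> \<le> dist z0 z" using abs_Re_le_cmod[of "z0 - z"] by (simp add: dist_norm)
    then have "\<bar>Re z - 1/2\<bar> \<le> \<bar>Re z0 - 1/2\<bar> + 1" using z d by linarith
    then have "(Re z - 1/2)\<^sup>2 \<le> (\<bar>Re z0 - 1/2\<bar> + 1)\<^sup>2" by (metis abs_ge_zero power2_abs power_mono)
    then have "exp ((Re z - 1/2)\<^sup>2 + 1) * exp (- \<bar>Im z\<bar> / 64) \<le> exp ((\<bar>Re z0 - 1/2\<bar> + 1)\<^sup>2 + 1) * 1"
      by (intro mult_mono) auto
    then have "exp ((Re z - 1/2)\<^sup>2 + 1) * exp (- \<bar>Im z\<bar> / 64) / (\<delta> / 2) * weight \<gamma> \<le> M * weight \<gamma>"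
      unfolding M_def using d by (intro mult_right_mono divide_right_mono weight_nonneg) auto
    moreover have "norm (pole_term \<gamma> z) \<le> exp ((Re z - 1/2)\<^sup>2 + 1) * exp (- \<bar>Im z\<bar> / 64) / (\<delta> / 2) * weight \<gamma>"
      using d dz by (intro pole_term_bound) auto
    ultimately show "norm (pole_term \<gamma> z) \<le> M * weight \<gamma>" by linarith
  qed
qed

lemma pole_sum_remove:
  assumes g: "\<gamma>0 \<in> ordinates" and v: "v \<notin> crit ` ordinates"
  shows "pole_sum ordinates v = pole_term \<gamma>0 v + pole_sum (ordinates - {\<gamma>0}) v"
proof -
  obtain \<delta> where d: "\<delta> > 0" "\<delta> \<le> 1/4" "\<And>\<gamma>. \<gamma> \<in> ordinates \<Longrightarrow> crit \<gamma> \<noteq> v \<Longrightarrow> \<delta> \<le> dist v (crit \<gamma>)"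
    by (rule crit_separated) (rule that)
  have s: "(\<lambda>\<gamma>. pole_term \<gamma> v) summable_on (ordinates - {\<gamma>0})"
  proof (rule abs_summable_summable, rule pole_term_norm_summable[OF _ d(1)])
    show "\<delta> \<le> norm (v - crit \<gamma>)" if "\<gamma> \<in> ordinates - {\<gamma>0}" for \<gamma>
      unfolding dist_norm[symmetric] using that v by (intro d(3)) auto
  qed auto
  have "pole_sum ordinates v = pole_sum ({\<gamma>0} \<union> (ordinates - {\<gamma>0})) v" using g by (simp add: insert_absorb)
  also have "\<dots> = pole_sum {\<gamma>0} v + pole_sum (ordinates - {\<gamma>0}) v"
    unfolding pole_sum_def by (rule infsum_Un_disjoint) (use s in auto)
  finally show ?thesis by (simp add: pole_sum_def)
qed

lemma deriv_zeta_reg_crit: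
  assumes "\<gamma> \<in> ordinates"
  shows "deriv zeta_reg (crit \<gamma>) = (crit \<gamma> - 1) * deriv zeta (crit \<gamma>)"
    and "deriv zeta (crit \<gamma>) \<noteq> 0"
proof -
  have "((\<lambda>s. (s - 1) * zeta s) has_field_derivative (crit \<gamma> - 1) * deriv zeta (crit \<gamma>)) (at (crit \<gamma>))"
  proof -
    have "(zeta has_field_derivative deriv zeta (crit \<gamma>)) (at (crit \<gamma>))"
      by (intro holomorphic_derivI[OF zeta_holomorphic]) auto
    then have "((\<lambda>s. (s - 1) * zeta s) has_field_derivative (1 * zeta (crit \<gamma>) + deriv zeta (crit \<gamma>) * (crit \<gamma> - 1))) (at (crit \<gamma>))"
      by (intro DERIV_mult) (auto intro!: derivative_eq_intros)
    moreover have "zeta (crit \<gamma>) = 0" using assms by (simp add: ordinates_def)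
    ultimately show ?thesis by (simp add: mult.commute)
  qed
  moreover have "eventually (\<lambda>s. s \<in> - {1}) (nhds (crit \<gamma>))"
    by (rule eventually_nhds_in_open) auto
  then have "eventually (\<lambda>s. (s - 1) * zeta s = zeta_reg s) (nhds (crit \<gamma>))"
    by eventually_elim (simp add: zeta_reg_def)
  ultimately have "(zeta_reg has_field_derivative (crit \<gamma> - 1) * deriv zeta (crit \<gamma>)) (at (crit \<gamma>))"
    using DERIV_cong_ev[of "crit \<gamma>" "crit \<gamma>" "\<lambda>s. (s - 1) * zeta s" zeta_reg] by blast
  then show "deriv zeta_reg (crit \<gamma>) = (crit \<gamma> - 1) * deriv zeta (crit \<gamma>)" by (rule DERIV_imp_deriv)
  obtain KD where KD: "KD > 0"
    "\<And>\<gamma>. zeta (1/2 + \<i> * of_real \<gamma>) = 0 \<Longrightarrow> 1 \<le> norm (deriv zeta (1/2 + \<i> * of_real \<gamma>)) * (KD * norm (1/2 + \<i> * complex_of_real \<gamma>))"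
    by (rule zeta_deriv_zero_bound[OF WM]) (rule that)
  show "deriv zeta (crit \<gamma>) \<noteq> 0"
  proof
    assume "deriv zeta (crit \<gamma>) = 0"
    then show False using KD(2)[of \<gamma>] assms by (simp add: ordinates_def crit_def)
  qed
qed

text \<open>The left side is the residue of \<open>mellin_F\<close> at a simple zero rho; the factor
  (1 - rho)/2 of Gamma((3 - rho)/2) cancels against rho - 1 in the derivative of
  \<open>zeta_reg\<close>.\<close>

lemma mellin_F_residue:
  assumes g: "\<gamma> \<in> ordinates"
  shows "- Gamma ((3 - crit \<gamma>) / 2) / deriv zeta_reg (crit \<gamma>) = zero_coeff \<gamma> / 2"
proof -
  have "(1 - crit \<gamma>) / 2 \<notin> \<int>\<^sub>\<le>\<^sub>0" by (rule Gamma_not_nonpos_Ints) simp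
  then have "Gamma ((1 - crit \<gamma>) / 2 + 1) = (1 - crit \<gamma>) / 2 * Gamma ((1 - crit \<gamma>) / 2)" by (rule Gamma_plus1)
  moreover have "(1 - crit \<gamma>) / 2 + 1 = (3 - crit \<gamma>) / 2" by (simp add: field_simps)
  moreover have "(1 - crit \<gamma>) / 2 = 1/4 - \<i> * of_real \<gamma> / 2" by (simp add: crit_def field_simps)
  ultimately have "Gamma ((3 - crit \<gamma>) / 2) = (1 - crit \<gamma>) / 2 * Gamma (1/4 - \<i> * of_real \<gamma> / 2)" by metis
  moreover have "zero_coeff \<gamma> = Gamma (1/4 - \<i> * of_real \<gamma> / 2) / deriv zeta (crit \<gamma>)"
    by (simp add: zero_coeff_def crit_def)
  moreover have "crit \<gamma> - 1 \<noteq> 0" by simp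
  moreover have "- ((1 - c) / 2 * G) / ((c - 1) * d) = G / d / 2" if "c - 1 \<noteq> 0" "d \<noteq> 0" for c G d :: complex
    using that by (simp add: field_simps)
  ultimately show ?thesis
    using deriv_zeta_reg_crit[OF g] by metis
qed

text \<open>With zeta_reg(v) = (v - rho) q(v), \<open>mellin_F\<close> and the pole term at rho
  combine to h(v)/(v - rho) with h holomorphic; equality of the residues means h(rho) = 0, so the
  singularity is removable. The other pole terms are holomorphic near rho.\<close>

lemma remainder_extension_at:
  assumes g0: "\<gamma>0 \<in> ordinates"
  obtains \<delta> f where "\<delta> > 0" "f holomorphic_on ball (crit \<gamma>0) \<delta>"
    "\<And>v. v \<in> ball (crit \<gamma>0) \<delta> \<Longrightarrow> v \<noteq> crit \<gamma>0 \<Longrightarrow> v \<notin> crit ` ordinates \<and> f v = mellin_F v - pole_sum ordinates v"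
proof -
  define \<rho> where "\<rho> = crit \<gamma>0"
  obtain \<delta> where d: "\<delta> > 0" "\<delta> \<le> 1/4" "\<And>\<gamma>. \<gamma> \<in> ordinates \<Longrightarrow> crit \<gamma> \<noteq> \<rho> \<Longrightarrow> \<delta> \<le> dist \<rho> (crit \<gamma>)"
    by (rule crit_separated) (rule that)
  define B where "B = ball \<rho> \<delta>"
  have B: "open B" "\<rho> \<in> interior B" using d by (simp_all add: B_def)
  have out: "v \<notin> crit ` ordinates" if v: "v \<in> B" "v \<noteq> \<rho>" for v
  proof
    assume "v \<in> crit ` ordinates"
    then obtain \<gamma> where "\<gamma> \<in> ordinates" "v = crit \<gamma>" by blast
    then have "\<delta> \<le> dist \<rho> v" using d(3) v by blast
    then show False using v by (simp add: B_def)
  qed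
  have re: "Re v > 0" "Re v < 1" if v: "v \<in> B" for v
  proof -
    have "\<bar>Re \<rho> - Re v\<bar> \<le> dist \<rho> v" using abs_Re_le_cmod[of "\<rho> - v"] by (simp add: dist_norm)
    then have "\<bar>Re \<rho> - Re v\<bar> < 1/4" using v d by (simp add: B_def)
    moreover have "Re \<rho> = 1/2" by (simp add: \<rho>_def)
    ultimately show "Re v > 0" "Re v < 1" by linarith+
  qed
  have z0: "zeta_reg \<rho> = 0" using g0 by (simp add: \<rho>_def zeta_reg_crit_eq_0_iff)
  define q where "q = (\<lambda>z. if z = \<rho> then deriv zeta_reg \<rho> else (zeta_reg z - zeta_reg \<rho>) / (z - \<rho>))"
  have q: "q holomorphic_on B" unfolding q_def by (rule pole_lemma[OF zeta_reg_holomorphic B(2)])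
  have dnz: "deriv zeta_reg \<rho> \<noteq> 0" using deriv_zeta_reg_crit[OF g0] by (simp add: \<rho>_def)
  have q0: "q v \<noteq> 0" if "v \<in> B" for v
    using dnz z0 out[OF that] re[OF that] by (auto simp: q_def zeta_reg_zero_iff[OF WM])
  define h where "h = (\<lambda>v. - Gamma ((3 - v) / 2) / q v - zero_coeff \<gamma>0 / 2 * exp ((v - \<rho>)\<^sup>2))"
  have gam: "(\<lambda>v. Gamma ((3 - v) / 2)) holomorphic_on B"
    by (intro holomorphic_Gamma' holomorphic_intros Gamma_not_nonpos_Ints) (auto dest: re)
  have h: "h holomorphic_on B" unfolding h_def
    by (intro holomorphic_on_diff holomorphic_on_divide holomorphic_on_minus gam q q0 holomorphic_on_mult holomorphic_on_exp' holomorphic_intros) auto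
  have h0: "h \<rho> = 0" using mellin_F_residue[OF g0] by (simp add: h_def q_def \<rho>_def)
  define e where "e = (\<lambda>z. if z = \<rho> then deriv h \<rho> else (h z - h \<rho>) / (z - \<rho>))"
  have e: "e holomorphic_on B" unfolding e_def by (rule pole_lemma[OF h B(2)])
  have sub: "B \<subseteq> - crit ` (ordinates - {\<gamma>0})"
  proof
    fix v assume v: "v \<in> B"
    show "v \<in> - crit ` (ordinates - {\<gamma>0})"
    proof (cases "v = \<rho>")
      case True
      then show ?thesis using inj_crit by (auto simp: \<rho>_def inj_def)
    next
      case False
      then show ?thesis using out[OF v] by blast
    qed
  qed
  have f: "(\<lambda>v. e v - pole_sum (ordinates - {\<gamma>0}) v) holomorphic_on B"
    by (intro holomorphic_on_diff e holomorphic_on_subset[OF pole_sum_holomorphic sub]) auto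
  have eq: "e v - pole_sum (ordinates - {\<gamma>0}) v = mellin_F v - pole_sum ordinates v" if v: "v \<in> B" "v \<noteq> \<rho>" for v
  proof -
    have "zeta_reg v = (v - \<rho>) * q v" using v z0 by (simp add: q_def)
    then have "mellin_F v = - Gamma ((3 - v) / 2) / q v / (v - \<rho>)" by (simp add: mellin_F_def field_simps)
    then have "h v / (v - \<rho>) = mellin_F v - pole_term \<gamma>0 v"
      by (simp only: h_def pole_term_def \<rho>_def diff_divide_distrib)
    moreover have "e v = h v / (v - \<rho>)" using v h0 by (simp add: e_def)
    ultimately have "e v = mellin_F v - pole_term \<gamma>0 v" by simp
    then show ?thesis using pole_sum_remove[OF g0 out[OF v]] by simp
  qed
  show ?thesis
    by (rule that[OF d(1) f[unfolded B_def \<rho>_def]]) (use eq out in \<open>auto simp: B_def \<rho>_def\<close>)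
qed

lemma remainder_exists:
  obtains D where "D holomorphic_on {v. 0 < Re v \<and> Re v < 3}"
    "\<And>v. v \<notin> crit ` ordinates \<Longrightarrow> D v = mellin_F v - pole_sum ordinates v"
proof -
  define E where "E = (\<lambda>v. mellin_F v - pole_sum ordinates v)"
  \<comment> \<open>The value at a zero is taken as a limit, so that one function agrees with all
    the local extensions at once.\<close>
  define D where "D = (\<lambda>v. if v \<in> crit ` ordinates then Lim (at v) E else E v)"
  define S where "S = {v. 0 < Re v \<and> Re v < 3}"
  have oS: "open S"
  proof -
    have "S = {z. 0 < Re z} \<inter> {z. Re z < 3}" by (auto simp: S_def)
    then show ?thesis by (simp add: open_Int open_halfspace_Re_gt open_halfspace_Re_lt)
  qed
  have "D field_differentiable (at v)" if v: "v \<in> S" for v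
  proof (cases "v \<in> crit ` ordinates")
    case True
    then obtain \<gamma> where g: "\<gamma> \<in> ordinates" "v = crit \<gamma>" by blast
    obtain \<delta> f where d: "\<delta> > 0" "f holomorphic_on ball (crit \<gamma>) \<delta>"
      "\<And>w. w \<in> ball (crit \<gamma>) \<delta> \<Longrightarrow> w \<noteq> crit \<gamma> \<Longrightarrow> w \<notin> crit ` ordinates \<and> f w = mellin_F w - pole_sum ordinates w"
      by (rule remainder_extension_at[OF g(1)]) (rule that)
    have "f field_differentiable (at v)"
      using d(2) by (rule holomorphic_on_imp_differentiable_at) (use d(1) g in auto)
    then have "isCont f v" by (rule field_differentiable_imp_continuous_at)
    then have "f \<midarrow>v\<rightarrow> f v" by (simp add: isCont_def)
    moreover have "eventually (\<lambda>w. w \<in> ball v \<delta> - {v}) (at v)"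
      using d(1) eventually_at_in_open[of "ball v \<delta>" v] by simp
    then have "eventually (\<lambda>w. f w = E w) (at v)"
      by eventually_elim (use d(3) g in \<open>auto simp: E_def\<close>)
    ultimately have "E \<midarrow>v\<rightarrow> f v" using tendsto_cong by blast
    then have "Lim (at v) E = f v" by (intro tendsto_Lim) auto
    then have "D w = f w" if "w \<in> ball v \<delta>" for w
      using True d(3) g that by (cases "w = v") (auto simp: D_def E_def)
    then have "D holomorphic_on ball v \<delta>"
      using holomorphic_cong[OF refl, of "ball v \<delta>" D f] d(2) g by simp
    then show ?thesis by (rule holomorphic_on_imp_differentiable_at) (use d(1) in auto)
  next
    case False
    define U where "U = S \<inter> - crit ` ordinates"
    have U: "open U" "v \<in> U" using oS open_Compl_crit[OF order_refl] v False by (auto simp: U_def)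
    have "E holomorphic_on U" unfolding E_def
      by (intro holomorphic_on_diff holomorphic_on_subset[OF mellin_F_holomorphic[OF WM]]
          holomorphic_on_subset[OF pole_sum_holomorphic[OF order_refl]]) (auto simp: U_def S_def)
    then have "D holomorphic_on U"
      using holomorphic_cong[OF refl, of U D E] by (simp add: U_def D_def)
    then show ?thesis by (rule holomorphic_on_imp_differentiable_at) (use U in auto)
  qed
  then have "D holomorphic_on S" unfolding holomorphic_on_def using field_differentiable_at_within by blast
  then show ?thesis by (intro that[of D]) (auto simp: D_def E_def S_def)
qed

lemma pole_sum_strip_bound:
  obtains K where "K > 0" "\<And>v. 1/4 \<le> Re v \<Longrightarrow> Re v \<le> 2 \<Longrightarrow> Re v \<noteq> 1/2 \<Longrightarrow>
    norm (pole_sum ordinates v) \<le> K * exp (- \<bar>Im v\<bar> / 64) / \<bar>Re v - 1/2\<bar>"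
proof -
  define W where "W = infsum weight ordinates"
  have W: "W \<ge> 0" unfolding W_def by (intro infsum_nonneg weight_nonneg)
  define K where "K = exp 4 * W + 1"
  have "norm (pole_sum ordinates v) \<le> K * exp (- \<bar>Im v\<bar> / 64) / \<bar>Re v - 1/2\<bar>"
    if v: "1/4 \<le> Re v" "Re v \<le> 2" "Re v \<noteq> 1/2" for v
  proof -
    have "\<bar>Re v - 1/2\<bar> \<le> 3/2" using v by linarith
    then have "(Re v - 1/2)\<^sup>2 \<le> (3/2)\<^sup>2" by (metis abs_ge_zero power2_abs power_mono)
    then have "(Re v - 1/2)\<^sup>2 + 1 \<le> 4" by (simp add: power2_eq_square)
    then have e: "exp ((Re v - 1/2)\<^sup>2 + 1) \<le> exp 4" by simp
    have "norm (pole_sum ordinates v) \<le> exp ((Re v - 1/2)\<^sup>2 + 1) * exp (- \<bar>Im v\<bar> / 64) / \<bar>Re v - 1/2\<bar> * W"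
      unfolding W_def
    proof (rule pole_sum_bound)
      show "\<bar>Re v - 1/2\<bar> \<le> norm (v - crit \<gamma>)" for \<gamma> using abs_Re_le_cmod[of "v - crit \<gamma>"] by simp
    qed (use v in auto)
    also have "\<dots> \<le> exp 4 * exp (- \<bar>Im v\<bar> / 64) / \<bar>Re v - 1/2\<bar> * W"
      using e W by (intro mult_right_mono divide_right_mono) auto
    also have "\<dots> = (exp 4 * W) * exp (- \<bar>Im v\<bar> / 64) / \<bar>Re v - 1/2\<bar>" by simp
    also have "\<dots> \<le> K * exp (- \<bar>Im v\<bar> / 64) / \<bar>Re v - 1/2\<bar>"
      unfolding K_def by (intro divide_right_mono mult_right_mono) auto
    finally show ?thesis .
  qed
  moreover have "K > 0" using W by (simp add: K_def add_nonneg_pos)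
  ultimately show ?thesis by (rule that[rotated])
qed

text \<open>
  Near the critical line the difference \<open>mellin_F - pole_sum\<close> is only bounded by a multiple of
  \<open>1 / \<bar>Re v - 1/2\<bar>\<close>. On the circle \<open>\<bar>u\<bar> = 1/4\<close> one has \<open>1 + 16 u\<^sup>2 = 32 Re u * u\<close>, so
  multiplication by \<open>1 + 16 (v - crit T)\<^sup>2\<close> removes this singularity.
\<close>
lemma remainder_bound:
  assumes D: "D holomorphic_on {v. 0 < Re v \<and> Re v < 3}"
    "\<And>v. v \<notin> crit ` ordinates \<Longrightarrow> D v = mellin_F v - pole_sum ordinates v"
  obtains K where "K > 0" "\<And>v. 3/8 \<le> Re v \<Longrightarrow> Re v \<le> 2 \<Longrightarrow> norm (D v) \<le> K * exp (- \<bar>Im v\<bar> / 64)"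
proof -
  obtain K1 where K1: "K1 > 0" "\<And>v. 1/4 \<le> Re v \<Longrightarrow> Re v \<le> 3/4 \<Longrightarrow> Re v \<noteq> 1/2 \<Longrightarrow>
        norm (mellin_F v) \<le> K1 * exp (- \<bar>Im v\<bar> / 16) / \<bar>Re v - 1/2\<bar>"
    by (rule mellin_F_bound_near[OF WM]) (rule that)
  obtain K2 where K2: "K2 > 0" "\<And>v. 1/4 \<le> Re v \<Longrightarrow> Re v \<le> 2 \<Longrightarrow> Re v \<noteq> 1/2 \<Longrightarrow>
    norm (pole_sum ordinates v) \<le> K2 * exp (- \<bar>Im v\<bar> / 64) / \<bar>Re v - 1/2\<bar>"
    by (rule pole_sum_strip_bound) (rule that)
  obtain K3 where K3: "K3 > 0" "\<And>v. 5/8 \<le> Re v \<Longrightarrow> Re v \<le> 2 \<Longrightarrow> norm (mellin_F v) \<le> K3 * exp (- \<bar>Im v\<bar> / 16)"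
    by (rule mellin_F_bound_right[OF WM]) (rule that)
  have e16: "exp (- \<bar>y\<bar> / 16) \<le> exp (- \<bar>y\<bar> / 64)" for y :: real by simp
  have off: "v \<notin> crit ` ordinates" if "Re v \<noteq> 1/2" for v using that by auto
  have near: "norm (D v) \<le> (K1 + K2) * exp (- \<bar>Im v\<bar> / 64) / \<bar>Re v - 1/2\<bar>"
    if v: "1/4 \<le> Re v" "Re v \<le> 3/4" "Re v \<noteq> 1/2" for v
  proof -
    have "norm (D v) \<le> norm (mellin_F v) + norm (pole_sum ordinates v)"
      using D(2)[OF off[OF v(3)]] norm_triangle_ineq4 by metis
    also have "\<dots> \<le> K1 * exp (- \<bar>Im v\<bar> / 16) / \<bar>Re v - 1/2\<bar> + K2 * exp (- \<bar>Im v\<bar> / 64) / \<bar>Re v - 1/2\<bar>"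
      using v by (intro add_mono K1(2) K2(2)) auto
    also have "\<dots> \<le> K1 * exp (- \<bar>Im v\<bar> / 64) / \<bar>Re v - 1/2\<bar> + K2 * exp (- \<bar>Im v\<bar> / 64) / \<bar>Re v - 1/2\<bar>"
      using K1(1) by (intro add_right_mono divide_right_mono mult_left_mono e16) auto
    also have "\<dots> = (K1 + K2) * exp (- \<bar>Im v\<bar> / 64) / \<bar>Re v - 1/2\<bar>" by (simp add: add_divide_distrib ring_distribs)
    finally show ?thesis .
  qed
  \<comment> \<open>The factor \<open>exp 1\<close> covers the change of the imaginary part by at
    most 1/4 across the disc.\<close>
  define L where "L = 8 * (K1 + K2) * exp 1"
  have mid: "norm (D v) \<le> L * exp (- \<bar>Im v\<bar> / 64)" if v: "3/8 \<le> Re v" "Re v \<le> 5/8" for v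
  proof -
    define T where "T = Im v"
    define g where "g = (\<lambda>w. (1 + 16 * (w - crit T)\<^sup>2) * D w)"
    define B where "B = ball (crit T) (1/4)"
    have sub: "cball (crit T) (1/4) \<subseteq> {v. 0 < Re v \<and> Re v < 3}"
    proof
      fix w assume "w \<in> cball (crit T) (1/4)"
      then have "\<bar>Re (crit T) - Re w\<bar> \<le> 1/4"
        using abs_Re_le_cmod[of "crit T - w"] by (simp add: dist_norm)
      then show "w \<in> {v. 0 < Re v \<and> Re v < 3}" unfolding crit_simps mem_Collect_eq by linarith
    qed
    have g: "g holomorphic_on cball (crit T) (1/4)" unfolding g_def
      by (intro holomorphic_on_mult holomorphic_on_subset[OF D(1) sub] holomorphic_intros)
    have "norm (g v) \<le> L * exp (- \<bar>T\<bar> / 64)"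
    proof (rule maximum_modulus_frontier[where S = B and f = g])
      show "g holomorphic_on interior B"
        using g by (rule holomorphic_on_subset) (auto simp: B_def)
      show "continuous_on (closure B) g"
        using holomorphic_on_imp_continuous_on[OF g] by (simp add: B_def)
      show "bounded B" by (simp add: B_def)
      have "v - crit T = of_real (Re v - 1/2)" by (simp add: complex_eq_iff T_def)
      then have "dist (crit T) v = \<bar>Re v - 1/2\<bar>" by (metis dist_commute dist_norm norm_of_real)
      then show "v \<in> B" using v by (auto simp: B_def abs_if)
      fix w assume "w \<in> frontier B"
      then have w: "norm (w - crit T) = 1/4" by (simp add: B_def dist_norm norm_minus_commute)
      define u where "u = w - crit T"
      have u: "Re u = Re w - 1/2" "Im u = Im w - T" "norm u = 1/4" using w by (simp_all add: u_def)
      have "(Re u)\<^sup>2 + (Im u)\<^sup>2 = 1/16" unfolding cmod_power2[symmetric] u(3) by (simp add: power2_eq_square)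
      then have "1 + 16 * u\<^sup>2 = 32 * of_real (Re u) * u"
        by (simp add: complex_eq_iff power2_eq_square algebra_simps)
      then have nu: "norm (1 + 16 * u\<^sup>2) = 8 * \<bar>Re u\<bar>" using u(3) by (simp add: norm_mult)
      show "norm (g w) \<le> L * exp (- \<bar>T\<bar> / 64)"
      proof (cases "Re u = 0")
        case True
        then have "norm (1 + 16 * u\<^sup>2) = 0" using nu by simp
        then have "g w = 0" by (simp add: g_def u_def)
        then show ?thesis using K1 K2 by (simp add: L_def)
      next
        case False
        have "\<bar>Re u\<bar> \<le> 1/4" "\<bar>Im u\<bar> \<le> 1/4" using abs_Re_le_cmod[of u] abs_Im_le_cmod[of u] u(3) by auto
        then have ww: "1/4 \<le> Re w" "Re w \<le> 3/4" "\<bar>T\<bar> - 1/4 \<le> \<bar>Im w\<bar>" using u by linarith+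
        have "norm (g w) = 8 * \<bar>Re u\<bar> * norm (D w)" by (simp add: g_def norm_mult nu flip: u_def)
        also have "\<dots> \<le> 8 * \<bar>Re u\<bar> * ((K1 + K2) * exp (- \<bar>Im w\<bar> / 64) / \<bar>Re u\<bar>)"
          using near[OF ww(1,2)] False u by (intro mult_left_mono) auto
        also have "\<dots> = 8 * (K1 + K2) * exp (- \<bar>Im w\<bar> / 64)" using False by simp
        also have "\<dots> \<le> 8 * (K1 + K2) * exp (1 + - \<bar>T\<bar> / 64)"
          using ww K1(1) K2(1) by (intro mult_left_mono) auto
        also have "\<dots> = L * exp (- \<bar>T\<bar> / 64)" by (simp only: L_def exp_add mult.assoc)
        finally show ?thesis .
      qed
    qed
    \<comment> \<open>As \<open>T = Im v\<close>, the difference \<open>v - crit T\<close> is real,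
      so the multiplier is at least 1 at the point of interest.\<close>
    moreover have "norm (D v) \<le> norm (g v)"
    proof -
      have "v - crit T = of_real (Re v - 1/2)" by (simp add: complex_eq_iff T_def)
      then have "1 + 16 * (v - crit T)\<^sup>2 = of_real (1 + 16 * (Re v - 1/2)\<^sup>2)" by simp
      then have "norm (1 + 16 * (v - crit T)\<^sup>2) = \<bar>1 + 16 * (Re v - 1/2)\<^sup>2\<bar>" by (metis norm_of_real real_norm_def)
      then have "1 \<le> norm (1 + 16 * (v - crit T)\<^sup>2)" by simp
      then show ?thesis unfolding g_def norm_mult using mult_right_mono[OF _ norm_ge_zero, of 1 _ "D v"] by simp
    qed
    ultimately show ?thesis by (simp add: T_def)
  qed
  define K where "K = L + K3 + 8 * K2"
  have L: "L > 0" using K1 K2 by (simp add: L_def)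
  have "norm (D v) \<le> K * exp (- \<bar>Im v\<bar> / 64)" if v: "3/8 \<le> Re v" "Re v \<le> 2" for v
  proof (cases "Re v \<le> 5/8")
    case True
    have "L * exp (- \<bar>Im v\<bar> / 64) \<le> K * exp (- \<bar>Im v\<bar> / 64)"
      using K2(1) K3(1) by (intro mult_right_mono) (auto simp: K_def)
    then show ?thesis using mid[OF v(1) True] by linarith
  next
    case False
    then have r: "\<bar>Re v - 1/2\<bar> \<ge> 1/8" "Re v \<noteq> 1/2" by auto
    have "norm (D v) \<le> norm (mellin_F v) + norm (pole_sum ordinates v)"
      using D(2)[OF off[OF r(2)]] norm_triangle_ineq4 by metis
    also have "\<dots> \<le> K3 * exp (- \<bar>Im v\<bar> / 16) + K2 * exp (- \<bar>Im v\<bar> / 64) / \<bar>Re v - 1/2\<bar>"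
      using v False r by (intro add_mono K3(2) K2(2)) auto
    also have "\<dots> \<le> K3 * exp (- \<bar>Im v\<bar> / 64) + K2 * exp (- \<bar>Im v\<bar> / 64) / (1/8)"
      using K3(1) K2(1) r by (intro add_mono mult_left_mono e16 divide_left_mono) auto
    also have "\<dots> = (K3 + 8 * K2) * exp (- \<bar>Im v\<bar> / 64)" by (simp add: ring_distribs)
    also have "\<dots> \<le> K * exp (- \<bar>Im v\<bar> / 64)" using L by (intro mult_right_mono) (auto simp: K_def)
    finally show ?thesis .
  qed
  moreover have "K > 0" using L K2 K3 by (simp add: K_def)
  ultimately show ?thesis by (rule that[rotated])
qed

end

section \<open>The approximation by a cosine sum\<close>

lemma integrable_scale_line:
  fixes f :: "real \<Rightarrow> complex"
  assumes "integrable lborel f"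
  shows "integrable lborel (\<lambda>u. f (- u / 2))" "(\<integral>u. f (- u / 2) \<partial>lborel) = 2 * (\<integral>y. f y \<partial>lborel)"
proof -
  have "integrable lborel (\<lambda>u. f (0 + (-1/2) * u))"
    using assms by (subst lborel_integrable_real_affine_iff) auto
  then show "integrable lborel (\<lambda>u. f (- u / 2))" by simp
  have "(\<integral>y. f y \<partial>lborel) = \<bar>-1/2\<bar> *\<^sub>R (\<integral>u. f (0 + (-1/2) * u) \<partial>lborel)"
    by (rule lborel_integral_real_affine) simp
  then have "(\<integral>y. f y \<partial>lborel) = (\<integral>u. f (- u / 2) \<partial>lborel) / 2" by (simp add: scaleR_conv_of_real)
  then show "(\<integral>u. f (- u / 2) \<partial>lborel) = 2 * (\<integral>y. f y \<partial>lborel)" by (simp add: mult.commute)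
qed

lemma exp_square_Mellin:
  fixes t :: real
  shows "integrable lborel (\<lambda>y. Gamma ((1 - Complex 2 y) / 2) / 2 * exp ((Complex 2 y - 1) * of_real t))"
    and "(\<integral>y. Gamma ((1 - Complex 2 y) / 2) / 2 * exp ((Complex 2 y - 1) * of_real t) \<partial>lborel) =
           2 * pi * of_real (exp (- (exp t)\<^sup>2) - 1)"
proof -
  define f where "f = (\<lambda>y. Gamma (Complex (-1/2) y) * exp (- Complex (-1/2) y * of_real (2 * t)))"
  have f: "integrable lborel f" "(\<integral>y. f y \<partial>lborel) = 2 * pi * of_real (exp (- exp (2 * t)) - 1)"
    unfolding f_def by (rule Gamma_Mellin_inversion)+
  have c: "Complex (-1/2) (- u / 2) = (1 - Complex 2 u) / 2" for u by (simp add: complex_eq_iff)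
  have "- ((1 - Complex 2 u) / 2) * of_real (2 * t) = (Complex 2 u - 1) * of_real t" for u by (simp add: complex_eq_iff)
  then have eq: "f (- u / 2) = 2 * (Gamma ((1 - Complex 2 u) / 2) / 2 * exp ((Complex 2 u - 1) * of_real t))" for u
    unfolding f_def c by simp
  have i: "integrable lborel (\<lambda>u. f (- u / 2) / 2)"
    using integrable_scale_line(1)[OF f(1)] by (rule integrable_divide_zero)
  then show "integrable lborel (\<lambda>y. Gamma ((1 - Complex 2 y) / 2) / 2 * exp ((Complex 2 y - 1) * of_real t))"
    unfolding eq by simp
  have "2 * (\<integral>y. Gamma ((1 - Complex 2 y) / 2) / 2 * exp ((Complex 2 y - 1) * of_real t) \<partial>lborel) =
     2 * (\<integral>y. f y \<partial>lborel)"
    using integrable_scale_line(2)[OF f(1)] unfolding eq by simp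
  moreover have "exp (2 * t) = (exp t)\<^sup>2" by (simp add: exp_double)
  ultimately show "(\<integral>y. Gamma ((1 - Complex 2 y) / 2) / 2 * exp ((Complex 2 y - 1) * of_real t) \<partial>lborel) =
           2 * pi * of_real (exp (- (exp t)\<^sup>2) - 1)" unfolding f(2) by simp
qed

lemma zeta_2_line_nonzero: "zeta (Complex 2 y) \<noteq> 0"
  using moebius_zeta(2)[of "Complex 2 y"] by auto

lemma moebius_norm_le: "norm (of_int (moebius n) :: 'a :: real_normed_algebra_1) \<le> 1"
  using abs_moebius_le[of n] by (simp add: norm_of_int)

context
  assumes WM: weak_Mertens_hypothesis
begin

text \<open>The Moebius series of 1/zeta is inserted on \<open>Re v = 2\<close>; its n-th term
  shifts t to t - ln n, so the Mellin formula produces exp(-(b/n)^2) - 1 with b = exp t.\<close>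

lemma moebius_exp_series_integral:
  fixes t :: real
  shows "2 * pi * of_real (moebius_exp_series (exp t)) =
    (\<integral>y. mellin_F (Complex 2 y) * exp ((Complex 2 y - 1) * of_real t) \<partial>lborel)"
proof -
  define g where "g = (\<lambda>y. Gamma ((1 - Complex 2 y) / 2) / 2 * exp ((Complex 2 y - 1) * of_real t))"
  have gi: "integrable lborel g" unfolding g_def by (rule exp_square_Mellin)
  define m where "m = (\<lambda>n. of_int (moebius (Suc n)) :: complex)"
  define h where "h = (\<lambda>n y. m n * of_nat (Suc n) powr (- Complex 2 y) * g y)"
  have m1: "norm (m n) \<le> 1" for n unfolding m_def by (rule moebius_norm_le)
  have h_eq: "h n y = m n / of_nat (Suc n) *
     (Gamma ((1 - Complex 2 y) / 2) / 2 * exp ((Complex 2 y - 1) * of_real (t - ln (real (Suc n)))))" for n y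
  proof -
    define N where "N = (of_nat (Suc n) :: complex)"
    have N: "N \<noteq> 0" unfolding N_def by (simp del: of_nat_Suc)
    have lN: "ln N = of_real (ln (real (Suc n)))" unfolding N_def
      by (metis Ln_of_real of_nat_0_less_iff of_real_of_nat_eq zero_less_Suc)
    have "N powr (- Complex 2 y) = N powr (1 - Complex 2 y) / N"
      using N powr_diff[of N "1 - Complex 2 y" 1] by (simp add: powr_one)
    also have "N powr (1 - Complex 2 y) = exp ((1 - Complex 2 y) * of_real (ln (real (Suc n))))"
      using N by (simp add: powr_def lN)
    finally have "N powr (- Complex 2 y) * exp ((Complex 2 y - 1) * of_real t) =
       exp ((1 - Complex 2 y) * of_real (ln (real (Suc n))) + (Complex 2 y - 1) * of_real t) / N"
      unfolding exp_add by simp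
    also have "(1 - Complex 2 y) * of_real (ln (real (Suc n))) + (Complex 2 y - 1) * of_real t =
       (Complex 2 y - 1) * of_real (t - ln (real (Suc n)))" unfolding of_real_diff by (simp add: algebra_simps del: of_nat_Suc)
    finally have e: "N powr (- Complex 2 y) * exp ((Complex 2 y - 1) * of_real t) =
      exp ((Complex 2 y - 1) * of_real (t - ln (real (Suc n)))) / N" .
    have "h n y = m n * (Gamma ((1 - Complex 2 y) / 2) / 2) * (N powr (- Complex 2 y) * exp ((Complex 2 y - 1) * of_real t))"
      unfolding h_def g_def N_def by (simp only: mult_ac)
    moreover have "a * (b / 2) * (c / d) = a / d * (b / 2 * c)" for a b c d :: complex by (simp add: mult_ac)
    ultimately show ?thesis unfolding e unfolding N_def by (simp only:)
  qed
  have hint: "integrable lborel (h n)" for n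
    unfolding h_eq by (intro integrable_mult_right exp_square_Mellin)
  have hI: "(\<integral>y. h n y \<partial>lborel) = 2 * pi * of_real (of_int (moebius (Suc n)) / real (Suc n) * exp (- (exp t / real (Suc n))\<^sup>2)
      - of_int (moebius (Suc n)) / real (Suc n))" for n
  proof -
    have "(\<integral>y. h n y \<partial>lborel) = m n / of_nat (Suc n) * (2 * pi * of_real (exp (- (exp (t - ln (real (Suc n))))\<^sup>2) - 1))"
      unfolding h_eq integral_mult_right_zero exp_square_Mellin ..
    also have "exp (t - ln (real (Suc n))) = exp t / real (Suc n)" by (simp add: exp_diff del: of_nat_Suc)
    also have "m n / of_nat (Suc n) = of_real (of_int (moebius (Suc n)) / real (Suc n))" by (simp add: m_def)
    finally show ?thesis by (simp add: algebra_simps del: of_nat_Suc)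
  qed
  have nh: "norm (h n y) \<le> real (Suc n) powr (- 2) * norm (g y)" for n y
  proof -
    have "norm (h n y) = norm (m n) * real (Suc n) powr (- 2) * norm (g y)"
      unfolding h_def norm_mult norm_nat_powr by simp
    also have "\<dots> \<le> 1 * real (Suc n) powr (- 2) * norm (g y)"
      by (intro mult_right_mono m1) auto
    finally show ?thesis by simp
  qed
  have sm: "summable (\<lambda>n. real (Suc n) powr (- 2))"
    by (subst summable_Suc_iff[of "\<lambda>n. real n powr (-2)"]) (simp add: summable_real_powr_iff)
  have "(\<lambda>n. \<integral>y. h n y \<partial>lborel) sums (\<integral>y. (\<Sum>n. h n y) \<partial>lborel)"
  proof (rule sums_integral)
    show "integrable lborel (h n)" for n by (rule hint)
    show "AE y in lborel. summable (\<lambda>n. norm (h n y))"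
    proof (rule AE_I2)
      fix y
      show "summable (\<lambda>n. norm (h n y))"
        by (rule summable_comparison_test'[OF summable_mult2[OF sm]]) (use nh in auto)
    qed
    show "summable (\<lambda>n. \<integral>y. norm (h n y) \<partial>lborel)"
    proof (rule summable_comparison_test'[OF summable_mult2[OF sm, of "\<integral>y. norm (g y) \<partial>lborel"]])
      fix n
      have "(\<integral>y. norm (h n y) \<partial>lborel) \<le> (\<integral>y. real (Suc n) powr (- 2) * norm (g y) \<partial>lborel)"
        by (intro integral_mono integrable_norm hint integrable_mult_right gi nh)
      then show "norm (\<integral>y. norm (h n y) \<partial>lborel) \<le> real (Suc n) powr (- 2) * (\<integral>y. norm (g y) \<partial>lborel)"
        by simp
    qed
  qed
  moreover have "(\<Sum>n. h n y) = mellin_F (Complex 2 y) * exp ((Complex 2 y - 1) * of_real t)" for y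
  proof -
    have c: "Re (Complex 2 y) > 1" "Re (Complex 2 y) < 3" "Complex 2 y \<noteq> 1" by (auto simp: complex_eq_iff)
    have "(\<Sum>n. h n y) = (\<Sum>n. m n * of_nat (Suc n) powr (- Complex 2 y)) * g y"
      unfolding h_def m_def by (rule suminf_mult2[OF moebius_zeta(1)[OF c(1)], symmetric])
    also have "(\<Sum>n. m n * of_nat (Suc n) powr (- Complex 2 y)) = 1 / zeta (Complex 2 y)"
      using moebius_zeta(2)[OF c(1)] zeta_2_line_nonzero[of y] unfolding m_def by (simp add: field_simps)
    finally show ?thesis using mellin_F_eq[OF c(3,2)] by (simp add: g_def)
  qed
  ultimately have S: "(\<lambda>n. \<integral>y. h n y \<partial>lborel) sums (\<integral>y. mellin_F (Complex 2 y) * exp ((Complex 2 y - 1) * of_real t) \<partial>lborel)"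
    by simp
  define a where "a = (\<lambda>n. of_int (moebius (Suc n)) / real (Suc n) * exp (- (exp t / real (Suc n))\<^sup>2)
      - of_int (moebius (Suc n)) / real (Suc n))"
  have "(\<lambda>n. complex_of_real (2 * pi * a n)) sums (\<integral>y. mellin_F (Complex 2 y) * exp ((Complex 2 y - 1) * of_real t) \<partial>lborel)"
    using S unfolding hI a_def by simp
  then have "(\<lambda>n. Re (complex_of_real (2 * pi * a n))) sums Re (\<integral>y. mellin_F (Complex 2 y) * exp ((Complex 2 y - 1) * of_real t) \<partial>lborel)"
    "(\<lambda>n. Im (complex_of_real (2 * pi * a n))) sums Im (\<integral>y. mellin_F (Complex 2 y) * exp ((Complex 2 y - 1) * of_real t) \<partial>lborel)"
    by (intro sums_Re sums_Im; assumption)+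
  then have 1: "(\<lambda>n. 2 * pi * a n) sums Re (\<integral>y. mellin_F (Complex 2 y) * exp ((Complex 2 y - 1) * of_real t) \<partial>lborel)"
    and 2: "Im (\<integral>y. mellin_F (Complex 2 y) * exp ((Complex 2 y - 1) * of_real t) \<partial>lborel) = 0"
    by (simp_all add: sums_iff)
  define I where "I = Re (\<integral>y. mellin_F (Complex 2 y) * exp ((Complex 2 y - 1) * of_real t) \<partial>lborel)"
  have "a sums (I / (2 * pi))" using sums_mult[OF 1, of "1 / (2 * pi)"] by (simp add: I_def)
  \<comment> \<open>Adding the series of mu(n)/n, whose sum is 0, cancels the terms - 1. Here the
    conditional convergence enters.\<close>
  from sums_add[OF this moebius_over_n_sums_0[OF WM]]
  have "(\<lambda>n. of_int (moebius (Suc n)) / real (Suc n) * exp (- (exp t / real (Suc n))\<^sup>2)) sums (I / (2 * pi))"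
    by (simp add: a_def)
  then have "moebius_exp_series (exp t) = I / (2 * pi)"
    unfolding moebius_exp_series_def by (simp add: sums_iff)
  then show ?thesis using 2 by (simp add: complex_eq_iff I_def)
qed

end

text \<open>With a majorant of product form the integral of the tail over \<open>X - A\<close> is at
  most the corresponding tail of \<open>w\<close> times the integral of \<open>h\<close>, which
  tends to 0 along the finite subsets \<open>A\<close>.\<close>

lemma has_sum_integral_dominated:
  fixes f :: "'a \<Rightarrow> 'b \<Rightarrow> complex"
  assumes f: "\<And>x. x \<in> X \<Longrightarrow> integrable M (f x)"
    and F: "integrable M (\<lambda>y. \<Sum>\<^sub>\<infinity>x\<in>X. f x y)" and h: "integrable M h"
    and w: "w summable_on X" and bound: "\<And>x y. x \<in> X \<Longrightarrow> norm (f x y) \<le> w x * h y"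
  shows "((\<lambda>x. \<integral>y. f x y \<partial>M) has_sum (\<integral>y. (\<Sum>\<^sub>\<infinity>x\<in>X. f x y) \<partial>M)) X"
proof -
  define W where "W = infsum w X"
  define H where "H = (\<integral>y. h y \<partial>M)"
  have fs: "(\<lambda>x. f x y) summable_on A" if "A \<subseteq> X" for y A
  proof (rule abs_summable_summable)
    show "(\<lambda>x. norm (f x y)) summable_on A"
    proof (rule summable_on_comparison_test)
      show "(\<lambda>x. w x * h y) summable_on A"
        by (intro summable_on_cmult_left summable_on_subset_banach[OF w that])
    qed (use that bound in auto)
  qed
  have *: "norm ((\<Sum>x\<in>A. \<integral>y. f x y \<partial>M) - (\<integral>y. (\<Sum>\<^sub>\<infinity>x\<in>X. f x y) \<partial>M)) \<le> (W - sum w A) * H"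
    if A: "finite A" "A \<subseteq> X" for A
  proof -
    have split: "(\<Sum>\<^sub>\<infinity>x\<in>X. f x y) = (\<Sum>x\<in>A. f x y) + (\<Sum>\<^sub>\<infinity>x\<in>X - A. f x y)" for y
      using infsum_Diff[OF fs[OF order_refl] fs[OF A(2)] A(2), of y] A by simp
    have ws: "infsum w (X - A) = W - sum w A" unfolding W_def
      using infsum_Diff[OF w _ A(2)] A by simp
    have "integrable M (\<lambda>y. \<Sum>x\<in>A. f x y)" using A f by (intro Bochner_Integration.integrable_sum) auto
    then have iR: "integrable M (\<lambda>y. \<Sum>\<^sub>\<infinity>x\<in>X - A. f x y)"
      using Bochner_Integration.integrable_diff[OF F] unfolding split by fastforce
    have "(\<integral>y. (\<Sum>\<^sub>\<infinity>x\<in>X. f x y) \<partial>M) = (\<Sum>x\<in>A. \<integral>y. f x y \<partial>M) + (\<integral>y. (\<Sum>\<^sub>\<infinity>x\<in>X - A. f x y) \<partial>M)"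
      unfolding split using A f iR by (subst Bochner_Integration.integral_add) (auto intro!: Bochner_Integration.integral_sum Bochner_Integration.integrable_sum)
    then have "norm ((\<Sum>x\<in>A. \<integral>y. f x y \<partial>M) - (\<integral>y. (\<Sum>\<^sub>\<infinity>x\<in>X. f x y) \<partial>M)) = norm (\<integral>y. (\<Sum>\<^sub>\<infinity>x\<in>X - A. f x y) \<partial>M)"
      by simp
    also have "\<dots> \<le> (\<integral>y. norm (\<Sum>\<^sub>\<infinity>x\<in>X - A. f x y) \<partial>M)" by (rule integral_norm_bound)
    also have "\<dots> \<le> (\<integral>y. infsum w (X - A) * h y \<partial>M)"
    proof (rule integral_mono)
      show "norm (\<Sum>\<^sub>\<infinity>x\<in>X - A. f x y) \<le> infsum w (X - A) * h y" for y
      proof (rule norm_infsum_le)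
        show "((\<lambda>x. f x y) has_sum (\<Sum>\<^sub>\<infinity>x\<in>X - A. f x y)) (X - A)" by (rule has_sum_infsum, rule fs) auto
        show "((\<lambda>x. w x * h y) has_sum infsum w (X - A) * h y) (X - A)"
          by (intro has_sum_cmult_left has_sum_infsum summable_on_subset_banach[OF w]) auto
      qed (use bound in auto)
    qed (use iR h in auto)
    finally show ?thesis by (simp add: ws H_def)
  qed
  have "((\<lambda>A. (W - sum w A) * H) \<longlongrightarrow> (W - W) * H) (finite_subsets_at_top X)"
    using has_sum_infsum[OF w] unfolding has_sum_def W_def by (intro tendsto_intros)
  then have "((\<lambda>A. (W - sum w A) * H) \<longlongrightarrow> 0) (finite_subsets_at_top X)" by simp
  moreover have "eventually (\<lambda>A. norm ((\<Sum>x\<in>A. \<integral>y. f x y \<partial>M) - (\<integral>y. (\<Sum>\<^sub>\<infinity>x\<in>X. f x y) \<partial>M)) \<le> (W - sum w A) * H)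
     (finite_subsets_at_top X)"
    by (rule eventually_finite_subsets_at_top_weakI) (rule *)
  ultimately have "((\<lambda>A. (\<Sum>x\<in>A. \<integral>y. f x y \<partial>M) - (\<integral>y. (\<Sum>\<^sub>\<infinity>x\<in>X. f x y) \<partial>M)) \<longlongrightarrow> 0) (finite_subsets_at_top X)"
    by (rule Lim_null_comparison[rotated])
  then show ?thesis unfolding has_sum_def by (rule LIM_zero_cancel)
qed

lemma exp_pole_bound:
  assumes v: "3/8 \<le> Re v" "Re v \<le> 2"
  shows "norm (zero_coeff \<gamma> / 2 * exp ((v - crit \<gamma>)\<^sup>2) * exp ((v - 1) * of_real t)) \<le>
    exp 4 * weight \<gamma> * exp ((Re v - 1) * t) * exp (- \<bar>Im v\<bar> / 64)"
proof -
  have "\<bar>Re v - 1/2\<bar> \<le> 3/2" using v by linarith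
  then have "(Re v - 1/2)\<^sup>2 \<le> (3/2)\<^sup>2" by (metis abs_ge_zero power2_abs power_mono)
  then have "(Re v - 1/2)\<^sup>2 + 1 \<le> 4" by (simp add: power2_eq_square)
  then have e: "exp ((Re v - 1/2)\<^sup>2 + 1) \<le> exp 4" by simp
  have "norm (exp ((v - crit \<gamma>)\<^sup>2)) \<le> exp ((Re v - 1/2)\<^sup>2 + 1) * (exp (\<bar>\<gamma>\<bar> / 64) * exp (- \<bar>Im v\<bar> / 64))"
    by (rule norm_exp_square_le)
  also have "\<dots> \<le> exp 4 * (exp (\<bar>\<gamma>\<bar> / 64) * exp (- \<bar>Im v\<bar> / 64))" using e by (intro mult_right_mono) auto
  finally have n: "norm (exp ((v - crit \<gamma>)\<^sup>2)) \<le> exp 4 * (exp (\<bar>\<gamma>\<bar> / 64) * exp (- \<bar>Im v\<bar> / 64))" .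
  have "norm (zero_coeff \<gamma> / 2 * exp ((v - crit \<gamma>)\<^sup>2) * exp ((v - 1) * of_real t)) =
    norm (zero_coeff \<gamma>) / 2 * norm (exp ((v - crit \<gamma>)\<^sup>2)) * exp ((Re v - 1) * t)"
    unfolding norm_mult norm_divide norm_exp_eq_Re by simp
  also have "\<dots> \<le> norm (zero_coeff \<gamma>) * (exp 4 * (exp (\<bar>\<gamma>\<bar> / 64) * exp (- \<bar>Im v\<bar> / 64))) * exp ((Re v - 1) * t)"
    by (intro mult_right_mono mult_mono n) auto
  also have "\<dots> = exp 4 * weight \<gamma> * exp ((Re v - 1) * t) * exp (- \<bar>Im v\<bar> / 64)"
    by (simp add: weight_def)
  finally show ?thesis .
qed

context
  assumes WM: weak_Mertens_hypothesis
begin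

lemma moebius_exp_series_approx:
  obtains K where "K > 0" "\<And>t. t \<ge> 0 \<Longrightarrow>
    norm (of_real (exp (t / 2) * moebius_exp_series (exp t)) -
      (\<Sum>\<^sub>\<infinity>\<gamma>\<in>ordinates. zero_coeff \<gamma> / 2 * exp (\<i> * of_real (\<gamma> * t)))) \<le> K * exp (- t / 8)"
proof -
  obtain D where D: "D holomorphic_on {v. 0 < Re v \<and> Re v < 3}"
    "\<And>v. v \<notin> crit ` ordinates \<Longrightarrow> D v = mellin_F v - pole_sum ordinates v"
    by (rule remainder_exists[OF WM]) (rule that)
  obtain KD where KD: "KD > 0" "\<And>v. 3/8 \<le> Re v \<Longrightarrow> Re v \<le> 2 \<Longrightarrow> norm (D v) \<le> KD * exp (- \<bar>Im v\<bar> / 64)"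
  proof (rule remainder_bound[OF WM D(1)])
    show "D v = mellin_F v - pole_sum ordinates v" if "v \<notin> crit ` ordinates" for v by (rule D(2)[OF that])
  qed (rule that)
  obtain K1 where K1: "K1 > 0" and "\<And>y::real. (1 + \<bar>y\<bar>) * exp (- (1/64) * \<bar>y\<bar>) \<le> K1 / (1 + y\<^sup>2)"
    and K1': "\<And>y::real. exp (- (1/64) * \<bar>y\<bar>) \<le> K1 / (1 + y\<^sup>2)"
    by (rule exp_decay_quadratic[where c = "1/64"]) (simp, rule that)
  have K1b: "exp (- \<bar>y\<bar> / 64) \<le> K1 / (1 + y\<^sup>2)" for y :: real using K1'[of y] by simp
  define e where "e = (\<lambda>y::real. exp (- \<bar>y\<bar> / 64))"
  have ei: "integrable lborel e"
  proof (rule Bochner_Integration.integrable_bound)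
    show "integrable lborel (\<lambda>y::real. K1 * (1 / (1 + y\<^sup>2)))"
      by (intro integrable_mult_right integrable_one_over_one_plus_square)
    show "e \<in> borel_measurable lborel" unfolding e_def by simp
    show "AE y in lborel. norm (e y) \<le> norm (K1 * (1 / (1 + y\<^sup>2)))"
      using K1b K1 by (auto simp: e_def abs_mult)
  qed
  define H where "H = (\<integral>y. e y \<partial>lborel)"
  have H: "H \<ge> 0" unfolding H_def e_def by (intro integral_nonneg_AE) auto
  define W where "W = infsum weight ordinates"
  have W: "W \<ge> 0" unfolding W_def by (intro infsum_nonneg weight_nonneg)
  define K where "K = KD * H + 8 * exp 4 * W * H + 1"
  have main: "norm (of_real (exp (t / 2) * moebius_exp_series (exp t)) -
      (\<Sum>\<^sub>\<infinity>\<gamma>\<in>ordinates. zero_coeff \<gamma> / 2 * exp (\<i> * of_real (\<gamma> * t)))) \<le> K * exp (- t / 8)" if t: "t \<ge> 0" for t :: real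
  proof -
    define E where "E = (\<lambda>v. exp ((v - 1) * complex_of_real t))"
    have nE: "norm (E v) = exp ((Re v - 1) * t)" for v unfolding E_def norm_exp_eq_Re by simp
    have E1: "norm (E v) \<le> exp t" if "Re v \<le> 2" for v
      unfolding nE using that t mult_right_mono[of "Re v - 1" 1 t] by simp
    define f where "f = (\<lambda>v. D v * E v)"
    have fh: "f holomorphic_on {v. 0 < Re v \<and> Re v < 3}" unfolding f_def E_def
      by (intro holomorphic_on_mult D(1) holomorphic_intros)
    have fb: "norm (f z) \<le> (KD * exp t) * exp (- (1/64) * \<bar>Im z\<bar>)" if z: "3/8 \<le> Re z" "Re z \<le> 2" for z
    proof -
      have "norm (f z) \<le> (KD * exp (- \<bar>Im z\<bar> / 64)) * exp t"
        unfolding f_def norm_mult using z KD(1) by (intro mult_mono KD(2) E1) auto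
      then show ?thesis by (simp add: mult_ac)
    qed
    have fs: "integrable lborel (\<lambda>y. f (Complex 2 y))" "integrable lborel (\<lambda>y. f (Complex (3/8) y))"
      "(\<integral>y. f (Complex 2 y) \<partial>lborel) = (\<integral>y. f (Complex (3/8) y) \<partial>lborel)"
      by (rule vertical_line_shift[OF fh, of "3/8" 2 "1/64" "KD * exp t"]; use fb in simp)+
    have "norm (\<integral>y. f (Complex (3/8) y) \<partial>lborel) \<le> (\<integral>y. norm (f (Complex (3/8) y)) \<partial>lborel)" by (rule integral_norm_bound)
    also have "\<dots> \<le> (\<integral>y. KD * exp (- (5/8) * t) * e y \<partial>lborel)"
    proof (rule integral_mono)
      show "norm (f (Complex (3/8) y)) \<le> KD * exp (- (5/8) * t) * e y" for y
      proof -
        have "norm (f (Complex (3/8) y)) = norm (D (Complex (3/8) y)) * exp (- (5/8) * t)"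
          by (simp add: f_def norm_mult nE)
        also have "\<dots> \<le> KD * e y * exp (- (5/8) * t)"
          using KD(2)[of "Complex (3/8) y"] by (intro mult_right_mono) (auto simp: e_def)
        finally show ?thesis by (simp add: mult_ac)
      qed
    qed (use fs ei in auto)
    finally have fI: "norm (\<integral>y. f (Complex 2 y) \<partial>lborel) \<le> KD * H * exp (- (5/8) * t)"
      unfolding fs(3) H_def by (simp add: mult_ac)

    define q where "q = (\<lambda>\<gamma> v. pole_term \<gamma> v * E v)"
    define A where "A = (\<lambda>\<gamma> v. zero_coeff \<gamma> / 2 * exp ((v - crit \<gamma>)\<^sup>2) * E v)"
    have qA: "q \<gamma> v = A \<gamma> v / (v - crit \<gamma>)" for \<gamma> v by (simp add: q_def A_def pole_term_def)
    have Ab: "norm (A \<gamma> v) \<le> exp 4 * weight \<gamma> * exp ((Re v - 1) * t) * e (Im v)" if "3/8 \<le> Re v" "Re v \<le> 2" for \<gamma> v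
      unfolding A_def E_def e_def by (rule exp_pole_bound[OF that])
    have Ab': "norm (A \<gamma> z) \<le> exp 4 * weight \<gamma> * exp t * K1 / (1 + (Im z)\<^sup>2)" if z: "3/8 \<le> Re z" "Re z \<le> 2" for \<gamma> z
    proof -
      have "(Re z - 1) * t \<le> t" using z t mult_right_mono[of "Re z - 1" 1 t] by simp
      then have "exp 4 * weight \<gamma> * exp ((Re z - 1) * t) * e (Im z) \<le> exp 4 * weight \<gamma> * exp t * (K1 / (1 + (Im z)\<^sup>2))"
        unfolding e_def by (intro mult_mono mult_left_mono K1b) (auto simp: weight_nonneg)
      then show ?thesis using Ab[OF z, of \<gamma>] by simp
    qed
    have Ah: "A \<gamma> holomorphic_on {v. 0 < Re v \<and> Re v < 3}" for \<gamma> unfolding A_def E_def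
      by (intro holomorphic_intros)
    have qs: "integrable lborel (\<lambda>y. q \<gamma> (Complex 2 y))" "integrable lborel (\<lambda>y. q \<gamma> (Complex (3/8) y))"
      "(\<integral>y. q \<gamma> (Complex 2 y) \<partial>lborel) - (\<integral>y. q \<gamma> (Complex (3/8) y) \<partial>lborel) = 2 * pi * A \<gamma> (crit \<gamma>)" for \<gamma>
      unfolding qA by (rule vertical_line_shift_pole[OF Ah[of \<gamma>], of "3/8" 2 "crit \<gamma>" "exp 4 * weight \<gamma> * exp t * K1"]; use Ab' in simp)+
    have nv2: "1 \<le> norm (Complex 2 y - crit \<gamma>)" for y \<gamma>
      using abs_Re_le_cmod[of "Complex 2 y - crit \<gamma>"] by simp
    have nv38: "1/8 \<le> norm (Complex (3/8) y - crit \<gamma>)" for y \<gamma>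
      using abs_Re_le_cmod[of "Complex (3/8) y - crit \<gamma>"] by simp
    have q2: "norm (q \<gamma> (Complex 2 y)) \<le> weight \<gamma> * (exp 4 * exp t * e y)" for \<gamma> y
    proof -
      have "norm (q \<gamma> (Complex 2 y)) \<le> norm (A \<gamma> (Complex 2 y)) / 1"
        unfolding qA norm_divide using nv2[of y \<gamma>] by (intro divide_left_mono) auto
      also have "\<dots> \<le> weight \<gamma> * (exp 4 * exp t * e y)" using Ab[of "Complex 2 y" \<gamma>] by (simp add: mult_ac)
      finally show ?thesis .
    qed
    have q38: "norm (\<integral>y. q \<gamma> (Complex (3/8) y) \<partial>lborel) \<le> 8 * exp 4 * H * exp (- (5/8) * t) * weight \<gamma>" for \<gamma>
    proof -
      have "norm (\<integral>y. q \<gamma> (Complex (3/8) y) \<partial>lborel) \<le> (\<integral>y. norm (q \<gamma> (Complex (3/8) y)) \<partial>lborel)" by (rule integral_norm_bound)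
      also have "\<dots> \<le> (\<integral>y. 8 * exp 4 * weight \<gamma> * exp (- (5/8) * t) * e y \<partial>lborel)"
      proof (rule integral_mono)
        fix y
        have "norm (q \<gamma> (Complex (3/8) y)) \<le> norm (A \<gamma> (Complex (3/8) y)) / (1/8)"
          unfolding qA norm_divide using nv38[of y \<gamma>] by (intro divide_left_mono) auto
        also have "\<dots> \<le> 8 * exp 4 * weight \<gamma> * exp (- (5/8) * t) * e y"
          using Ab[of "Complex (3/8) y" \<gamma>] by simp
        finally show "norm (q \<gamma> (Complex (3/8) y)) \<le> 8 * exp 4 * weight \<gamma> * exp (- (5/8) * t) * e y" .
      qed (use qs ei in auto)
      finally show ?thesis unfolding H_def by (simp add: mult_ac)
    qed
    have off: "Complex 2 y \<notin> crit ` ordinates" for y by (auto simp: complex_eq_iff crit_def)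
    have Psum: "pole_sum ordinates (Complex 2 y) * E (Complex 2 y) = (\<Sum>\<^sub>\<infinity>\<gamma>\<in>ordinates. q \<gamma> (Complex 2 y))" for y
      unfolding pole_sum_def q_def by (rule infsum_cmult_left'[symmetric])
    have contE: "continuous_on UNIV (\<lambda>y. E (Complex 2 y))" unfolding E_def Complex_eq by (intro continuous_intros)
    have contP: "continuous_on UNIV (\<lambda>y. pole_sum ordinates (Complex 2 y))"
      by (rule continuous_on_compose2[OF holomorphic_on_imp_continuous_on[OF pole_sum_holomorphic[OF WM order_refl]]])
         (use off in \<open>auto simp: Complex_eq intro!: continuous_intros\<close>)
    have intP: "integrable lborel (\<lambda>y. pole_sum ordinates (Complex 2 y) * E (Complex 2 y))"
    proof (rule Bochner_Integration.integrable_bound)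
      show "integrable lborel (\<lambda>y. W * (exp 4 * exp t * e y))" by (intro integrable_mult_right ei)
      show "(\<lambda>y. pole_sum ordinates (Complex 2 y) * E (Complex 2 y)) \<in> borel_measurable lborel"
        using contP contE by (simp add: borel_measurable_continuous_onI continuous_on_mult)
      show "AE y in lborel. norm (pole_sum ordinates (Complex 2 y) * E (Complex 2 y)) \<le> norm (W * (exp 4 * exp t * e y))"
      proof (rule AE_I2)
        fix y
        have "norm (\<Sum>\<^sub>\<infinity>\<gamma>\<in>ordinates. q \<gamma> (Complex 2 y)) \<le> W * (exp 4 * exp t * e y)"
        proof (rule norm_infsum_le)
          have sw: "((\<lambda>\<gamma>. weight \<gamma> * (exp 4 * exp t * e y)) has_sum W * (exp 4 * exp t * e y)) ordinates"
            unfolding W_def by (intro has_sum_cmult_left has_sum_infsum weight_summable[OF WM])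
          show "((\<lambda>\<gamma>. weight \<gamma> * (exp 4 * exp t * e y)) has_sum W * (exp 4 * exp t * e y)) ordinates" by (rule sw)
          show "((\<lambda>\<gamma>. q \<gamma> (Complex 2 y)) has_sum (\<Sum>\<^sub>\<infinity>\<gamma>\<in>ordinates. q \<gamma> (Complex 2 y))) ordinates"
          proof (rule has_sum_infsum, rule abs_summable_summable, rule summable_on_comparison_test)
            show "(\<lambda>\<gamma>. weight \<gamma> * (exp 4 * exp t * e y)) summable_on ordinates" using sw by (rule has_sum_imp_summable)
          qed (rule q2 norm_ge_zero)+
          show "norm (q \<gamma> (Complex 2 y)) \<le> weight \<gamma> * (exp 4 * exp t * e y)" for \<gamma> by (rule q2)
        qed
        then show "norm (pole_sum ordinates (Complex 2 y) * E (Complex 2 y)) \<le> norm (W * (exp 4 * exp t * e y))"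
          unfolding Psum by (metis abs_ge_self order_trans real_norm_def)
      qed
    qed
    have qsum: "((\<lambda>\<gamma>. \<integral>y. q \<gamma> (Complex 2 y) \<partial>lborel) has_sum (\<integral>y. pole_sum ordinates (Complex 2 y) * E (Complex 2 y) \<partial>lborel)) ordinates"
      unfolding Psum
    proof (rule has_sum_integral_dominated)
      show "integrable lborel (\<lambda>y. q \<gamma> (Complex 2 y))" for \<gamma> by (rule qs)
      show "integrable lborel (\<lambda>y. \<Sum>\<^sub>\<infinity>\<gamma>\<in>ordinates. q \<gamma> (Complex 2 y))" using intP unfolding Psum .
      show "integrable lborel (\<lambda>y. exp 4 * exp t * e y)" by (intro integrable_mult_right ei)
      show "weight summable_on ordinates" by (rule weight_summable[OF WM])
      show "norm (q \<gamma> (Complex 2 y)) \<le> weight \<gamma> * (exp 4 * exp t * e y)" for \<gamma> y by (rule q2)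
    qed
    have err_summable: "(\<lambda>\<gamma>. \<integral>y. q \<gamma> (Complex (3/8) y) \<partial>lborel) summable_on ordinates"
    proof (rule abs_summable_summable, rule summable_on_comparison_test)
      show "(\<lambda>\<gamma>. 8 * exp 4 * H * exp (- (5/8) * t) * weight \<gamma>) summable_on ordinates"
        by (intro summable_on_cmult_right weight_summable[OF WM])
    qed (rule q38 norm_ge_zero)+
    have err: "norm (\<Sum>\<^sub>\<infinity>\<gamma>\<in>ordinates. \<integral>y. q \<gamma> (Complex (3/8) y) \<partial>lborel) \<le> 8 * exp 4 * H * exp (- (5/8) * t) * W"
    proof (rule norm_infsum_le)
      show "((\<lambda>\<gamma>. 8 * exp 4 * H * exp (- (5/8) * t) * weight \<gamma>) has_sum 8 * exp 4 * H * exp (- (5/8) * t) * W) ordinates"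
        unfolding W_def by (intro has_sum_cmult_right has_sum_infsum weight_summable[OF WM])
      show "((\<lambda>\<gamma>. \<integral>y. q \<gamma> (Complex (3/8) y) \<partial>lborel) has_sum (\<Sum>\<^sub>\<infinity>\<gamma>\<in>ordinates. \<integral>y. q \<gamma> (Complex (3/8) y) \<partial>lborel)) ordinates"
        by (rule has_sum_infsum[OF err_summable])
    qed (rule q38)
    define R where "R = (\<Sum>\<^sub>\<infinity>\<gamma>\<in>ordinates. \<integral>y. q \<gamma> (Complex (3/8) y) \<partial>lborel)"
    define P where "P = (\<integral>y. pole_sum ordinates (Complex 2 y) * E (Complex 2 y) \<partial>lborel)"
    have main_sum: "((\<lambda>\<gamma>. 2 * pi * A \<gamma> (crit \<gamma>)) has_sum (P - R)) ordinates"
      using has_sum_add[OF qsum has_sum_uminusI[OF has_sum_infsum[OF err_summable]]]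
      unfolding qs(3)[symmetric] P_def R_def by simp
    \<comment> \<open>(rho - 1) t has real part - t/2; this factor is what the normalisation by sqrt
      b removes.\<close>
    have Ac: "2 * pi * A \<gamma> (crit \<gamma>) = 2 * pi * exp (- t / 2) * (zero_coeff \<gamma> / 2 * exp (\<i> * of_real (\<gamma> * t)))" for \<gamma>
    proof -
      have "(crit \<gamma> - 1) * of_real t = of_real (- t / 2) + \<i> * of_real (\<gamma> * t)" by (simp add: complex_eq_iff)
      then have "E (crit \<gamma>) = of_real (exp (- t / 2)) * exp (\<i> * of_real (\<gamma> * t))"
        unfolding E_def by (simp only: exp_add exp_of_real)
      then show ?thesis by (simp add: A_def)
    qed
    define Z where "Z = (\<Sum>\<^sub>\<infinity>\<gamma>\<in>ordinates. zero_coeff \<gamma> / 2 * exp (\<i> * of_real (\<gamma> * t)))"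
    have Z: "2 * pi * exp (- t / 2) * Z = P - R"
    proof -
      have "P - R = (\<Sum>\<^sub>\<infinity>\<gamma>\<in>ordinates. complex_of_real (2 * pi * exp (- t / 2)) * (zero_coeff \<gamma> / 2 * exp (\<i> * of_real (\<gamma> * t))))"
        using main_sum unfolding Ac by (simp add: infsumI)
      also have "\<dots> = complex_of_real (2 * pi * exp (- t / 2)) * Z" unfolding Z_def by (rule infsum_cmult_right')
      finally show ?thesis by simp
    qed
    have "2 * pi * of_real (moebius_exp_series (exp t)) = (\<integral>y. f (Complex 2 y) + pole_sum ordinates (Complex 2 y) * E (Complex 2 y) \<partial>lborel)"
      unfolding moebius_exp_series_integral[OF WM] f_def
      by (intro Bochner_Integration.integral_cong refl) (simp add: D(2)[OF off] E_def ring_distribs)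
    also have "\<dots> = (\<integral>y. f (Complex 2 y) \<partial>lborel) + P" unfolding P_def
      by (rule Bochner_Integration.integral_add[OF fs(1) intP])
    finally have tot: "2 * pi * of_real (moebius_exp_series (exp t)) - 2 * pi * exp (- t / 2) * Z = (\<integral>y. f (Complex 2 y) \<partial>lborel) + R"
      unfolding Z by simp
    have ee: "exp (t / 2) * exp (- t / 2) = (1::real)" by (simp flip: exp_add)
    have ee2: "exp (t / 2) * exp (- (5/8) * t) = exp (- t / 8)" by (simp flip: exp_add)
    have "of_real (exp (t / 2) * exp (- t / 2)) * Z = Z" unfolding ee by simp
    then have "of_real (2 * pi) * (of_real (exp (t / 2) * moebius_exp_series (exp t)) - Z) =
        of_real (exp (t / 2)) * (2 * pi * of_real (moebius_exp_series (exp t)) - 2 * pi * exp (- t / 2) * Z)"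
      by (simp add: algebra_simps)
    then have "norm (of_real (2 * pi) * (of_real (exp (t / 2) * moebius_exp_series (exp t)) - Z)) = exp (t / 2) * norm ((\<integral>y. f (Complex 2 y) \<partial>lborel) + R)"
      unfolding tot by (simp add: norm_mult)
    also have "\<dots> \<le> exp (t / 2) * (KD * H * exp (- (5/8) * t) + 8 * exp 4 * H * exp (- (5/8) * t) * W)"
      using norm_triangle_le[OF add_mono[OF fI err[folded R_def]]] by (intro mult_left_mono) auto
    also have "\<dots> = (KD * H + 8 * exp 4 * W * H) * (exp (t / 2) * exp (- (5/8) * t))" by (simp add: algebra_simps)
    also have "\<dots> \<le> K * exp (- t / 8)" unfolding ee2 K_def by (intro mult_right_mono) auto
    finally have "2 * pi * norm (of_real (exp (t / 2) * moebius_exp_series (exp t)) - Z) \<le> K * exp (- t / 8)"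
      by (simp add: norm_mult)
    moreover have "1 * norm (of_real (exp (t / 2) * moebius_exp_series (exp t)) - Z) \<le> 2 * pi * norm (of_real (exp (t / 2) * moebius_exp_series (exp t)) - Z)"
      using pi_gt3 by (intro mult_right_mono) auto
    ultimately show ?thesis unfolding Z_def by linarith
  qed
  have "K > 0" unfolding K_def using H W KD by (intro add_nonneg_pos add_nonneg_nonneg mult_nonneg_nonneg) auto
  then show ?thesis using main by (rule that)
qed

end

section \<open>Kronecker's theorem\<close>

lemma abs_cos_diff_le: "\<bar>cos x - cos y\<bar> \<le> \<bar>x - y\<bar>" for x y :: real
proof -
  have "\<bar>cos x - cos y\<bar> = 2 * (\<bar>sin ((x + y) / 2)\<bar> * \<bar>sin ((y - x) / 2)\<bar>)"
    unfolding cos_diff_cos by (simp add: abs_mult)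
  also have "\<dots> \<le> 2 * (1 * \<bar>(y - x) / 2\<bar>)"
    by (intro mult_left_mono mult_mono abs_sin_x_le_abs_x) auto
  finally show ?thesis by simp
qed

text \<open>Kronecker's theorem works modulo 1 with integer relations, while the hypothesis is
  rational and the phases are modulo 2 pi; division by \<open>d\<close> rescales every
  relation.\<close>

lemma int_independent_of_rat_independent:
  fixes X :: "real set"
  assumes "module.independent (\<lambda>(q::rat) (x::real). of_rat q * x) X" "d \<noteq> 0"
  shows "module.independent (\<lambda>r. (*) (real_of_int r)) ((\<lambda>x. x / d) ` X)"
proof -
  interpret Q: Modules.module "\<lambda>(q::rat) (x::real). of_rat q * x"
    by unfold_locales (simp_all add: ring_distribs of_rat_add of_rat_mult)
  interpret Z: Modules.module "\<lambda>r. (*) (real_of_int r)"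
    by unfold_locales (simp_all add: ring_distribs)
  show ?thesis
    unfolding Z.independent_explicit_module
  proof (intro allI impI)
    fix t u v
    assume t: "finite t" "t \<subseteq> (\<lambda>x. x / d) ` X" "(\<Sum>v\<in>t. real_of_int (u v) * v) = 0" "v \<in> t"
    define s where "s = (\<lambda>x. x * d) ` t"
    have inj: "inj_on (\<lambda>x. x * d) t" using assms(2) by (auto simp: inj_on_def)
    have "(\<Sum>x\<in>s. of_rat (of_int (u (x / d))) * x) = (\<Sum>v\<in>t. (real_of_int (u v) * v) * d)"
      unfolding s_def using assms(2) by (subst sum.reindex[OF inj]) (simp add: mult.assoc)
    also have "\<dots> = 0" unfolding sum_distrib_right[symmetric] t(3) by simp
    finally have z: "(\<Sum>x\<in>s. of_rat (of_int (u (x / d))) * x) = 0" .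
    have "of_int (u (v * d / d)) = (0 :: rat)"
    proof (rule Q.independentD[OF assms(1) _ _ z])
      show "finite s" "v * d \<in> s" using t by (auto simp: s_def)
      show "s \<subseteq> X" using t(2) assms(2) by (auto simp: s_def)
    qed
    then show "u v = 0" using assms(2) by simp
  qed
qed

text \<open>Kronecker's theorem gives some real \<open>t1\<close> without control of its size.
  Simultaneous Dirichlet approximation of the numbers \<open>L * \<theta> i\<close> yields a
  positive integer q such that adding q L nearly preserves all phases, and \<open>L\<close> is at
  least \<open>T - t1\<close>.\<close>

lemma Kronecker_large:
  fixes \<theta> \<alpha> :: "nat \<Rightarrow> real"
  assumes "module.independent (\<lambda>r. (*) (real_of_int r)) (\<theta> ` {..<n})" "inj_on \<theta> {..<n}" "\<epsilon> > 0"
  obtains t h where "t \<ge> T" "\<And>i. i < n \<Longrightarrow> \<bar>t * \<theta> i - of_int (h i) - \<alpha> i\<bar> < \<epsilon>"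
proof -
  have e2: "\<epsilon> / 2 > 0" using assms by simp
  obtain t1 h1 where t1: "\<And>i. i < n \<Longrightarrow> \<bar>t1 * \<theta> i - of_int (h1 i) - \<alpha> i\<bar> < \<epsilon> / 2"
    by (rule Kronecker_thm_1[OF assms(1,2) e2, where \<alpha> = \<alpha>]) (rule that)
  define L where "L = max 1 (T - t1)"
  obtain N where N: "N > 0" "inverse (real N) < \<epsilon> / 2" using real_arch_inverse[of "\<epsilon> / 2"] e2 by auto
  obtain q p where q: "(0::int) < q" "q \<le> int (N ^ n)"
    "\<And>i. i < n \<Longrightarrow> \<bar>of_int q * (L * \<theta> i) - of_int (p i)\<bar> < 1 / real N"
    by (rule Dirichlet_approx_simult[OF N(1), of n "\<lambda>i. L * \<theta> i"]) (rule that)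
  have "L \<ge> 1" "L \<ge> T - t1" by (auto simp: L_def)
  moreover have "1 * L \<le> of_int q * L" using q(1) \<open>L \<ge> 1\<close> by (intro mult_right_mono) auto
  ultimately have "t1 + of_int q * L \<ge> T" by linarith
  moreover have "\<bar>(t1 + of_int q * L) * \<theta> i - of_int (h1 i + p i) - \<alpha> i\<bar> < \<epsilon>" if i: "i < n" for i
  proof -
    have "(t1 + of_int q * L) * \<theta> i - of_int (h1 i + p i) - \<alpha> i =
      (t1 * \<theta> i - of_int (h1 i) - \<alpha> i) + (of_int q * (L * \<theta> i) - of_int (p i))" by (simp add: algebra_simps)
    then show ?thesis using t1[OF i] q(3)[OF i] N(2) unfolding inverse_eq_divide by linarith
  qed
  ultimately show ?thesis by (rule that[of _ "\<lambda>i. h1 i + p i"])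
qed

text \<open>One common target phase is enough: if every cosine of a large finite part is close to
  a/C, the weighted sum is close to a. This reaches the whole interval and not only its
  endpoints.\<close>

lemma cosine_sum_dense:
  fixes X :: "real set" and w \<phi> :: "real \<Rightarrow> real"
  assumes indep: "module.independent (\<lambda>(q::rat) (x::real). of_rat q * x) X"
    and w: "w summable_on X" "\<And>x. w x \<ge> 0" and a: "\<bar>a\<bar> \<le> infsum w X" and \<epsilon>: "\<epsilon> > 0"
  shows "\<exists>t\<ge>T. \<bar>(\<Sum>\<^sub>\<infinity>x\<in>X. w x * cos (x * t + \<phi> x)) - a\<bar> < \<epsilon>"
proof -
  define C where "C = infsum w X"
  have C: "C \<ge> 0" unfolding C_def using w by (intro infsum_nonneg)
  obtain A where A: "finite A" "A \<subseteq> X" "dist (sum w A) C \<le> \<epsilon> / 8"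
    using infsum_finite_approximation[OF w(1), of "\<epsilon> / 8"] \<epsilon> unfolding C_def by auto
  define \<mu> where "\<mu> = (if C = 0 then 0 else a / C)"
  have mu: "\<bar>\<mu>\<bar> \<le> 1" "\<mu> * C = a" using a C by (auto simp: \<mu>_def C_def abs_divide)
  define \<beta> where "\<beta> = arccos \<mu>"
  have \<beta>: "cos \<beta> = \<mu>" unfolding \<beta>_def using mu(1) by (intro cos_arccos) auto
  obtain \<nu> n where nu: "bij_betw \<nu> {..<n::nat} A"
    using ex_bij_betw_nat_finite[OF A(1)] by (metis atLeast0LessThan)
  \<comment> \<open>Chosen such that (C + 1) times \<open>2 * pi * \<eta>\<close> is
    \<open>\<epsilon> / 2\<close>; the summand 1 avoids division by 0.\<close>
  define \<eta> where "\<eta> = \<epsilon> / (4 * pi * (C + 1))"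
  have eta: "\<eta> > 0" using \<epsilon> C by (simp add: \<eta>_def)
  have img: "(\<lambda>i. \<nu> i / (2 * pi)) ` {..<n} = (\<lambda>x. x / (2 * pi)) ` A"
    using nu by (auto simp: bij_betw_def image_image[symmetric])
  have "module.independent (\<lambda>(q::rat) (x::real). of_rat q * x) A"
  proof -
    interpret Q: Modules.module "\<lambda>(q::rat) (x::real). of_rat q * x"
      by unfold_locales (simp_all add: ring_distribs of_rat_add of_rat_mult)
    show ?thesis by (rule Q.independent_mono[OF indep A(2)])
  qed
  then have ind: "module.independent (\<lambda>r. (*) (real_of_int r)) ((\<lambda>i. \<nu> i / (2 * pi)) ` {..<n})"
    unfolding img by (rule int_independent_of_rat_independent) simp
  have inj: "inj_on (\<lambda>i. \<nu> i / (2 * pi)) {..<n}" using nu by (auto simp: bij_betw_def inj_on_def)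
  obtain t h where t: "t \<ge> T"
    "\<And>i. i < n \<Longrightarrow> \<bar>t * (\<nu> i / (2 * pi)) - of_int (h i) - (\<beta> - \<phi> (\<nu> i)) / (2 * pi)\<bar> < \<eta>"
    by (rule Kronecker_large[OF ind inj eta, where \<alpha> = "\<lambda>i. (\<beta> - \<phi> (\<nu> i)) / (2 * pi)" and T = T]) (rule that)
  have near: "\<bar>cos (x * t + \<phi> x) - \<mu>\<bar> \<le> 2 * pi * \<eta>" if x: "x \<in> A" for x
  proof -
    obtain i where i: "i < n" "x = \<nu> i" using nu x by (auto simp: bij_betw_def)
    have "x * t + \<phi> x - (\<beta> + 2 * pi * of_int (h i)) =
      2 * pi * (t * (\<nu> i / (2 * pi)) - of_int (h i) - (\<beta> - \<phi> (\<nu> i)) / (2 * pi))" by (simp add: i field_simps)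
    then have "\<bar>x * t + \<phi> x - (\<beta> + 2 * pi * of_int (h i))\<bar> =
      2 * pi * \<bar>t * (\<nu> i / (2 * pi)) - of_int (h i) - (\<beta> - \<phi> (\<nu> i)) / (2 * pi)\<bar>" by (simp add: abs_mult)
    also have "\<dots> \<le> 2 * pi * \<eta>" using t(2)[OF i(1)] by (intro mult_left_mono) auto
    finally have "\<bar>x * t + \<phi> x - (\<beta> + 2 * pi * of_int (h i))\<bar> \<le> 2 * pi * \<eta>" .
    moreover have "cos (\<beta> + 2 * pi * of_int (h i)) = \<mu>"
      unfolding \<beta>[symmetric] cos_add by simp
    ultimately show ?thesis using abs_cos_diff_le[of "x * t + \<phi> x" "\<beta> + 2 * pi * of_int (h i)"] by linarith
  qed
  define s where "s = (\<lambda>x. w x * cos (x * t + \<phi> x))"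
  have sb: "\<bar>s x\<bar> \<le> w x" for x
    using mult_left_mono[OF abs_cos_le_one w(2)] w(2)[of x] unfolding s_def by (simp add: abs_mult)
  have ss: "s summable_on B" if "B \<subseteq> X" for B
  proof (rule abs_summable_summable, rule summable_on_comparison_test)
    show "w summable_on B" by (rule summable_on_subset_banach[OF w(1) that])
  qed (use sb in auto)
  have tail: "infsum w (X - A) = C - sum w A" unfolding C_def
    using infsum_Diff[OF w(1) _ A(2)] A(1) by simp
  have split: "infsum s X = sum s A + infsum s (X - A)"
    using infsum_Diff[OF ss[OF order_refl] ss[OF A(2)] A(2)] A(1) by simp
  have 1: "\<bar>infsum s (X - A)\<bar> \<le> C - sum w A"
  proof -
    have "norm (infsum s (X - A)) \<le> infsum w (X - A)"
    proof (rule norm_infsum_le)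
      show "(s has_sum infsum s (X - A)) (X - A)" by (rule has_sum_infsum, rule ss) auto
      show "(w has_sum infsum w (X - A)) (X - A)" by (rule has_sum_infsum, rule summable_on_subset_banach[OF w(1)]) auto
    qed (use sb in auto)
    then show ?thesis by (simp add: tail)
  qed
  have tl: "0 \<le> C - sum w A" "C - sum w A \<le> \<epsilon> / 8" using 1 A(3) by (auto simp: dist_real_def)
  have 2: "\<bar>sum s A - \<mu> * sum w A\<bar> \<le> \<epsilon> / 2"
  proof -
    have "sum s A - \<mu> * sum w A = (\<Sum>x\<in>A. w x * (cos (x * t + \<phi> x) - \<mu>))"
      by (simp add: s_def sum_distrib_left sum_subtractf algebra_simps)
    also have "\<bar>\<dots>\<bar> \<le> (\<Sum>x\<in>A. \<bar>w x * (cos (x * t + \<phi> x) - \<mu>)\<bar>)" by (rule sum_abs)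
    also have "\<dots> \<le> (\<Sum>x\<in>A. w x * (2 * pi * \<eta>))"
      unfolding abs_mult using w(2) by (intro sum_mono mult_mono near) auto
    also have "\<dots> = sum w A * (2 * pi * \<eta>)" by (simp add: sum_distrib_right)
    also have "\<dots> \<le> (C + 1) * (2 * pi * \<eta>)" using tl eta by (intro mult_right_mono) auto
    also have "\<dots> = \<epsilon> / 2"
    proof -
      have "C + 1 \<noteq> 0" using C by simp
      then show ?thesis by (simp add: \<eta>_def divide_simps)
    qed
    finally show ?thesis .
  qed
  have 3: "\<bar>\<mu> * (C - sum w A)\<bar> \<le> \<epsilon> / 8"
    using mult_mono[OF mu(1) tl(2)] tl(1) by (simp add: abs_mult)
  have "infsum s X - a = (sum s A - \<mu> * sum w A) + infsum s (X - A) - \<mu> * (C - sum w A)"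
    unfolding split mu(2)[symmetric] by (simp add: algebra_simps)
  then have "\<bar>infsum s X - a\<bar> < \<epsilon>" using 1 2 3 tl \<epsilon> by linarith
  then show ?thesis unfolding s_def using t(1) by blast
qed

section \<open>Real form of the cosine sum and the final limits\<close>

lemma Limsup_eq_ereal:
  fixes f :: "'a \<Rightarrow> real"
  assumes "\<And>\<epsilon>. \<epsilon> > 0 \<Longrightarrow> eventually (\<lambda>x. f x \<le> c + \<epsilon>) F"
    and "\<And>\<epsilon>. \<epsilon> > 0 \<Longrightarrow> frequently (\<lambda>x. f x > c - \<epsilon>) F"
  shows "Limsup F (\<lambda>x. ereal (f x)) = ereal c"
proof (rule antisym)
  show "Limsup F (\<lambda>x. ereal (f x)) \<le> ereal c"
  proof (rule ereal_le_epsilon2)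
    fix e :: real assume "e > 0"
    from assms(1)[OF this] have "eventually (\<lambda>x. ereal (f x) \<le> ereal (c + e)) F"
      by eventually_elim simp
    then show "Limsup F (\<lambda>x. ereal (f x)) \<le> ereal c + ereal e" by (simp add: Limsup_bounded)
  qed
  show "ereal c \<le> Limsup F (\<lambda>x. ereal (f x))"
  proof (rule ereal_le_epsilon2)
    fix e :: real assume e: "e > 0"
    have "ereal (c - e) \<le> Limsup F (\<lambda>x. ereal (f x))"
    proof (rule ccontr)
      assume "\<not> ?thesis"
      then have "eventually (\<lambda>x. ereal (f x) < ereal (c - e)) F" by (intro Limsup_lessD) simp
      then have "eventually (\<lambda>x. \<not> f x > c - e) F" by eventually_elim simp
      then show False using assms(2)[OF e] by (simp add: frequently_def)
    qed
    then have "ereal (c - e) + ereal e \<le> Limsup F (\<lambda>x. ereal (f x)) + ereal e" by (rule add_right_mono)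
    then show "ereal c \<le> Limsup F (\<lambda>x. ereal (f x)) + ereal e" by simp
  qed
qed

text \<open>The terms at gamma and - gamma are complex conjugates, so the two halves of a(gamma) add
  up to a real part; no ordinate 0 is left unpaired.\<close>

lemma zero_coeff_sum_eq_real:
  assumes WM: weak_Mertens_hypothesis
  shows "(\<Sum>\<^sub>\<infinity>\<gamma>\<in>ordinates. zero_coeff \<gamma> / 2 * exp (\<i> * of_real (\<gamma> * t))) =
    of_real (\<Sum>\<^sub>\<infinity>\<gamma>\<in>positive_ordinates. norm (zero_coeff \<gamma>) * cos (\<gamma> * t + Arg (zero_coeff \<gamma>)))"
    and "(\<lambda>\<gamma>. norm (zero_coeff \<gamma>)) summable_on positive_ordinates"
proof -
  define f where "f = (\<lambda>\<gamma>. zero_coeff \<gamma> / 2 * exp (\<i> * of_real (\<gamma> * t)))"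
  define P where "P = positive_ordinates"
  have P: "P = {\<gamma> \<in> ordinates. \<gamma> > 0}" by (simp add: P_def positive_ordinates_eq[OF WM])
  have ns: "(\<lambda>\<gamma>. norm (zero_coeff \<gamma>)) summable_on ordinates"
  proof (rule summable_on_comparison_test[OF zero_coeff_summable[OF WM]])
    show "norm (zero_coeff \<gamma>) \<le> norm (zero_coeff \<gamma>) * exp (\<bar>\<gamma>\<bar> / 64)" for \<gamma>
      using mult_left_mono[of 1 "exp (\<bar>\<gamma>\<bar> / 64)" "norm (zero_coeff \<gamma>)"] by simp
  qed auto
  then show nP: "(\<lambda>\<gamma>. norm (zero_coeff \<gamma>)) summable_on positive_ordinates"
    unfolding P_def[symmetric] by (rule summable_on_subset_banach) (auto simp: P)
  have cs: "(\<lambda>\<gamma>. norm (zero_coeff \<gamma>) * cos (\<gamma> * t + Arg (zero_coeff \<gamma>))) summable_on positive_ordinates"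
  proof (rule abs_summable_summable, rule summable_on_comparison_test[OF nP])
    show "norm (norm (zero_coeff \<gamma>) * cos (\<gamma> * t + Arg (zero_coeff \<gamma>))) \<le> norm (zero_coeff \<gamma>)" for \<gamma>
      using mult_left_mono[OF abs_cos_le_one norm_ge_zero] by (simp add: abs_mult)
  qed auto
  have fs: "f summable_on B" if "B \<subseteq> ordinates" for B
  proof (rule abs_summable_summable, rule summable_on_comparison_test)
    show "(\<lambda>\<gamma>. norm (zero_coeff \<gamma>)) summable_on B" by (rule summable_on_subset_banach[OF ns that])
  qed (auto simp: f_def norm_mult)
  have un: "ordinates = P \<union> uminus ` P"
  proof -
    have "x \<in> uminus ` P" if "x \<in> ordinates" "x < 0" for x
      using that ordinates_uminus[of x] by (intro image_eqI[of _ _ "- x"]) (auto simp: P)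
    moreover have "x \<noteq> 0" if "x \<in> ordinates" for x using that zero_notin_ordinates by blast
    ultimately show ?thesis using ordinates_uminus by (force simp: P)
  qed
  have "infsum f ordinates = infsum f P + infsum f (uminus ` P)"
    unfolding un by (rule infsum_Un_disjoint) (use un fs in \<open>auto simp: P\<close>)
  also have "infsum f (uminus ` P) = infsum (f \<circ> uminus) P" by (rule infsum_reindex) simp
  also have "infsum f P + infsum (f \<circ> uminus) P = (\<Sum>\<^sub>\<infinity>\<gamma>\<in>P. f \<gamma> + (f \<circ> uminus) \<gamma>)"
  proof (rule infsum_add[symmetric])
    show "f summable_on P" by (rule fs) (auto simp: P)
    have "f summable_on uminus ` P" by (rule fs) (use un in auto)
    then show "(f \<circ> uminus) summable_on P" by (subst (asm) summable_on_reindex) auto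
  qed
  also have "\<dots> = (\<Sum>\<^sub>\<infinity>\<gamma>\<in>P. of_real (norm (zero_coeff \<gamma>) * cos (\<gamma> * t + Arg (zero_coeff \<gamma>))))"
  proof (rule infsum_cong)
    fix \<gamma>
    define z where "z = zero_coeff \<gamma> * exp (\<i> * of_real (\<gamma> * t))"
    have "f (- \<gamma>) = cnj z / 2" by (simp add: f_def z_def zero_coeff_uminus exp_cnj)
    moreover have "f \<gamma> = z / 2" by (simp add: f_def z_def)
    ultimately have "f \<gamma> + (f \<circ> uminus) \<gamma> = (z + cnj z) / 2" by (simp only: o_apply add_divide_distrib)
    also have "\<dots> = of_real (Re z)" unfolding complex_add_cnj by simp
    also have "z = of_real (norm (zero_coeff \<gamma>)) * exp (\<i> * of_real (\<gamma> * t + Arg (zero_coeff \<gamma>)))"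
    proof (cases "zero_coeff \<gamma> = 0")
      case False
      have "exp (\<i> * of_real (\<gamma> * t + Arg (zero_coeff \<gamma>))) = exp (\<i> * of_real (Arg (zero_coeff \<gamma>))) * exp (\<i> * of_real (\<gamma> * t))"
        by (simp add: ring_distribs flip: exp_add) (simp add: add.commute)
      then show ?thesis using Arg_eq[OF False] unfolding z_def by (metis mult.assoc)
    qed (simp add: z_def)
    also have "Re \<dots> = norm (zero_coeff \<gamma>) * cos (\<gamma> * t + Arg (zero_coeff \<gamma>))"
      by (simp add: Re_exp)
    finally show "f \<gamma> + (f \<circ> uminus) \<gamma> = of_real (norm (zero_coeff \<gamma>) * cos (\<gamma> * t + Arg (zero_coeff \<gamma>)))" .
  qed
  also have "\<dots> = of_real (\<Sum>\<^sub>\<infinity>\<gamma>\<in>P. norm (zero_coeff \<gamma>) * cos (\<gamma> * t + Arg (zero_coeff \<gamma>)))"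
    unfolding P_def
    by (intro infsumI has_sum_of_real has_sum_infsum cs)
  finally show "(\<Sum>\<^sub>\<infinity>\<gamma>\<in>ordinates. zero_coeff \<gamma> / 2 * exp (\<i> * of_real (\<gamma> * t))) =
    of_real (\<Sum>\<^sub>\<infinity>\<gamma>\<in>positive_ordinates. norm (zero_coeff \<gamma>) * cos (\<gamma> * t + Arg (zero_coeff \<gamma>)))"
    by (simp add: f_def P_def)
qed

theorem theorem2:
  assumes "weak_Mertens_hypothesis" and "linear_independence_hypothesis"
  shows "{- zero_coeff_sum..zero_coeff_sum}
           \<subseteq> closure ((\<lambda>b. sqrt b * moebius_exp_series b) ` {pi..}) \<and>
    Liminf at_top (\<lambda>b. ereal (sqrt b * moebius_exp_series b)) = ereal (- zero_coeff_sum) \<and>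
    Limsup at_top (\<lambda>b. ereal (sqrt b * moebius_exp_series b)) = ereal zero_coeff_sum"
proof -
  define g where "g = (\<lambda>b. sqrt b * moebius_exp_series b)"
  define s where "s = (\<lambda>t. \<Sum>\<^sub>\<infinity>\<gamma>\<in>positive_ordinates. norm (zero_coeff \<gamma>) * cos (\<gamma> * t + Arg (zero_coeff \<gamma>)))"
  define C where "C = zero_coeff_sum"
  note summ = zero_coeff_sum_eq_real(2)[OF assms(1)]
  obtain K where K: "K > 0" "\<And>t. t \<ge> 0 \<Longrightarrow>
    norm (of_real (exp (t / 2) * moebius_exp_series (exp t)) -
      (\<Sum>\<^sub>\<infinity>\<gamma>\<in>ordinates. zero_coeff \<gamma> / 2 * exp (\<i> * of_real (\<gamma> * t)))) \<le> K * exp (- t / 8)"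
    by (rule moebius_exp_series_approx[OF assms(1)]) (rule that)
  have approx: "\<bar>g (exp t) - s t\<bar> \<le> K * exp (- t / 8)" if t: "t \<ge> 0" for t
  proof -
    have "sqrt (exp t) = exp (t / 2)" by (rule real_sqrt_unique) (auto simp: power2_eq_square simp flip: exp_add)
    then show ?thesis using K(2)[OF t]
      unfolding zero_coeff_sum_eq_real(1)[OF assms(1)] of_real_diff[symmetric] norm_of_real
      by (simp only: g_def s_def)
  qed
  have small: "\<exists>T0\<ge>0. \<forall>t\<ge>T0. K * exp (- t / 8) < \<epsilon>" if e: "\<epsilon> > 0" for \<epsilon> :: real
  proof -
    have "((\<lambda>t. K * exp (- t / 8)) \<longlongrightarrow> 0) at_top" by real_asymp
    then have "eventually (\<lambda>t. K * exp (- t / 8) < \<epsilon>) at_top" using e by (rule order_tendstoD)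
    then obtain T0 where "\<forall>t\<ge>T0. K * exp (- t / 8) < \<epsilon>" by (auto simp: eventually_at_top_linorder)
    then show ?thesis by (intro exI[of _ "max 0 T0"]) auto
  qed
  \<comment> \<open>Every value is approximated at arbitrarily large \<open>b\<close>: with
    \<open>B = pi\<close> this gives the closure statement, with all \<open>B\<close> the frequent
    approximation behind both limits.\<close>
  have hit: "\<exists>b\<ge>B. \<bar>g b - a\<bar> < \<epsilon>" if a: "\<bar>a\<bar> \<le> C" and e: "\<epsilon> > 0" for a \<epsilon> B
  proof -
    have e2: "\<epsilon> / 2 > 0" using e by simp
    obtain T0 where T0: "T0 \<ge> 0" "\<And>t. t \<ge> T0 \<Longrightarrow> K * exp (- t / 8) < \<epsilon> / 2" using small[OF e2] by blast
    have "\<exists>t\<ge>max T0 (ln (max B 1)). \<bar>s t - a\<bar> < \<epsilon> / 2" unfolding s_def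
      by (rule cosine_sum_dense[OF _ summ])
         (use assms(2) a e in \<open>auto simp: linear_independence_hypothesis_def C_def zero_coeff_sum_def\<close>)
    then obtain t where t: "t \<ge> T0" "t \<ge> ln (max B 1)" "\<bar>s t - a\<bar> < \<epsilon> / 2" by auto
    have "exp (ln (max B 1)) \<le> exp t" using t(2) by (simp only: exp_le_cancel_iff)
    then have "max B 1 \<le> exp t" by (subst (asm) exp_ln) auto
    moreover have "\<bar>g (exp t) - a\<bar> < \<epsilon>" using approx[of t] T0(1) T0(2)[OF t(1)] t by linarith
    ultimately show ?thesis by (intro exI[of _ "exp t"]) auto
  qed
  have sC: "\<bar>s t\<bar> \<le> C" for t
  proof -
    have b: "\<bar>norm (zero_coeff \<gamma>) * cos (\<gamma> * t + Arg (zero_coeff \<gamma>))\<bar> \<le> norm (zero_coeff \<gamma>)" for \<gamma>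
      using mult_left_mono[OF abs_cos_le_one norm_ge_zero] by (simp add: abs_mult)
    have "norm (s t) \<le> C" unfolding s_def
    proof (rule norm_infsum_le)
      show "((\<lambda>\<gamma>. norm (zero_coeff \<gamma>)) has_sum C) positive_ordinates"
        unfolding C_def zero_coeff_sum_def by (rule has_sum_infsum[OF summ])
      show "((\<lambda>\<gamma>. norm (zero_coeff \<gamma>) * cos (\<gamma> * t + Arg (zero_coeff \<gamma>))) has_sum
         (\<Sum>\<^sub>\<infinity>\<gamma>\<in>positive_ordinates. norm (zero_coeff \<gamma>) * cos (\<gamma> * t + Arg (zero_coeff \<gamma>)))) positive_ordinates"
        by (rule has_sum_infsum, rule abs_summable_summable, rule summable_on_comparison_test[OF summ]) (use b in auto)
    qed (use b in auto)
    then show ?thesis by simp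
  qed
  have C0: "C \<ge> 0" using sC[of 0] by linarith
  have upper: "eventually (\<lambda>b. \<bar>g b\<bar> \<le> C + \<epsilon>) at_top" if e: "\<epsilon> > 0" for \<epsilon>
  proof -
    obtain T0 where T0: "T0 \<ge> 0" "\<And>t. t \<ge> T0 \<Longrightarrow> K * exp (- t / 8) < \<epsilon>" using small[OF e] by blast
    have "\<bar>g b\<bar> \<le> C + \<epsilon>" if b: "b \<ge> exp T0" for b
    proof -
      have b0: "b > 0" using b exp_gt_zero[of T0] by linarith
      then have l: "ln b \<ge> T0" using b by (simp add: ln_ge_iff)
      have "ln b \<ge> 0" using l T0(1) by linarith
      from approx[OF this] have "\<bar>g b - s (ln b)\<bar> \<le> K * exp (- ln b / 8)" unfolding exp_ln[OF b0] .
      then show ?thesis using T0(2)[OF l] sC[of "ln b"] by linarith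
    qed
    then show ?thesis unfolding eventually_at_top_linorder by blast
  qed
  have freq: "frequently (\<lambda>b. \<bar>g b - a\<bar> < \<epsilon>) at_top" if "\<bar>a\<bar> \<le> C" "\<epsilon> > 0" for a \<epsilon>
    unfolding frequently_def eventually_at_top_linorder using hit[OF that] by blast
  have "{- C..C} \<subseteq> closure (g ` {pi..})"
  proof
    fix a assume "a \<in> {- C..C}"
    then have "\<bar>a\<bar> \<le> C" by auto
    then show "a \<in> closure (g ` {pi..})"
      unfolding closure_approachable dist_real_def using hit[of a _ pi] by fastforce
  qed
  moreover have "Limsup at_top (\<lambda>b. ereal (g b)) = ereal C"
  proof (rule Limsup_eq_ereal)
    fix e :: real assume e: "e > 0"
    from upper[OF e] show "eventually (\<lambda>b. g b \<le> C + e) at_top" by eventually_elim simp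
    have "\<bar>C\<bar> \<le> C" using C0 by simp
    from freq[OF this e] show "frequently (\<lambda>b. g b > C - e) at_top" by (rule frequently_elim1) linarith
  qed
  moreover have "Liminf at_top (\<lambda>b. ereal (g b)) = ereal (- C)"
  proof -
    have "Limsup at_top (\<lambda>b. ereal (- g b)) = ereal C"
    proof (rule Limsup_eq_ereal)
      fix e :: real assume e: "e > 0"
      from upper[OF e] show "eventually (\<lambda>b. - g b \<le> C + e) at_top" by eventually_elim simp
      have "\<bar>- C\<bar> \<le> C" using C0 by simp
      from freq[OF this e] show "frequently (\<lambda>b. - g b > C - e) at_top" by (rule frequently_elim1) linarith
    qed
    then have "- Liminf at_top (\<lambda>b. ereal (g b)) = ereal C"
      unfolding ereal_Limsup_uminus[symmetric] by simp
    then show ?thesis by (metis ereal_uminus_uminus uminus_ereal.simps(1))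
  qed
  ultimately show ?thesis by (simp add: g_def C_def)
qed

end
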